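(* Let $F$ be a $2$-adic field with residue field of size $q$, and let $\mathcal{A}\subseteq F^\times$ be a finitely generated subgroup. The pre-mass $\widetilde m\big(\mathrm{Et}_{(1^21^2)/F}^{\mathcal{A}}\big)$ is equal to the sum of the following two quantities: (1) $$\frac18\cdot\sum_{4\leq m\leq4e_F+2}q^{-m}\,\#\mathrm{Et}_{(1^2)/F,\frac m2}^{\mathcal{A}};$$ (2) $$\frac14\cdot\sum_{4\leq m\leq4e_F+2}q^{-m}\,N_{(1^21^2)}^{\neq}(m).$$
   Context: A $2$-adic field is a finite extension of $\mathbb{Q}_2$; $e_F$ is its absolute ramification index and $v_F$ its normalised valuation. The pre-mass of a set $S$ of isomorphism classes of étale algebras over $F$ is $\widetilde m(S)=\sum_{L\in S}\frac{\mathrm{Nm}(\mathrm{disc}(L/F))^{-1}}{\#\mathrm{Aut}(L/F)}$. $\mathrm{Et}_{(1^21^2)/F}^{\mathcal{A}}$ is the set of isomorphism classes of étale algebras $L=L_1\times L_2$ with $L_1,L_2$ totally ramified quadratic field extensions of $F$ and $\mathcal{A}\subseteq N_{L/F}L^\times$. $\mathrm{Et}_{(1^2)/F,r}^{\mathcal{A}}$ is the set of isomorphism classes of totally ramified quadratic field extensions $L/F$ with $\mathcal{A}\subseteq N_{L/F}L^\times$ and discriminant valuation $v_F(d_{L/F})=r$ (empty if $r$ is not an integer). Sums are over integers $m$. The function $N_{(1^21^2)}^{\neq}$ is $$N_{(1^21^2)}^{\neq}(m)=\begin{cases}2(q-1)^2q^{\frac m2-2}(\frac m2-1)-\mathbb{1}_{4\mid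 m}(q-1)q^{\frac m4-1}&\text{if }4\leq m\leq2e_F,\ m\text{ even},\\ 2(q-1)^2q^{\frac m2-2}(2e_F-\frac m2+1)-\mathbb{1}_{4\mid m}(q-1)q^{\frac m4-1}&\text{if }2e_F+2\leq m\leq4e_F,\ m\text{ even},\\ 4(q-1)q^{\frac{m-1}2-1}&\text{if }2e_F+3\leq m\leq4e_F+1,\ m\text{ odd},\\ q^{e_F}(2q^{e_F}-1)&\text{if }m=4e_F+2,\\0&\text{otherwise,}\end{cases}$$ where $\mathbb{1}_P$ is $1$ if $P$ holds and $0$ otherwise. *)

theory Defs
  imports Complex_Main "HOL-Algebra.Algebra" "HOL-Combinatorics.Permutations"
    "HOL-Computational_Algebra.Primes"
begin

section \<open>The field of 2-adic numbers\<close>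

definition val2 :: "rat \<Rightarrow> int" where
  "val2 x = int (multiplicity 2 (fst (quotient_of x))) - int (multiplicity 2 (snd (quotient_of x)))"

definition abs2 :: "rat \<Rightarrow> real" where
  "abs2 x = (if x = 0 then 0 else 2 powi (- val2 x))"

definition cauchy2 :: "(nat \<Rightarrow> rat) set" where
  "cauchy2 = {s. \<forall>\<epsilon>>0. \<exists>N. \<forall>m\<ge>N. \<forall>n\<ge>N. abs2 (s m - s n) < \<epsilon>}"

definition null2 :: "(nat \<Rightarrow> rat) set" where
  "null2 = {s. \<forall>\<epsilon>>0. \<exists>N. \<forall>n\<ge>N. abs2 (s n) < \<epsilon>}"

definition cauchy2_ring :: "(nat \<Rightarrow> rat) ring" where
  "cauchy2_ring = \<lparr>carrier = cauchy2, monoid.mult = (\<lambda>s t n. s n * t n), one = (\<lambda>n. 1),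
     ring.zero = (\<lambda>n. 0), ring.add = (\<lambda>s t n. s n + t n)\<rparr>"

type_synonym q2 = "(nat \<Rightarrow> rat) set"

text \<open>The completion of the rationals at 2, as Cauchy sequences modulo null sequences.\<close>

definition Q2 :: "q2 ring" where
  "Q2 = cauchy2_ring Quot null2"

text \<open>A class of absolute value at most 1 has a representative all of whose terms have absolute
  value at most 1, because the absolute value is discrete away from 0.\<close>

definition Z2 :: "q2 set" where
  "Z2 = {null2 +>\<^bsub>cauchy2_ring\<^esub> s | s. s \<in> cauchy2 \<and> (\<forall>n. abs2 (s n) \<le> 1)}"


section \<open>Algebras of finite dimension\<close>

definition alg_basis :: "('a, 'm) ring_scheme \<Rightarrow> ('a, 'b, 'n) module_scheme \<Rightarrow> 'b list \<Rightarrow> bool" where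
  "alg_basis F L b \<longleftrightarrow> set b \<subseteq> carrier L \<and>
     (\<forall>x\<in>carrier L. \<exists>!c. c \<in> {..<length b} \<rightarrow>\<^sub>E carrier F \<and>
        x = (\<Oplus>\<^bsub>L\<^esub>i\<in>{..<length b}. c i \<odot>\<^bsub>L\<^esub> b ! i))"

definition coords ::
    "('a, 'm) ring_scheme \<Rightarrow> ('a, 'b, 'n) module_scheme \<Rightarrow> 'b list \<Rightarrow> 'b \<Rightarrow> nat \<Rightarrow> 'a" where
  "coords F L b x = (THE c. c \<in> {..<length b} \<rightarrow>\<^sub>E carrier F \<and>
        x = (\<Oplus>\<^bsub>L\<^esub>i\<in>{..<length b}. c i \<odot>\<^bsub>L\<^esub> b ! i))"

definition degree_over :: "('a, 'm) ring_scheme \<Rightarrow> ('a, 'b, 'n) module_scheme \<Rightarrow> nat" where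
  "degree_over F L = (THE n. \<exists>b. alg_basis F L b \<and> length b = n)"

definition finite_field_ext :: "('a, 'm) ring_scheme \<Rightarrow> ('a, 'b, 'n) module_scheme \<Rightarrow> bool" where
  "finite_field_ext F L \<longleftrightarrow> field L \<and> algebra F L \<and> (\<exists>b. alg_basis F L b)"

text \<open>\<open>mult_matrix F L x\<close> is the matrix of multiplication by \<open>x\<close> in some basis of \<open>L\<close> over
  \<open>F\<close>; the trace and the determinant do not depend on that basis.\<close>

definition some_basis :: "('a, 'm) ring_scheme \<Rightarrow> ('a, 'b, 'n) module_scheme \<Rightarrow> 'b list" where
  "some_basis F L = (SOME b. alg_basis F L b)"

definition mult_matrix ::
    "('a, 'm) ring_scheme \<Rightarrow> ('a, 'b, 'n) module_scheme \<Rightarrow> 'b \<Rightarrow> nat \<Rightarrow> nat \<Rightarrow> 'a" where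
  "mult_matrix F L x i j = coords F L (some_basis F L) (x \<otimes>\<^bsub>L\<^esub> some_basis F L ! j) i"

definition ring_det :: "('a, 'm) ring_scheme \<Rightarrow> nat \<Rightarrow> (nat \<Rightarrow> nat \<Rightarrow> 'a) \<Rightarrow> 'a" where
  "ring_det F n M = (\<Oplus>\<^bsub>F\<^esub>p\<in>{p. p permutes {..<n}}.
     add_pow F (sign p) (\<Otimes>\<^bsub>F\<^esub>i\<in>{..<n}. M i (p i)))"

definition alg_trace :: "('a, 'm) ring_scheme \<Rightarrow> ('a, 'b, 'n) module_scheme \<Rightarrow> 'b \<Rightarrow> 'a" where
  "alg_trace F L x = (\<Oplus>\<^bsub>F\<^esub>i\<in>{..<degree_over F L}. mult_matrix F L x i i)"

definition alg_norm :: "('a, 'm) ring_scheme \<Rightarrow> ('a, 'b, 'n) module_scheme \<Rightarrow> 'b \<Rightarrow> 'a" where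
  "alg_norm F L x = ring_det F (degree_over F L) (mult_matrix F L x)"

definition alg_iso ::
    "('a, 'm) ring_scheme \<Rightarrow> ('a, 'b, 'n) module_scheme \<Rightarrow> ('a, 'c, 'k) module_scheme \<Rightarrow> ('b \<Rightarrow> 'c) set"
  where
  "alg_iso F L M = {f \<in> ring_iso L M.
     \<forall>a\<in>carrier F. \<forall>x\<in>carrier L. f (a \<odot>\<^bsub>L\<^esub> x) = a \<odot>\<^bsub>M\<^esub> f x}"

definition alg_isomorphic ::
    "('a, 'm) ring_scheme \<Rightarrow> ('a, 'b, 'n) module_scheme \<Rightarrow> ('a, 'c, 'k) module_scheme \<Rightarrow> bool" where
  "alg_isomorphic F L M \<longleftrightarrow> alg_iso F L M \<noteq> {}"

text \<open>Extensional functions, so that maps that agree on the carrier are counted once.\<close>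

definition alg_aut :: "('a, 'm) ring_scheme \<Rightarrow> ('a, 'b, 'n) module_scheme \<Rightarrow> ('b \<Rightarrow> 'b) set" where
  "alg_aut F L = alg_iso F L L \<inter> extensional (carrier L)"

definition alg_prod ::
    "('a, 'b, 'n) module_scheme \<Rightarrow> ('a, 'c, 'k) module_scheme \<Rightarrow> ('a, 'b \<times> 'c) module" where
  "alg_prod L M = ring.extend (RDirProd L M)
     (module.fields (\<lambda>a (x, y). (a \<odot>\<^bsub>L\<^esub> x, a \<odot>\<^bsub>M\<^esub> y)))"

text \<open>Finite products of finite field extensions, up to isomorphism. This is only used over
  fields of characteristic 0, where every finite field extension is separable.\<close>

inductive etale :: "('a, 'm) ring_scheme \<Rightarrow> ('a, 'b) module \<Rightarrow> bool" for F where
  zero: "algebra F L \<Longrightarrow> carrier L = {\<zero>\<^bsub>L\<^esub>} \<Longrightarrow> etale F L"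
| ext: "finite_field_ext F L \<Longrightarrow> etale F L"
| prod: "etale F L1 \<Longrightarrow> etale F L2 \<Longrightarrow> algebra F L \<Longrightarrow> alg_isomorphic F L (alg_prod L1 L2)
    \<Longrightarrow> etale F L"

text \<open>Isomorphism classes are formed among the algebras carried by the type \<open>'a list\<close>; this loses
  nothing, see \<open>algebra_copy_on_lists\<close> below.\<close>

definition iso_class ::
    "('a, 'm) ring_scheme \<Rightarrow> ('a, 'a list) module \<Rightarrow> ('a, 'a list) module set" where
  "iso_class F L = {M. algebra F M \<and> alg_isomorphic F L M}"


section \<open>Valuations and rings of integers\<close>

text \<open>Integrality of an element of the \<open>K\<close>-algebra \<open>L\<close> over a subring \<open>A\<close> of \<open>K\<close>.\<close>

definition integral_over ::
    "'a set \<Rightarrow> ('a, 'b, 'n) module_scheme \<Rightarrow> 'b \<Rightarrow> bool" where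
  "integral_over A L x \<longleftrightarrow> (\<exists>n::nat. \<exists>c\<in>{..<n} \<rightarrow> A.
     x [^]\<^bsub>L\<^esub> n \<oplus>\<^bsub>L\<^esub> (\<Oplus>\<^bsub>L\<^esub>i\<in>{..<n}. c i \<odot>\<^bsub>L\<^esub> (x [^]\<^bsub>L\<^esub> i)) = \<zero>\<^bsub>L\<^esub>)"

definition integral_closure :: "'a set \<Rightarrow> ('a, 'b, 'n) module_scheme \<Rightarrow> 'b set" where
  "integral_closure A L = {x \<in> carrier L. integral_over A L x}"

text \<open>In the following three definitions \<open>B\<close> is a discrete valuation ring with field of
  fractions \<open>K\<close>.\<close>

definition max_ideal :: "('a, 'm) ring_scheme \<Rightarrow> 'a set \<Rightarrow> 'a set" where
  "max_ideal K B = B - Units (K\<lparr>carrier := B\<rparr>)"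

definition uniformizer :: "('a, 'm) ring_scheme \<Rightarrow> 'a set \<Rightarrow> 'a \<Rightarrow> bool" where
  "uniformizer K B \<pi> \<longleftrightarrow> \<pi> \<in> B \<and> PIdl\<^bsub>K\<lparr>carrier := B\<rparr>\<^esub> \<pi> = max_ideal K B"

definition dvr_val :: "('a, 'm) ring_scheme \<Rightarrow> 'a set \<Rightarrow> 'a \<Rightarrow> int" where
  "dvr_val K B x = (THE n. \<exists>\<pi> u. uniformizer K B \<pi> \<and> u \<in> Units (K\<lparr>carrier := B\<rparr>) \<and>
     x = (\<pi> [^]\<^bsub>K\<^esub> n) \<otimes>\<^bsub>K\<^esub> u)"

text \<open>A 2-adic field carries its structure of extension of \<open>Q2\<close> in the scalar multiplication.\<close>

definition two_adic_field :: "(q2, 'a) module \<Rightarrow> bool" where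
  "two_adic_field F \<longleftrightarrow> finite_field_ext Q2 F"

definition O_F :: "(q2, 'a) module \<Rightarrow> 'a set" where
  "O_F F = integral_closure Z2 F"

definition v_F :: "(q2, 'a) module \<Rightarrow> 'a \<Rightarrow> int" where
  "v_F F = dvr_val F (O_F F)"

definition abs_ram_index :: "(q2, 'a) module \<Rightarrow> nat" where
  "abs_ram_index F = nat (v_F F (\<one>\<^bsub>F\<^esub> \<oplus>\<^bsub>F\<^esub> \<one>\<^bsub>F\<^esub>))"

definition residue_field :: "(q2, 'a) module \<Rightarrow> 'a set ring" where
  "residue_field F = F\<lparr>carrier := O_F F\<rparr> Quot max_ideal F (O_F F)"

definition ideal_norm :: "(q2, 'a) module \<Rightarrow> 'a set \<Rightarrow> nat" where
  "ideal_norm F I = card (carrier (F\<lparr>carrier := O_F F\<rparr> Quot I))"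

definition ideal_val :: "(q2, 'a) module \<Rightarrow> 'a set \<Rightarrow> int" where
  "ideal_val F I = Inf (v_F F ` (I - {\<zero>\<^bsub>F\<^esub>}))"

definition O_L :: "(q2, 'a) module \<Rightarrow> ('a, 'b) module \<Rightarrow> 'b set" where
  "O_L F L = integral_closure (O_F F) L"

text \<open>The discriminant ideal is generated by the discriminants of all tuples of \<open>[L:F]\<close> integral
  elements; tuples that are not bases contribute 0.\<close>

definition disc_ideal :: "(q2, 'a) module \<Rightarrow> ('a, 'b) module \<Rightarrow> 'a set" where
  "disc_ideal F L = Idl\<^bsub>F\<lparr>carrier := O_F F\<rparr>\<^esub>
     {ring_det F (degree_over F L) (\<lambda>i j. alg_trace F L (w i \<otimes>\<^bsub>L\<^esub> w j)) | w.
        w \<in> {..<degree_over F L} \<rightarrow> O_L F L}"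

definition disc_val :: "(q2, 'a) module \<Rightarrow> ('a, 'b) module \<Rightarrow> int" where
  "disc_val F L = ideal_val F (disc_ideal F L)"

text \<open>For a field extension \<open>L\<close> of \<open>F\<close>: the valuation in \<open>L\<close> of a uniformizer of \<open>F\<close>.\<close>

definition ram_index :: "(q2, 'a) module \<Rightarrow> ('a, 'b) module \<Rightarrow> int" where
  "ram_index F L =
     dvr_val L (O_L F L) ((SOME \<pi>. uniformizer F (O_F F) \<pi>) \<odot>\<^bsub>L\<^esub> \<one>\<^bsub>L\<^esub>)"

definition tot_ram_quadratic :: "(q2, 'a) module \<Rightarrow> ('a, 'b) module \<Rightarrow> bool" where
  "tot_ram_quadratic F L \<longleftrightarrow> finite_field_ext F L \<and> degree_over F L = 2 \<and>
     ram_index F L = int (degree_over F L)"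


section \<open>Sets of isomorphism classes and pre-mass\<close>

definition fg_subgroup :: "'a set \<Rightarrow> ('a, 'm) monoid_scheme \<Rightarrow> bool" where
  "fg_subgroup A G \<longleftrightarrow> subgroup A G \<and> (\<exists>S. finite S \<and> S \<subseteq> carrier G \<and> generate G S = A)"

definition norm_group :: "(q2, 'a) module \<Rightarrow> ('a, 'b) module \<Rightarrow> 'a set" where
  "norm_group F L = alg_norm F L ` Units L"

text \<open>The third argument is rational so that the valuation can be compared with \<open>m / 2\<close>; the set
  is empty if it is not an integer.\<close>

definition Et_ram2 :: "(q2, 'a) module \<Rightarrow> 'a set \<Rightarrow> rat \<Rightarrow> ('a, 'a list) module set set" where
  "Et_ram2 F A r = {iso_class F L | L :: ('a, 'a list) module.
     tot_ram_quadratic F L \<and> A \<subseteq> norm_group F L \<and> of_int (disc_val F L) = r}"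

definition Et_ram2_ram2 :: "(q2, 'a) module \<Rightarrow> 'a set \<Rightarrow> ('a, 'a list) module set set" where
  "Et_ram2_ram2 F A = {iso_class F L | L :: ('a, 'a list) module.
     etale F L \<and>
     (\<exists>(L1 :: ('a, 'a list) module) (L2 :: ('a, 'a list) module).
        tot_ram_quadratic F L1 \<and> tot_ram_quadratic F L2 \<and>
        alg_isomorphic F L (alg_prod L1 L2)) \<and>
     A \<subseteq> norm_group F L}"

text \<open>The summand depends only on the isomorphism class, not on the chosen representative.
  This is meant for finite sets of classes; the sum over an infinite set is 0 by convention.\<close>

definition premass :: "(q2, 'a) module \<Rightarrow> ('a, 'a list) module set set \<Rightarrow> real" where
  "premass F S = (\<Sum>C\<in>S. let L = (SOME L. L \<in> C) in
     inverse (real (ideal_norm F (disc_ideal F L))) / real (card (alg_aut F L)))"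

definition N_neq :: "nat \<Rightarrow> nat \<Rightarrow> nat \<Rightarrow> real" where
  "N_neq q e m =
    (if 4 \<le> m \<and> m \<le> 2 * e \<and> even m then
       2 * (real q - 1)\<^sup>2 * real q ^ (m div 2 - 2) * (real m / 2 - 1)
       - (if 4 dvd m then (real q - 1) * real q ^ (m div 4 - 1) else 0)
     else if 2 * e + 2 \<le> m \<and> m \<le> 4 * e \<and> even m then
       2 * (real q - 1)\<^sup>2 * real q ^ (m div 2 - 2) * (2 * real e - real m / 2 + 1)
       - (if 4 dvd m then (real q - 1) * real q ^ (m div 4 - 1) else 0)
     else if 2 * e + 3 \<le> m \<and> m \<le> 4 * e + 1 \<and> odd m then
       4 * (real q - 1) * real q ^ ((m - 1) div 2 - 1)
     else if m = 4 * e + 2 then real q ^ e * (2 * real q ^ e - 1)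
     else 0)"


section \<open>Every finite-dimensional algebra is isomorphic to one carried by lists\<close>

lemma algebra_copy:
  fixes L :: "('a, 'b) module" and f :: "'b \<Rightarrow> 'c"
  assumes L: "algebra F L" and inj: "inj_on f (carrier L)"
  shows "\<exists>M :: ('a, 'c) module. algebra F M \<and> alg_isomorphic F L M"
proof -
  interpret L: cring L by (rule algebra.M_cring[OF L])
  interpret algebra F L by (rule L)
  define g where "g = inv_into (carrier L) f"
  have gf [simp]: "g (f x) = x" if "x \<in> carrier L" for x
    using inj that by (simp add: g_def)
  define M :: "('a, 'c) module" where
    "M = \<lparr>carrier = f ` carrier L, monoid.mult = (\<lambda>u v. f (g u \<otimes>\<^bsub>L\<^esub> g v)), one = f \<one>\<^bsub>L\<^esub>,
       ring.zero = f \<zero>\<^bsub>L\<^esub>, ring.add = (\<lambda>u v. f (g u \<oplus>\<^bsub>L\<^esub> g v)), smult = (\<lambda>a u. f (a \<odot>\<^bsub>L\<^esub> g u))\<rparr>"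
  have cr: "cring M"
  proof (rule cringI)
    show "abelian_group M"
    proof (rule abelian_groupI)
      fix x assume "x \<in> carrier M"
      then obtain x' where x': "x = f x'" "x' \<in> carrier L" by (auto simp: M_def)
      show "\<exists>y\<in>carrier M. y \<oplus>\<^bsub>M\<^esub> x = \<zero>\<^bsub>M\<^esub>"
        by (rule bexI[of _ "f (\<ominus>\<^bsub>L\<^esub> x')"]) (use x' in \<open>auto simp: M_def L.l_neg\<close>)
    qed (auto simp: M_def L.a_ac)
    show "comm_monoid M"
      by (rule comm_monoidI) (auto simp: M_def L.m_ac)
  qed (auto simp: M_def L.l_distr)
  have "algebra F M"
    by (rule algebraI[OF R_cring cr])
       (auto simp: M_def smult_l_distr smult_r_distr smult_assoc1 smult_assoc2)
  moreover have "f \<in> alg_iso F L M"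
    using inj by (auto simp: alg_iso_def ring_iso_def ring_hom_def M_def bij_betw_def)
  ultimately show ?thesis by (auto simp: alg_isomorphic_def)
qed

lemma algebra_copy_on_lists:
  fixes L :: "('a, 'b) module"
  assumes L: "algebra F L" and b: "alg_basis F L b"
  shows "\<exists>M :: ('a, 'a list) module. algebra F M \<and> alg_isomorphic F L M"
proof (rule algebra_copy[OF L])
  let ?P = "\<lambda>x c. c \<in> {..<length b} \<rightarrow>\<^sub>E carrier F \<and>
        x = (\<Oplus>\<^bsub>L\<^esub>i\<in>{..<length b}. c i \<odot>\<^bsub>L\<^esub> b ! i)"
  have P: "?P x (coords F L b x)" if "x \<in> carrier L" for x
  proof -
    have "\<exists>!c. ?P x c"
      by (rule bspec[OF b[unfolded alg_basis_def, THEN conjunct2] that])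
    then show ?thesis unfolding coords_def by (rule theI'[of "?P x"])
  qed
  show "inj_on (\<lambda>x. map (coords F L b x) [0..<length b]) (carrier L)"
  proof (rule inj_onI)
    fix x y
    assume x: "x \<in> carrier L" and y: "y \<in> carrier L"
      and eq: "map (coords F L b x) [0..<length b] = map (coords F L b y) [0..<length b]"
    have "coords F L b x = coords F L b y"
    proof (rule PiE_ext[OF P[OF x, THEN conjunct1] P[OF y, THEN conjunct1]])
      fix i assume "i \<in> {..<length b}"
      then show "coords F L b x i = coords F L b y i"
        using arg_cong[OF eq, of "\<lambda>l. l ! i"] by simp
    qed
    then have "(\<Oplus>\<^bsub>L\<^esub>i\<in>{..<length b}. coords F L b x i \<odot>\<^bsub>L\<^esub> b ! i) =
        (\<Oplus>\<^bsub>L\<^esub>i\<in>{..<length b}. coords F L b y i \<odot>\<^bsub>L\<^esub> b ! i)"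
      by (simp only:)
    then show "x = y"
      by (rule trans[OF trans[OF P[OF x, THEN conjunct2]] P[OF y, THEN conjunct2, symmetric]])
  qed
qed

end

theory Submission
  imports Defs "Jordan_Normal_Form.Char_Poly" "HOL-Library.Product_Plus"
begin

text \<open>Totally ramified quadratic extensions of \<open>F\<close> correspond to square classes, and the valuation
  \<open>r\<close> of the discriminant is read off a normal form of the class: \<open>r = 2e + 1\<close> for classes of odd
  valuation, \<open>r = 2e + 1 - d\<close> for classes of \<open>1 + x\<close> with \<open>v x = d\<close> odd and less than \<open>2e\<close>. Hence there
  are \<open>2(q - 1)q^(k - 1)\<close> classes with \<open>r = 2k\<close> and \<open>2q^e\<close> with \<open>r = 2e + 1\<close>. A product of two such
  extensions is determined by an unordered pair of classes; discriminants add up, and there are 8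
  automorphisms if the classes agree and 4 otherwise. For different classes \<open>a\<close>, \<open>b\<close> the norm groups
  generate \<open>F - {0}\<close>, since the Hilbert symbol is nondegenerate, so the condition on \<open>A\<close> matters only for
  equal classes. Equal classes give the first sum; for different classes the sum over unordered pairs
  is half of the square of the generating function of the class numbers minus its diagonal, which is
  the generating function of \<open>N_neq\<close>.

  The arithmetic is done in a type of class \<open>field_char_0\<close>. The field \<open>F\<close> is only a carrier set in a type,
  so at the end a type is defined whose elements form a hypothetical counterexample.\<close>

text \<open>No valuation on \<open>F\<close> is available at the start: its integers are defined as
  an integral closure, and a discrete valuation, a finite residue field and Hensel lifting have to
  be won from Cauchy sequences. The tool is a lattice closed under multiplication. Its compactness
  gives a theory of power-bounded elements, and these prove to be a valuation ring and to be exactly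
  the integral elements. The Hilbert symbol is treated without class field theory. Norm groups have
  index at most 2 by successive approximation: squares correct a unit at even levels of the unit
  filtration, values of the norm form correct it at odd levels, and what is left at one critical
  level is governed by the map \<open>z \<mapsto> z ^ 2 + z\<close> on the residue field, whose
  image has index 2. For a nonsquare the index is exactly 2 because a non-norm can be written down,
  by comparison with the unramified extension. The parity phenomenon behind this, that even levels
  below \<open>2 * e\<close> yield no new square classes, also drives the count of classes.\<close>

section \<open>Compact lattices closed under multiplication, and power-bounded elements\<close>

text \<open>A compact open subring, described through the 2-adic topology that it defines. It need
  not contain 1; \<open>absorbing\<close> supplies some power of 2 instead.\<close>

locale two_adic_lattice =
 fixes \<Lambda> :: "'k::field_char_0 set"
 assumes zero_in: "0 \<in> \<Lambda>"
  and add_in: "x \<in> \<Lambda> ==> y \<in> \<Lambda> ==> x + y \<in> \<Lambda>"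
  and uminus_in: "x \<in> \<Lambda> ==> - x \<in> \<Lambda>"
  and mult_in: "x \<in> \<Lambda> ==> y \<in> \<Lambda> ==> x * y \<in> \<Lambda>"
  and absorbing: "\<exists>k::nat. 2 ^ k * x \<in> \<Lambda>"
  and separated: "(\<And>k::nat. x / 2 ^ k \<in> \<Lambda>) ==> x = 0"
  and finite_mod_2: "\<exists>S. finite S \<and> (\<forall>x\<in>\<Lambda>. \<exists>s\<in>S. (x - s) / 2 \<in> \<Lambda>)"
  and complete: "(\<And>k::nat. (s (Suc k) - s k) / 2 ^ k \<in> \<Lambda>) ==> \<exists>x. \<forall>k. (x - s k) / 2 ^ k \<in> \<Lambda>"
begin

lemma diff_in: "x \<in> \<Lambda> ==> y \<in> \<Lambda> ==> x - y \<in> \<Lambda>"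
 using add_in[OF _ uminus_in] by fastforce

lemma double_in: "x \<in> \<Lambda> ==> 2 * x \<in> \<Lambda>"
 by (metis add_in mult_2)

lemma two_power_in: "x \<in> \<Lambda> ==> 2 ^ k * x \<in> \<Lambda>"
 by (induction k) (auto simp: mult.assoc intro: double_in)

lemma two_power_mono: "2 ^ j * x \<in> \<Lambda> ==> j \<le> k ==> 2 ^ k * x \<in> \<Lambda>"
 using two_power_in[of "2 ^ j * x" "k - j"] by (simp add: mult.assoc[symmetric] power_add[symmetric])

lemma of_nat_in: "x \<in> \<Lambda> ==> of_nat n * x \<in> \<Lambda>"
 by (induction n) (auto simp: distrib_right zero_in add_in)

lemma sum_in: "(\<And>i. i \<in> I ==> f i \<in> \<Lambda>) ==> sum f I \<in> \<Lambda>"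
 by (induction I rule: infinite_finite_induct) (auto simp: zero_in add_in)

lemma div_two_power_antimono: "x / 2 ^ k \<in> \<Lambda> ==> j \<le> k ==> x / 2 ^ j \<in> \<Lambda>"
proof -
 assume a: "x / 2 ^ k \<in> \<Lambda>" "j \<le> k"
 have "2 ^ (k - j) * (x / 2 ^ k) = x / 2 ^ j"
  using a(2) by (simp add: power_diff)
 then show ?thesis using two_power_in[OF a(1), of "k - j"] by simp
qed

text \<open>Sequential compactness of the lattice, by nested pigeonholes.\<close>

lemma cluster_point:
 fixes y :: "nat => 'k"
 assumes y: "\<And>n. y n \<in> \<Lambda>"
 shows "\<exists>z. \<forall>k N. \<exists>n\<ge>N. (y n - z) / 2 ^ k \<in> \<Lambda>"
proof -
 obtain S where S: "finite S" "\<And>x. x \<in> \<Lambda> ==> \<exists>s\<in>S. (x - s) / 2 \<in> \<Lambda>"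
  using finite_mod_2 by blast
 let ?Q = "\<lambda>k z. \<forall>N. \<exists>n\<ge>N. (y n - z) / 2 ^ k \<in> \<Lambda>"
 \<comment> \<open>Pigeonhole on the residue of \<open>(y n - z) / 2 ^ k\<close> modulo 2:
   infinitely many indices share one representative \<open>s\<close>, and
   \<open>w = z + 2 ^ k * s\<close> approximates those terms one level better.\<close>
 have step: "\<exists>w. ?Q (Suc k) w \<and> (w - z) / 2 ^ k \<in> \<Lambda>" if Q: "?Q k z" for k z
 proof -
  have inf: "infinite {n. (y n - z) / 2 ^ k \<in> \<Lambda>}"
   using Q unfolding infinite_nat_iff_unbounded_le by simp
  let ?f = "\<lambda>n. SOME s. s \<in> S \<and> ((y n - z) / 2 ^ k - s) / 2 \<in> \<Lambda>"
  have f: "?f n \<in> S \<and> ((y n - z) / 2 ^ k - ?f n) / 2 \<in> \<Lambda>" if "(y n - z) / 2 ^ k \<in> \<Lambda>" for n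
   by (rule someI_ex[where P="\<lambda>s. s \<in> S \<and> ((y n - z) / 2 ^ k - s) / 2 \<in> \<Lambda>"])
    (use S(2)[OF that] in blast)
  have "finite (?f ` {n. (y n - z) / 2 ^ k \<in> \<Lambda>})"
   by (rule finite_subset[OF _ S(1)]) (use f in blast)
  from pigeonhole_infinite[OF inf this]
  obtain s where s: "infinite {n \<in> {n. (y n - z) / 2 ^ k \<in> \<Lambda>}. ?f n = s}" by blast
  define w where "w = z + 2 ^ k * s"
  have eq: "((y n - z) / 2 ^ k - s) / 2 = (y n - w) / 2 ^ Suc k" for n
   by (simp add: w_def field_simps)
  have sub: "{n \<in> {n. (y n - z) / 2 ^ k \<in> \<Lambda>}. ?f n = s} \<subseteq> {n. (y n - z) / 2 ^ k \<in> \<Lambda> \<and> (y n - w) / 2 ^ Suc k \<in> \<Lambda>}"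
   using f unfolding eq[symmetric] by blast
  have inf2: "infinite {n. (y n - z) / 2 ^ k \<in> \<Lambda> \<and> (y n - w) / 2 ^ Suc k \<in> \<Lambda>}"
   using s sub infinite_super by blast
  have 1: "?Q (Suc k) w"
  proof
   fix N
   show "\<exists>n\<ge>N. (y n - w) / 2 ^ Suc k \<in> \<Lambda>"
    using inf2 unfolding infinite_nat_iff_unbounded_le by blast
  qed
  obtain n where n: "(y n - z) / 2 ^ k \<in> \<Lambda>" "(y n - w) / 2 ^ Suc k \<in> \<Lambda>"
   using inf2[unfolded infinite_nat_iff_unbounded_le] by blast
  have "(y n - w) / 2 ^ k \<in> \<Lambda>" using div_two_power_antimono[OF n(2), of k] by simp
  from diff_in[OF n(1) this] have "(w - z) / 2 ^ k \<in> \<Lambda>" by (simp add: diff_divide_distrib[symmetric])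
  with 1 show ?thesis by blast
 qed
 have Q0: "?Q 0 0" using y by auto
 define s where "s = rec_nat 0 (\<lambda>k z. SOME w. ?Q (Suc k) w \<and> (w - z) / 2 ^ k \<in> \<Lambda>)"
 have s0: "s 0 = 0" by (simp add: s_def)
 have sS: "s (Suc k) = (SOME w. ?Q (Suc k) w \<and> (w - s k) / 2 ^ k \<in> \<Lambda>)" for k
  by (simp add: s_def)
 have Qs: "?Q k (s k)" for k
 proof (induction k)
  case 0 then show ?case using Q0 s0 by simp
 next
  case (Suc k) show ?case
   unfolding sS using someI_ex[OF step[OF Suc]] by blast
 qed
 have ds: "(s (Suc k) - s k) / 2 ^ k \<in> \<Lambda>" for k
  unfolding sS using someI_ex[OF step[OF Qs]] by blast
 obtain z where z: "\<And>k. (z - s k) / 2 ^ k \<in> \<Lambda>" using complete[OF ds] by blast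
 have "\<exists>n\<ge>N. (y n - z) / 2 ^ k \<in> \<Lambda>" for k N
 proof -
  obtain n where n: "n \<ge> N" "(y n - s k) / 2 ^ k \<in> \<Lambda>" using Qs by blast
  then have "(y n - z) / 2 ^ k \<in> \<Lambda>"
   using diff_in[OF n(2) z[of k]] by (simp add: diff_divide_distrib[symmetric])
  with n show ?thesis by blast
 qed
 then show ?thesis by blast
qed

text \<open>Staying outside the double of \<open>\<Lambda>\<close> keeps the terms away from 0: a
  cluster point 0 would put some \<open>y n / 2\<close> into \<open>\<Lambda>\<close>.\<close>

lemma cluster_point_outside_double:
 fixes y :: "nat => 'k"
 assumes y: "\<And>n. y n \<in> \<Lambda>" "\<And>n. y n / 2 \<notin> \<Lambda>"
 shows "\<exists>z. z \<noteq> 0 \<and> (\<forall>k N. \<exists>n\<ge>N. (y n - z) / 2 ^ k \<in> \<Lambda>)"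
proof -
 obtain z where z: "\<And>k N. \<exists>n\<ge>N. (y n - z) / 2 ^ k \<in> \<Lambda>" using cluster_point[of y] y(1) by blast
 have "z \<noteq> 0"
 proof
  assume "z = 0"
  then obtain n where "y n / 2 ^ 1 \<in> \<Lambda>" using z[of 0 1] by auto
  with y(2) show False by simp
 qed
 with z show ?thesis by blast
qed

text \<open>A topological stand-in for the ring of integers that makes sense before any valuation
  exists; \<open>power_bounded_iff_integral\<close> later identifies it with the integral
  closure.\<close>

definition power_bounded :: "'k set" where
 "power_bounded = {x. \<exists>k. \<forall>n. 2 ^ k * x ^ n \<in> \<Lambda>}"

abbreviation "Ob \<equiv> power_bounded"

lemma lattice_sub_Ob: "x \<in> \<Lambda> ==> x \<in> Ob"
proof -
 assume x: "x \<in> \<Lambda>"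
 obtain k where k: "2 ^ k * 1 \<in> \<Lambda>" using absorbing by blast
 have "2 ^ k * x ^ n \<in> \<Lambda>" for n
  using k x by (induction n) (auto simp: mult.left_commute intro: mult_in)
 then show ?thesis by (auto simp: power_bounded_def)
qed

lemma Ob_zero: "0 \<in> Ob" by (simp add: lattice_sub_Ob zero_in)

lemma Ob_one: "1 \<in> Ob"
 using absorbing[of 1] by (auto simp: power_bounded_def)

lemma Ob_mult: "x \<in> Ob ==> y \<in> Ob ==> x * y \<in> Ob"
proof -
 assume "x \<in> Ob" "y \<in> Ob"
 then obtain a b where ab: "\<And>n. 2 ^ a * x ^ n \<in> \<Lambda>" "\<And>n. 2 ^ b * y ^ n \<in> \<Lambda>"
  by (auto simp: power_bounded_def)
 have "2 ^ (a + b) * (x * y) ^ n \<in> \<Lambda>" for n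
  using mult_in[OF ab(1)[of n] ab(2)[of n]] by (simp add: power_add power_mult_distrib ac_simps)
 then show ?thesis by (auto simp: power_bounded_def)
qed

lemma Ob_add: "x \<in> Ob ==> y \<in> Ob ==> x + y \<in> Ob"
proof -
 assume "x \<in> Ob" "y \<in> Ob"
 then obtain a b where ab: "\<And>n. 2 ^ a * x ^ n \<in> \<Lambda>" "\<And>n. 2 ^ b * y ^ n \<in> \<Lambda>"
  by (auto simp: power_bounded_def)
 have "2 ^ (a + b) * (x + y) ^ n \<in> \<Lambda>" for n
 proof -
  have "2 ^ (a + b) * (x + y) ^ n =
   (\<Sum>k\<le>n. of_nat (n choose k) * ((2 ^ a * x ^ k) * (2 ^ b * y ^ (n - k))))"
   by (simp add: binomial_ring sum_distrib_left power_add ac_simps)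
  also have "\<dots> \<in> \<Lambda>" by (intro sum_in of_nat_in mult_in ab)
  finally show ?thesis .
 qed
 then show ?thesis by (auto simp: power_bounded_def)
qed

lemma Ob_uminus: "x \<in> Ob ==> - x \<in> Ob"
proof -
 assume "x \<in> Ob"
 then obtain a where a: "\<And>n. 2 ^ a * x ^ n \<in> \<Lambda>" by (auto simp: power_bounded_def)
 have "2 ^ a * (- x) ^ n \<in> \<Lambda>" for n
  using a[of n] uminus_in[OF a[of n]] by (cases "even n") auto
 then show ?thesis by (auto simp: power_bounded_def)
qed

lemma Ob_diff: "x \<in> Ob ==> y \<in> Ob ==> x - y \<in> Ob"
 using Ob_add[OF _ Ob_uminus] by fastforce

lemma Ob_power: "x \<in> Ob ==> x ^ n \<in> Ob"
 by (induction n) (auto intro: Ob_mult Ob_one)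

lemma Ob_sum: "(\<And>i. i \<in> I ==> f i \<in> Ob) ==> sum f I \<in> Ob"
 by (induction I rule: infinite_finite_induct) (auto simp: Ob_zero Ob_add)

lemma Ob_of_nat: "of_nat n \<in> Ob"
 by (induction n) (auto simp: Ob_zero Ob_one Ob_add)

lemma Ob_two_power: "2 ^ n \<in> Ob"
 using Ob_of_nat[of "2 ^ n"] by simp

lemma half_notin_Ob: "1 / 2 \<notin> Ob"
proof
 assume "1 / 2 \<in> Ob"
 then obtain k where k: "\<And>n. 2 ^ k * (1 / 2) ^ n \<in> \<Lambda>" by (auto simp: power_bounded_def)
 have "2 ^ k / 2 ^ n \<in> \<Lambda>" for n using k[of n] by (simp add: power_one_over)
 from separated[OF this] show False by simp
qed

text \<open>Take the least \<open>j\<close> with \<open>2 ^ j * x \<in> \<Lambda>\<close>: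
  minimality forbids one more halving. This normalization feeds the compactness arguments.\<close>

lemma exists_primitive_multiple:
 assumes "x \<noteq> 0" "2 ^ k * x \<notin> \<Lambda>"
 shows "\<exists>j>k. 2 ^ j * x \<in> \<Lambda> \<and> 2 ^ j * x / 2 \<notin> \<Lambda>"
proof -
 obtain j0 where j0: "2 ^ j0 * x \<in> \<Lambda>" using absorbing by blast
 define j where "j = (LEAST j. 2 ^ j * x \<in> \<Lambda>)"
 have j: "2 ^ j * x \<in> \<Lambda>" unfolding j_def by (rule LeastI[of _ j0]) (rule j0)
 have jk: "j > k" using two_power_mono[OF j, of k] assms(2) by (meson not_le)
 then obtain i where i: "j = Suc i" by (cases j) auto
 have "2 ^ i * x \<notin> \<Lambda>" using not_less_Least[of i "\<lambda>j. 2 ^ j * x \<in> \<Lambda>"] i j_def by simp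
 then show ?thesis using j jk i by (intro exI[of _ j]) auto
qed

text \<open>If the powers of \<open>x\<close> are unbounded, a cluster point \<open>z\<close> of the normalized record powers
 satisfies \<open>z / x ^ m \<in> \<Lambda>\<close> for all \<open>m\<close>; as \<open>z\<close> is invertible, the powers of \<open>1 / x\<close> are bounded.\<close>

lemma Ob_valuation: "x \<in> Ob \<or> 1 / x \<in> Ob"
proof (rule disjCI)
 assume nb: "1 / x \<notin> Ob"
 show "x \<in> Ob"
 proof (rule ccontr)
  assume x: "x \<notin> Ob"
  then have x0: "x \<noteq> 0" using Ob_zero by auto
  have ex: "\<exists>n. 2 ^ k * x ^ n \<notin> \<Lambda>" for k using x by (auto simp: power_bounded_def)
  \<comment> \<open>\<open>N k\<close> is the first exponent whose power escapes at scale
    \<open>2 ^ k\<close>; all earlier powers are still inside.\<close>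
  define N where "N k = (LEAST n. 2 ^ k * x ^ n \<notin> \<Lambda>)" for k
  have N: "2 ^ k * x ^ N k \<notin> \<Lambda>" for k
   unfolding N_def using ex[of k] by (rule LeastI_ex)
  have N': "2 ^ k * x ^ n \<in> \<Lambda>" if "n < N k" for k n
   using not_less_Least[of n "\<lambda>n. 2 ^ k * x ^ n \<notin> \<Lambda>"] that by (auto simp: N_def)
  have "\<exists>j>k. 2 ^ j * x ^ N k \<in> \<Lambda> \<and> 2 ^ j * x ^ N k / 2 \<notin> \<Lambda>" for k
   by (rule exists_primitive_multiple) (use x0 N in auto)
  then obtain J where J: "\<And>k. J k > k" "\<And>k. 2 ^ J k * x ^ N k \<in> \<Lambda>" "\<And>k. 2 ^ J k * x ^ N k / 2 \<notin> \<Lambda>"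
   by metis
  define y where "y k = 2 ^ J k * x ^ N k" for k
  obtain z where z: "z \<noteq> 0" "\<And>k N. \<exists>n\<ge>N. (y n - z) / 2 ^ k \<in> \<Lambda>"
   using cluster_point_outside_double[of y] J by (auto simp: y_def)
  have zx: "z / x ^ m \<in> \<Lambda>" for m
  proof -
   \<comment> \<open>The precision \<open>k\<close> is chosen such that an error in
     \<open>2 ^ k * \<Lambda>\<close> survives division by \<open>x ^ m\<close>.\<close>
   obtain k where k: "2 ^ k * (1 / x ^ m) \<in> \<Lambda>" using absorbing by blast
   have "\<exists>K. \<forall>i\<le>m. 2 ^ K * x ^ i \<in> \<Lambda>"
   proof (induction m)
    case 0 then show ?case using absorbing[of 1] by auto
   next
    case (Suc m)
    then obtain K K' where "\<forall>i\<le>m. 2 ^ K * x ^ i \<in> \<Lambda>" "2 ^ K' * x ^ Suc m \<in> \<Lambda>" using absorbing by blast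
    then have "\<forall>i\<le>Suc m. 2 ^ (max K K') * x ^ i \<in> \<Lambda>"
     by (metis le_Suc_eq max.cobounded1 max.cobounded2 two_power_mono)
    then show ?case by blast
   qed
   then obtain K where K: "\<And>i. i \<le> m ==> 2 ^ K * x ^ i \<in> \<Lambda>" by blast
   obtain n where n: "n \<ge> K" "(y n - z) / 2 ^ k \<in> \<Lambda>" using z(2) by blast
   \<comment> \<open>The factor \<open>2 ^ K\<close> clears all powers up to \<open>m\<close>, and
     \<open>K \<le> n\<close>; so the escaping exponent \<open>N n\<close> lies beyond
     \<open>m\<close>. Dividing by \<open>x ^ m\<close> then leads back to an exponent that has not
     escaped.\<close>
   have Nn: "N n > m"
    using N[of n] K[of "N n"] n(1) by (meson not_le two_power_mono)
   have e1: "y n / x ^ m = 2 ^ J n * x ^ (N n - m)"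
    using Nn x0 by (simp add: y_def power_diff)
   have "y n / x ^ m \<in> \<Lambda>"
   proof (cases "m = 0")
    case True then show ?thesis using J(2) by (simp add: y_def)
   next
    case False
    then have "2 ^ n * x ^ (N n - m) \<in> \<Lambda>" using Nn by (intro N') auto
    then show ?thesis unfolding e1 using J(1)[of n] by (meson less_imp_le two_power_mono)
   qed
   moreover have "(y n - z) / 2 ^ k * (2 ^ k * (1 / x ^ m)) \<in> \<Lambda>" by (rule mult_in[OF n(2) k])
   ultimately have "y n / x ^ m - (y n - z) / 2 ^ k * (2 ^ k * (1 / x ^ m)) \<in> \<Lambda>" by (rule diff_in)
   then show ?thesis by (simp add: diff_divide_distrib[symmetric])
  qed
  obtain c where c: "2 ^ c * (1 / z) \<in> \<Lambda>" using absorbing by blast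
  have "2 ^ c * (1 / x) ^ m \<in> \<Lambda>" for m
   using mult_in[OF c zx[of m]] z(1) by (simp add: power_one_over)
  then have "1 / x \<in> Ob" by (auto simp: power_bounded_def)
  with nb show False by simp
 qed
qed

text \<open>Otherwise normalized multiples of power-bounded elements cluster at some
  \<open>z \<noteq> 0\<close> with all \<open>z / 2 ^ j\<close> power-bounded. Multiplying by a
  lattice multiple of \<open>1 / z\<close> would make \<open>1 / 2\<close> power-bounded.\<close>

lemma Ob_bounded: "\<exists>c. \<forall>x\<in>Ob. 2 ^ c * x \<in> \<Lambda>"
proof (rule ccontr)
 assume "\<not> ?thesis"
 then obtain x where x: "\<And>c. x c \<in> Ob" "\<And>c. 2 ^ c * x c \<notin> \<Lambda>" by metis
 have "\<exists>j>c. 2 ^ j * x c \<in> \<Lambda> \<and> 2 ^ j * x c / 2 \<notin> \<Lambda>" for c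
  by (rule exists_primitive_multiple) (use x zero_in in \<open>auto, metis mult_zero_right\<close>)
 then obtain J where J: "\<And>k. J k > k" "\<And>k. 2 ^ J k * x k \<in> \<Lambda>" "\<And>k. 2 ^ J k * x k / 2 \<notin> \<Lambda>"
  by metis
 obtain z where z: "z \<noteq> 0" "\<And>k N. \<exists>n\<ge>N. (2 ^ J n * x n - z) / 2 ^ k \<in> \<Lambda>"
  using cluster_point_outside_double[of "\<lambda>n. 2 ^ J n * x n"] J by auto
 have zj: "z / 2 ^ j \<in> Ob" for j
 proof -
  obtain n where n: "n \<ge> j" "(2 ^ J n * x n - z) / 2 ^ j \<in> \<Lambda>" using z(2) by blast
  have "2 ^ (J n - j) * x n \<in> Ob" using x(1) by (intro Ob_mult Ob_two_power)
  moreover have "2 ^ (J n - j) * x n = 2 ^ J n * x n / 2 ^ j"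
   using n(1) J(1)[of n] by (simp add: power_diff)
  ultimately have "2 ^ J n * x n / 2 ^ j - (2 ^ J n * x n - z) / 2 ^ j \<in> Ob"
   using Ob_diff lattice_sub_Ob n(2) by metis
  then show ?thesis by (simp add: diff_divide_distrib[symmetric])
 qed
 obtain c where c: "2 ^ c * (1 / z) \<in> \<Lambda>" using absorbing by blast
 have "z / 2 ^ Suc c * (2 ^ c * (1 / z)) \<in> Ob" by (intro Ob_mult zj lattice_sub_Ob c)
 then show False using half_notin_Ob z(1) by simp
qed

text \<open>By \<open>Ob_bounded\<close> a fixed factor \<open>2 ^ c\<close> carries the sequence
  into \<open>\<Lambda>\<close>, where limits exist.\<close>

lemma Ob_complete:
 assumes "\<And>k::nat. (s (Suc k) - s k) / 2 ^ k \<in> Ob"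
 shows "\<exists>x. \<forall>k. (x - s k) / 2 ^ k \<in> Ob"
proof -
 obtain c where c: "\<And>x. x \<in> Ob ==> 2 ^ c * x \<in> \<Lambda>" using Ob_bounded by blast
 have "(2 ^ c * s (Suc k) - 2 ^ c * s k) / 2 ^ k \<in> \<Lambda>" for k
  using c[OF assms[of k]] by (simp add: right_diff_distrib)
 then obtain y where y: "\<And>k. (y - 2 ^ c * s k) / 2 ^ k \<in> \<Lambda>"
  using complete[of "\<lambda>k. 2 ^ c * s k"] by blast
 define x where "x = y / 2 ^ c"
 have tele: "(s (k + j) - s k) / 2 ^ k \<in> Ob" for k j
 proof (induction j)
  case 0 then show ?case by (simp add: Ob_zero)
 next
  case (Suc j)
  have "2 ^ j * ((s (Suc (k + j)) - s (k + j)) / 2 ^ (k + j)) \<in> Ob"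
   by (intro Ob_mult Ob_two_power assms)
  then have "(s (Suc (k + j)) - s (k + j)) / 2 ^ k \<in> Ob" by (simp add: power_add)
  from Ob_add[OF this Suc] show ?case by (simp add: add_divide_distrib[symmetric])
 qed
 have "(x - s k) / 2 ^ k \<in> Ob" for k
 proof -
  \<comment> \<open>Reading the approximation \<open>c\<close> indices later makes up for the
    division by \<open>2 ^ c\<close>.\<close>
  have "(y - 2 ^ c * s (k + c)) / 2 ^ (k + c) \<in> Ob" using y lattice_sub_Ob by blast
  then have "(x - s (k + c)) / 2 ^ k \<in> Ob"
   by (simp add: x_def power_add field_simps)
  from Ob_add[OF this tele[of k c]] show ?thesis by (simp add: add_divide_distrib[symmetric])
 qed
 then show ?thesis by blast
qed

text \<open>Multiplication by \<open>2 ^ c\<close> embeds \<open>Ob\<close> into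
  \<open>\<Lambda>\<close>, which has finitely many classes modulo \<open>2 ^ Suc c\<close>; one
  preimage is chosen for each class that is met.\<close>

lemma Ob_finite_mod_2: "\<exists>T. finite T \<and> T \<subseteq> Ob \<and> (\<forall>x\<in>Ob. \<exists>t\<in>T. (x - t) / 2 \<in> Ob)"
proof -
 obtain S where S: "finite S" "\<And>x. x \<in> \<Lambda> ==> \<exists>s\<in>S. (x - s) / 2 \<in> \<Lambda>"
  using finite_mod_2 by blast
 have fin: "\<exists>S. finite S \<and> (\<forall>x\<in>\<Lambda>. \<exists>s\<in>S. (x - s) / 2 ^ n \<in> \<Lambda>)" for n
 proof (induction n)
  case 0 show ?case by (rule exI[of _ "{0}"]) auto
 next
  case (Suc n)
  then obtain S' where S': "finite S'" "\<And>x. x \<in> \<Lambda> ==> \<exists>s\<in>S'. (x - s) / 2 ^ n \<in> \<Lambda>" by blast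
  let ?S = "(\<lambda>(a, b). a + 2 ^ n * b) ` (S' \<times> S)"
  have "\<exists>s\<in>?S. (x - s) / 2 ^ Suc n \<in> \<Lambda>" if x: "x \<in> \<Lambda>" for x
  proof -
   obtain a where a: "a \<in> S'" "(x - a) / 2 ^ n \<in> \<Lambda>" using S'(2)[OF x] by blast
   obtain b where b: "b \<in> S" "((x - a) / 2 ^ n - b) / 2 \<in> \<Lambda>" using S(2)[OF a(2)] by blast
   have "(x - (a + 2 ^ n * b)) / 2 ^ Suc n = ((x - a) / 2 ^ n - b) / 2"
    by (simp add: field_simps)
   then have "(x - (a + 2 ^ n * b)) / 2 ^ Suc n \<in> \<Lambda>" using b(2) by (simp only:)
   moreover have "a + 2 ^ n * b \<in> ?S" using a(1) b(1) by force
   ultimately show ?thesis by blast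
  qed
  moreover have "finite ?S" using S(1) S'(1) by simp
  ultimately show ?case by blast
 qed
 obtain c where c: "\<And>x. x \<in> Ob ==> 2 ^ c * x \<in> \<Lambda>" using Ob_bounded by blast
 obtain S' where S': "finite S'" "\<And>x. x \<in> \<Lambda> ==> \<exists>s\<in>S'. (x - s) / 2 ^ Suc c \<in> \<Lambda>" using fin[of "Suc c"] by blast
 let ?rep = "\<lambda>s. SOME t. t \<in> Ob \<and> (2 ^ c * t - s) / 2 ^ Suc c \<in> \<Lambda>"
 let ?S = "{s \<in> S'. \<exists>t. t \<in> Ob \<and> (2 ^ c * t - s) / 2 ^ Suc c \<in> \<Lambda>}"
 have rep: "?rep s \<in> Ob \<and> (2 ^ c * ?rep s - s) / 2 ^ Suc c \<in> \<Lambda>" if "s \<in> ?S" for s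
  using that by (intro someI_ex[where P = "\<lambda>t. t \<in> Ob \<and> (2 ^ c * t - s) / 2 ^ Suc c \<in> \<Lambda>"]) blast
 have "\<exists>t\<in>?rep ` ?S. (x - t) / 2 \<in> Ob" if x: "x \<in> Ob" for x
 proof -
  obtain s where s: "s \<in> S'" "(2 ^ c * x - s) / 2 ^ Suc c \<in> \<Lambda>" using S'(2)[OF c[OF x]] by blast
  then have sS: "s \<in> ?S" using x by blast
  note r = rep[OF sS]
  have "(2 ^ c * x - s) / 2 ^ Suc c - (2 ^ c * ?rep s - s) / 2 ^ Suc c \<in> \<Lambda>"
   using diff_in s(2) r by blast
  moreover have "(2 ^ c * x - s) / 2 ^ Suc c - (2 ^ c * ?rep s - s) / 2 ^ Suc c = (x - ?rep s) / 2"
   by (simp add: field_simps)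
  ultimately have "(x - ?rep s) / 2 \<in> \<Lambda>" by (simp only:)
  then show ?thesis using sS lattice_sub_Ob by blast
 qed
 moreover have "finite (?rep ` ?S)" using S'(1) by simp
 moreover have "?rep ` ?S \<subseteq> Ob" using rep by blast
 ultimately show ?thesis by (intro exI[of _ "?rep ` ?S"]) blast
qed

end

section \<open>Complete discrete valuation rings with residue characteristic 2\<close>

text \<open>Everything that the arithmetic of square classes draws from a 2-adic field:
  \<open>R\<close> represents the residue field, \<open>e\<close> is the absolute ramification
  index, and completeness enters only through \<open>hensel\<close>, the lifting of roots of
  \<open>z ^ 2 + z = c\<close>.\<close>

locale dyadic =
 fixes Ob :: "'k::field_char_0 set" and \<pi> :: 'k and e :: nat and R :: "'k set"
 assumes one_O: "1 \<in> Ob"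
  and add_O: "x \<in> Ob ==> y \<in> Ob ==> x + y \<in> Ob"
  and uminus_O: "x \<in> Ob ==> - x \<in> Ob"
  and mult_O: "x \<in> Ob ==> y \<in> Ob ==> x * y \<in> Ob"
  and pi_O: "\<pi> \<in> Ob"
  and pi_nonzero: "\<pi> \<noteq> 0"
  and pi_nonunit: "1 / \<pi> \<notin> Ob"
  and factor: "x \<noteq> 0 ==> \<exists>(n::int) u. u \<in> Ob \<and> 1 / u \<in> Ob \<and> x = \<pi> powi n * u"
  and e_pos: "e > 0"
  and factor_2: "\<exists>u. u \<in> Ob \<and> 1 / u \<in> Ob \<and> 2 = \<pi> ^ e * u"
  and finite_R: "finite R"
  and R_O: "R \<subseteq> Ob"
  and R_transversal: "x \<in> Ob ==> \<exists>!r. r \<in> R \<and> (x - r) / \<pi> \<in> Ob"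
  and hensel: "c / \<pi> \<in> Ob ==> \<exists>z\<in>Ob. z\<^sup>2 + z = c"

context two_adic_lattice
begin

text \<open>Since \<open>1 / 0 = 0\<close> lies in \<open>Ob\<close>, the element 0 has to be named
  separately.\<close>

definition nonunit :: "'k => bool" where
 "nonunit x \<longleftrightarrow> x \<in> Ob \<and> (x = 0 \<or> 1 / x \<notin> Ob)"

lemma nonunit_mult: "nonunit x ==> y \<in> Ob ==> nonunit (x * y)"
proof -
 assume x: "nonunit x" and y: "y \<in> Ob"
 show "nonunit (x * y)"
 proof (cases "x * y = 0")
  case False
  have "1 / x \<in> Ob" if "1 / (x * y) \<in> Ob"
   using Ob_mult[OF y that] False by simp
  with x y False show ?thesis by (auto simp: nonunit_def Ob_mult)
 qed (auto simp: nonunit_def Ob_zero)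
qed

text \<open>In a valuation ring one of two elements divides the other, so the sum is a multiple of a
  nonunit.\<close>

lemma nonunit_add: "nonunit x ==> nonunit y ==> nonunit (x + y)"
proof -
 assume x: "nonunit x" and y: "nonunit y"
 consider "x = 0" | "y = 0" | "x \<noteq> 0" "y \<noteq> 0" "x / y \<in> Ob" | "x \<noteq> 0" "y \<noteq> 0" "y / x \<in> Ob"
  using Ob_valuation[of "x / y"] by auto
 then show ?thesis
 proof cases
  case 3
  then have "x + y = y * (x / y + 1)" by (simp add: field_simps)
  then show ?thesis using nonunit_mult[OF y Ob_add[OF 3(3) Ob_one]] by simp
 next
  case 4
  then have "x + y = x * (y / x + 1)" by (simp add: field_simps)
  then show ?thesis using nonunit_mult[OF x Ob_add[OF 4(3) Ob_one]] by simp
 qed (use x y in auto)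
qed

lemma nonunit_two: "nonunit 2"
 using half_notin_Ob Ob_of_nat[of 2] by (simp add: nonunit_def)

text \<open>Divisibility is a total preorder by \<open>Ob_valuation\<close>, so a finite set has a
  smallest element.\<close>

lemma exists_common_divisor:
 "finite M ==> M \<noteq> {} ==> \<exists>p\<in>M. \<forall>x\<in>M. \<exists>c\<in>Ob. x = p * c"
proof (induction rule: finite_ne_induct)
 case (singleton x)
 then show ?case using Ob_one by force
next
 case (insert y M)
 then obtain p where p: "p \<in> M" "\<And>x. x \<in> M ==> \<exists>c\<in>Ob. x = p * c" by blast
 have "(\<exists>c\<in>Ob. y = p * c) \<or> (\<exists>c\<in>Ob. p = y * c)"
 proof (cases "y = 0 \<or> p = 0")
  case True then show ?thesis using Ob_zero by (metis mult_zero_right)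
 next
  case False
  then consider "y / p \<in> Ob" "y = p * (y / p)" | "p / y \<in> Ob" "p = y * (p / y)"
   using Ob_valuation[of "y / p"] by (cases "y / p \<in> Ob") simp_all
  then show ?thesis by cases blast+
 qed
 then show ?case
 proof
  assume "\<exists>c\<in>Ob. y = p * c"
  then show ?thesis using p by blast
 next
  assume "\<exists>c\<in>Ob. p = y * c"
  then obtain c where c: "c \<in> Ob" "p = y * c" by blast
  have "\<exists>d\<in>Ob. x = y * d" if "x \<in> M" for x
   using p(2)[OF that] c Ob_mult by (metis mult.assoc)
  moreover have "\<exists>d\<in>Ob. y = y * d" using Ob_one by (metis mult.right_neutral)
  ultimately show ?thesis by blast
 qed
qed

text \<open>The maximal ideal is principal because it is finite modulo 2: a common divisor of 2 and
  of the finitely many nonunit representatives divides every nonunit.\<close>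

lemma exists_generator: "\<exists>p. nonunit p \<and> p \<noteq> 0 \<and> (\<forall>x. nonunit x --> x / p \<in> Ob)"
proof -
 obtain T where T: "finite T" "T \<subseteq> Ob" "\<And>x. x \<in> Ob ==> \<exists>t\<in>T. (x - t) / 2 \<in> Ob"
  using Ob_finite_mod_2 by blast
 define M where "M = insert 2 {t \<in> T. nonunit t}"
 have "finite M" "M \<noteq> {}" using T(1) by (auto simp: M_def)
 from exists_common_divisor[OF this] obtain p where
  p: "p \<in> M" "\<And>x. x \<in> M ==> \<exists>c\<in>Ob. x = p * c" by blast
 have nu: "nonunit p" using p(1) nonunit_two by (auto simp: M_def)
 have p0: "p \<noteq> 0" using p(2)[of 2] by (auto simp: M_def)
 have M: "x / p \<in> Ob" if "x \<in> M" for x using p(2)[OF that] p0 by auto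
 have "x / p \<in> Ob" if x: "nonunit x" for x
 proof -
  obtain t where t: "t \<in> T" "(x - t) / 2 \<in> Ob" using T(3) x by (auto simp: nonunit_def)
  have "nonunit (x + 2 * - ((x - t) / 2))"
   by (intro nonunit_add x nonunit_mult nonunit_two Ob_uminus t)
  also have "x + 2 * - ((x - t) / 2) = t" by (simp add: field_simps)
  finally have "nonunit t" .
  then have "t / p \<in> Ob" using t(1) by (intro M) (simp add: M_def)
  moreover have "2 / p \<in> Ob" by (rule M) (simp add: M_def)
  ultimately have "t / p + 2 / p * ((x - t) / 2) \<in> Ob" using t by (intro Ob_add Ob_mult)
  also have "t / p + 2 / p * ((x - t) / 2) = x / p" using p0 by (simp add: field_simps)
  finally show ?thesis .
 qed
 with nu p0 show ?thesis by blast
qed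

lemma Ob_separated: "(\<And>k::nat. x / 2 ^ k \<in> Ob) ==> x = 0"
proof -
 assume x: "\<And>k::nat. x / 2 ^ k \<in> Ob"
 obtain c where c: "\<And>x. x \<in> Ob ==> 2 ^ c * x \<in> \<Lambda>" using Ob_bounded by blast
 have "2 ^ c * x / 2 ^ k \<in> \<Lambda>" for k using c[OF x[of k]] by simp
 from separated[OF this] show "x = 0" by simp
qed

text \<open>Division by \<open>p\<close> must stop: if all \<open>x / p ^ n\<close> were in
  \<open>Ob\<close>, then multiplying by a lattice multiple of \<open>1 / x\<close> and using
  \<open>Ob_bounded\<close> would make \<open>1 / p\<close> power-bounded.\<close>

lemma factor_nat:
 assumes p: "nonunit p" "p \<noteq> 0" "\<And>x. nonunit x ==> x / p \<in> Ob" and x: "x \<in> Ob" "x \<noteq> 0"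
 shows "\<exists>n u. u \<in> Ob \<and> 1 / u \<in> Ob \<and> x = p ^ n * u"
proof -
 have "\<exists>n. x / p ^ n \<notin> Ob"
 proof (rule ccontr)
  assume "\<not> ?thesis"
  then have a: "\<And>n. x / p ^ n \<in> Ob" by blast
  obtain k where k: "2 ^ k * (1 / x) \<in> \<Lambda>" using absorbing by blast
  have b: "2 ^ k * (1 / p) ^ n \<in> Ob" for n
   using Ob_mult[OF lattice_sub_Ob[OF k] a[of n]] x(2) by (simp add: power_one_over)
  obtain c where c: "\<And>x. x \<in> Ob ==> 2 ^ c * x \<in> \<Lambda>" using Ob_bounded by blast
  have "2 ^ (c + k) * (1 / p) ^ n \<in> \<Lambda>" for n using c[OF b[of n]] by (simp add: power_add mult.assoc)
  then have "1 / p \<in> Ob" by (auto simp: power_bounded_def)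
  then show False using p(1,2) by (simp add: nonunit_def)
 qed
 define n where "n = (LEAST n. x / p ^ n \<notin> Ob)"
 have n: "x / p ^ n \<notin> Ob" unfolding n_def by (rule LeastI_ex) fact
 then obtain m where m: "n = Suc m" using x(1) by (cases n) auto
 have u: "x / p ^ m \<in> Ob" using not_less_Least[of m "\<lambda>n. x / p ^ n \<notin> Ob"] m n_def by auto
 have "1 / (x / p ^ m) \<in> Ob"
 proof (rule ccontr)
  assume "1 / (x / p ^ m) \<notin> Ob"
  then have "nonunit (x / p ^ m)" using u by (simp add: nonunit_def)
  from p(3)[OF this] n m show False by (simp add: mult.commute)
 qed
 with u show ?thesis using p(2) by (intro exI[of _ m] exI[of _ "x / p ^ m"]) simp
qed

theorem exists_dyadic: "\<exists>\<pi> e R. dyadic Ob \<pi> e R"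
proof -
 obtain p where p: "nonunit p" "p \<noteq> 0" "\<And>x. nonunit x ==> x / p \<in> Ob"
  using exists_generator by blast
 have pO: "p \<in> Ob" using p by (simp add: nonunit_def)
 obtain e u where eu: "u \<in> Ob" "1 / u \<in> Ob" "2 = p ^ e * u"
  using factor_nat[OF p, of 2] Ob_of_nat[of 2] by auto
 have e0: "e > 0"
  using eu half_notin_Ob by (cases e) auto
 have u0: "u \<noteq> 0" using eu(3) by auto
 obtain T where T: "finite T" "T \<subseteq> Ob" "\<And>x. x \<in> Ob ==> \<exists>t\<in>T. (x - t) / 2 \<in> Ob"
  using Ob_finite_mod_2 by blast
 have twop: "2 / p \<in> Ob" by (rule p(3)[OF nonunit_two])
 have Tp: "\<exists>t. t \<in> T \<and> (x - t) / p \<in> Ob" if x: "x \<in> Ob" for x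
 proof -
  obtain t where t: "t \<in> T" "(x - t) / 2 \<in> Ob" using T(3)[OF x] by blast
  have "2 / p * ((x - t) / 2) \<in> Ob" by (intro Ob_mult twop t)
  also have "2 / p * ((x - t) / 2) = (x - t) / p" using p(2) by (simp add: field_simps)
  finally show ?thesis using t(1) by blast
 qed
 \<comment> \<open>The choice depends only on the class of \<open>x\<close> modulo \<open>p\<close>,
   so its range is a transversal even if \<open>T\<close> holds several representatives of one
   class.\<close>
 define r where "r x = (SOME t. t \<in> T \<and> (x - t) / p \<in> Ob)" for x
 have r: "r x \<in> T \<and> (x - r x) / p \<in> Ob" if "x \<in> Ob" for x
  unfolding r_def by (rule someI_ex[OF Tp[OF that]])
 have r_cong: "r x = r y" if "(x - y) / p \<in> Ob" for x y
 proof -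
  have "(x - t) / p \<in> Ob \<longleftrightarrow> (y - t) / p \<in> Ob" for t
   using Ob_diff[OF _ that, of "(x - t) / p"] Ob_add[OF _ that, of "(y - t) / p"]
   by (auto simp: diff_divide_distrib add_divide_distrib)
  then show ?thesis by (simp add: r_def)
 qed
 have unique: "\<exists>!s. s \<in> r ` Ob \<and> (x - s) / p \<in> Ob" if x: "x \<in> Ob" for x
 proof (rule ex1I[of _ "r x"])
  show "r x \<in> r ` Ob \<and> (x - r x) / p \<in> Ob" using r x by blast
  fix s assume s: "s \<in> r ` Ob \<and> (x - s) / p \<in> Ob"
  then obtain y where y: "y \<in> Ob" "s = r y" by blast
  have "(x - s) / p - (y - r y) / p \<in> Ob" using s r[OF y(1)] by (intro Ob_diff) auto
  then have "(x - y) / p \<in> Ob" by (simp add: y(2) diff_divide_distrib)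
  with r_cong y show "s = r x" by metis
 qed
 have hensel: "\<exists>z\<in>Ob. z\<^sup>2 + z = c" if c: "c / p \<in> Ob" for c
 proof -
  \<comment> \<open>Fixed-point iteration for \<open>z = c - z ^ 2\<close>. All iterates lie in the
    maximal ideal, where the difference of two squares gains a factor \<open>p\<close>.\<close>
  define z where "z = rec_nat 0 (\<lambda>_ w. c - w\<^sup>2)"
  have z0: "z 0 = 0" and zS: "z (Suc k) = c - (z k)\<^sup>2" for k by (simp_all add: z_def)
  have zp: "z k / p \<in> Ob" for k
  proof (induction k)
   case (Suc k)
   have "c / p - z k / p * (p * (z k / p)) \<in> Ob" by (intro Ob_diff Ob_mult c pO Suc)
   then show ?case using p(2) by (simp add: zS diff_divide_distrib power2_eq_square)
  qed (simp add: z0 Ob_zero)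
  have zO: "z k \<in> Ob" for k using Ob_mult[OF pO zp[of k]] p(2) by simp
  have dz: "(z (Suc k) - z k) / p ^ k \<in> Ob" for k
  proof (induction k)
   case 0 then show ?case using Ob_diff[OF zO zO] by simp
  next
   case (Suc k)
   have "(z (Suc k) - z k) / p ^ k * - (z (Suc k) / p + z k / p) \<in> Ob"
    by (intro Ob_mult Suc Ob_uminus Ob_add zp)
   moreover have "(z (Suc k) - z k) / p ^ k * - (z (Suc k) / p + z k / p) = (z (Suc (Suc k)) - z (Suc k)) / p ^ Suc k"
   proof -
    have "z (Suc (Suc k)) - z (Suc k) = (z (Suc k) - z k) * - (z (Suc k) + z k)"
     by (simp add: zS[of "Suc k"] zS[of k] algebra_simps power2_eq_square)
    then show ?thesis by (simp only:) (simp add: field_simps p(2))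
   qed
   ultimately show ?case by simp
  qed
  have dz2: "(z (k + j) - z k) / p ^ k \<in> Ob" for k j
  proof (induction j)
   case 0 then show ?case by (simp add: Ob_zero)
  next
   case (Suc j)
   have "p ^ j * ((z (Suc (k + j)) - z (k + j)) / p ^ (k + j)) \<in> Ob"
    by (intro Ob_mult Ob_power pO dz)
   then have "(z (Suc (k + j)) - z (k + j)) / p ^ k \<in> Ob" using p(2) by (simp add: power_add)
   from Ob_add[OF this Suc] show ?case by (simp add: add_divide_distrib[symmetric])
  qed
  have pe: "x / 2 ^ k \<in> Ob" if "x / p ^ (e * k) \<in> Ob" for x k
  proof -
   have "x / p ^ (e * k) * (1 / u) ^ k \<in> Ob" by (intro Ob_mult Ob_power that eu)
   then show ?thesis by (simp add: eu(3) power_mult_distrib power_mult power_one_over)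
  qed
  \<comment> \<open>Completeness is stated for powers of 2, and 2 is \<open>p ^ e\<close> times a
    unit: \<open>e\<close> iterations gain one such power.\<close>
  define w where "w k = z (e * k)" for k
  have "(w (Suc k) - w k) / 2 ^ k \<in> Ob" for k
   unfolding w_def by (rule pe) (use dz2[of "e * k" e] in \<open>simp add: add.commute\<close>)
  then obtain l where l: "\<And>k. (l - w k) / 2 ^ k \<in> Ob" using Ob_complete by blast
  have lO: "l \<in> Ob" using l[of 0] by (simp add: w_def z0)
  have "(l\<^sup>2 + l - c) / 2 ^ k \<in> Ob" for k
  proof -
   have 1: "(z (Suc (e * k)) - z (e * k)) / 2 ^ k \<in> Ob" by (intro pe dz)
   have "(l - w k) / 2 ^ k * (l + w k + 1) - (z (Suc (e * k)) - z (e * k)) / 2 ^ k \<in> Ob"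
    by (intro Ob_diff Ob_mult Ob_add l lO Ob_one 1) (simp add: w_def zO)
   also have "(l - w k) / 2 ^ k * (l + w k + 1) - (z (Suc (e * k)) - z (e * k)) / 2 ^ k =
     ((l - w k) * (l + w k + 1) - (z (Suc (e * k)) - z (e * k))) / 2 ^ k"
    unfolding diff_divide_distrib[of "(l - w k) * (l + w k + 1)"] by simp
   also have "(l - w k) * (l + w k + 1) - (z (Suc (e * k)) - z (e * k)) = l\<^sup>2 + l - c"
    by (simp add: w_def zS algebra_simps power2_eq_square)
   finally show ?thesis .
  qed
  from Ob_separated[OF this] lO show ?thesis by auto
 qed
 have factor: "\<exists>(n::int) u. u \<in> Ob \<and> 1 / u \<in> Ob \<and> x = p powi n * u" if x: "x \<noteq> 0" for x
 proof (cases "x \<in> Ob")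
  case True
  from factor_nat[OF p this x] obtain n u where "u \<in> Ob" "1 / u \<in> Ob" "x = p ^ n * u" by auto
  then show ?thesis by (intro exI[of _ "int n"] exI[of _ u]) simp
 next
  case False
  then have "1 / x \<in> Ob" using Ob_valuation by blast
  from factor_nat[OF p this] x obtain n v where v: "v \<in> Ob" "1 / v \<in> Ob" "1 / x = p ^ n * v" by auto
  have "x = 1 / (1 / x)" by simp
  also have "\<dots> = p powi (- int n) * (1 / v)" unfolding v(3) by (simp add: power_int_minus divide_simps)
  finally show ?thesis using v by (intro exI[of _ "- int n"] exI[of _ "1 / v"]) auto
 qed
 have "dyadic Ob p e (r ` Ob)"
 proof
  show "finite (r ` Ob)" by (rule finite_subset[OF _ T(1)]) (use r in blast)
  show "r ` Ob \<subseteq> Ob" using r T(2) by blast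
  show "\<exists>u. u \<in> Ob \<and> 1 / u \<in> Ob \<and> 2 = p ^ e * u" using eu by blast
  show "1 / p \<notin> Ob" using p by (simp add: nonunit_def)
 qed (fact Ob_one Ob_add Ob_uminus Ob_mult pO p(2) factor e0 unique hensel | assumption)+
 then show ?thesis by blast
qed

end

section \<open>Power-bounded elements are the integral elements\<close>

text \<open>\<open>Z\<close> plays the part of the 2-adic integers inside the field; the lattice is
  a module over it.\<close>

locale two_adic_lattice_over = two_adic_lattice \<Lambda> for \<Lambda> :: "'k::field_char_0 set" +
 fixes Z :: "'k set"
 assumes zero_Z: "0 \<in> Z" and one_Z: "1 \<in> Z"
  and add_Z: "x \<in> Z ==> y \<in> Z ==> x + y \<in> Z"
  and uminus_Z: "x \<in> Z ==> - x \<in> Z"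
  and mult_Z: "x \<in> Z ==> y \<in> Z ==> x * y \<in> Z"
  and scale_in: "x \<in> Z ==> y \<in> \<Lambda> ==> x * y \<in> \<Lambda>"
  and complete_Z: "(\<And>k::nat. (s (Suc k) - s k) / 2 ^ k \<in> Z) ==> \<exists>x. \<forall>k. (x - s k) / 2 ^ k \<in> Z"
begin

lemma Z_sub_Ob: "z \<in> Z ==> z \<in> Ob"
proof -
 assume z: "z \<in> Z"
 obtain k where k: "2 ^ k * 1 \<in> \<Lambda>" using absorbing by blast
 have "2 ^ k * z ^ n \<in> \<Lambda>" for n
  using k z by (induction n) (auto simp: mult.left_commute intro: scale_in)
 then show ?thesis by (auto simp: power_bounded_def)
qed

lemma sum_Z: "(\<And>i. i \<in> I ==> f i \<in> Z) ==> sum f I \<in> Z"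
 by (induction I rule: infinite_finite_induct) (auto simp: zero_Z add_Z)

text \<open>Expand \<open>y\<close> as a 2-adic series with digits in the finite set
  \<open>T\<close> and collect equal digits: the coefficient of \<open>t\<close> is a 2-adic integer
  with digits 0 and 1.\<close>

lemma Ob_finitely_generated:
 "\<exists>T. finite T \<and> T \<subseteq> Ob \<and> (\<forall>y\<in>Ob. \<exists>c. (\<forall>t\<in>T. c t \<in> Z) \<and> y = (\<Sum>t\<in>T. c t * t))"
proof -
 obtain T where T: "finite T" "T \<subseteq> Ob" "\<And>x. x \<in> Ob ==> \<exists>t\<in>T. (x - t) / 2 \<in> Ob"
  using Ob_finite_mod_2 by blast
 then obtain f where f: "\<And>x. x \<in> Ob ==> f x \<in> T" "\<And>x. x \<in> Ob ==> (x - f x) / 2 \<in> Ob" by metis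
 have "\<forall>y\<in>Ob. \<exists>c. (\<forall>t\<in>T. c t \<in> Z) \<and> y = (\<Sum>t\<in>T. c t * t)"
 proof
  fix y assume y: "y \<in> Ob"
  define Y where "Y = rec_nat y (\<lambda>_ x. (x - f x) / 2)"
  have Y0: "Y 0 = y" and YS: "Y (Suc k) = (Y k - f (Y k)) / 2" for k by (simp_all add: Y_def)
  have YO: "Y k \<in> Ob" for k by (induction k) (auto simp: Y0 YS y f)
  \<comment> \<open>Partial sums of \<open>2 ^ j\<close> over the positions \<open>j < k\<close>
    that carry the digit \<open>t\<close>.\<close>
  define s where "s t k = (\<Sum>j<k. if f (Y j) = t then 2 ^ j else (0::'k))" for t k
  have "(s t (Suc k) - s t k) / 2 ^ k \<in> Z" for t k
   by (simp add: s_def zero_Z one_Z)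
  then have "\<exists>x. \<forall>k. (x - s t k) / 2 ^ k \<in> Z" for t using complete_Z[of "s t"] by blast
  then obtain c where c: "\<And>t k. (c t - s t k) / 2 ^ k \<in> Z" by metis
  have expand: "y = (\<Sum>t\<in>T. s t k * t) + 2 ^ k * Y k" for k
  proof (induction k)
   case 0 then show ?case by (simp add: s_def Y0)
  next
   case (Suc k)
   have "(\<Sum>t\<in>T. s t (Suc k) * t) = (\<Sum>t\<in>T. s t k * t) + (\<Sum>t\<in>T. if f (Y k) = t then 2 ^ k * t else 0)"
    by (auto simp: s_def distrib_right sum.distrib intro!: sum.cong arg_cong2[where f = "(+)"])
   also have "(\<Sum>t\<in>T. if f (Y k) = t then 2 ^ k * t else 0) = 2 ^ k * f (Y k)"
    using T(1) f(1)[OF YO] by simp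
   finally show ?case using Suc by (simp add: YS field_simps)
  qed
  have "(y - (\<Sum>t\<in>T. c t * t)) / 2 ^ k \<in> Ob" for k
  proof -
   have "(c t - s t k) / 2 ^ k \<in> Ob" for t by (intro Z_sub_Ob c)
   then have "Y k - (\<Sum>t\<in>T. (c t - s t k) / 2 ^ k * t) \<in> Ob"
    using T(2) by (intro Ob_diff YO Ob_sum Ob_mult) auto
   also have "Y k - (\<Sum>t\<in>T. (c t - s t k) / 2 ^ k * t) =
     (2 ^ k * Y k - ((\<Sum>t\<in>T. c t * t) - (\<Sum>t\<in>T. s t k * t))) / 2 ^ k"
    by (simp add: diff_divide_distrib sum_subtractf[symmetric] sum_divide_distrib left_diff_distrib)
   also have "2 ^ k * Y k - ((\<Sum>t\<in>T. c t * t) - (\<Sum>t\<in>T. s t k * t)) = y - (\<Sum>t\<in>T. c t * t)"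
    by (subst expand[of k]) simp
   finally show ?thesis .
  qed
  from Ob_separated[OF this] have "y = (\<Sum>t\<in>T. c t * t)" by simp
  moreover have "c t \<in> Z" for t using c[of t 0] by (simp add: s_def)
  ultimately show "\<exists>c. (\<forall>t\<in>T. c t \<in> Z) \<and> y = (\<Sum>t\<in>T. c t * t)" by (intro exI[of _ c] conjI ballI)
 qed
 with T(1,2) show ?thesis by (intro exI[of _ T] conjI)
qed

lemma coeffs_Z_mult:
 assumes "\<And>i. coeff p i \<in> Z" "\<And>i. coeff q i \<in> Z"
 shows "coeff (p * q) i \<in> Z"
 unfolding coeff_mult by (intro sum_Z mult_Z assms)

lemma coeffs_Z_prod:
 assumes "\<And>j i. j \<in> J ==> coeff (f j) i \<in> Z"
 shows "coeff (prod f J) i \<in> Z"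
 using assms
proof (induction J arbitrary: i rule: infinite_finite_induct)
 case (insert x J)
 then show ?case by (simp add: coeffs_Z_mult)
qed (auto simp: zero_Z one_Z coeff_1)

lemma coeffs_Z_char_poly:
 assumes A: "A \<in> carrier_mat n n" and AZ: "\<And>i j. i < n ==> j < n ==> A $$ (i, j) \<in> Z"
 shows "coeff (char_poly A) i \<in> Z"
proof -
 have ent: "coeff (char_poly_matrix A $$ (a, b)) i \<in> Z" if "a < n" "b < n" for a b i
  using A that AZ[of a b] zero_Z one_Z uminus_Z
  by (auto simp: char_poly_matrix_def coeff_pCons split: nat.splits if_splits)
 have sg: "coeff (signof p :: 'k poly) i \<in> Z" for p i
  using zero_Z one_Z uminus_Z by (auto simp: sign_def coeff_1)
 have cm: "char_poly_matrix A \<in> carrier_mat n n" using A by simp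
 have "coeff (\<Sum>p | p permutes {0..<n}. signof p * (\<Prod>i = 0..<n. char_poly_matrix A $$ (i, p i))) i \<in> Z"
  unfolding coeff_sum
  by (intro sum_Z coeffs_Z_mult sg coeffs_Z_prod ent) (auto dest: permutes_in_image)
 then show ?thesis using cm by (simp add: char_poly_def det_def)
qed

text \<open>Integral elements are power-bounded because their powers lie in a finitely generated module;
 the converse is the determinant trick on the finitely generated module \<open>Ob\<close>.\<close>

theorem power_bounded_iff_integral:
 "x \<in> Ob \<longleftrightarrow> (\<exists>n::nat. \<exists>c. (\<forall>i<n. c i \<in> Z) \<and> x ^ n + (\<Sum>i<n. c i * x ^ i) = 0)"
proof
 assume x: "x \<in> Ob"
 obtain T where T: "finite T" "T \<subseteq> Ob" "\<And>y. y \<in> Ob ==> \<exists>c. (\<forall>t\<in>T. c t \<in> Z) \<and> y = (\<Sum>t\<in>T. c t * t)"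
  using Ob_finitely_generated by blast
 obtain ts where ts: "set ts = T" "distinct ts" using finite_distinct_list[OF T(1)] by blast
 define n where "n = length ts"
 have sumT: "(\<Sum>t\<in>T. g t) = (\<Sum>i<n. g (ts ! i))" for g :: "'k => 'k"
  using sum.reindex_bij_betw[OF bij_betw_nth[OF ts(2) _ ts(1)[symmetric], of "{..<n}"], of g]
  by (simp add: n_def)
 have "\<exists>c. (\<forall>s\<in>T. c s \<in> Z) \<and> x * t = (\<Sum>s\<in>T. c s * s)" if "t \<in> T" for t
  using T(3)[of "x * t"] that T(2) x Ob_mult by blast
 then obtain C where C: "\<And>t s. t \<in> T ==> s \<in> T ==> C t s \<in> Z" "\<And>t. t \<in> T ==> x * t = (\<Sum>s\<in>T. C t s * s)"
  by metis
 define A where "A = mat n n (\<lambda>(i, j). C (ts ! i) (ts ! j))"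
 have A: "A \<in> carrier_mat n n" by (simp add: A_def)
 have tsT: "ts ! i \<in> T" if "i < n" for i using that ts n_def by auto
 have AZ: "A $$ (i, j) \<in> Z" if "i < n" "j < n" for i j
  using that C(1) tsT by (simp add: A_def)
 \<comment> \<open>The matrix \<open>A\<close> expresses multiplication by \<open>x\<close> on the
   generators, so the vector of generators is an eigenvector for \<open>x\<close>, and the monic
   characteristic polynomial of \<open>A\<close> annihilates \<open>x\<close>.\<close>
 define v where "v = vec n (\<lambda>i. ts ! i)"
 have "A *\<^sub>v v = x \<cdot>\<^sub>v v"
  by (rule eq_vecI)
   (auto simp: A_def v_def scalar_prod_def C(2)[OF tsT] sumT lessThan_atLeast0)
 moreover have "v \<noteq> 0\<^sub>v n"
 proof
  assume "v = 0\<^sub>v n"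
  then have "ts ! i = 0" if "i < n" for i using that by (metis index_vec index_zero_vec(1) v_def)
  then have "(1::'k) = 0" using T(3)[OF Ob_one] sumT by auto
  then show False by simp
 qed
 moreover have "v \<in> carrier_vec (dim_row A)" using A by (simp add: v_def)
 ultimately have "eigenvector A v x" using A by (simp add: eigenvector_def)
 then have "eigenvalue A x" by (auto simp: eigenvalue_def)
 then have root: "poly (char_poly A) x = 0" using eigenvalue_root_char_poly[OF A] by simp
 have "poly (char_poly A) x = (\<Sum>i\<le>n. coeff (char_poly A) i * x ^ i)"
  using degree_monic_char_poly[OF A] by (simp add: poly_altdef)
 also have "\<dots> = (\<Sum>i<n. coeff (char_poly A) i * x ^ i) + x ^ n"
  using degree_monic_char_poly[OF A] by (simp add: lessThan_Suc_atMost[symmetric])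
 finally have "x ^ n + (\<Sum>i<n. coeff (char_poly A) i * x ^ i) = 0" using root by (simp add: add.commute)
 then show "\<exists>n::nat. \<exists>c. (\<forall>i<n. c i \<in> Z) \<and> x ^ n + (\<Sum>i<n. c i * x ^ i) = 0"
  using coeffs_Z_char_poly[OF A AZ] by (intro exI[of _ n] exI[of _ "coeff (char_poly A)"]) auto
next
 assume "\<exists>n::nat. \<exists>c. (\<forall>i<n. c i \<in> Z) \<and> x ^ n + (\<Sum>i<n. c i * x ^ i) = 0"
 then obtain n c where c: "\<And>i. i < n ==> c i \<in> Z" "x ^ n + (\<Sum>i<n. c i * x ^ i) = 0" by blast
 \<comment> \<open>For \<open>n = 0\<close> the equation would read 1 = 0.\<close>
 then obtain m where m: "n = Suc m" by (cases n) auto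
 have xn: "x ^ n = - (\<Sum>i<n. c i * x ^ i)" using c(2) by (simp add: eq_neg_iff_add_eq_0)
 have span: "\<exists>d. (\<forall>i<n. d i \<in> Z) \<and> x ^ j = (\<Sum>i<n. d i * x ^ i)" for j
 proof (induction j)
  case 0
  have "(\<Sum>i<n. (if i = 0 then 1 else 0) * x ^ i) = (\<Sum>i<n. if i = 0 then 1 else (0::'k))"
   by (intro sum.cong) auto
  then show ?case using m by (intro exI[of _ "\<lambda>i. if i = 0 then 1 else 0"]) (auto simp: zero_Z one_Z)
 next
  case (Suc j)
  then obtain d where d: "\<And>i. i < n ==> d i \<in> Z" "x ^ j = (\<Sum>i<n. d i * x ^ i)" by blast
  \<comment> \<open>Multiplication by \<open>x\<close> shifts the coefficients; the overflow
    \<open>d m * x ^ n\<close> is rewritten by the equation of \<open>x\<close>.\<close>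
  define d' where "d' i = (if i = 0 then 0 else d (i - 1)) - d m * c i" for i
  have "x ^ Suc j = (\<Sum>i<Suc m. d i * x ^ Suc i)" by (simp add: d(2) sum_distrib_left m distrib_left ac_simps)
  also have "\<dots> = (\<Sum>i<m. d i * x ^ Suc i) + d m * x ^ n" by (simp add: m)
  also have "(\<Sum>i<m. d i * x ^ Suc i) = (\<Sum>i<Suc m. (if i = 0 then 0 else d (i - 1)) * x ^ i)"
   by (subst sum.lessThan_Suc_shift) simp
  also have "\<dots> + d m * x ^ n = (\<Sum>i<n. d' i * x ^ i)"
  proof -
   have "(\<Sum>i<n. d' i * x ^ i) =
     (\<Sum>i<n. (if i = 0 then 0 else d (i - 1)) * x ^ i - d m * (c i * x ^ i))"
    by (rule sum.cong) (simp_all add: d'_def left_diff_distrib mult.assoc)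
   also have "\<dots> = (\<Sum>i<n. (if i = 0 then 0 else d (i - 1)) * x ^ i) - d m * (\<Sum>i<n. c i * x ^ i)"
    unfolding sum_subtractf sum_distrib_left ..
   finally show ?thesis unfolding xn by (simp only: m mult_minus_right diff_conv_add_uminus)
  qed
  finally have "x ^ Suc j = (\<Sum>i<n. d' i * x ^ i)" .
  moreover have "\<forall>i<n. d' i \<in> Z"
  proof (intro allI impI)
   fix i assume i: "i < n"
   have "- (d m * c i) \<in> Z" using d(1)[of m] c(1)[OF i] m by (intro uminus_Z mult_Z) auto
   then show "d' i \<in> Z" using d(1)[of "i - 1"] i zero_Z add_Z[OF d(1)[of "i - 1"], of "- (d m * c i)"]
    by (auto simp: d'_def)
  qed
  ultimately show ?case by blast
 qed
 have "\<exists>K. \<forall>i<n. 2 ^ K * x ^ i \<in> \<Lambda>"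
 proof (induction n)
  case (Suc n)
  then obtain K K' where "\<forall>i<n. 2 ^ K * x ^ i \<in> \<Lambda>" "2 ^ K' * x ^ n \<in> \<Lambda>" using absorbing by blast
  then have "\<forall>i<Suc n. 2 ^ (max K K') * x ^ i \<in> \<Lambda>"
   by (metis less_Suc_eq max.cobounded1 max.cobounded2 two_power_mono)
  then show ?case by blast
 qed simp
 then obtain K where K: "\<And>i. i < n ==> 2 ^ K * x ^ i \<in> \<Lambda>" by blast
 have "2 ^ K * x ^ j \<in> \<Lambda>" for j
 proof -
  obtain d where d: "\<And>i. i < n ==> d i \<in> Z" "x ^ j = (\<Sum>i<n. d i * x ^ i)" using span[of j] by blast
  have "(\<Sum>i<n. d i * (2 ^ K * x ^ i)) \<in> \<Lambda>" by (intro sum_in scale_in d K) auto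
  then show ?thesis by (simp add: d(2) sum_distrib_left ac_simps)
 qed
 then show "x \<in> Ob" by (auto simp: power_bounded_def)
qed

end

section \<open>Valuation, residue field, and the Artin-Schreier map\<close>

context dyadic
begin

lemma zero_O: "0 \<in> Ob"
 using add_O[OF one_O uminus_O[OF one_O]] by simp

lemma diff_O: "x \<in> Ob ==> y \<in> Ob ==> x - y \<in> Ob"
 using add_O[OF _ uminus_O] by fastforce

lemma power_O: "x \<in> Ob ==> x ^ n \<in> Ob"
 by (induction n) (auto intro: one_O mult_O)

lemma sum_O: "(\<And>i. i \<in> I ==> f i \<in> Ob) ==> sum f I \<in> Ob"
 by (induction I rule: infinite_finite_induct) (auto intro: zero_O add_O)

lemma prod_O: "(\<And>i. i \<in> I ==> f i \<in> Ob) ==> prod f I \<in> Ob"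
 by (induction I rule: infinite_finite_induct) (auto intro: one_O mult_O)

definition unit :: "'k => bool" where
 "unit u \<longleftrightarrow> u \<noteq> 0 \<and> u \<in> Ob \<and> 1 / u \<in> Ob"

lemma unit_mult: "unit u ==> unit w ==> unit (u * w)"
 using mult_O[of "1 / u" "1 / w"] by (auto simp: unit_def mult_O)

lemma factor_unit: "x \<noteq> 0 ==> \<exists>(n::int) u. unit u \<and> x = \<pi> powi n * u"
 using factor unfolding unit_def by (metis mult_zero_right)

text \<open>If \<open>m\<close> exceeded \<open>n\<close>, cancelling would exhibit
  \<open>1 / \<pi>\<close> as an integral element.\<close>

lemma factor_le:
 assumes "unit u" "unit w" "\<pi> powi n * u = \<pi> powi m * w"
 shows "m \<le> n"
proof (rule ccontr)
 assume "\<not> m \<le> n"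
 then have mn: "m > n" by simp
 have "\<pi> powi m = \<pi> powi n * \<pi> ^ nat (m - n)"
  using mn pi_nonzero by (simp add: power_int_add[symmetric] flip: power_int_of_nat)
 with assms(3) have "u = \<pi> ^ nat (m - n) * w" using pi_nonzero by (simp add: mult.assoc)
 also have "nat (m - n) = Suc (nat (m - n - 1))" using mn by simp
 finally have "1 / \<pi> = \<pi> ^ nat (m - n - 1) * w * (1 / u)"
  using assms(1) pi_nonzero by (simp add: unit_def field_simps)
 also have "\<dots> \<in> Ob" using assms by (intro mult_O power_O pi_O) (auto simp: unit_def)
 finally show False using pi_nonunit by simp
qed

definition v :: "'k => int" where
 "v x = (THE n. \<exists>u. unit u \<and> x = \<pi> powi n * u)"

lemma v_eqI: "unit u ==> x = \<pi> powi n * u ==> v x = n"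
 unfolding v_def by (rule the_equality) (use factor_le in \<open>metis order.antisym\<close>)+

lemma v_factor: "x \<noteq> 0 ==> \<exists>u. unit u \<and> x = \<pi> powi (v x) * u"
 using factor_unit v_eqI by metis

lemma v_mult: "x \<noteq> 0 ==> y \<noteq> 0 ==> v (x * y) = v x + v y"
proof -
 assume "x \<noteq> 0" "y \<noteq> 0"
 then obtain u w where uw: "unit u" "x = \<pi> powi (v x) * u" "unit w" "y = \<pi> powi (v y) * w"
  using v_factor by metis
 have "x * y = \<pi> powi (v x + v y) * (u * w)"
  by (subst uw(2), subst uw(4)) (simp add: pi_nonzero power_int_add ac_simps)
 then show ?thesis using v_eqI[OF unit_mult[OF uw(1,3)]] by blast
qed

lemma unit_one: "unit 1" by (simp add: unit_def one_O)

lemma v_one [simp]: "v 1 = 0"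
 by (rule v_eqI[OF unit_one]) simp

lemma v_divide: "x \<noteq> 0 ==> y \<noteq> 0 ==> v (x / y) = v x - v y"
 using v_mult[of "x / y" y] by simp

lemma v_uminus [simp]: "v (- x) = v x"
proof (cases "x = 0")
 case False
 have "2 * v (- 1) = 0" using v_mult[of "- 1" "- 1"] by simp
 then show ?thesis using v_mult[of "- 1" x] False by simp
qed simp

lemma v_power: "x \<noteq> 0 ==> v (x ^ n) = int n * v x"
 by (induction n) (auto simp: v_mult algebra_simps)

lemma v_pi_powi [simp]: "v (\<pi> powi n) = n"
 by (rule v_eqI[OF unit_one]) simp

lemma v_pi [simp]: "v \<pi> = 1"
 using v_pi_powi[of 1] by simp

lemma in_O_iff: "x \<in> Ob \<longleftrightarrow> x = 0 \<or> 0 \<le> v x"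
proof (cases "x = 0")
 case False
 then obtain u where u: "unit u" "x = \<pi> powi (v x) * u" using v_factor by blast
 show ?thesis
 proof (cases "0 \<le> v x")
  case True
  then have "x = \<pi> ^ nat (v x) * u" using u by (simp flip: power_int_of_nat)
  also have "\<dots> \<in> Ob" using u by (intro mult_O power_O pi_O) (auto simp: unit_def)
  finally show ?thesis using True by simp
 next
  case neg: False
  have "x \<notin> Ob"
  proof
   assume x: "x \<in> Ob"
   have "1 / x \<in> Ob"
   proof -
    have "1 / x = \<pi> powi (- v x) * (1 / u)" by (subst u(2)) (simp add: power_int_minus divide_simps)
    also have "\<dots> = \<pi> ^ nat (- v x) * (1 / u)" using neg by (simp flip: power_int_of_nat)
    also have "\<dots> \<in> Ob" using u by (intro mult_O power_O pi_O) (auto simp: unit_def)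
    finally show ?thesis .
   qed
   then have "unit x" using x False by (simp add: unit_def)
   then have "v x = 0" by (intro v_eqI[of x]) auto
   with neg show False by simp
  qed
  then show ?thesis using neg False by simp
 qed
qed (simp add: zero_O)

text \<open>The fractional ideal of level \<open>n\<close>, for every integer \<open>n\<close>. The
  value \<open>v 0\<close> carries no meaning, which is why 0 is added by hand. Congruences are
  written as membership of a difference.\<close>

definition P :: "int => 'k set" where
 "P n = {x. x = 0 \<or> n \<le> v x}"

lemma P_0: "P 0 = Ob"
 by (auto simp: P_def in_O_iff)

lemma zero_P [simp]: "0 \<in> P n" by (simp add: P_def)

lemma P_iff: "x \<in> P n \<longleftrightarrow> x / \<pi> powi n \<in> Ob"
 by (cases "x = 0") (auto simp: P_def in_O_iff v_divide pi_nonzero)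

lemma P_add: "x \<in> P n ==> y \<in> P n ==> x + y \<in> P n"
 unfolding P_iff add_divide_distrib by (rule add_O)

lemma P_uminus: "x \<in> P n ==> - x \<in> P n"
 by (simp add: P_def)

lemma P_diff: "x \<in> P n ==> y \<in> P n ==> x - y \<in> P n"
 using P_add[OF _ P_uminus] by fastforce

lemma P_mult: "x \<in> P m ==> y \<in> P n ==> x * y \<in> P (m + n)"
 using v_mult[of x y] by (cases "x = 0 \<or> y = 0") (auto simp: P_def)

lemma P_mono: "x \<in> P m ==> n \<le> m ==> x \<in> P n"
 by (auto simp: P_def)

lemma P_mult_O: "x \<in> P n ==> y \<in> Ob ==> x * y \<in> P n"
 using P_mult[of x n y 0] by (simp add: P_0)

lemma P_sub_O: "x \<in> P n ==> 0 \<le> n ==> x \<in> Ob"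
 using P_mono[of x n 0] by (simp add: P_0)

lemma P_one_iff: "x \<in> P 1 \<longleftrightarrow> x / \<pi> \<in> Ob"
 by (simp add: P_iff)

lemma v_two: "v 2 = int e"
proof -
 obtain u where u: "u \<in> Ob" "1 / u \<in> Ob" "2 = \<pi> ^ e * u" using factor_2 by blast
 then have "unit u" by (auto simp: unit_def)
 then show ?thesis using u by (intro v_eqI[of u]) simp_all
qed

lemma two_P: "2 \<in> P (int e)"
 by (simp add: P_def v_two)

lemma two_P1: "x \<in> Ob ==> 2 * x \<in> P 1"
 using P_mult_O[OF P_mono[OF two_P, of 1]] e_pos by simp

lemma v_add_eq:
 assumes "x \<noteq> 0" "y \<in> P (v x + 1)"
 shows "x + y \<noteq> 0" "v (x + y) = v x"
proof -
 have "x + y \<notin> P (v x + 1)"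
 proof
  assume "x + y \<in> P (v x + 1)"
  from P_diff[OF this assms(2)] show False using assms(1) by (simp add: P_def)
 qed
 then show nz: "x + y \<noteq> 0" by auto
 have "x + y \<in> P (v x)" by (intro P_add P_mono[OF assms(2)]) (auto simp: P_def)
 with \<open>x + y \<notin> P (v x + 1)\<close> nz show "v (x + y) = v x" by (auto simp: P_def)
qed

lemma one_plus_P:
 assumes "x \<in> P n" "0 < n"
 shows "1 + x \<noteq> 0" "v (1 + x) = 0"
 using v_add_eq[of 1 x] P_mono[OF assms(1), of 1] assms(2) by auto

lemma unit_of_congruent:
 assumes "x - y \<in> P n" "0 < n" "y \<noteq> 0" "v y = 0"
 shows "x \<noteq> 0" "v x = 0"
 using v_add_eq[of y "x - y"] P_mono[OF assms(1), of 1] assms(2-) by auto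

lemma O_mult_P1: "x \<in> Ob ==> y \<in> Ob ==> x * y \<in> P 1 ==> x \<in> P 1 \<or> y \<in> P 1"
 by (cases "x = 0 \<or> y = 0") (auto simp: P_def in_O_iff v_mult)

definition rep :: "'k => 'k" where
 "rep x = (THE r. r \<in> R \<and> x - r \<in> P 1)"

lemma rep: assumes "x \<in> Ob" shows "rep x \<in> R" "x - rep x \<in> P 1"
 using theI'[OF R_transversal[OF assms]] unfolding rep_def P_one_iff by auto

lemma rep_unique: "r \<in> R ==> r' \<in> R ==> r - r' \<in> P 1 ==> r = r'"
proof -
 assume a: "r \<in> R" "r' \<in> R" "r - r' \<in> P 1"
 have "r \<in> Ob" using a R_O by blast
 from R_transversal[OF this] a show ?thesis unfolding P_one_iff using zero_O by auto
qed

lemma rep_eq_iff: "x \<in> Ob ==> y \<in> Ob ==> rep x = rep y \<longleftrightarrow> x - y \<in> P 1"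
proof
 assume xy: "x \<in> Ob" "y \<in> Ob" "rep x = rep y"
 then have "(x - rep x) - (y - rep y) \<in> P 1" using P_diff[OF rep(2) rep(2)] by blast
 then show "x - y \<in> P 1" using xy by simp
next
 assume xy: "x \<in> Ob" "y \<in> Ob" "x - y \<in> P 1"
 then have "(x - y) - (x - rep x) + (y - rep y) \<in> P 1" 
  using P_add[OF P_diff[OF xy(3) rep(2)[OF xy(1)]] rep(2)[OF xy(2)]] by blast
 then show "rep x = rep y" using xy by (intro rep_unique rep) simp_all
qed

lemma R_in_O: "r \<in> R ==> r \<in> Ob"
 using R_O by blast

lemma card_R_pos: "card R > 0"
 using finite_R rep(1)[OF zero_O] by (auto simp: card_gt_0_iff)

text \<open>Modulo the maximal ideal \<open>r ^ 2 - s ^ 2\<close> equals \<open>(r - s) ^ 2\<close>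
  because 2 vanishes there; so squaring is injective on the finite residue field and hence
  onto.\<close>

lemma residue_square_root:
 assumes "u \<in> Ob"
 shows "\<exists>s\<in>Ob. u - s\<^sup>2 \<in> P 1"
proof -
 have sq: "r\<^sup>2 \<in> Ob" if "r \<in> R" for r using that by (intro power_O R_in_O)
 have "inj_on (\<lambda>r. rep (r\<^sup>2)) R"
 proof (rule inj_onI)
  fix r s assume rs: "r \<in> R" "s \<in> R" "rep (r\<^sup>2) = rep (s\<^sup>2)"
  then have "r\<^sup>2 - s\<^sup>2 \<in> P 1" using rep_eq_iff sq by blast
  moreover have "2 * (s * (r - s)) \<in> P 1" using rs by (intro two_P1 mult_O diff_O R_in_O)
  ultimately have "(r\<^sup>2 - s\<^sup>2) - 2 * (s * (r - s)) \<in> P 1" by (rule P_diff)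
  also have "(r\<^sup>2 - s\<^sup>2) - 2 * (s * (r - s)) = (r - s) * (r - s)"
   by (simp add: power2_eq_square algebra_simps)
  finally have "r - s \<in> P 1" using O_mult_P1[of "r - s" "r - s"] rs by (auto simp: diff_O R_in_O)
  then show "r = s" using rs rep_unique by blast
 qed
 then have "(\<lambda>r. rep (r\<^sup>2)) ` R = R"
  using rep(1)[OF sq] by (intro endo_inj_surj finite_R image_subsetI)
 then have "rep u \<in> (\<lambda>r. rep (r\<^sup>2)) ` R" using rep(1)[OF assms] by simp
 then obtain r where r: "r \<in> R" "rep u = rep (r\<^sup>2)" by (rule imageE)
 then show ?thesis using rep_eq_iff[OF assms sq] R_in_O by blast
qed

text \<open>Completing the square, \<open>AS c\<close> says that \<open>1 + 4 * c\<close> is a square.\<close>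

definition AS :: "'k => bool" where
 "AS c \<longleftrightarrow> (\<exists>z\<in>Ob. z\<^sup>2 + z = c)"

lemma AS_O: "AS c ==> c \<in> Ob"
 by (auto simp: AS_def intro: add_O power_O)

lemma one_plus_two: "z \<in> Ob ==> 1 + 2 * z \<noteq> 0 \<and> v (1 + 2 * z) = 0"
 using one_plus_P[OF two_P1[of z]] by simp

text \<open>Replacing \<open>z\<close> by \<open>z + (1 + 2 * z) * y\<close> changes
  \<open>z ^ 2 + z\<close> by \<open>(1 + 2 * z) ^ 2 * (y ^ 2 + y)\<close>, and
  \<open>1 + 2 * z\<close> is a unit; so correcting an approximate root is an instance of
  \<open>hensel\<close>.\<close>

lemma AS_lift:
 assumes "z \<in> Ob" "z\<^sup>2 + z - c \<in> P 1"
 shows "AS c"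
proof -
 note u = one_plus_two[OF assms(1)]
 define d where "d = - (z\<^sup>2 + z - c) / (1 + 2 * z)\<^sup>2"
 have "d \<in> P 1"
 proof (cases "z\<^sup>2 + z - c = 0")
  case False
  then have "v d = v (z\<^sup>2 + z - c)"
   unfolding d_def using u by (subst v_divide) (simp_all add: v_power del: minus_diff_eq)
  then show ?thesis using assms(2) False by (simp add: P_def)
 qed (simp add: d_def)
 then obtain y where y: "y \<in> Ob" "y\<^sup>2 + y = d" using hensel unfolding P_one_iff by blast
 have "(z + (1 + 2 * z) * y)\<^sup>2 + (z + (1 + 2 * z) * y) = z\<^sup>2 + z + (1 + 2 * z)\<^sup>2 * (y\<^sup>2 + y)"
  by (simp add: power2_eq_square algebra_simps)
 also have "\<dots> = c" using u by (simp add: y d_def)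
 finally show ?thesis
  using assms(1) y(1) add_O[OF one_O add_O[OF assms(1) assms(1)]] unfolding AS_def
  by (intro bexI[of _ "z + (1 + 2 * z) * y"]) (auto intro!: add_O mult_O)
qed

lemma AS_P1: "c \<in> P 1 ==> AS c"
 by (rule AS_lift[of 0]) (auto simp: zero_O P_uminus)

lemma AS_congruent: "AS c ==> c - d \<in> P 1 ==> AS d"
 unfolding AS_def using AS_lift AS_def by metis

lemma AS_zero: "AS 0" by (rule AS_P1) simp

text \<open>The map \<open>z \<mapsto> z ^ 2 + z\<close> is additive up to
  \<open>2 * (z * w)\<close>, an error that \<open>AS_lift\<close> absorbs.\<close>

lemma AS_add: "AS c ==> AS d ==> AS (c + d)"
proof -
 assume "AS c" "AS d"
 then obtain z w where zw: "z \<in> Ob" "w \<in> Ob" "c = z\<^sup>2 + z" "d = w\<^sup>2 + w" by (auto simp: AS_def)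
 have "(z + w)\<^sup>2 + (z + w) - (c + d) = 2 * (z * w)"
  by (simp add: zw power2_eq_square algebra_simps)
 also have "\<dots> \<in> P 1" using zw by (intro two_P1 mult_O)
 finally show ?thesis using zw by (intro AS_lift[of "z + w"] add_O)
qed

lemma AS_uminus: "AS c ==> AS (- c)"
 by (rule AS_congruent) (use two_P1[of c] AS_O in auto)

lemma AS_diff: "AS c ==> AS d ==> AS (c - d)"
 using AS_add[OF _ AS_uminus] by fastforce

text \<open>The map \<open>z \<mapsto> z\<^sup>2 + z + c\<close> on residues has fibres of size at most 2.\<close>

lemma card_AS_image:
 assumes c: "c \<in> Ob"
 shows "card R \<le> 2 * card ((\<lambda>r. rep (r\<^sup>2 + r + c)) ` R)"
proof -
 let ?f = "\<lambda>r. rep (r\<^sup>2 + r + c)"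
 have fO: "r\<^sup>2 + r + c \<in> Ob" if "r \<in> R" for r using R_in_O[OF that] c by (intro add_O power_O)
 define g where "g = inv_into R ?f"
 have g: "g y \<in> R \<and> ?f (g y) = y" if "y \<in> ?f ` R" for y
  unfolding g_def using inv_into_into[OF that] f_inv_into_f[OF that] by simp
 \<comment> \<open>The second point of the fibre through \<open>s\<close> is the class of
   \<open>- 1 - s\<close>, as the difference of values factors into
   \<open>(r - s) * (r - (- 1 - s))\<close>.\<close>
 have "R \<subseteq> (\<Union>y\<in>?f ` R. {g y, rep (- 1 - g y)})"
 proof
  fix r assume r: "r \<in> R"
  define s where "s = g (?f r)"
  have s: "s \<in> R" "?f s = ?f r" using g r by (auto simp: s_def)
  have "(r\<^sup>2 + r + c) - (s\<^sup>2 + s + c) \<in> P 1" using rep_eq_iff fO s r by metis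
  also have "(r\<^sup>2 + r + c) - (s\<^sup>2 + s + c) = (r - s) * (r - (- 1 - s))"
   by (simp add: power2_eq_square algebra_simps)
  finally have "r - s \<in> P 1 \<or> r - (- 1 - s) \<in> P 1"
   using r s by (intro O_mult_P1 diff_O uminus_O one_O R_in_O)
  then have "r = s \<or> r = rep (- 1 - s)"
  proof
   assume "r - s \<in> P 1" then show ?thesis using rep_unique r s by blast
  next
   assume a: "r - (- 1 - s) \<in> P 1"
   have o: "- 1 - s \<in> Ob" using s by (intro diff_O uminus_O one_O R_in_O)
   have "(r - (- 1 - s)) + ((- 1 - s) - rep (- 1 - s)) \<in> P 1" by (rule P_add[OF a rep(2)[OF o]])
   then show ?thesis using rep_unique[OF r rep(1)[OF o]] by simp
  qed
  then show "r \<in> (\<Union>y\<in>?f ` R. {g y, rep (- 1 - g y)})" using r by (auto simp: s_def)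
 qed
 then have "card R \<le> card (\<Union>y\<in>?f ` R. {g y, rep (- 1 - g y)})"
  by (intro card_mono) (auto simp: finite_R)
 also have "\<dots> \<le> (\<Sum>y\<in>?f ` R. card {g y, rep (- 1 - g y)})"
  by (intro card_UN_le) (simp add: finite_R)
 also have "\<dots> \<le> (\<Sum>y\<in>?f ` R. 2)" by (intro sum_mono) (simp add: card_insert_if)
 finally show ?thesis by simp
qed

text \<open>If \<open>c\<close>, \<open>d\<close> and \<open>c + d\<close> all failed, the
  translates of the image by 0, \<open>c\<close> and \<open>- d\<close> would be pairwise disjoint;
  each fills at least half of the residue field by \<open>card_AS_image\<close>, which is too
  much.\<close>

lemma AS_index: "c \<in> Ob ==> d \<in> Ob ==> \<not> AS c ==> \<not> AS d ==> AS (c + d)"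
proof (rule ccontr)
 assume cd: "c \<in> Ob" "d \<in> Ob" "\<not> AS c" "\<not> AS d" "\<not> AS (c + d)"
 let ?I = "\<lambda>c. (\<lambda>r. rep (r\<^sup>2 + r + c)) ` R"
 have disj: "?I a \<inter> ?I b = {}" if "a \<in> Ob" "b \<in> Ob" "\<not> AS (a - b)" for a b
 proof (rule ccontr)
  assume "?I a \<inter> ?I b \<noteq> {}"
  then obtain r s where rs: "r \<in> R" "s \<in> R" "rep (r\<^sup>2 + r + a) = rep (s\<^sup>2 + s + b)" by auto
  have "r\<^sup>2 + r + a \<in> Ob" "s\<^sup>2 + s + b \<in> Ob"
   using R_in_O[OF rs(1)] R_in_O[OF rs(2)] that by (auto intro!: add_O power_O)
  then have "(r\<^sup>2 + r + a) - (s\<^sup>2 + s + b) \<in> P 1" using rs(3) rep_eq_iff by blast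
  then have "((s\<^sup>2 + s) - (r\<^sup>2 + r)) - (a - b) \<in> P 1" using P_uminus by (fastforce simp: algebra_simps)
  moreover have "AS ((s\<^sup>2 + s) - (r\<^sup>2 + r))" using rs R_in_O by (intro AS_diff) (auto simp: AS_def)
  ultimately show False using AS_congruent that by blast
 qed
 have md: "\<not> AS (- d)" using AS_uminus cd(4) by fastforce
 have d1: "?I 0 \<inter> ?I c = {}" by (rule disj) (use cd AS_uminus in \<open>fastforce simp: zero_O\<close>)+
 have d2: "?I 0 \<inter> ?I (- d) = {}" by (rule disj) (use cd in \<open>auto simp: zero_O uminus_O\<close>)
 have d3: "?I c \<inter> ?I (- d) = {}" by (rule disj) (use cd in \<open>auto simp: uminus_O\<close>)
 have sub: "?I a \<subseteq> R" if "a \<in> Ob" for a using that R_in_O by (auto intro!: rep add_O power_O)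
 have fin: "finite (?I a)" for a using finite_R by simp
 have "card (?I 0 \<union> ?I c \<union> ?I (- d)) = card (?I 0) + card (?I c) + card (?I (- d))"
 proof -
  have "card (A \<union> B \<union> C) = card A + card B + card C"
   if "finite A" "finite B" "finite C" "A \<inter> B = {}" "A \<inter> C = {}" "B \<inter> C = {}" for A B C :: "'k set"
   using that by (subst card_Un_disjoint; (subst card_Un_disjoint)?) auto
  from this[OF fin fin fin d1 d2 d3] show ?thesis .
 qed
 moreover have "card (?I 0 \<union> ?I c \<union> ?I (- d)) \<le> card R"
  using sub[of 0] sub[of c] sub[of "- d"] cd by (intro card_mono finite_R) (auto simp: zero_O uminus_O)
 ultimately show False
  using card_AS_image[OF zero_O] card_AS_image[OF cd(1)] card_AS_image[OF uminus_O[OF cd(2)]] card_R_pos by linarith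
qed

text \<open>The residues of 0 and of \<open>- 1\<close> have the same image under
  \<open>r \<mapsto> r ^ 2 + r\<close>, and a map of a finite set that is not injective misses a
  value.\<close>

lemma exists_not_AS: "\<exists>c\<in>Ob. \<not> AS c"
proof -
 let ?f = "\<lambda>r. rep (r\<^sup>2 + r)"
 have O: "r\<^sup>2 + r \<in> Ob" if "r \<in> R" for r using that by (intro add_O power_O R_in_O)
 have "rep 0 \<in> R" "rep (- 1) \<in> R" by (auto intro!: rep zero_O uminus_O one_O)
 moreover have "?f (rep 0) = ?f (rep (- 1))"
 proof -
  let ?r = "rep 0" and ?s = "rep (- 1)"
  have "?r - 0 \<in> P 1" "?s - (- 1) \<in> P 1"
   using P_uminus[OF rep(2)[OF zero_O]] P_uminus[OF rep(2)[OF uminus_O[OF one_O]]] by auto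
  then have "?r * (?r + 1) - (?s + 1) * ?s \<in> P 1"
   using R_in_O calculation by (intro P_diff P_mult_O add_O one_O) auto
  then show ?thesis
   using rep_eq_iff O calculation by (simp add: power2_eq_square algebra_simps)
 qed
 moreover have "rep 0 \<noteq> rep (- 1)"
  using rep_eq_iff[OF zero_O uminus_O[OF one_O]] by (simp add: P_def)
 ultimately have "\<not> inj_on ?f R" by (auto simp: inj_on_def)
 then have "\<not> R \<subseteq> ?f ` R" using finite_R by (metis endo_inj_surj finite_surj_inj)
 then obtain c where c: "c \<in> R" "c \<notin> ?f ` R" by blast
 have "\<not> AS c"
 proof
  assume "AS c"
  then obtain z where z: "z \<in> Ob" "c = z\<^sup>2 + z" by (auto simp: AS_def)
  note r = rep[OF z(1)]
  have "c - (rep z ^ 2 + rep z) = (z - rep z) * (z + rep z + 1)"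
   by (simp add: z(2) power2_eq_square algebra_simps)
  also have "\<dots> \<in> P 1" using r z R_in_O by (intro P_mult_O add_O one_O) auto
  finally have "(c - (rep z ^ 2 + rep z)) + ((rep z ^ 2 + rep z) - ?f (rep z)) \<in> P 1"
   by (rule P_add[OF _ rep(2)[OF O[OF r(1)]]])
  then have "c = ?f (rep z)" using c(1) rep(1)[OF O[OF r(1)]] by (intro rep_unique) auto
  with c r show False by blast
 qed
 with c R_in_O show ?thesis by blast
qed

definition is_square :: "'k => bool" where
 "is_square a \<longleftrightarrow> (\<exists>s. a = s\<^sup>2)"

lemma AS_imp_square: "AS c ==> is_square (1 + 4 * c)"
proof -
 assume "AS c"
 then obtain z where "c = z\<^sup>2 + z" by (auto simp: AS_def)
 then have "1 + 4 * c = (1 + 2 * z)\<^sup>2" by (simp add: power2_eq_square algebra_simps)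
 then show ?thesis by (auto simp: is_square_def)
qed

lemma v_four: "v 4 = 2 * int e"
 using v_mult[of 2 2] v_two by simp

text \<open>With \<open>p = \<pi> ^ j\<close> the square of \<open>1 + p * s\<close> is
  \<open>1 + p ^ 2 * s ^ 2 + 2 * p * s\<close>. The cross term has level at least
  \<open>e + j\<close>, above \<open>2 * j\<close>, and \<open>s ^ 2\<close> can match any residue.
  Level 0 is separate, as \<open>1 + s\<close> need not be a unit.\<close>

lemma even_level_square:
 assumes a: "a \<noteq> 0" "v a = 0" "a - 1 \<in> P (2 * int j)" and j: "j < e"
 shows "\<exists>t. t \<noteq> 0 \<and> v t = 0 \<and> a - t\<^sup>2 \<in> P (2 * int j + 1)"
proof (cases "j = 0")
 case True
 have "a \<in> Ob" using a by (simp add: in_O_iff)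
 then obtain s where s: "s \<in> Ob" "a - s\<^sup>2 \<in> P 1" using residue_square_root by blast
 have "s\<^sup>2 - a \<in> P 1" using P_uminus[OF s(2)] by simp
 from unit_of_congruent[OF this] a have "s\<^sup>2 \<noteq> 0" "v (s\<^sup>2) = 0" by auto
 with s True show ?thesis by (auto simp: v_power)
next
 case False
 have "(a - 1) / \<pi> powi (2 * int j) \<in> Ob" using a(3) P_iff by blast
 then obtain s where s: "s \<in> Ob" "(a - 1) / \<pi> powi (2 * int j) - s\<^sup>2 \<in> P 1"
  using residue_square_root by blast
 let ?p = "\<pi> powi int j"
 have pp: "\<pi> powi (2 * int j) = ?p\<^sup>2" by (simp add: power_int_mult power2_eq_square flip: power_int_add) (simp add: power_mult power2_eq_square power_mult_distrib mult_2 power_add)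
 have pP: "?p \<in> P (int j)" "?p\<^sup>2 \<in> P (2 * int j)"
  using pi_nonzero by (auto simp: P_def v_power v_pi_powi simp del: power_int_of_nat)
 have p0: "?p \<noteq> 0" using pi_nonzero by simp
 have t: "?p * s \<in> P (int j)" using P_mult_O[OF pP(1) s(1)] .
 have "a - (1 + ?p * s)\<^sup>2 = ?p\<^sup>2 * ((a - 1) / \<pi> powi (2 * int j) - s\<^sup>2) - 2 * (?p * s)"
  unfolding pp using p0 by (simp add: power2_eq_square field_simps)
 also have "\<dots> \<in> P (2 * int j + 1)"
  using j by (intro P_diff P_mult pP s P_mono[OF P_mult[OF two_P t]]) auto
 finally show ?thesis using one_plus_P[OF t] False by (intro exI[of _ "1 + ?p * s"]) auto
qed

section \<open>Norm groups of quadratic extensions\<close>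

text \<open>The nonzero values of the norm form of the extension by a square root of
  \<open>a\<close>; for nonzero \<open>a\<close> and \<open>c\<close>, membership of
  \<open>c\<close> says that the Hilbert symbol of \<open>a\<close> and \<open>c\<close> is trivial.
  The definition also covers squares.\<close>

definition N :: "'k => 'k set" where
 "N a = {c. c \<noteq> 0 \<and> (\<exists>x y. c = x\<^sup>2 - a * y\<^sup>2)}"

lemma N_I: "x\<^sup>2 - a * y\<^sup>2 \<noteq> 0 ==> x\<^sup>2 - a * y\<^sup>2 \<in> N a"
 by (auto simp: N_def)

lemma N_nonzero: "c \<in> N a ==> c \<noteq> 0"
 by (simp add: N_def)

lemma N_mult: "c \<in> N a ==> d \<in> N a ==> c * d \<in> N a"
proof -
 assume "c \<in> N a" "d \<in> N a"
 then obtain x y z w where a: "c \<noteq> 0" "d \<noteq> 0" "c = x\<^sup>2 - a * y\<^sup>2" "d = z\<^sup>2 - a * w\<^sup>2"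
  by (auto simp: N_def)
 have "c * d = (x * z + a * y * w)\<^sup>2 - a * (x * w + y * z)\<^sup>2"
  by (simp add: a(3,4) power2_eq_square algebra_simps)
 with a(1,2) show ?thesis by (auto simp: N_def)
qed

lemma N_square: "s \<noteq> 0 ==> s\<^sup>2 \<in> N a"
 using N_I[of s a 0] by simp

lemma N_square_mult_iff: "s \<noteq> 0 ==> c * s\<^sup>2 \<in> N a \<longleftrightarrow> c \<in> N a"
proof
 assume s: "s \<noteq> 0" "c * s\<^sup>2 \<in> N a"
 have "c * s\<^sup>2 * (1 / s)\<^sup>2 \<in> N a" by (intro N_mult s N_square) (use s in simp)
 then show "c \<in> N a" using s(1) by (simp add: power_one_over)
qed (intro N_mult N_square)

lemma N_inverse: "c \<in> N a ==> 1 / c \<in> N a"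
proof -
 assume c: "c \<in> N a"
 then have "c * (1 / c)\<^sup>2 \<in> N a" by (intro N_mult N_square) (auto dest: N_nonzero)
 then show ?thesis using N_nonzero[OF c] by (simp add: power2_eq_square)
qed

lemma N_divide: "c \<in> N a ==> d \<in> N a ==> c / d \<in> N a"
 using N_mult[OF _ N_inverse] by fastforce

lemma N_cancel: "n \<in> N a ==> c * n \<in> N a \<longleftrightarrow> c \<in> N a"
 using N_mult N_divide[of "c * n" a n] N_nonzero by auto

lemma N_cong_square: "s \<noteq> 0 ==> N (a * s\<^sup>2) = N a"
proof -
 have sub: "N (a * s\<^sup>2) \<subseteq> N a" for a s
 proof
  fix c assume "c \<in> N (a * s\<^sup>2)"
  then obtain x y where xy: "c \<noteq> 0" "c = x\<^sup>2 - a * s\<^sup>2 * y\<^sup>2" by (auto simp: N_def)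
  then have "c = x\<^sup>2 - a * (s * y)\<^sup>2" by (simp add: power_mult_distrib mult.assoc)
  with xy show "c \<in> N a" by (auto simp: N_def)
 qed
 assume "s \<noteq> 0"
 then have "a = a * s\<^sup>2 * (1 / s)\<^sup>2" by (simp add: power_one_over)
 with sub[of a s] sub[of "a * s\<^sup>2" "1 / s"] show ?thesis by simp
qed

text \<open>If \<open>a = t ^ 2\<close>, the form splits into
  \<open>(x - t * y) * (x + t * y)\<close>; the factors are made equal to 1 and
  \<open>c\<close>.\<close>

lemma N_of_square: "is_square a ==> a \<noteq> 0 ==> c \<noteq> 0 ==> c \<in> N a"
proof -
 assume a: "is_square a" "a \<noteq> 0" "c \<noteq> 0"
 then obtain t where t: "a = t\<^sup>2" "t \<noteq> 0" by (auto simp: is_square_def)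
 have "((c + 1) / 2)\<^sup>2 - a * ((c - 1) / (2 * t))\<^sup>2 = c"
  using t by (simp add: power2_eq_square field_simps)
 with a(3) show ?thesis by (metis N_I)
qed

text \<open>Dividing \<open>b = x ^ 2 - a * y ^ 2\<close> by \<open>y ^ 2\<close> and solving for
  \<open>a\<close> exchanges the roles; for \<open>y = 0\<close> the element \<open>b\<close> is a
  square.\<close>

lemma N_symmetric:
 assumes "a \<noteq> 0" "b \<noteq> 0"
 shows "b \<in> N a \<longleftrightarrow> a \<in> N b"
proof -
 have "a \<in> N b" if "b \<in> N a" "a \<noteq> 0" "b \<noteq> 0" for a b
 proof -
  obtain x y where xy: "b = x\<^sup>2 - a * y\<^sup>2" using \<open>b \<in> N a\<close> by (auto simp: N_def)
  show ?thesis
  proof (cases "y = 0")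
   case True
   then have "is_square b" using xy by (auto simp: is_square_def)
   then show ?thesis using N_of_square that by blast
  next
   case False
   then have "(x / y)\<^sup>2 - b * (1 / y)\<^sup>2 = a" unfolding xy by (simp add: field_simps)
   then show ?thesis using N_I[of "x / y" b "1 / y"] that by simp
  qed
 qed
 with assms show ?thesis by blast
qed

text \<open>The Steinberg relation of the Hilbert symbol.\<close>

lemma one_minus_in_N: "g \<noteq> 0 ==> g \<in> N (1 - g)"
 using N_I[of 1 "1 - g" 1] by simp

text \<open>The three types of square classes: odd valuation, \<open>1 + x\<close> with \<open>x\<close> of odd valuation below
 \<open>2 * e\<close>, and \<open>1 + 4 * c\<close> (which is a square or generates the unramified extension).\<close>

definition normal :: "'k => bool" where
 "normal a \<longleftrightarrow> a \<noteq> 0 \<and> (v a = 1 \<or>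
   (a \<noteq> 1 \<and> odd (v (a - 1)) \<and> 0 < v (a - 1) \<and> v (a - 1) < 2 * int e) \<or>
   (\<exists>c\<in>Ob. a = 1 + 4 * c))"

text \<open>For odd valuation scale by a power of \<open>\<pi>\<close>. Otherwise scale to a unit
  and climb through the levels of its distance to 1: at an odd level below \<open>2 * e\<close> the
  unit is normal, an even level is improved by a square, and at level \<open>2 * e\<close> the form
  \<open>1 + 4 * c\<close> is reached.\<close>

lemma normal_form:
 assumes x: "x \<noteq> 0"
 shows "\<exists>s. s \<noteq> 0 \<and> normal (x * s\<^sup>2)"
proof (cases "odd (v x)")
 case True
 define k where "k = (1 - v x) div 2"
 have k: "v x + 2 * k = 1" using True by (auto simp: k_def elim!: oddE)
 have "v (x * (\<pi> powi k)\<^sup>2) = 1"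
  using x pi_nonzero k by (subst v_mult) (simp_all add: v_power)
 then have "normal (x * (\<pi> powi k)\<^sup>2)" using x pi_nonzero by (simp add: normal_def)
 then show ?thesis using pi_nonzero by (intro exI[of _ "\<pi> powi k"]) simp
next
 case False
 define k where "k = - (v x div 2)"
 have k: "v x + 2 * k = 0" using False by (auto simp: k_def elim!: evenE)
 define x0 where "x0 = x * (\<pi> powi k)\<^sup>2"
 have x0: "x0 \<noteq> 0" "v x0 = 0"
  using x pi_nonzero k by (simp_all add: x0_def v_mult v_power)
 have "i \<le> 2 * e ==> \<exists>s. s \<noteq> 0 \<and> v s = 0 \<and> (normal (x0 * s\<^sup>2) \<or> x0 * s\<^sup>2 - 1 \<in> P (int i))" for i
 proof (induction i)
  case 0
  have "x0 - 1 \<in> Ob" using x0 by (intro diff_O one_O) (simp add: in_O_iff)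
  then show ?case by (intro exI[of _ 1]) (simp add: P_0)
 next
  case (Suc i)
  then obtain s where s: "s \<noteq> 0" "v s = 0" "normal (x0 * s\<^sup>2) \<or> x0 * s\<^sup>2 - 1 \<in> P (int i)" by auto
  define a where "a = x0 * s\<^sup>2"
  have a: "a \<noteq> 0" "v a = 0" using s x0 by (simp_all add: a_def v_mult v_power)
  show ?case
  proof (cases "normal a \<or> a - 1 \<in> P (int (Suc i))")
   case True
   with s show ?thesis unfolding a_def by blast
  next
   case nn: False
   then have iP: "a - 1 \<in> P (int i)" using s a_def by blast
   with nn have v1: "a \<noteq> 1" "v (a - 1) = int i" by (auto simp: P_def)
   have "even i"
   proof (rule ccontr)
    assume "odd i"
    moreover from this have "i > 0" by (cases i) auto
    ultimately have "normal a" using v1 a Suc.prems by (simp add: normal_def)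
    with nn show False by simp
   qed
   then obtain j where j: "i = 2 * j" by blast
   obtain t where t: "t \<noteq> 0" "v t = 0" "a - t\<^sup>2 \<in> P (2 * int j + 1)"
    using even_level_square[OF a, of j] iP j Suc.prems by auto
   have "(a - t\<^sup>2) * (1 / t)\<^sup>2 \<in> P (2 * int j + 1)"
    using t by (intro P_mult_O) (auto simp: in_O_iff v_divide v_power intro!: power_O)
   also have "(a - t\<^sup>2) * (1 / t)\<^sup>2 = x0 * (s / t)\<^sup>2 - 1"
    using t by (simp add: a_def power_divide field_simps)
   finally show ?thesis using s t j by (intro exI[of _ "s / t"]) (auto simp: v_divide ac_simps)
  qed
 qed
 from this[of "2 * e"] obtain s where s: "s \<noteq> 0" "normal (x0 * s\<^sup>2) \<or> x0 * s\<^sup>2 - 1 \<in> P (2 * int e)" by auto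
 have "normal (x0 * s\<^sup>2)"
 proof (cases "normal (x0 * s\<^sup>2)")
  case False
  then have p: "x0 * s\<^sup>2 - 1 \<in> P (2 * int e)" using s by blast
  have "(x0 * s\<^sup>2 - 1) / 4 \<in> Ob"
   using p by (cases "x0 * s\<^sup>2 - 1 = 0") (auto simp: P_def in_O_iff v_divide v_four)
  moreover have "x0 * s\<^sup>2 = 1 + 4 * ((x0 * s\<^sup>2 - 1) / 4)" by (simp add: field_simps)
  moreover have "x0 * s\<^sup>2 \<noteq> 0" using x0 s(1) by simp
  ultimately show ?thesis unfolding normal_def by blast
 qed
 also have "x0 * s\<^sup>2 = x * (\<pi> powi k * s)\<^sup>2" by (simp add: x0_def power_mult_distrib mult.assoc)
 finally show ?thesis using s(1) pi_nonzero by (intro exI[of _ "\<pi> powi k * s"]) simp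
qed

text \<open>Even levels below \<open>2 * e\<close> are corrected by squares, which are norms from
  every extension; the assumption \<open>odd_levels\<close> deals with the odd ones.\<close>

lemma approximate_by_norms:
 assumes t: "1 \<le> t" "t \<le> 2 * e"
  and odd_levels: "\<And>w i. odd i ==> 0 < i ==> i < int t ==> w \<noteq> 0 ==> v w = i ==>
   \<exists>n\<in>N a. n - (1 + w) \<in> P (i + 1)"
  and c: "c \<noteq> 0" "v c = 0"
 shows "\<exists>n\<in>N a. v n = 0 \<and> c / n - 1 \<in> P (int t)"
proof -
 have "i \<le> t ==> \<exists>n\<in>N a. v n = 0 \<and> c / n - 1 \<in> P (int i)" for i
 proof (induction i)
  case 0
  have "c - 1 \<in> Ob" using c by (intro diff_O one_O) (simp add: in_O_iff)
  then show ?case using N_square[of 1 a] by (intro bexI[of _ 1]) (simp_all add: P_0)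
 next
  case (Suc i)
  then obtain n where n: "n \<in> N a" "v n = 0" "c / n - 1 \<in> P (int i)" by auto
  note n0 = N_nonzero[OF n(1)]
  define d where "d = c / n"
  have d: "d \<noteq> 0" "v d = 0" using c n n0 by (simp_all add: d_def v_divide)
  have "\<exists>m\<in>N a. m - d \<in> P (int i + 1)"
  proof (cases "d - 1 \<in> P (int i + 1)")
   case True
   then show ?thesis using N_square[of 1 a] P_uminus[OF True] by (intro bexI[of _ 1]) simp_all
  next
   case False
   then have w: "d - 1 \<noteq> 0" "v (d - 1) = int i" using n(3) by (auto simp: P_def d_def)
   show ?thesis
   proof (cases "odd i")
    case True
    from True have "0 < i" by (cases i) auto
    then show ?thesis using odd_levels[of "int i" "d - 1"] True w Suc.prems by simp
   next
    case False
    then obtain j where j: "i = 2 * j" by blast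
    obtain s where s: "s \<noteq> 0" "d - s\<^sup>2 \<in> P (2 * int j + 1)"
     using even_level_square[OF d, of j] n(3) j Suc.prems t by (auto simp: d_def)
    then show ?thesis using N_square[of s a] P_uminus[OF s(2)] j by (intro bexI[of _ "s\<^sup>2"]) (simp_all add: ac_simps)
   qed
  qed
  then obtain m where m: "m \<in> N a" "m - d \<in> P (int i + 1)" by blast
  have mv: "m \<noteq> 0" "v m = 0" using unit_of_congruent[OF m(2) _ d] by auto
  have "- ((m - d) * (1 / m)) \<in> P (int i + 1)"
   using m mv by (intro P_uminus P_mult_O) (simp_all add: in_O_iff v_divide)
  also have "- ((m - d) * (1 / m)) = c / (n * m) - 1"
   using mv n0 by (simp add: d_def field_simps)
  finally show ?case using m n mv n0 by (intro bexI[of _ "n * m"]) (auto simp: N_mult v_mult ac_simps)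
 qed
 from this[of t] show ?thesis by simp
qed

text \<open>\<open>t\<close> is the critical level. Below it units are approximated by norms, so up
  to norms every nonzero element is \<open>1 + \<kappa> * y\<close> with integral \<open>y\<close>,
  after \<open>g\<close> has corrected an odd valuation. In products the \<open>y\<close> add up
  modulo the maximal ideal, those with \<open>AS y\<close> give norms, and two failures of
  \<open>AS\<close> add up to a success by \<open>AS_index\<close>.\<close>

lemma norm_index_at_level:
 assumes t: "1 \<le> t" "t \<le> 2 * e"
  and odd_levels: "\<And>w i. odd i ==> 0 < i ==> i < int t ==> w \<noteq> 0 ==> v w = i ==>
   \<exists>n\<in>N a. n - (1 + w) \<in> P (i + 1)"
  and odd_norm: "g \<in> N a" "odd (v g)"
  and \<kappa>: "\<kappa> \<noteq> 0" "v \<kappa> = int t" "\<And>c. AS c ==> 1 + \<kappa> * c \<in> N a"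
  and bc: "b \<noteq> 0" "c \<noteq> 0" "b \<notin> N a" "c \<notin> N a"
 shows "b * c \<in> N a"
proof -
 have red: "\<exists>n\<in>N a. \<exists>y\<in>Ob. x = n * (1 + \<kappa> * y)" if x: "x \<noteq> 0" for x
 proof -
  have "\<exists>m\<in>N a. even (v (x * m))"
  proof (cases "even (v x)")
   case True then show ?thesis using N_square[of 1 a] by (intro bexI[of _ 1]) simp_all
  next
   case False then show ?thesis using odd_norm N_nonzero[OF odd_norm(1)] x by (intro bexI[of _ g]) (simp_all add: v_mult)
  qed
  then obtain m where m: "m \<in> N a" "even (v (x * m))" by blast
  define k where "k = - (v (x * m) div 2)"
  have k: "v (x * m) + 2 * k = 0" using m by (auto simp: k_def elim!: evenE)
  define s where "s = \<pi> powi k"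
  have s: "s \<noteq> 0" "v s = k" using pi_nonzero by (simp_all add: s_def)
  note m0 = N_nonzero[OF m(1)]
  have u: "x * m * s\<^sup>2 \<noteq> 0" "v (x * m * s\<^sup>2) = 0"
   using x m0 s k by (simp_all add: v_mult v_power)
  obtain n where n: "n \<in> N a" "v n = 0" "x * m * s\<^sup>2 / n - 1 \<in> P (int t)"
   using approximate_by_norms[OF t odd_levels u] by blast
  define y where "y = (x * m * s\<^sup>2 / n - 1) / \<kappa>"
  have "y \<in> Ob" using n(3) \<kappa>(1,2) unfolding y_def
   by (cases "x * m * s\<^sup>2 / n - 1 = 0") (auto simp: P_def in_O_iff v_divide)
  moreover have "n / (m * s\<^sup>2) \<in> N a" by (intro N_divide N_mult N_square n m s)
  moreover have "x = n / (m * s\<^sup>2) * (1 + \<kappa> * y)"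
   using \<kappa>(1) N_nonzero[OF n(1)] m0 s by (simp add: y_def)
  ultimately show ?thesis by blast
 qed
 obtain n y where b: "n \<in> N a" "y \<in> Ob" "b = n * (1 + \<kappa> * y)" using red[OF bc(1)] by blast
 obtain m z where c: "m \<in> N a" "z \<in> Ob" "c = m * (1 + \<kappa> * z)" using red[OF bc(2)] by blast
 have "\<not> AS y" using \<kappa>(3)[of y] b bc(3) N_mult by blast
 moreover have "\<not> AS z" using \<kappa>(3)[of z] c bc(4) N_mult by blast
 ultimately have "AS (y + z)" using AS_index b c by blast
 moreover have "\<kappa> * (y * z) \<in> P 1"
  using \<kappa>(1,2) t b c by (intro P_mult_O mult_O) (auto simp: P_def)
 ultimately have "AS (y + z + \<kappa> * (y * z))" using AS_add AS_P1 by blast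
 from N_mult[OF N_mult[OF b(1) c(1)] \<kappa>(3)[OF this]] show ?thesis
  by (simp add: b(3) c(3) algebra_simps)
qed

text \<open>Equal parity lets a square of a power of \<open>\<pi>\<close> match the valuations; the
  remaining unit is a square in the residue field.\<close>

lemma odd_level_norm:
 assumes g: "g \<noteq> 0" "odd (v g)" and w: "w \<noteq> 0" "odd (v w)"
 shows "\<exists>y. y \<noteq> 0 \<and> v g + 2 * v y = v w \<and> g * y\<^sup>2 - w \<in> P (v w + 1)"
proof -
 define k where "k = (v w - v g) div 2"
 have k: "v g + 2 * k = v w" using g w by (auto simp: k_def elim!: oddE)
 define p where "p = \<pi> powi k"
 have p: "p \<noteq> 0" "v p = k" using pi_nonzero by (simp_all add: p_def)
 have u: "w / (g * p\<^sup>2) \<noteq> 0" "v (w / (g * p\<^sup>2)) = 0"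
  using w g p k by (simp_all add: v_divide v_mult v_power)
 then have "w / (g * p\<^sup>2) \<in> Ob" by (simp add: in_O_iff)
 then obtain s where s: "s \<in> Ob" "w / (g * p\<^sup>2) - s\<^sup>2 \<in> P 1" using residue_square_root by blast
 have sv: "s \<noteq> 0" "v s = 0"
  using unit_of_congruent[of "s\<^sup>2" "w / (g * p\<^sup>2)" 1] u P_uminus[OF s(2)] by (auto simp: v_power)
 have "g * p\<^sup>2 \<in> P (v w)" using g p k by (simp add: P_def v_mult v_power)
 from P_uminus[OF P_mult[OF this s(2)]] have "g * (p * s)\<^sup>2 - w \<in> P (v w + 1)"
  using g p by (simp add: right_diff_distrib power_mult_distrib mult.assoc)
 then show ?thesis using p sv k by (intro exI[of _ "p * s"]) (simp add: v_mult)
qed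

text \<open>In the coordinates \<open>W\<close>, \<open>Y\<close> the norm is
  \<open>Y ^ 2 * (r ^ 2 + r - c)\<close> with \<open>r = W / Y\<close>. For integral
  \<open>r\<close> the second factor is a unit since \<open>c\<close> is not \<open>AS\<close>; for
  other \<open>r\<close> the term \<open>r ^ 2\<close> dominates.\<close>

lemma unramified_norm_even:
 assumes c: "c \<in> Ob" "\<not> AS c" and n: "n \<in> N (1 + 4 * c)"
 shows "even (v n)"
proof -
 obtain x y where xy: "n = x\<^sup>2 - (1 + 4 * c) * y\<^sup>2" "n \<noteq> 0" using n by (auto simp: N_def)
 define Y W where "Y = 2 * y" and "W = x - y"
 have n_eq: "n = W\<^sup>2 + W * Y - c * Y\<^sup>2" unfolding xy(1) W_def Y_def by (simp add: power2_eq_square algebra_simps)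
 show ?thesis
 proof (cases "Y = 0")
  case True
  then show ?thesis using n_eq xy(2) by (auto simp: v_power)
 next
  case False
  define r where "r = W / Y"
  have n_r: "n = Y\<^sup>2 * (r\<^sup>2 + r - c)" using False by (simp add: n_eq r_def power2_eq_square field_simps)
  have nz: "r\<^sup>2 + r - c \<noteq> 0" using n_r xy(2) by auto
  have "even (v (r\<^sup>2 + r - c))"
  proof (cases "r \<in> Ob")
   case True
   then have "r\<^sup>2 + r - c \<notin> P 1" using AS_lift c by blast
   moreover have "r\<^sup>2 + r - c \<in> Ob" using True c by (intro diff_O add_O power_O)
   ultimately have "v (r\<^sup>2 + r - c) = 0" using nz by (auto simp: P_def in_O_iff)
   then show ?thesis by simp
  next
   case False
   then have r: "r \<noteq> 0" "v r < 0" by (auto simp: in_O_iff)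
   have "c \<in> P (v r)" using P_mono[of c 0 "v r"] r c by (simp add: P_0)
   then have "r - c \<in> P (v r)" by (rule P_diff[rotated]) (simp add: P_def)
   then have "r - c \<in> P (v (r\<^sup>2) + 1)" by (rule P_mono) (use r in \<open>simp add: v_power\<close>)
   from v_add_eq(2)[OF _ this] r have "v (r\<^sup>2 + (r - c)) = 2 * v r" by (simp add: v_power)
   moreover have "r\<^sup>2 + r - c = r\<^sup>2 + (r - c)" by simp
   ultimately show ?thesis by (simp only:) simp
  qed
  then show ?thesis unfolding n_r using False nz by (simp add: v_mult v_power)
 qed
qed

text \<open>Squares reduce the claim to elements \<open>1 + w\<close> with \<open>w\<close> in the
  maximal ideal. Such an element is the norm of
  \<open>1 + y / 2 + (y / 2) * sqrt (1 + 4 * c)\<close> when \<open>y - c * y ^ 2 = w\<close>, which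
  \<open>hensel\<close> solves.\<close>

lemma unramified_unit_norm:
 assumes c: "c \<in> Ob" "\<not> AS c" and x: "x \<noteq> 0" "even (v x)"
 shows "x \<in> N (1 + 4 * c)"
proof -
 define k where "k = - (v x div 2)"
 have k: "v x + 2 * k = 0" using x by (auto simp: k_def elim!: evenE)
 define s where "s = \<pi> powi k"
 have s: "s \<noteq> 0" "v s = k" using pi_nonzero by (simp_all add: s_def)
 have u: "x * s\<^sup>2 \<noteq> 0" "v (x * s\<^sup>2) = 0" using x s k by (simp_all add: v_mult v_power)
 have "x * s\<^sup>2 - 1 \<in> P (2 * int 0)"
  using u diff_O[OF _ one_O, of "x * s\<^sup>2"] by (simp add: P_0 in_O_iff)
 from even_level_square[OF u this e_pos] obtain t where
  t: "t \<noteq> 0" "v t = 0" "x * s\<^sup>2 - t\<^sup>2 \<in> P 1" by auto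
 define w where "w = x * s\<^sup>2 / t\<^sup>2 - 1"
 have "(x * s\<^sup>2 - t\<^sup>2) * (1 / t\<^sup>2) \<in> P 1" using t by (intro P_mult_O) (auto simp: in_O_iff v_divide v_power)
 then have w: "w \<in> P 1" using t by (simp add: w_def field_simps)
 have c0: "c \<noteq> 0" using c AS_zero by auto
 have "- (c * w) \<in> P 1" using P_mult_O[OF w c(1)] by (intro P_uminus) (simp add: mult.commute)
 then obtain z where z: "z\<^sup>2 + z = - (c * w)" using hensel unfolding P_one_iff by blast
 define y where "y = - z / c"
 have "y - c * y\<^sup>2 = - (z\<^sup>2 + z) / c" using c0 by (simp add: y_def power2_eq_square field_simps)
 also have "\<dots> = w" using c0 by (simp add: z)
 finally have yw: "y - c * y\<^sup>2 = w" .
 have "(1 + y / 2)\<^sup>2 - (1 + 4 * c) * (y / 2)\<^sup>2 = 1 + (y - c * y\<^sup>2)"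
  by (simp add: power2_eq_square field_simps)
 also have "\<dots> = x * s\<^sup>2 / t\<^sup>2" by (simp add: yw w_def)
 finally have "x * s\<^sup>2 / t\<^sup>2 \<in> N (1 + 4 * c)" using N_I[of "1 + y / 2" "1 + 4 * c" "y / 2"] u t by simp
 then have "x * (s / t)\<^sup>2 \<in> N (1 + 4 * c)" by (simp add: power_divide)
 then show ?thesis using N_square_mult_iff[of "s / t"] s t by simp
qed

lemma norm_index_normal:
 assumes a: "normal a" and bc: "b \<noteq> 0" "c \<noteq> 0" "b \<notin> N a" "c \<notin> N a"
 shows "b * c \<in> N a"
proof -
 have a0: "a \<noteq> 0" using a by (simp add: normal_def)
 consider "v a = 1" | "a \<noteq> 1" "odd (v (a - 1))" "0 < v (a - 1)" "v (a - 1) < 2 * int e"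
  | d where "d \<in> Ob" "a = 1 + 4 * d" using a by (auto simp: normal_def)
 then show ?thesis
 proof cases
  case 1
  show ?thesis
  \<comment> \<open>The critical level is \<open>2 * e\<close>, where \<open>1 + 4 * c\<close> with
    \<open>AS c\<close> is even a square. The element \<open>- a\<close>, the norm of a square root
    of \<open>a\<close>, supplies the odd valuation.\<close>
  proof (rule norm_index_at_level[where t = "2 * e" and g = "- a" and \<kappa> = 4, OF _ _ _ _ _ _ _ _ bc])
   fix w i assume wi: "odd i" "0 < i" "i < int (2 * e)" "w \<noteq> 0" "v w = i"
   obtain y where y: "y \<noteq> 0" "- a * y\<^sup>2 - w \<in> P (v w + 1)"
    using odd_level_norm[of "- a" w] wi a0 1 by auto
   have nz: "1\<^sup>2 - a * y\<^sup>2 \<noteq> 0" and "1\<^sup>2 - a * y\<^sup>2 - (1 + w) \<in> P (i + 1)"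
   proof -
    show "1\<^sup>2 - a * y\<^sup>2 - (1 + w) \<in> P (i + 1)" using y wi by simp
    then show "1\<^sup>2 - a * y\<^sup>2 \<noteq> 0"
     using unit_of_congruent[of "1\<^sup>2 - a * y\<^sup>2" "1 + w" "i + 1"] one_plus_P[of w i] wi by (simp add: P_def)
   qed
   then show "\<exists>n\<in>N a. n - (1 + w) \<in> P (i + 1)" using N_I[of 1 a y] by blast
  next
   show "- a \<in> N a" using N_I[of 0 a 1] a0 by simp
  next
   fix c assume "AS c"
   then obtain s where s: "1 + 4 * c = s\<^sup>2" using AS_imp_square by (auto simp: is_square_def)
   have "4 * c \<in> P (2 * int e)" using AS_O[OF \<open>AS c\<close>] by (intro P_mult_O) (simp add: P_def v_four)
   then have "1 + 4 * c \<noteq> 0" using one_plus_P e_pos by simp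
   then show "1 + 4 * c \<in> N a" using N_square[of s a] s by auto
  qed (use 1 e_pos v_four in auto)
 next
  case 2
  define \<delta> where "\<delta> = a - 1"
  \<comment> \<open>The critical level is complementary to the level of \<open>\<delta>\<close>: it
    is the valuation of \<open>- 4 / \<delta>\<close>.\<close>
  define t where "t = nat (2 * int e - v \<delta>)"
  have \<delta>: "\<delta> \<noteq> 0" "odd (v \<delta>)" "0 < v \<delta>" "v \<delta> < 2 * int e" using 2 by (simp_all add: \<delta>_def)
  have a_eq: "a = 1 + \<delta>" by (simp add: \<delta>_def)
  have norm: "(1 + y)\<^sup>2 - a * y\<^sup>2 = 1 + 2 * y - \<delta> * y\<^sup>2" for y
   by (simp add: a_eq power2_eq_square algebra_simps)
  show ?thesis
  proof (rule norm_index_at_level[where t = t and g = "- \<delta>" and \<kappa> = "- 4 / \<delta>", OF _ _ _ _ _ _ _ _ bc])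
   fix w i assume wi: "odd i" "0 < i" "i < int t" "w \<noteq> 0" "v w = i"
   obtain y where y: "y \<noteq> 0" "v \<delta> + 2 * v y = i" "- \<delta> * y\<^sup>2 - w \<in> P (i + 1)"
    using odd_level_norm[of "- \<delta>" w] wi \<delta> by auto
   \<comment> \<open>From \<open>v \<delta> + 2 * v y = i\<close> and
     \<open>i < 2 * e - v \<delta>\<close> follows \<open>v \<delta> + v y < e\<close>; so the
     linear term \<open>2 * y\<close> of the norm is negligible at level \<open>i\<close>.\<close>
   have "int e + v y \<ge> i + 1" using y(2) wi(3) \<delta> by (simp add: t_def)
   then have "2 * y \<in> P (i + 1)" using y(1) by (simp add: P_def v_mult v_two)
   from P_add[OF this y(3)] have near: "(1 + y)\<^sup>2 - a * y\<^sup>2 - (1 + w) \<in> P (i + 1)"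
    unfolding norm by (simp add: algebra_simps)
   then have "(1 + y)\<^sup>2 - a * y\<^sup>2 \<noteq> 0"
    using unit_of_congruent[OF near] one_plus_P[of w i] wi by (simp add: P_def)
   then show "\<exists>n\<in>N a. n - (1 + w) \<in> P (i + 1)" using N_I[of "1 + y" a y] near by blast
  next
   show "- \<delta> \<in> N a" using N_I[of 1 a 1] \<delta> by (simp add: a_eq)
  next
   fix c assume "AS c"
   then obtain z where z: "z \<in> Ob" "c = z\<^sup>2 + z" by (auto simp: AS_def)
   have "- 4 / \<delta> * c \<in> P (int t)"
    using AS_O[OF \<open>AS c\<close>] \<delta> by (intro P_mult_O) (simp_all add: P_def v_divide v_four t_def)
   moreover have "0 < int t" using \<delta> by (simp add: t_def)
   ultimately have nz: "1 + - 4 / \<delta> * c \<noteq> 0" using one_plus_P by blast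
   \<comment> \<open>For \<open>y = - 2 / \<delta> * z\<close> the linear and the quadratic term of
     the norm combine to \<open>- 4 / \<delta> * (z ^ 2 + z)\<close>; this is where the
     Artin-Schreier form arises.\<close>
   have eq: "(1 + - 2 / \<delta> * z)\<^sup>2 - a * (- 2 / \<delta> * z)\<^sup>2 = 1 + - 4 / \<delta> * c"
    unfolding norm using \<delta>(1) by (simp add: z power2_eq_square field_simps)
   show "1 + - 4 / \<delta> * c \<in> N a"
    using N_I[of "1 + - 2 / \<delta> * z" a "- 2 / \<delta> * z", unfolded eq, OF nz] .
  qed (use \<delta> in \<open>auto simp: t_def v_divide v_four\<close>)
 next
  case 3
  show ?thesis
  proof (cases "AS d")
   case True
   then show ?thesis using N_of_square AS_imp_square bc 3 a0 by blast
  next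
   case False
   have "odd (v b)" "odd (v c)" using unramified_unit_norm[OF 3(1) False] bc 3(2) by auto
   then show ?thesis using unramified_unit_norm[OF 3(1) False, of "b * c"] bc 3(2) by (simp add: v_mult)
  qed
 qed
qed

lemma norm_index:
 assumes a: "a \<noteq> 0" and bc: "b \<noteq> 0" "c \<noteq> 0" "b \<notin> N a" "c \<notin> N a"
 shows "b * c \<in> N a"
proof -
 obtain s where "s \<noteq> 0" "normal (a * s\<^sup>2)" using normal_form[OF a] by blast
 with norm_index_normal[of "a * s\<^sup>2" b c] bc show ?thesis by (simp add: N_cong_square)
qed

text \<open>Since the index is at most 2, membership in the norm group is bimultiplicative.\<close>

lemma N_mult_iff:
 assumes "a \<noteq> 0" "b \<noteq> 0" "c \<noteq> 0"
 shows "b * c \<in> N a \<longleftrightarrow> (b \<in> N a \<longleftrightarrow> c \<in> N a)"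
proof (cases "b \<in> N a")
 case True
 then show ?thesis using N_cancel[OF True, of c] by (simp add: mult.commute)
next
 case False
 then show ?thesis using norm_index[OF assms] N_cancel[of c a b] by auto
qed

lemma N_mult_iff2:
 assumes "a \<noteq> 0" "b \<noteq> 0" "c \<noteq> 0"
 shows "c \<in> N (a * b) \<longleftrightarrow> (c \<in> N a \<longleftrightarrow> c \<in> N b)"
 using N_mult_iff[of c a b] N_symmetric[of "a * b" c] N_symmetric[of a c] N_symmetric[of b c] assms by simp

text \<open>In the wildly ramified case \<open>a = 1 + x\<close> the non-norm is \<open>b = 1 + y\<close> with
 \<open>x * y / (1 + x) = 4 * c\<close>: by bimultiplicativity the symbol of \<open>a\<close> and \<open>b\<close> equals that of the
 unramified class \<open>1 + 4 * c\<close> and \<open>- x * b\<close>, which has odd valuation.\<close>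

lemma exists_non_norm:
 assumes a: "a \<noteq> 0" "\<not> is_square a"
 shows "\<exists>b. b \<noteq> 0 \<and> b \<notin> N a"
proof -
 obtain s where s: "s \<noteq> 0" "normal (a * s\<^sup>2)" using normal_form[OF a(1)] by blast
 define a' where "a' = a * s\<^sup>2"
 have a': "a' \<noteq> 0" "normal a'" "N a' = N a" using a s by (simp_all add: a'_def N_cong_square)
 have ns: "\<not> is_square a'"
 proof
  assume "is_square a'"
  then obtain t where "a' = t\<^sup>2" by (auto simp: is_square_def)
  then have "a = (t / s)\<^sup>2" using s(1) by (simp add: a'_def power_divide field_simps)
  with a(2) show False by (auto simp: is_square_def)
 qed
 obtain c where c: "c \<in> Ob" "\<not> AS c" using exists_not_AS by blast
 define \<epsilon> where "\<epsilon> = 1 + 4 * c"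
 have "4 * c \<in> P (2 * int e)" using c by (intro P_mult_O) (simp add: P_def v_four)
 then have \<epsilon>0: "\<epsilon> \<noteq> 0" using one_plus_P[of "4 * c" "2 * int e"] e_pos by (simp add: \<epsilon>_def)
 have c0: "c \<noteq> 0" using c AS_zero by auto
 have h\<epsilon>: "x \<notin> N \<epsilon>" if "odd (v x)" for x
  using unramified_norm_even[OF c] that by (auto simp: \<epsilon>_def)
 consider "v a' = 1" | "a' \<noteq> 1" "odd (v (a' - 1))" "0 < v (a' - 1)" "v (a' - 1) < 2 * int e"
  | d where "d \<in> Ob" "a' = 1 + 4 * d" using a' by (auto simp: normal_def)
 then have "\<exists>b. b \<noteq> 0 \<and> b \<notin> N a'"
 proof cases
  case 1
  then show ?thesis using h\<epsilon>[of a'] N_symmetric[OF a'(1) \<epsilon>0] \<epsilon>0 by auto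
 next
  case 2
  define x where "x = a' - 1"
  have x: "x \<noteq> 0" "odd (v x)" "0 < v x" "v x < 2 * int e" using 2 by (simp_all add: x_def)
  have ax: "a' = 1 + x" by (simp add: x_def)
  have va: "v a' = 0" using one_plus_P[of x "v x"] x ax by (simp add: P_def)
  define y where "y = 4 * c * a' / x"
  define b where "b = 1 + y"
  have vc: "0 \<le> v c" using c c0 by (simp add: in_O_iff)
  have "v y > 0" using x va vc c0 a' by (simp add: y_def v_divide v_mult v_four)
  then have b: "b \<noteq> 0" "v b = 0" using one_plus_P[of y "v y"] by (simp_all add: P_def b_def)
  \<comment> \<open>Chosen to make \<open>a' * \<epsilon> = 1 - g\<close>, so that the Steinberg
    relation puts \<open>g\<close> into the norm group of the product.\<close>
  define g where "g = - x * b"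
  have g: "g \<noteq> 0" "odd (v g)" using x b by (simp_all add: g_def v_mult)
  have "a' * \<epsilon> = 1 - g" using x(1) by (simp add: g_def b_def y_def \<epsilon>_def ax field_simps)
  with one_minus_in_N[OF g(1)] have "g \<in> N (a' * \<epsilon>)" by simp
  then have "g \<notin> N a'" using N_mult_iff2[OF a'(1) \<epsilon>0 g(1)] h\<epsilon>[OF g(2)] by simp
  moreover have "- x \<in> N a'" using one_minus_in_N[of "- x"] x(1) ax by simp
  ultimately have "b \<notin> N a'" using N_mult[of "- x" a' b] by (auto simp: g_def)
  with b show ?thesis by blast
 next
  case 3
  have "\<not> AS d" using ns 3 AS_imp_square by blast
  from unramified_norm_even[OF 3(1) this, of \<pi>] 3(2) pi_nonzero show ?thesis by auto
 qed
 then show ?thesis using a'(3) by simp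
qed

text \<open>If \<open>c\<close> is no such product, it lies in neither group, and index 2 forces the
  groups to coincide: for \<open>n\<close> in one and not in the other, \<open>c * n\<close> would
  lie in the other. By bimultiplicativity every nonzero element is then in \<open>N (a * b)\<close>,
  against \<open>exists_non_norm\<close>.\<close>

theorem norm_groups_generate:
 assumes ab: "a \<noteq> 0" "b \<noteq> 0" "\<not> is_square (a * b)" and c: "c \<noteq> 0"
 shows "\<exists>n\<in>N a. \<exists>m\<in>N b. c = n * m"
proof (rule ccontr)
 assume no: "\<not> ?thesis"
 have one: "1 \<in> N d" for d using N_square[of 1 d] by simp
 have cn: "c \<notin> N a" "c \<notin> N b" using no one by (metis mult.right_neutral, metis mult_1)
 have sub1: "N a \<subseteq> N b"
 proof
  fix n assume n: "n \<in> N a"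
  show "n \<in> N b"
  proof (rule ccontr)
   assume "n \<notin> N b"
   then have "c * n \<in> N b" using norm_index[OF ab(2) c N_nonzero[OF n]] cn by blast
   moreover have "c = 1 / n * (c * n)" using N_nonzero[OF n] by simp
   ultimately show False using no N_inverse[OF n] by blast
  qed
 qed
 have sub2: "N b \<subseteq> N a"
 proof
  fix n assume n: "n \<in> N b"
  show "n \<in> N a"
  proof (rule ccontr)
   assume "n \<notin> N a"
   then have "c * n \<in> N a" using norm_index[OF ab(1) c N_nonzero[OF n]] cn by blast
   moreover have "c = c * n * (1 / n)" using N_nonzero[OF n] by simp
   ultimately show False using no N_inverse[OF n] by blast
  qed
 qed
 obtain d where "d \<noteq> 0" "d \<notin> N (a * b)" using exists_non_norm[of "a * b"] ab by auto
 then show False using N_mult_iff2[OF ab(1,2)] sub1 sub2 by blast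
qed

section \<open>Counting square classes\<close>

definition cls :: "'k => 'k set" where
 "cls a = {a * s\<^sup>2 | s. s \<noteq> 0}"

lemma cls_self: "a \<in> cls a"
 by (auto simp: cls_def intro!: exI[of _ 1])

lemma cls_eq_iff: "cls a = cls b \<longleftrightarrow> (\<exists>s. s \<noteq> 0 \<and> a = b * s\<^sup>2)"
proof
 assume "cls a = cls b"
 then have "a \<in> cls b" using cls_self by blast
 then show "\<exists>s. s \<noteq> 0 \<and> a = b * s\<^sup>2" by (auto simp: cls_def)
next
 have sub: "cls (b * s\<^sup>2) \<subseteq> cls b" if "s \<noteq> 0" for b s
 proof
  fix x assume "x \<in> cls (b * s\<^sup>2)"
  then obtain t where "t \<noteq> 0" "x = b * (s * t)\<^sup>2" by (auto simp: cls_def power_mult_distrib mult.assoc)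
  then show "x \<in> cls b" using that unfolding cls_def by (auto intro!: exI[of _ "s * t"])
 qed
 assume "\<exists>s. s \<noteq> 0 \<and> a = b * s\<^sup>2"
 then obtain s where s: "s \<noteq> 0" "a = b * s\<^sup>2" by blast
 have b: "a * (1 / s)\<^sup>2 = b" using s by (simp add: power_one_over)
 show "cls a = cls b" using sub[of s b] sub[of "1 / s" a, unfolded b] s by auto
qed

lemma cls_mult_square: "s \<noteq> 0 ==> cls (a * s\<^sup>2) = cls a"
 by (auto simp: cls_eq_iff)

lemma image_mult_cls: "(*) c ` cls a = cls (c * a)"
 by (auto simp: cls_def image_iff mult.assoc)

text \<open>The filtration that the unit groups of level \<open>i\<close> induce on square classes;
  level 0 gives the classes of all units.\<close>

definition G :: "nat => 'k set set" where
 "G i = cls ` {a. a \<noteq> 0 \<and> v a = 0 \<and> a - 1 \<in> P (int i)}"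

lemma G_mono: "i \<le> j ==> G j \<subseteq> G i"
 unfolding G_def by (intro image_mono) (auto intro: P_mono)

text \<open>By \<open>even_level_square\<close> a unit at an even level below \<open>2 * e\<close>
  can be moved one level up within its square class.\<close>

lemma G_even: "j < e ==> G (2 * j) = G (2 * j + 1)"
proof
 assume j: "j < e"
 show "G (2 * j) \<subseteq> G (2 * j + 1)"
 proof
  fix C assume "C \<in> G (2 * j)"
  then obtain a where a: "C = cls a" "a \<noteq> 0" "v a = 0" "a - 1 \<in> P (2 * int j)" by (auto simp: G_def)
  obtain t where t: "t \<noteq> 0" "v t = 0" "a - t\<^sup>2 \<in> P (2 * int j + 1)"
   using even_level_square[OF a(2-4) j] by blast
  have "(a - t\<^sup>2) * (1 / t\<^sup>2) \<in> P (2 * int j + 1)"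
   using t by (intro P_mult_O) (auto simp: in_O_iff v_divide v_power)
  then have "a * (1 / t)\<^sup>2 - 1 \<in> P (int (2 * j + 1))" using t by (simp add: power_one_over field_simps)
  moreover have "cls a = cls (a * (1 / t)\<^sup>2)" using t by (intro cls_mult_square[symmetric]) simp
  moreover have "a * (1 / t)\<^sup>2 \<noteq> 0" "v (a * (1 / t)\<^sup>2) = 0"
   using a t by (simp_all add: v_mult v_divide v_power)
  ultimately show "C \<in> G (2 * j + 1)" using a(1) unfolding G_def by blast
 qed
qed (intro G_mono, simp)

text \<open>With \<open>y = s - 1\<close> the element is \<open>y * (y + 2)\<close>. Its valuation
  is the even number \<open>2 * v y\<close> if \<open>v y < e\<close>, and otherwise its level is at
  least \<open>2 * e\<close>; an odd level below that is never attained.\<close>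

lemma square_odd_level:
 assumes i: "odd i" "i < 2 * e" and s: "s\<^sup>2 - 1 \<in> P (int i)"
 shows "s\<^sup>2 - 1 \<in> P (int i + 1)"
proof -
 have "s\<^sup>2 \<in> Ob" using add_O[OF P_sub_O[OF s] one_O] by simp
 then have sO: "s \<in> Ob" by (cases "s = 0") (auto simp: in_O_iff v_power)
 define y where "y = s - 1"
 have y: "s\<^sup>2 - 1 = y * (y + 2)"
  unfolding y_def power2_eq_square square_diff_one_factored by (simp add: mult.commute)
 show ?thesis
 proof (cases "y \<in> P (int e)")
  case True
  show ?thesis unfolding y by (rule P_mono[OF P_mult[OF True P_add[OF True two_P]]]) (use i in auto)
 next
  case False
  then have y0: "y \<noteq> 0" "v y < int e" by (auto simp: P_def)
  have "2 \<in> P (v y + 1)" using y0 by (intro P_mono[OF two_P]) simp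
  from v_add_eq[OF y0(1) this] have "v (y * (y + 2)) = 2 * v y" "y * (y + 2) \<noteq> 0" using y0 by (simp_all add: v_mult)
  moreover have "2 * v y \<noteq> int i" using i by presburger
  ultimately show ?thesis using s unfolding y by (auto simp: P_def)
 qed
qed

lemma cls_one_iff: "a \<noteq> 0 ==> cls a = cls 1 \<longleftrightarrow> is_square a"
 by (auto simp: cls_eq_iff is_square_def)

lemma not_AS_not_square:
 assumes "c \<in> Ob" "\<not> AS c" shows "\<not> is_square (1 + 4 * c)"
proof
 assume "is_square (1 + 4 * c)"
 moreover have "4 * c \<in> P (2 * int e)" using assms by (intro P_mult_O) (simp add: P_def v_four)
 then have "1 + 4 * c \<noteq> 0" using one_plus_P e_pos by simp
 ultimately have "\<pi> \<in> N (1 + 4 * c)" using N_of_square pi_nonzero by blast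
 from unramified_norm_even[OF assms this] show False by simp
qed

text \<open>The classes are those of 1 and of an unramified generator: by \<open>AS_index\<close>
  the product of two nonsquares of the form \<open>1 + 4 * c\<close> is a square.\<close>

lemma card_G_2e: "card (G (2 * e)) = 2"
proof -
 obtain c where c: "c \<in> Ob" "\<not> AS c" using exists_not_AS by blast
 have four: "4 * x \<in> P (2 * int e)" if "x \<in> Ob" for x using that by (intro P_mult_O) (simp add: P_def v_four)
 have u: "1 + 4 * x \<noteq> 0" "v (1 + 4 * x) = 0" if "x \<in> Ob" for x
  using one_plus_P[OF four[OF that]] e_pos by auto
 have "G (2 * e) = {cls 1, cls (1 + 4 * c)}"
 proof
  show "{cls 1, cls (1 + 4 * c)} \<subseteq> G (2 * e)" unfolding G_def using u c four
   by (auto intro!: image_eqI[of _ _ 1] image_eqI[of _ _ "1 + 4 * c"])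
  show "G (2 * e) \<subseteq> {cls 1, cls (1 + 4 * c)}"
  proof
   fix C assume "C \<in> G (2 * e)"
   then obtain a where a: "C = cls a" "a \<noteq> 0" "v a = 0" "a - 1 \<in> P (2 * int e)" by (auto simp: G_def)
   define d where "d = (a - 1) / 4"
   have d: "d \<in> Ob" "a = 1 + 4 * d"
    using a(4) unfolding d_def by (cases "a = 1"; auto simp: P_def in_O_iff v_divide v_four field_simps)+
   show "C \<in> {cls 1, cls (1 + 4 * c)}"
   proof (cases "AS d")
    case True
    then show ?thesis using AS_imp_square cls_one_iff a d by blast
   next
    case False
    define n where "n = (1 + 4 * d) * (1 + 4 * c)"
    have "AS (d + c)" using AS_index c d False by blast
    moreover have "4 * (d * c) \<in> P 1" by (rule P_mono[OF four[OF mult_O[OF d(1) c(1)]]]) (use e_pos in simp)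
    ultimately have "AS (d + c + 4 * (d * c))" using AS_add AS_P1 by blast
    then have "is_square (1 + 4 * (d + c + 4 * (d * c)))" by (rule AS_imp_square)
    also have "1 + 4 * (d + c + 4 * (d * c)) = n" by (simp add: n_def algebra_simps)
    finally obtain s where s: "n = s\<^sup>2" by (auto simp: is_square_def)
    have n0: "n \<noteq> 0" using u c d by (simp add: n_def)
    have "1 + 4 * d = (1 + 4 * c) * (s / (1 + 4 * c))\<^sup>2"
     using u[OF c(1)] unfolding power_divide s[symmetric] by (simp add: n_def power2_eq_square)
    then have "cls a = cls (1 + 4 * c)" unfolding d(2)
     using s n0 u[OF c(1)] by (subst cls_eq_iff) (auto intro!: exI[of _ "s / (1 + 4 * c)"])
    then show ?thesis using a(1) by simp
   qed
  qed
 qed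
 moreover have "cls 1 \<noteq> cls (1 + 4 * c)"
  using cls_one_iff[of "1 + 4 * c"] u c not_AS_not_square by auto
 ultimately show ?thesis by simp
qed

text \<open>Multiplying a class of the next level by \<open>1 + \<pi> ^ i * r\<close> gives a
  bijection with pairs. Injectivity rests on \<open>square_odd_level\<close>: a square of odd level
  \<open>i\<close> cannot disturb the residue \<open>r\<close>.\<close>

lemma card_G_odd:
 assumes i: "odd i" "i < 2 * e"
 shows "card (G i) = card R * card (G (Suc i))"
proof -
 define p where "p = \<pi> ^ i"
 have i0: "i > 0" using i by (cases i) auto
 have p: "p \<noteq> 0" "v p = int i" using pi_nonzero by (simp_all add: p_def v_power)
 have pP: "p * x \<in> P (int i)" if "x \<in> Ob" for x using that p by (intro P_mult_O) (simp_all add: P_def)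
 define f where "f = (\<lambda>(r, C). (*) (1 + p * r) ` C)"
 have u: "1 + p * r \<noteq> 0" "v (1 + p * r) = 0" if "r \<in> R" for r
  using one_plus_P[OF pP[OF R_in_O[OF that]]] i0 by auto
 have "inj_on f (R \<times> G (Suc i))"
 proof (rule inj_onI, clarify)
  fix r C r' C'
  assume r: "r \<in> R" "r' \<in> R" and C: "C \<in> G (Suc i)" "C' \<in> G (Suc i)" and eq: "f (r, C) = f (r', C')"
  obtain a where a: "C = cls a" "a \<noteq> 0" "v a = 0" "a - 1 \<in> P (int i + 1)" using C by (auto simp: G_def ac_simps)
  obtain b where b: "C' = cls b" "b \<noteq> 0" "v b = 0" "b - 1 \<in> P (int i + 1)" using C by (auto simp: G_def ac_simps)
  have "cls ((1 + p * r) * a) = cls ((1 + p * r') * b)"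
   using eq unfolding f_def a(1) b(1) by (simp add: image_mult_cls)
  then obtain s where s: "s \<noteq> 0" "(1 + p * r) * a = (1 + p * r') * b * s\<^sup>2" by (auto simp: cls_eq_iff)
  have vs: "v (s\<^sup>2) = 0"
  proof -
   have "v ((1 + p * r) * a) = 0" "v ((1 + p * r') * b * s\<^sup>2) = v (s\<^sup>2)"
    using u[OF r(1)] u[OF r(2)] a b s(1) by (simp_all add: v_mult)
   then show ?thesis using s by simp
  qed
  have aO: "a \<in> Ob" "b \<in> Ob" "s\<^sup>2 \<in> Ob" using a b vs by (simp_all add: in_O_iff)
  have prP: "p * r \<in> P (int i)" "p * r' \<in> P (int i)" using pP R_in_O r by auto
  \<comment> \<open>\<open>W\<close> is the level \<open>i\<close> part of the equation. It yields
    level \<open>i\<close> for \<open>s ^ 2 - 1\<close>, hence level \<open>i + 1\<close> as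
    \<open>i\<close> is odd; then \<open>W\<close>, and with it \<open>p * (r' - r)\<close>, has
    level \<open>i + 1\<close> too.\<close>
  define W where "W = p * r' * b * s\<^sup>2 - p * r * a"
  have eq2: "s\<^sup>2 * b - a = - W" using s(2) by (simp add: W_def algebra_simps)
  have WP: "W \<in> P (int i)" unfolding W_def
   using P_diff[OF P_mult_O[OF P_mult_O[OF prP(2) aO(2)] aO(3)] P_mult_O[OF prP(1) aO(1)]] .
  have bP: "s\<^sup>2 * (b - 1) \<in> P (int i + 1)" "a - 1 \<in> P (int i + 1)"
   using P_mult_O[OF b(4) aO(3)] a(4) by (simp_all add: mult.commute)
  have "s\<^sup>2 - 1 = - W - s\<^sup>2 * (b - 1) + (a - 1)" using eq2 by (simp add: algebra_simps)
  also have "\<dots> \<in> P (int i)"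
   by (rule P_add[OF P_diff[OF P_uminus[OF WP] P_mono[OF bP(1)]] P_mono[OF bP(2)]]) auto
  finally have sP: "s\<^sup>2 - 1 \<in> P (int i + 1)" using square_odd_level[OF i] by blast
  have "W = - (s\<^sup>2 - 1) - s\<^sup>2 * (b - 1) + (a - 1)" using eq2 by (simp add: algebra_simps)
  also have "\<dots> \<in> P (int i + 1)" by (rule P_add[OF P_diff[OF P_uminus[OF sP] bP(1)] bP(2)])
  finally have X1: "W \<in> P (int i + 1)" .
  have bs: "b * s\<^sup>2 - 1 \<in> P 1"
  proof -
   have "b * s\<^sup>2 - 1 = s\<^sup>2 * (b - 1) + (s\<^sup>2 - 1)" by (simp add: algebra_simps)
   also have "\<dots> \<in> P 1" by (rule P_mono[OF P_add[OF bP(1) sP]]) simp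
   finally show ?thesis .
  qed
  have "p * (r' - r) = W - p * r' * (b * s\<^sup>2 - 1) + p * r * (a - 1)" by (simp add: W_def algebra_simps)
  also have "\<dots> \<in> P (int i + 1)"
   by (rule P_add[OF P_diff[OF X1 P_mult[OF prP(2) bs]]])
    (rule P_mult[OF prP(1)], rule P_mono[OF a(4)], simp)
  finally have "r' - r \<in> P 1" using p by (cases "r' - r = 0") (auto simp: P_def v_mult)
  then have rr: "r' = r" using rep_unique r by blast
  moreover have "cls a = cls b" using s u[OF r(1)] unfolding rr by (subst cls_eq_iff) auto
  ultimately show "r = r' \<and> C = C'" using a b by simp
 qed
 moreover have "f ` (R \<times> G (Suc i)) = G i"
 proof (intro equalityI subsetI)
  fix D assume "D \<in> f ` (R \<times> G (Suc i))"
  then obtain r a where ra: "r \<in> R" "D = cls ((1 + p * r) * a)" "a \<noteq> 0" "v a = 0" "a - 1 \<in> P (int (Suc i))"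
   by (auto simp: f_def G_def image_mult_cls)
  have "(1 + p * r) * a - 1 = (a - 1) + p * (r * a)" by (simp add: algebra_simps)
  also have "\<dots> \<in> P (int i)"
   by (rule P_add[OF P_mono[OF ra(5)] pP[OF mult_O]]) (use ra R_in_O in \<open>auto simp: in_O_iff\<close>)
  finally show "D \<in> G i" using ra u[OF ra(1)] unfolding G_def by (auto simp: v_mult)
 next
  fix D assume "D \<in> G i"
  then obtain a where a: "D = cls a" "a \<noteq> 0" "v a = 0" "a - 1 \<in> P (int i)" by (auto simp: G_def)
  define w where "w = (a - 1) / p"
  have w: "w \<in> Ob" using a(4) p unfolding w_def by (cases "a = 1") (auto simp: P_def in_O_iff v_divide)
  have aw: "a = 1 + p * w" using p by (simp add: w_def)
  define r where "r = rep w"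
  have r: "r \<in> R" "w - r \<in> P 1" using rep[OF w] by (simp_all add: r_def)
  define b where "b = a / (1 + p * r)"
  have b: "b \<noteq> 0" "v b = 0" using a u[OF r(1)] by (simp_all add: b_def v_divide)
  have "p * (w - r) * (1 / (1 + p * r)) \<in> P (int i + 1)"
   using p r u[OF r(1)] by (intro P_mult_O P_mult) (simp_all add: P_def in_O_iff v_divide)
  also have "p * (w - r) * (1 / (1 + p * r)) = b - 1" using u[OF r(1)] by (simp add: b_def aw field_simps)
  finally have "cls b \<in> G (Suc i)" using b unfolding G_def by (auto simp: ac_simps)
  moreover have "D = f (r, cls b)" using u[OF r(1)] by (simp add: f_def image_mult_cls a(1) b_def)
  ultimately show "D \<in> f ` (R \<times> G (Suc i))" using r by blast
 qed
 ultimately have "card (G i) = card (R \<times> G (Suc i))" using card_image by metis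
 then show ?thesis by (simp add: card_cartesian_product)
qed

lemma card_G:
 assumes "k \<le> e"
 shows "card (G (2 * e - 2 * k)) = 2 * card R ^ k"
 using assms
proof (induction k)
 case 0 then show ?case by (simp add: card_G_2e)
next
 case (Suc k)
 define j where "j = e - Suc k"
 have "2 * e - 2 * Suc k = 2 * j" "Suc (2 * j + 1) = 2 * e - 2 * k" "j < e" using Suc.prems by (auto simp: j_def)
 then show ?case using G_even[of j] card_G_odd[of "2 * j + 1"] Suc by simp
qed

text \<open>\<open>TR r\<close> is the set of square classes \<open>cls a\<close> for which \<open>a\<close> generates a totally ramified
 quadratic extension with discriminant valuation \<open>r\<close>.\<close>

definition ram_gen :: "'k => int => bool" where
 "ram_gen a r \<longleftrightarrow> a \<noteq> 0 \<and> (v a = 1 \<and> r = 2 * int e + 1 \<or>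
   (a \<noteq> 1 \<and> odd (v (a - 1)) \<and> 0 < v (a - 1) \<and> v (a - 1) < 2 * int e \<and> r = 2 * int e + 1 - v (a - 1)))"

lemma ram_gen_cases:
 assumes "ram_gen a r"
 obtains "a \<noteq> 0" "v a = 1" "r = 2 * int e + 1"
 | "a \<noteq> 0" "v a = 0" "a \<noteq> 1" "odd (v (a - 1))" "0 < v (a - 1)" "v (a - 1) < 2 * int e" "r = 2 * int e + 1 - v (a - 1)"
 using assms one_plus_P[of "a - 1" "v (a - 1)"] by (auto simp: ram_gen_def P_def)

definition TR :: "int => 'k set set" where
 "TR r = cls ` {a. ram_gen a r}"

text \<open>Exponent \<open>2 k\<close> belongs to the level \<open>2 e + 1 - 2 k\<close> of
  \<open>a - 1\<close>. Changing \<open>a\<close> by a square cannot raise this odd level, again by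
  \<open>square_odd_level\<close>, so the generators fill the difference of two steps of the
  filtration.\<close>

lemma TR_wild:
 assumes k: "1 \<le> k" "k \<le> e"
 shows "TR (2 * int k) = G (2 * e + 1 - 2 * k) - G (2 * e + 2 - 2 * k)"
proof -
 define d where "d = 2 * e + 1 - 2 * k"
 have d: "odd d" "d < 2 * e" "0 < d" "2 * e + 2 - 2 * k = Suc d" "int d = 2 * int e + 1 - 2 * int k" using k by (auto simp: d_def)
 have ram: "ram_gen a (2 * int k) \<longleftrightarrow> a \<noteq> 0 \<and> a \<noteq> 1 \<and> v (a - 1) = int d" for a
  using d by (auto simp: ram_gen_def)
 have "TR (2 * int k) = G d - G (Suc d)"
 proof (intro equalityI subsetI)
  fix C assume "C \<in> TR (2 * int k)"
  then obtain a where a: "C = cls a" "a \<noteq> 0" "a \<noteq> 1" "v (a - 1) = int d" by (auto simp: TR_def ram)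
  have aP: "a - 1 \<in> P (int d)" using a by (simp add: P_def)
  have va: "v a = 0" using one_plus_P[OF aP] d by simp
  have "C \<notin> G (Suc d)"
  proof
   assume "C \<in> G (Suc d)"
   then obtain b where b: "cls a = cls b" "b \<noteq> 0" "v b = 0" "b - 1 \<in> P (int d + 1)"
    using a(1) by (auto simp: G_def ac_simps)
   obtain s where s: "s \<noteq> 0" "b = a * s\<^sup>2" using b(1) cls_eq_iff[of b a] by auto
   have vs: "v (s\<^sup>2) = 0" using s b va a(2) by (simp add: v_mult)
   have as: "(a - 1) * s\<^sup>2 \<in> P (int d)" using aP vs by (intro P_mult_O) (simp_all add: in_O_iff)
   have "s\<^sup>2 - 1 = (b - 1) - (a - 1) * s\<^sup>2" by (simp add: s(2) algebra_simps)
   also have "\<dots> \<in> P (int d)" by (rule P_diff[OF P_mono[OF b(4)] as]) simp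
   finally have "s\<^sup>2 - 1 \<in> P (int d + 1)" by (rule square_odd_level[OF d(1,2)])
   from P_diff[OF b(4) this] have "(a - 1) * s\<^sup>2 \<in> P (int d + 1)" by (simp add: s(2) algebra_simps)
   moreover have "v ((a - 1) * s\<^sup>2) = int d" using a s vs by (simp add: v_mult)
   ultimately show False using a(3) s by (simp add: P_def)
  qed
  moreover have "C \<in> G d" using a va aP unfolding G_def by blast
  ultimately show "C \<in> G d - G (Suc d)" by blast
 next
  fix C assume C: "C \<in> G d - G (Suc d)"
  then obtain a where a: "C = cls a" "a \<noteq> 0" "v a = 0" "a - 1 \<in> P (int d)" by (auto simp: G_def)
  have "a - 1 \<notin> P (int (Suc d))" using C a unfolding G_def by blast
  then have "a \<noteq> 1" "v (a - 1) = int d" using a(4) by (auto simp: P_def)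
  then show "C \<in> TR (2 * int k)" using a by (auto simp: TR_def ram)
 qed
 then show ?thesis using d by (simp add: d_def)
qed

lemma card_TR_wild:
 assumes k: "1 \<le> k" "k \<le> e"
 shows "card (TR (2 * int k)) = 2 * (card R - 1) * card R ^ (k - 1)"
proof -
 have e1: "2 * e + 1 - 2 * k = 2 * (e - k) + 1" "2 * e - 2 * k = 2 * (e - k)" "e - k < e" using k by auto
 then have "G (2 * e + 1 - 2 * k) = G (2 * e - 2 * k)" using G_even[of "e - k"] by simp
 then have c1: "card (G (2 * e + 1 - 2 * k)) = 2 * card R ^ k" using card_G[OF k(2)] by simp
 have "2 * e + 2 - 2 * k = 2 * e - 2 * (k - 1)" using k by auto
 then have c2: "card (G (2 * e + 2 - 2 * k)) = 2 * card R ^ (k - 1)" using card_G[of "k - 1"] k by simp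
 have "finite (G (2 * e + 2 - 2 * k))" using c2 card_R_pos by (intro card_ge_0_finite) simp
 moreover have "G (2 * e + 2 - 2 * k) \<subseteq> G (2 * e + 1 - 2 * k)" by (rule G_mono) simp
 ultimately have "card (TR (2 * int k)) = 2 * card R ^ k - 2 * card R ^ (k - 1)"
  unfolding TR_wild[OF k] using c1 c2 by (simp add: card_Diff_subset)
 also have "\<dots> = 2 * (card R - 1) * card R ^ (k - 1)"
  using k by (cases k) (simp_all add: diff_mult_distrib diff_mult_distrib2)
 finally show ?thesis .
qed

text \<open>Multiplication by \<open>\<pi>\<close> carries the unit classes bijectively to the
  classes of valuation 1.\<close>

lemma card_TR_top: "card (TR (2 * int e + 1)) = 2 * card R ^ e"
proof -
 have ram: "ram_gen a (2 * int e + 1) \<longleftrightarrow> a \<noteq> 0 \<and> v a = 1" for a by (auto simp: ram_gen_def)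
 have "TR (2 * int e + 1) = (\<lambda>C. (*) \<pi> ` C) ` G 0"
 proof (intro equalityI subsetI)
  fix C assume "C \<in> TR (2 * int e + 1)"
  then obtain a where a: "C = cls a" "a \<noteq> 0" "v a = 1" by (auto simp: TR_def ram)
  define b where "b = a / \<pi>"
  have b: "b \<noteq> 0" "v b = 0" using a pi_nonzero by (simp_all add: b_def v_divide)
  have "b - 1 \<in> P (int 0)" using b diff_O[OF _ one_O, of b] by (simp add: P_0 in_O_iff)
  then have "cls b \<in> G 0" using b unfolding G_def by blast
  moreover have "C = (*) \<pi> ` cls b" using pi_nonzero by (simp add: image_mult_cls a(1) b_def)
  ultimately show "C \<in> (\<lambda>C. (*) \<pi> ` C) ` G 0" by blast
 next
  fix C assume "C \<in> (\<lambda>C. (*) \<pi> ` C) ` G 0"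
  then obtain b where b: "C = cls (\<pi> * b)" "b \<noteq> 0" "v b = 0" by (auto simp: G_def image_mult_cls)
  then show "C \<in> TR (2 * int e + 1)" using pi_nonzero by (auto simp: TR_def ram v_mult)
 qed
 moreover have "inj_on (\<lambda>C. (*) \<pi> ` C) (G 0)"
  by (rule inj_onI, subst (asm) inj_image_eq_iff) (use pi_nonzero in \<open>auto intro: injI\<close>)
 ultimately have "card (TR (2 * int e + 1)) = card (G 0)" using card_image by metis
 then show ?thesis using card_G[of e] by simp
qed

lemma ram_gen_not_square: "ram_gen a r ==> \<not> is_square a"
proof
 assume a: "ram_gen a r" "is_square a"
 obtain s where s: "a = s\<^sup>2" using a by (auto simp: is_square_def)
 from a(1) have a0: "a \<noteq> 0" by (simp add: ram_gen_def)
 then have "v a = 2 * v s" using s by (auto simp: v_power)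
 then have v1: "v a \<noteq> 1" by presburger
 then have d: "a \<noteq> 1" "odd (v (a - 1))" "0 < v (a - 1)" "v (a - 1) < 2 * int e"
  using a(1) by (auto simp: ram_gen_def)
 have "s\<^sup>2 - 1 \<in> P (int (nat (v (a - 1))) + 1)"
  by (rule square_odd_level) (use d s in \<open>auto simp: P_def even_nat_iff\<close>)
 then show False using d s by (auto simp: P_def)
qed

text \<open>The parity of the valuation separates exponent \<open>2 e + 1\<close> from the others;
  those are separated by \<open>TR_wild\<close>, because the filtration \<open>G\<close>
  decreases.\<close>

lemma TR_disjoint: "r \<noteq> r' ==> TR r \<inter> TR r' = {}"
proof -
 assume "r \<noteq> r'"
 have dis: False if C: "cls a = cls b" "ram_gen a r" "ram_gen b r'" "r < r'" for a b r r'
 proof -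
  obtain s where s: "s \<noteq> 0" "a = b * s\<^sup>2" using C(1) cls_eq_iff by blast
  have par: "even (v a) \<longleftrightarrow> even (v b)" using s C(3) by (simp add: v_mult v_power ram_gen_def)
  have "v a = 0 \<and> odd (v (a - 1)) \<and> 0 < v (a - 1) \<and> v (a - 1) < 2 * int e \<and> r = 2 * int e + 1 - v (a - 1)"
   using C(2)
  proof (cases rule: ram_gen_cases)
   case 1
   from C(3) have "r' \<le> 2 * int e + 1" by (cases rule: ram_gen_cases) auto
   with C(4) 1 show ?thesis by auto
  qed auto
  then have a: "v a = 0" "odd (v (a - 1))" "0 < v (a - 1)" "v (a - 1) < 2 * int e" "r = 2 * int e + 1 - v (a - 1)"
   by auto
  have b: "odd (v (b - 1))" "0 < v (b - 1)" "v (b - 1) < 2 * int e" "r' = 2 * int e + 1 - v (b - 1)"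
   using C(3) by (cases rule: ram_gen_cases; use par a(1) in auto)+
  define k where "k = nat (r div 2)"
  have k: "r = 2 * int k" "1 \<le> k" "k \<le> e" using a by (auto simp: k_def elim!: oddE)
  define k' where "k' = nat (r' div 2)"
  have k': "r' = 2 * int k'" "1 \<le> k'" "k' \<le> e" using b by (auto simp: k'_def elim!: oddE)
  have "cls a \<in> G (2 * e + 1 - 2 * k)" using C(2) TR_wild[OF k(2,3)] k(1) by (auto simp: TR_def)
  moreover have "G (2 * e + 1 - 2 * k) \<subseteq> G (2 * e + 2 - 2 * k')" using C(4) k k' by (intro G_mono) auto
  moreover have "cls b \<notin> G (2 * e + 2 - 2 * k')" using C(3) TR_wild[OF k'(2,3)] k'(1) by (auto simp: TR_def)
  ultimately show False using C(1) by auto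
 qed
 show ?thesis
 proof (rule ccontr)
  assume "TR r \<inter> TR r' \<noteq> {}"
  then obtain a b where "cls a = cls b" "ram_gen a r" "ram_gen b r'" by (auto simp: TR_def)
  then show False using dis[of a b r r'] dis[of b a r' r] \<open>r \<noteq> r'\<close> by (cases "r < r'") auto
 qed
qed

lemma ram_gen_values: "ram_gen a r ==> r = 2 * int e + 1 \<or> (\<exists>k. 1 \<le> k \<and> k \<le> e \<and> r = 2 * int k)"
proof -
 assume "ram_gen a r"
 then consider "r = 2 * int e + 1" | "odd (v (a - 1))" "0 < v (a - 1)" "v (a - 1) < 2 * int e" "r = 2 * int e + 1 - v (a - 1)"
  by (auto simp: ram_gen_def)
 then show ?thesis
 proof cases
  case 2
  then show ?thesis by (intro disjI2 exI[of _ "nat (r div 2)"]) (auto elim!: oddE)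
 qed simp
qed

section \<open>Integers of quadratic extensions\<close>

text \<open>The pair \<open>(x, y)\<close> stands for \<open>x + y * sqrt a\<close>.\<close>

definition qmul :: "'k => 'k \<times> 'k => 'k \<times> 'k => 'k \<times> 'k" where
 "qmul a z w = (fst z * fst w + a * snd z * snd w, fst z * snd w + snd z * fst w)"

definition qnorm :: "'k => 'k \<times> 'k => 'k" where
 "qnorm a z = (fst z)\<^sup>2 - a * (snd z)\<^sup>2"

lemma qnorm_qmul: "qnorm a (qmul a z w) = qnorm a z * qnorm a w"
 by (simp add: qnorm_def qmul_def power2_eq_square algebra_simps)

lemma qnorm_eq_0: "\<not> is_square a ==> qnorm a z = 0 \<longleftrightarrow> z = 0"
proof
 assume a: "\<not> is_square a" "qnorm a z = 0"
 show "z = 0"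
 proof (cases "snd z = 0")
  case True
  then show ?thesis using a(2) by (cases z) (auto simp: qnorm_def zero_prod_def)
 next
  case False
  then have "a = (fst z / snd z)\<^sup>2" using a(2) by (simp add: qnorm_def field_simps)
  then show ?thesis using a(1) by (auto simp: is_square_def)
 qed
qed (simp add: qnorm_def)

text \<open>The integers of the extension described through the norm alone. Closure under addition
  and integrality of traces are not visible here; they come from an explicit basis in
  \<open>QO_add\<close> and \<open>QO_trace\<close>.\<close>

definition QO :: "'k => ('k \<times> 'k) set" where
 "QO a = {z. qnorm a z \<in> Ob}"

lemma QO_qmul: "z \<in> QO a ==> w \<in> QO a ==> qmul a z w \<in> QO a"
 by (simp add: QO_def qnorm_qmul mult_O)

text \<open>Says that 1 and \<open>g + h * sqrt a\<close> form a basis of \<open>QO a\<close> over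
  \<open>Ob\<close>: the two conditions are integrality of the coordinates of
  \<open>x + y * sqrt a\<close>.\<close>

definition int_basis :: "'k => 'k => 'k => bool" where
 "int_basis a g h \<longleftrightarrow> h \<noteq> 0 \<and> (\<forall>x y. (x, y) \<in> QO a \<longleftrightarrow> y / h \<in> Ob \<and> x - y / h * g \<in> Ob)"

text \<open>In the next two lemmas the terms of the norm form have valuations of different parity, so that
 they cannot cancel.\<close>

lemma int_basis_tame:
 assumes a: "a \<noteq> 0" "v a = 1"
 shows "int_basis a 0 1"
proof -
 have "x \<in> Ob \<and> y \<in> Ob" if xy: "x\<^sup>2 - a * y\<^sup>2 \<in> Ob" for x y
 proof -
  consider "x = 0" | "y = 0" | "x \<noteq> 0" "y \<noteq> 0" by blast
  then show ?thesis
  proof cases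
   case 1
   show ?thesis
   proof (cases "y = 0")
    case False
    then have "0 \<le> 1 + 2 * v y" using xy 1 a by (simp add: in_O_iff v_mult v_power)
    then show ?thesis using 1 by (simp add: in_O_iff)
   qed (use 1 zero_O in simp)
  next
   case 2
   then show ?thesis using xy zero_O by (cases "x = 0") (auto simp: in_O_iff v_power)
  next
   case 3
   have v1: "v (x\<^sup>2) = 2 * v x" "v (a * y\<^sup>2) = 1 + 2 * v y" using 3 a by (simp_all add: v_power v_mult)
   have nz: "x\<^sup>2 \<noteq> 0" "a * y\<^sup>2 \<noteq> 0" using 3 a by simp_all
   show ?thesis
   proof (cases "v x \<le> v y")
    case True
    then have "- (a * y\<^sup>2) \<in> P (v (x\<^sup>2) + 1)" using v1 nz by (simp add: P_def)
    from v_add_eq[OF nz(1) this] have "0 \<le> v (x\<^sup>2)" using xy by (auto simp: in_O_iff)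
    then show ?thesis using True v1 by (auto simp: in_O_iff)
   next
    case False
    then have "x\<^sup>2 \<in> P (v (- (a * y\<^sup>2)) + 1)" using v1 nz by (simp add: P_def)
    from v_add_eq[OF _ this] nz have "0 \<le> v (a * y\<^sup>2)" using xy by (auto simp: in_O_iff)
    then have "0 \<le> v y" using v1 by simp
    then show ?thesis using False by (auto simp: in_O_iff)
   qed
  qed
 qed
 moreover have "a \<in> Ob" using a by (simp add: in_O_iff)
 ultimately have "x\<^sup>2 - a * y\<^sup>2 \<in> Ob \<longleftrightarrow> x \<in> Ob \<and> y \<in> Ob" for x y
  using diff_O[OF power_O mult_O[OF _ power_O], of x a y 2 2] by blast
 then show ?thesis by (auto simp: int_basis_def QO_def qnorm_def)
qed

lemma int_basis_wild:
 assumes d: "d \<noteq> 0" "v d = 2 * int j + 1" "j < e"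
 shows "int_basis (1 + d) (1 / \<pi> ^ j) (1 / \<pi> ^ j)"
proof -
 have norm: "qnorm (1 + d) (x, y) = (x - y)\<^sup>2 + 2 * ((x - y) * y) - d * y\<^sup>2" for x y
  by (simp add: qnorm_def power2_eq_square algebra_simps)
 have "u \<in> Ob \<and> (y = 0 \<or> - int j \<le> v y) \<longleftrightarrow> u\<^sup>2 + 2 * (u * y) - d * y\<^sup>2 \<in> Ob" for u y
 proof
  assume uy: "u \<in> Ob \<and> (y = 0 \<or> - int j \<le> v y)"
  have "2 * y \<in> P 0" using uy d(3) by (cases "y = 0") (auto simp: P_def v_mult v_two)
  then have "(2 * y) * u \<in> Ob" using uy mult_O by (simp add: P_0)
  moreover have "d * y\<^sup>2 \<in> Ob" using uy d by (cases "y = 0") (auto simp: in_O_iff v_mult v_power)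
  ultimately have "u\<^sup>2 + (2 * y) * u - d * y\<^sup>2 \<in> Ob"
   using diff_O[OF add_O[OF power_O[of u 2]]] uy by blast
  then show "u\<^sup>2 + 2 * (u * y) - d * y\<^sup>2 \<in> Ob" by (simp add: mult.assoc mult.commute[of u y])
 next
  assume n: "u\<^sup>2 + 2 * (u * y) - d * y\<^sup>2 \<in> Ob"
  consider "u = 0" | "y = 0" | "u \<noteq> 0" "y \<noteq> 0" by blast
  then show "u \<in> Ob \<and> (y = 0 \<or> - int j \<le> v y)"
  proof cases
   case 1
   show ?thesis
   proof (cases "y = 0")
    case False
    then have "0 \<le> 2 * int j + 1 + 2 * v y" using n 1 d by (simp add: in_O_iff v_mult v_power)
    then show ?thesis using 1 zero_O by simp
   qed (use 1 zero_O in simp)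
  next
   case 2
   then show ?thesis using n by (cases "u = 0") (auto simp: in_O_iff v_power)
  next
   case 3
   have v1: "v (u\<^sup>2) = 2 * v u" "v (d * y\<^sup>2) = 2 * int j + 1 + 2 * v y" "v (2 * (u * y)) = int e + v u + v y"
    using 3 d by (simp_all add: v_power v_mult v_two)
   have nz: "u\<^sup>2 \<noteq> 0" "d * y\<^sup>2 \<noteq> 0" "2 * (u * y) \<noteq> 0" using 3 d by simp_all
   \<comment> \<open>The mixed term never matters: since \<open>j < e\<close>, its valuation exceeds
     the smaller of the other two in either case.\<close>
   show ?thesis
   proof (cases "v u \<le> int j + v y")
    case True
    then have "2 * (u * y) + - (d * y\<^sup>2) \<in> P (v (u\<^sup>2) + 1)"
     using v1 nz d(3) by (intro P_add) (simp_all add: P_def)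
    from v_add_eq[OF nz(1) this] have "0 \<le> v (u\<^sup>2)"
     using n by (simp add: in_O_iff algebra_simps)
    then show ?thesis using True v1 by (auto simp: in_O_iff)
   next
    case False
    then have "u\<^sup>2 + 2 * (u * y) \<in> P (v (- (d * y\<^sup>2)) + 1)"
     using v1 nz d(3) by (intro P_add) (simp_all add: P_def)
    from v_add_eq[OF _ this] nz have "0 \<le> v (d * y\<^sup>2)"
     using n by (simp add: in_O_iff algebra_simps)
    then have "- int j \<le> v y" using v1 by simp
    then show ?thesis using False by (auto simp: in_O_iff)
   qed
  qed
 qed
 moreover have "y / (1 / \<pi> ^ j) \<in> Ob \<longleftrightarrow> y = 0 \<or> - int j \<le> v y" for y
  using pi_nonzero by (cases "y = 0") (auto simp: in_O_iff v_mult v_power)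
 ultimately show ?thesis using pi_nonzero by (auto simp: int_basis_def QO_def norm)
qed

text \<open>In the coordinates \<open>W = x - y\<close>, \<open>Y = 2 * y\<close> the norm is
  \<open>W ^ 2 + W * Y - c * Y ^ 2\<close>. This form has no nontrivial zero over the residue field
  since \<open>c\<close> is not \<open>AS\<close>, so integral values force integral
  arguments.\<close>

lemma int_basis_unramified:
 assumes c: "c \<in> Ob" "\<not> AS c"
 shows "int_basis (1 + 4 * c) (1 / 2) (1 / 2)"
proof -
 have norm: "qnorm (1 + 4 * c) (x, y) = (x - y)\<^sup>2 + (x - y) * (2 * y) - c * (2 * y)\<^sup>2" for x y
  by (simp add: qnorm_def power2_eq_square algebra_simps)
 have "W \<in> Ob \<and> Y \<in> Ob" if n: "W\<^sup>2 + W * Y - c * Y\<^sup>2 \<in> Ob" for W Y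
 proof (cases "Y = 0")
  case True
  then show ?thesis using n zero_O by (cases "W = 0") (auto simp: in_O_iff v_power)
 next
  case False
  define r where "r = W / Y"
  have W: "W = r * Y" using False by (simp add: r_def)
  have n_r: "W\<^sup>2 + W * Y - c * Y\<^sup>2 = Y\<^sup>2 * (r\<^sup>2 + r - c)" unfolding W by (simp add: power2_eq_square algebra_simps)
  show ?thesis
  proof (cases "r \<in> Ob")
   case True
   then have "r\<^sup>2 + r - c \<notin> P 1" using AS_lift c by blast
   moreover have "r\<^sup>2 + r - c \<in> Ob" using True c by (intro diff_O add_O power_O)
   ultimately have "r\<^sup>2 + r - c \<noteq> 0" "v (r\<^sup>2 + r - c) = 0" by (auto simp: P_def in_O_iff)
   then have "Y \<in> Ob" using n False unfolding n_r by (simp add: in_O_iff v_mult v_power)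
   then show ?thesis using True W mult_O by simp
  next
   case F2: False
   then have r: "r \<noteq> 0" "v r < 0" by (auto simp: in_O_iff)
   have "c \<in> P (v r)" using P_mono[of c 0 "v r"] r c by (simp add: P_0)
   then have "r - c \<in> P (v r)" by (rule P_diff[rotated]) (simp add: P_def)
   then have "r - c \<in> P (v (r\<^sup>2) + 1)" by (rule P_mono) (use r in \<open>simp add: v_power\<close>)
   from v_add_eq[OF _ this] r have e1: "v (r\<^sup>2 + (r - c)) = 2 * v r" "r\<^sup>2 + (r - c) \<noteq> 0" by (simp_all add: v_power)
   have "0 \<le> 2 * v Y + 2 * v r"
    using n e1 False unfolding n_r by (simp add: in_O_iff v_mult v_power add_diff_eq)
   then show ?thesis using r False by (auto simp: in_O_iff W v_mult)
  qed
 qed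
 moreover have "W\<^sup>2 + W * Y - c * Y\<^sup>2 \<in> Ob" if "W \<in> Ob" "Y \<in> Ob" for W Y
  using that c by (intro diff_O add_O mult_O power_O)
 ultimately have K: "W\<^sup>2 + W * Y - c * Y\<^sup>2 \<in> Ob \<longleftrightarrow> W \<in> Ob \<and> Y \<in> Ob" for W Y by blast
 show ?thesis unfolding int_basis_def QO_def mem_Collect_eq norm K by (auto simp: mult.commute)
qed

text \<open>\<open>4 * a * h ^ 2\<close> is the discriminant of the basis 1,
  \<open>g + h * sqrt a\<close>. In the wild case \<open>h = 1 / \<pi> ^ j\<close> with
  \<open>v (a - 1) = 2 * j + 1\<close>, which leaves \<open>2 * e - 2 * j\<close>.\<close>

lemma ram_gen_int_basis:
 assumes "ram_gen a r"
 shows "\<exists>g h. int_basis a g h \<and> v (4 * a * h\<^sup>2) = r"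
 using assms
proof (cases rule: ram_gen_cases)
 case 1
 then show ?thesis using int_basis_tame[of a] by (intro exI[of _ 0] exI[of _ 1]) (simp add: v_mult v_four)
next
 case 2
 define j where "j = nat ((v (a - 1) - 1) div 2)"
 have j: "v (a - 1) = 2 * int j + 1" "j < e" using 2 by (auto simp: j_def elim!: oddE)
 have "int_basis a (1 / \<pi> ^ j) (1 / \<pi> ^ j)" using int_basis_wild[of "a - 1" j] j 2 by simp
 moreover have "v (4 * a * (1 / \<pi> ^ j)\<^sup>2) = r"
  using 2 j pi_nonzero by (simp add: v_mult v_four v_power v_divide)
 ultimately show ?thesis by blast
qed

text \<open>An element with norm of valuation 1 will be a uniformizer of the extension:
  \<open>sqrt a\<close> itself, or \<open>(1 + sqrt a) / \<pi> ^ j\<close>, whose norm is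
  \<open>(1 - a) / \<pi> ^ (2 * j)\<close>.\<close>

lemma ram_gen_norm_one:
 assumes "ram_gen a r"
 shows "\<exists>z. z \<noteq> 0 \<and> v (qnorm a z) = 1"
 using assms
proof (cases rule: ram_gen_cases)
 case 1
 then show ?thesis by (intro exI[of _ "(0, 1)"]) (simp add: qnorm_def zero_prod_def)
next
 case 2
 define j where "j = nat ((v (a - 1) - 1) div 2)"
 have j: "v (a - 1) = 2 * int j + 1" using 2 by (auto simp: j_def elim!: oddE)
 have "qnorm a (1 / \<pi> ^ j, 1 / \<pi> ^ j) = - (a - 1) / (\<pi> ^ j)\<^sup>2"
  using pi_nonzero by (simp add: qnorm_def power_one_over field_simps)
 moreover have "v (- (a - 1) / (\<pi> ^ j)\<^sup>2) = 1"
  using 2 j pi_nonzero by (subst v_divide) (simp_all add: v_power del: minus_diff_eq)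
 ultimately show ?thesis using pi_nonzero by (intro exI[of _ "(1 / \<pi> ^ j, 1 / \<pi> ^ j)"]) (simp add: zero_prod_def)
qed

lemma unramified_qnorm_even:
 assumes "c \<in> Ob" "\<not> AS c" "z \<noteq> 0"
 shows "even (v (qnorm (1 + 4 * c) z))"
 by (rule unramified_norm_even[OF assms(1,2)])
  (use qnorm_eq_0[OF not_AS_not_square[OF assms(1,2)]] assms(3) in \<open>auto simp: N_def qnorm_def\<close>)

lemma normal_cases:
 assumes "normal a" "\<not> is_square a"
 obtains r where "ram_gen a r" | c where "c \<in> Ob" "\<not> AS c" "a = 1 + 4 * c"
 using assms AS_imp_square unfolding normal_def ram_gen_def by blast

lemma QO_add: "int_basis a g h ==> z \<in> QO a ==> w \<in> QO a ==> z + w \<in> QO a"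
proof -
 assume a: "int_basis a g h" "z \<in> QO a" "w \<in> QO a"
 have iff: "z \<in> QO a \<longleftrightarrow> snd z / h \<in> Ob \<and> fst z - snd z / h * g \<in> Ob" for z
  using a(1) by (cases z) (simp add: int_basis_def)
 have "snd z / h + snd w / h \<in> Ob" "(fst z - snd z / h * g) + (fst w - snd w / h * g) \<in> Ob"
  using a(2,3) unfolding iff by (auto intro!: add_O)
 then show "z + w \<in> QO a" unfolding iff
  by (simp add: add_divide_distrib distrib_right add_diff_eq diff_add_eq diff_diff_eq add.commute[of _ "snd w / h * g"])
qed

lemma QO_scale: "x \<in> Ob ==> z \<in> QO a ==> (x * fst z, x * snd z) \<in> QO a"
proof -
 assume a: "x \<in> Ob" "z \<in> QO a"
 have "qnorm a (x * fst z, x * snd z) = x\<^sup>2 * qnorm a z"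
  by (simp add: qnorm_def power_mult_distrib algebra_simps)
 then show ?thesis using a by (simp add: QO_def mult_O power_O)
qed

text \<open>Polarization: the trace of \<open>z\<close> is the norm of \<open>1 + z\<close> minus 1
  minus the norm of \<open>z\<close>, and \<open>1 + z\<close> is again in
  \<open>QO a\<close>.\<close>

lemma QO_trace: "int_basis a g h ==> z \<in> QO a ==> 2 * fst z \<in> Ob"
proof -
 assume a: "int_basis a g h" "z \<in> QO a"
 have one: "(1, 0) \<in> QO a" by (simp add: QO_def qnorm_def one_O)
 have "(1, 0) + z \<in> QO a" by (rule QO_add[OF a(1) one a(2)])
 then have "qnorm a ((1, 0) + z) - 1 - qnorm a z \<in> Ob" using a(2) by (intro diff_O one_O) (simp_all add: QO_def)
 also have "qnorm a ((1, 0) + z) - 1 - qnorm a z = 2 * fst z"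
  by (cases z) (simp add: qnorm_def power2_eq_square algebra_simps)
 finally show ?thesis .
qed

text \<open>Expansions with \<open>n\<close> digits from \<open>R\<close> in powers of
  \<open>\<pi>\<close>; this computes the norm of the \<open>n\<close>-th power of the maximal
  ideal.\<close>

lemma transversal:
 "\<exists>S. finite S \<and> card S = card R ^ n \<and> S \<subseteq> Ob \<and> (\<forall>x\<in>Ob. \<exists>!s. s \<in> S \<and> x - s \<in> P (int n))"
proof (induction n)
 case 0
 show ?case using diff_O by (intro exI[of _ "{0}"]) (auto simp: P_0 zero_O)
next
 case (Suc n)
 then obtain S where S0: "finite S \<and> card S = card R ^ n \<and> S \<subseteq> Ob \<and> (\<forall>x\<in>Ob. \<exists>!s. s \<in> S \<and> x - s \<in> P (int n))"
  by (rule exE)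
 then have S: "finite S" "card S = card R ^ n" "S \<subseteq> Ob" by simp_all
 have S4: "\<exists>!s. s \<in> S \<and> x - s \<in> P (int n)" if "x \<in> Ob" for x using S0 that by simp
 define p where "p = \<pi> ^ n"
 have p: "p \<noteq> 0" "v p = int n" "p \<in> Ob" "p \<in> P (int n)" using pi_nonzero by (auto simp: p_def v_power P_def power_O pi_O)
 let ?f = "\<lambda>(r, s). s + p * r"
 have uniq: "r = r' \<and> s = s'"
  if m: "r \<in> R" "r' \<in> R" "s \<in> S" "s' \<in> S" and D: "(s + p * r) - (s' + p * r') \<in> P (int (Suc n))" for r s r' s'
 proof -
  have pr: "p * r \<in> P (int n)" "p * r' \<in> P (int n)" using P_mult_O p R_in_O m by blast+
  have D0: "(s + p * r) - (s' + p * r') \<in> P (int n)" by (rule P_mono[OF D]) simp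
  have "s - s' = (s + p * r) - (s' + p * r') - (p * r - p * r')" by simp
  also have "\<dots> \<in> P (int n)" by (rule P_diff[OF D0 P_diff[OF pr]])
  finally have "s - s' \<in> P (int n)" .
  moreover have "s \<in> Ob" using S(3) m by blast
  ultimately have ss: "s = s'" using ex1E[OF S4[of s]] m by (metis diff_self zero_P)
  then have "p * (r - r') \<in> P (int n + 1)" using D by (simp add: algebra_simps)
  then have "r - r' \<in> P 1" using p by (cases "r = r'") (auto simp: P_def v_mult)
  with ss m rep_unique show ?thesis by blast
 qed
 have "inj_on ?f (R \<times> S)" using uniq by (force simp: inj_on_def)
 then have "card (?f ` (R \<times> S)) = card R ^ Suc n" using S(2) by (simp add: card_image card_cartesian_product)
 moreover have "finite (?f ` (R \<times> S))" using S(1) finite_R by simp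
 moreover have "?f ` (R \<times> S) \<subseteq> Ob" using S(3) R_in_O p by (auto intro!: add_O mult_O)
 moreover have "\<exists>!y. y \<in> ?f ` (R \<times> S) \<and> x - y \<in> P (int (Suc n))" if x: "x \<in> Ob" for x
 proof -
  obtain s where s: "s \<in> S" "x - s \<in> P (int n)" using ex1_implies_ex[OF S4[OF x]] by blast
  have w: "(x - s) / p \<in> Ob" using s(2) p by (cases "x = s") (auto simp: P_def in_O_iff v_divide)
  define r where "r = rep ((x - s) / p)"
  have r: "r \<in> R" "(x - s) / p - r \<in> P 1" using rep[OF w] by (simp_all add: r_def)
  have "p * ((x - s) / p - r) \<in> P (int n + 1)" by (rule P_mult[OF p(4) r(2)])
  also have "p * ((x - s) / p - r) = x - (s + p * r)" using p(1) by (simp add: field_simps)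
  finally have near: "x - (s + p * r) \<in> P (int (Suc n))" by (simp add: ac_simps)
  show ?thesis
  proof (rule ex1I[of _ "s + p * r"])
   show "s + p * r \<in> ?f ` (R \<times> S) \<and> x - (s + p * r) \<in> P (int (Suc n))" using near r(1) s(1) by force
   fix y assume y: "y \<in> ?f ` (R \<times> S) \<and> x - y \<in> P (int (Suc n))"
   then obtain r' s' where rs: "r' \<in> R" "s' \<in> S" "y = s' + p * r'" by auto
   have "(x - (s + p * r)) - (x - y) \<in> P (int (Suc n))" using P_diff[OF near] y by blast
   then have "(s' + p * r') - (s + p * r) \<in> P (int (Suc n))" by (simp add: rs(3) algebra_simps)
   with uniq rs r(1) s(1) show "y = s + p * r" by blast
  qed
 qed
 ultimately show ?case by (intro exI[of _ "?f ` (R \<times> S)"] conjI ballI)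
qed

end

section \<open>Linear algebra over a field identified with a type\<close>

locale typed_field = F: cring F for F :: "('a, 'm) ring_scheme" +
 fixes h :: "'k::field_char_0 => 'a"
 assumes h_bij: "bij_betw h UNIV (carrier F)"
  and h_add: "h (x + y) = h x \<oplus>\<^bsub>F\<^esub> h y"
  and h_mult: "h (x * y) = h x \<otimes>\<^bsub>F\<^esub> h y"
  and h_one: "h 1 = \<one>\<^bsub>F\<^esub>"
begin

lemma h_closed [simp]: "h x \<in> carrier F"
 using h_bij by (auto simp: bij_betw_def)

lemma h_eq_iff [simp]: "h x = h y \<longleftrightarrow> x = y"
 using h_bij by (auto simp: bij_betw_def inj_on_def)

lemma h_surj: "a \<in> carrier F ==> \<exists>x. a = h x"
 using h_bij by (auto simp: bij_betw_def)

lemma h_zero: "h 0 = \<zero>\<^bsub>F\<^esub>"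
proof -
 have "h 0 \<oplus>\<^bsub>F\<^esub> h 0 = h 0 \<oplus>\<^bsub>F\<^esub> \<zero>\<^bsub>F\<^esub>" using h_add[of 0 0] by simp
 then show ?thesis by (simp only: F.add.l_cancel h_closed F.zero_closed)
qed

lemma h_uminus: "h (- x) = \<ominus>\<^bsub>F\<^esub> h x"
proof -
 have "h (- x) \<oplus>\<^bsub>F\<^esub> h x = \<zero>\<^bsub>F\<^esub>" using h_add[of "- x" x] h_zero by simp
 then show ?thesis by (metis F.minus_equality h_closed)
qed

lemma h_sum: "h (sum f I) = (\<Oplus>\<^bsub>F\<^esub>i\<in>I. h (f i))"
 by (induction I rule: infinite_finite_induct) (auto simp: h_zero h_add Pi_def F.finsum_infinite)

lemma h_prod: "h (prod f I) = (\<Otimes>\<^bsub>F\<^esub>i\<in>I. h (f i))"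
 by (induction I rule: infinite_finite_induct) (auto simp: h_one h_mult Pi_def F.finprod_infinite)

lemma h_sign: "add_pow F (sign p) (h x) = h (signof p * x)"
 by (auto simp: sign_def h_uminus a_inv_def add_pow_def int_pow_def nat_pow_def)

lemma ring_det_h:
 assumes "\<And>i j. i < n ==> j < n ==> M i j = h (m i j)"
 shows "ring_det F n M = h (det (mat n n (\<lambda>(i, j). m i j)))"
proof -
 have "h (det (mat n n (\<lambda>(i, j). m i j))) =
  h (\<Sum>p | p permutes {0..<n}. signof p * (\<Prod>i = 0..<n. m i (p i)))"
  by (subst det_def'[of _ n]) (auto intro!: arg_cong[where f = h] sum.cong prod.cong arg_cong2[where f = "(*)"]
    simp: permutes_in_image[of _ "{0..<n}", simplified])
 also have "\<dots> = (\<Oplus>\<^bsub>F\<^esub>p\<in>{p. p permutes {..<n}}. add_pow F (sign p) (\<Otimes>\<^bsub>F\<^esub>i\<in>{..<n}. h (m i (p i))))"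
  by (simp add: h_sum h_sign h_prod lessThan_atLeast0 flip: h_prod)
 also have "\<dots> = ring_det F n M"
  unfolding ring_det_def
 proof (rule F.finsum_cong')
  fix p assume p: "p \<in> {p. p permutes {..<n}}"
  have "(\<Otimes>\<^bsub>F\<^esub>i\<in>{..<n}. h (m i (p i))) = (\<Otimes>\<^bsub>F\<^esub>i\<in>{..<n}. M i (p i))"
  proof (rule F.finprod_cong')
   fix i assume "i \<in> {..<n}"
   moreover from this have "p i < n" using p permutes_in_image[of p "{..<n}" i] by simp
   ultimately show "h (m i (p i)) = M i (p i)" using assms by simp
  next
   show "(\<lambda>i. M i (p i)) \<in> {..<n} \<rightarrow> carrier F"
    using p assms permutes_in_image[of p "{..<n}"] by auto
  qed simp
  then show "add_pow F (sign p) (\<Otimes>\<^bsub>F\<^esub>i\<in>{..<n}. h (m i (p i))) = add_pow F (sign p) (\<Otimes>\<^bsub>F\<^esub>i\<in>{..<n}. M i (p i))"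
   by simp
 next
  show "(\<lambda>p. add_pow F (sign p) (\<Otimes>\<^bsub>F\<^esub>i\<in>{..<n}. M i (p i))) \<in> {p. p permutes {..<n}} \<rightarrow> carrier F"
  proof
   fix p assume p: "p \<in> {p. p permutes {..<n}}"
   have "(\<Otimes>\<^bsub>F\<^esub>i\<in>{..<n}. M i (p i)) \<in> carrier F"
    using p assms permutes_in_image[of p "{..<n}"] by (intro F.finprod_closed) auto
   then show "add_pow F (sign p) (\<Otimes>\<^bsub>F\<^esub>i\<in>{..<n}. M i (p i)) \<in> carrier F" by simp
  qed
 qed simp
 finally show ?thesis by simp
qed

end

locale typed_algebra = typed_field F h + L: cring L + A: algebra F L
 for F :: "('a, 'm) ring_scheme" and h :: "'k::field_char_0 => 'a" and L :: "('a, 'b, 'n) module_scheme"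
begin

definition lc :: "'b list => (nat => 'k) => 'b" where
 "lc b c = (\<Oplus>\<^bsub>L\<^esub>i\<in>{..<length b}. h (c i) \<odot>\<^bsub>L\<^esub> b ! i)"

text \<open>Coordinates with values in the field type. Beyond the length of the basis they are
  arbitrary, so all statements compare them below it.\<close>

definition crd :: "'b list => 'b => nat => 'k" where
 "crd b x = (SOME c. x = lc b c)"

lemma lc_closed: "set b \<subseteq> carrier L ==> lc b c \<in> carrier L"
 unfolding lc_def by (intro L.finsum_closed) (auto simp: subset_iff)

lemma lc_cong: "(\<And>i. i < length b ==> c i = d i) ==> set b \<subseteq> carrier L ==> lc b c = lc b d"
 unfolding lc_def by (intro L.finsum_cong') (auto simp: subset_iff)

lemma basis_closed: "alg_basis F L b ==> set b \<subseteq> carrier L"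
 by (simp add: alg_basis_def)

lemma basis_nth: "alg_basis F L b ==> i < length b ==> b ! i \<in> carrier L"
 using basis_closed[of b] by auto

lemma lc_restrict: 
 assumes "set b \<subseteq> carrier L"
 shows "lc b c = (\<Oplus>\<^bsub>L\<^esub>i\<in>{..<length b}. restrict (\<lambda>i. h (c i)) {..<length b} i \<odot>\<^bsub>L\<^esub> b ! i)"
 unfolding lc_def using assms by (intro L.finsum_cong') (auto simp: subset_iff)

lemma alg_basis_iff:
 "alg_basis F L b \<longleftrightarrow> set b \<subseteq> carrier L \<and> (\<forall>x\<in>carrier L. \<exists>c. x = lc b c) \<and>
   (\<forall>c d. lc b c = lc b d --> (\<forall>i<length b. c i = d i))"
proof
 assume b: "alg_basis F L b"
 note cl = basis_closed[OF b]
 define Q where "Q x c \<longleftrightarrow> c \<in> {..<length b} \<rightarrow>\<^sub>E carrier F \<and> x = (\<Oplus>\<^bsub>L\<^esub>i\<in>{..<length b}. c i \<odot>\<^bsub>L\<^esub> b ! i)" for x c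
 have ex1: "\<exists>!c. Q x c" if "x \<in> carrier L" for x
  unfolding Q_def by (rule bspec[OF b[unfolded alg_basis_def, THEN conjunct2] that])
 have "\<exists>c. x = lc b c" if x: "x \<in> carrier L" for x
 proof -
  obtain c where "Q x c" using ex1[OF x] by blast
  then have c: "c \<in> {..<length b} \<rightarrow>\<^sub>E carrier F" "x = (\<Oplus>\<^bsub>L\<^esub>i\<in>{..<length b}. c i \<odot>\<^bsub>L\<^esub> b ! i)"
   by (simp_all add: Q_def)
  have "\<forall>i. \<exists>y. i < length b --> c i = h y" using h_surj PiE_mem[OF c(1)] by (metis lessThan_iff)
  then obtain d where d: "\<And>i. i < length b ==> c i = h (d i)" by metis
  have "x = lc b d" unfolding c(2) lc_def
   using cl d by (intro L.finsum_cong') (auto simp: subset_iff)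
  then show ?thesis by blast
 qed
 moreover have "c i = d i" if cd: "lc b c = lc b d" "i < length b" for c d i
 proof -
  have Q: "Q (lc b c) (restrict (\<lambda>i. h (c i)) {..<length b})" for c
   unfolding Q_def using lc_restrict[OF cl, of c] by simp
  have "restrict (\<lambda>i. h (c i)) {..<length b} = restrict (\<lambda>i. h (d i)) {..<length b}"
   using ex1[OF lc_closed[OF cl, of c]] Q[of c] Q[of d] cd(1) by auto
  then have "restrict (\<lambda>i. h (c i)) {..<length b} i = restrict (\<lambda>i. h (d i)) {..<length b} i"
   by (rule fun_cong)
  then show ?thesis using cd(2) by simp
 qed
 ultimately show "set b \<subseteq> carrier L \<and> (\<forall>x\<in>carrier L. \<exists>c. x = lc b c) \<and>
   (\<forall>c d. lc b c = lc b d --> (\<forall>i<length b. c i = d i))" using cl by blast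
next
 assume b: "set b \<subseteq> carrier L \<and> (\<forall>x\<in>carrier L. \<exists>c. x = lc b c) \<and>
   (\<forall>c d. lc b c = lc b d --> (\<forall>i<length b. c i = d i))"
 then have cl: "set b \<subseteq> carrier L" by blast
 have "\<exists>!c. c \<in> {..<length b} \<rightarrow>\<^sub>E carrier F \<and> x = (\<Oplus>\<^bsub>L\<^esub>i\<in>{..<length b}. c i \<odot>\<^bsub>L\<^esub> b ! i)"
  if x: "x \<in> carrier L" for x
 proof -
  obtain c where c: "x = lc b c" using b x by blast
  show ?thesis
  proof (rule ex1I[of _ "restrict (\<lambda>i. h (c i)) {..<length b}"])
   show "restrict (\<lambda>i. h (c i)) {..<length b} \<in> {..<length b} \<rightarrow>\<^sub>E carrier F \<and>
    x = (\<Oplus>\<^bsub>L\<^esub>i\<in>{..<length b}. restrict (\<lambda>i. h (c i)) {..<length b} i \<odot>\<^bsub>L\<^esub> b ! i)"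
    using lc_restrict[OF cl, of c] c by auto
   fix d assume d: "d \<in> {..<length b} \<rightarrow>\<^sub>E carrier F \<and> x = (\<Oplus>\<^bsub>L\<^esub>i\<in>{..<length b}. d i \<odot>\<^bsub>L\<^esub> b ! i)"
   have "\<forall>i. \<exists>y. i < length b --> d i = h y" using h_surj PiE_mem[OF conjunct1[OF d]] by (metis lessThan_iff)
   then obtain d' where d': "\<And>i. i < length b ==> d i = h (d' i)" by metis
   have "(\<Oplus>\<^bsub>L\<^esub>i\<in>{..<length b}. d i \<odot>\<^bsub>L\<^esub> b ! i) = lc b d'" unfolding lc_def
    using cl d' by (intro L.finsum_cong') (auto simp: subset_iff)
   then have "lc b d' = lc b c" using conjunct2[OF d] c by (simp only:)
   then have "\<And>i. i < length b ==> d' i = c i" using b by blast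
   then show "d = restrict (\<lambda>i. h (c i)) {..<length b}"
    using d d' by (intro PiE_ext[of _ "{..<length b}" "\<lambda>_. carrier F"]) auto
  qed
 qed
 then show "alg_basis F L b" unfolding alg_basis_def using cl by (intro conjI ballI)
qed

lemma lc_crd: "alg_basis F L b ==> x \<in> carrier L ==> lc b (crd b x) = x"
 unfolding crd_def alg_basis_iff by (metis (mono_tags) someI_ex)

lemma lc_inj: "alg_basis F L b ==> lc b c = lc b d ==> i < length b ==> c i = d i"
 unfolding alg_basis_iff by blast

lemma crd_lc: "alg_basis F L b ==> i < length b ==> crd b (lc b c) i = c i"
 using lc_inj lc_crd lc_closed basis_closed by metis

lemma coords_crd:
 assumes b: "alg_basis F L b" and x: "x \<in> carrier L" and i: "i < length b"
 shows "coords F L b x i = h (crd b x i)"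
proof -
 define Q where "Q c \<longleftrightarrow> c \<in> {..<length b} \<rightarrow>\<^sub>E carrier F \<and> x = (\<Oplus>\<^bsub>L\<^esub>i\<in>{..<length b}. c i \<odot>\<^bsub>L\<^esub> b ! i)" for c
 have ex1: "\<exists>!c. Q c" unfolding Q_def by (rule bspec[OF b[unfolded alg_basis_def, THEN conjunct2] x])
 have "Q (restrict (\<lambda>i. h (crd b x i)) {..<length b})"
  unfolding Q_def using lc_restrict[OF basis_closed[OF b], of "crd b x"] lc_crd[OF b x] by simp
 then have "(THE c. Q c) = restrict (\<lambda>i. h (crd b x i)) {..<length b}"
  using theI'[OF ex1] ex1 by blast
 then have "coords F L b x = restrict (\<lambda>i. h (crd b x i)) {..<length b}"
  unfolding coords_def Q_def .
 then show ?thesis using i by simp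
qed

lemma lc_add: "set b \<subseteq> carrier L ==> lc b c \<oplus>\<^bsub>L\<^esub> lc b d = lc b (\<lambda>i. c i + d i)"
proof -
 assume b: "set b \<subseteq> carrier L"
 have "lc b (\<lambda>i. c i + d i) = (\<Oplus>\<^bsub>L\<^esub>i\<in>{..<length b}. h (c i) \<odot>\<^bsub>L\<^esub> b ! i \<oplus>\<^bsub>L\<^esub> h (d i) \<odot>\<^bsub>L\<^esub> b ! i)"
  unfolding lc_def using b by (intro L.finsum_cong') (auto simp: subset_iff h_add A.smult_l_distr)
 then show ?thesis unfolding lc_def using b by (subst (asm) L.finsum_addf) (auto simp: subset_iff)
qed

lemma lc_smult: "set b \<subseteq> carrier L ==> h s \<odot>\<^bsub>L\<^esub> lc b c = lc b (\<lambda>i. s * c i)"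
 unfolding lc_def
 by (subst A.finsum_smult_ldistr) (auto simp: subset_iff h_mult A.smult_assoc1 intro!: L.finsum_cong')

lemma lc_zero: "set b \<subseteq> carrier L ==> lc b (\<lambda>i. 0) = \<zero>\<^bsub>L\<^esub>"
 using lc_smult[of b 0 "\<lambda>_. 0"] lc_closed[of b "\<lambda>_. 0"] by (simp add: h_zero)

lemma crd_eqI: "alg_basis F L b ==> x = lc b c ==> i < length b ==> crd b x i = c i"
 using crd_lc by blast

lemma crd_add:
 assumes "alg_basis F L b" "x \<in> carrier L" "y \<in> carrier L" "i < length b"
 shows "crd b (x \<oplus>\<^bsub>L\<^esub> y) i = crd b x i + crd b y i"
 by (rule crd_eqI[OF assms(1) _ assms(4)])
  (use lc_add[OF basis_closed[OF assms(1)], of "crd b x" "crd b y"] lc_crd assms in simp)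

lemma crd_smult:
 assumes "alg_basis F L b" "x \<in> carrier L" "i < length b"
 shows "crd b (h s \<odot>\<^bsub>L\<^esub> x) i = s * crd b x i"
 by (rule crd_eqI[OF assms(1) _ assms(3)])
  (use lc_smult[OF basis_closed[OF assms(1)], of s "crd b x"] lc_crd assms in simp)

lemma crd_zero: "alg_basis F L b ==> i < length b ==> crd b \<zero>\<^bsub>L\<^esub> i = 0"
 using crd_lc[of b i "\<lambda>_. 0"] lc_zero basis_closed by simp

lemma crd_finsum:
 assumes b: "alg_basis F L b" and i: "i < length b" and J: "finite J" "\<And>j. j \<in> J ==> y j \<in> carrier L"
 shows "crd b (\<Oplus>\<^bsub>L\<^esub>j\<in>J. h (s j) \<odot>\<^bsub>L\<^esub> y j) i = (\<Sum>j\<in>J. s j * crd b (y j) i)"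
 using J
proof (induction J rule: finite_induct)
 case empty
 then show ?case using crd_zero[OF b i] by simp
next
 case (insert x J)
 have cl: "(\<lambda>j. h (s j) \<odot>\<^bsub>L\<^esub> y j) \<in> J \<rightarrow> carrier L" "h (s x) \<odot>\<^bsub>L\<^esub> y x \<in> carrier L"
  using insert.prems by auto
 show ?case
  using insert cl by (simp add: crd_add[OF b cl(2) L.finsum_closed[OF cl(1)] i] crd_smult[OF b _ i])
qed

lemma crd_change:
 assumes b: "alg_basis F L b" and b': "alg_basis F L b'" and x: "x \<in> carrier L" and i: "i < length b'"
 shows "crd b' x i = (\<Sum>j<length b. crd b' (b ! j) i * crd b x j)"
proof -
 have "crd b' (lc b (crd b x)) i = (\<Sum>j<length b. crd b x j * crd b' (b ! j) i)"
  unfolding lc_def by (rule crd_finsum[OF b' i]) (auto intro: basis_nth[OF b])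
 then show ?thesis using lc_crd[OF b x] by (simp add: mult.commute)
qed

lemma crd_nth:
 assumes b: "alg_basis F L b" and "i < length b" "j < length b"
 shows "crd b (b ! j) i = (if i = j then 1 else 0)"
proof (rule crd_eqI[OF b _ assms(2)])
 have "lc b (\<lambda>i. if i = j then 1 else 0) = (\<Oplus>\<^bsub>L\<^esub>i\<in>{..<length b}. if j = i then b ! i else \<zero>\<^bsub>L\<^esub>)"
  unfolding lc_def using basis_nth[OF b] by (intro L.finsum_cong') (auto simp: h_zero h_one)
 also have "\<dots> = b ! j" using assms basis_nth[OF b] by (subst L.finsum_singleton) auto
 finally show "b ! j = lc b (\<lambda>i. if i = j then 1 else 0)" ..
qed

lemma change_inverse:
 assumes b: "alg_basis F L b" and b': "alg_basis F L b'" and "i < length b'" "k < length b'"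
 shows "(\<Sum>j<length b. crd b' (b ! j) i * crd b (b' ! k) j) = (if i = k then 1 else 0)"
 using crd_change[OF b b' basis_nth[OF b' assms(4)] assms(3)] crd_nth[OF b' assms(3,4)] by simp

text \<open>Two bases have equal length because \<open>trace (P * Q) = trace (Q * P)\<close> for the matrices \<open>P\<close>, \<open>Q\<close>
 of the change of basis, and the characteristic is 0.\<close>

lemma basis_length_unique:
 assumes b: "alg_basis F L b" and b': "alg_basis F L b'"
 shows "length b = length b'"
proof -
 have "(of_nat (length b') :: 'k) = (\<Sum>i<length b'. \<Sum>j<length b. crd b' (b ! j) i * crd b (b' ! i) j)"
  using change_inverse[OF b b'] by simp
 also have "\<dots> = (\<Sum>j<length b. \<Sum>i<length b'. crd b (b' ! i) j * crd b' (b ! j) i)"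
  by (subst sum.swap) (simp add: mult.commute)
 also have "\<dots> = of_nat (length b)" using change_inverse[OF b' b] by simp
 finally show ?thesis by simp
qed

lemma degree_over_eq: "alg_basis F L b ==> degree_over F L = length b"
 unfolding degree_over_def by (rule the_equality) (blast dest: basis_length_unique)+

lemma some_basis: "alg_basis F L b ==> alg_basis F L (some_basis F L)"
 unfolding some_basis_def by (rule someI[where P = "alg_basis F L"])

lemma crd_mult_lc:
 assumes b: "alg_basis F L b" and x: "x \<in> carrier L" and y: "y \<in> carrier L" and i: "i < length b"
 shows "crd b (x \<otimes>\<^bsub>L\<^esub> y) i = (\<Sum>l<length b. crd b (x \<otimes>\<^bsub>L\<^esub> b ! l) i * crd b y l)"
proof -
 have "x \<otimes>\<^bsub>L\<^esub> y = x \<otimes>\<^bsub>L\<^esub> lc b (crd b y)" using lc_crd[OF b y] by simp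
 also have "\<dots> = (\<Oplus>\<^bsub>L\<^esub>l\<in>{..<length b}. h (crd b y l) \<odot>\<^bsub>L\<^esub> (x \<otimes>\<^bsub>L\<^esub> b ! l))"
  unfolding lc_def using x basis_nth[OF b]
  by (subst L.finsum_rdistr) (auto simp: L.m_comm[of x] A.smult_assoc2 intro!: L.finsum_cong')
 also have "crd b \<dots> i = (\<Sum>l<length b. crd b y l * crd b (x \<otimes>\<^bsub>L\<^esub> b ! l) i)"
  by (rule crd_finsum[OF b i]) (auto intro: x basis_nth[OF b])
 finally show ?thesis by (simp add: mult.commute)
qed

definition tr :: "'b list => 'b => 'k" where
 "tr b x = (\<Sum>i<length b. crd b (x \<otimes>\<^bsub>L\<^esub> b ! i) i)"

definition nm :: "'b list => 'b => 'k" where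
 "nm b x = det (mat (length b) (length b) (\<lambda>(i, j). crd b (x \<otimes>\<^bsub>L\<^esub> b ! j) i))"

lemma crd_conjugate:
 assumes b: "alg_basis F L b" and b': "alg_basis F L b'" and x: "x \<in> carrier L"
  and i: "i < length b'" and k: "k < length b'"
 shows "crd b' (x \<otimes>\<^bsub>L\<^esub> b' ! k) i =
  (\<Sum>j<length b. crd b' (b ! j) i * (\<Sum>l<length b. crd b (x \<otimes>\<^bsub>L\<^esub> b ! l) j * crd b (b' ! k) l))"
 using crd_change[OF b b' _ i, of "x \<otimes>\<^bsub>L\<^esub> b' ! k"] crd_mult_lc[OF b x basis_nth[OF b' k]] x basis_nth[OF b' k]
 by simp

lemma tr_unique:
 assumes b: "alg_basis F L b" and b': "alg_basis F L b'" and x: "x \<in> carrier L"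
 shows "tr b' x = tr b x"
proof -
 let ?n = "length b" and ?n' = "length b'"
 let ?P = "\<lambda>i j. crd b' (b ! j) i" and ?Q = "\<lambda>l i. crd b (b' ! i) l" and ?M = "\<lambda>j l. crd b (x \<otimes>\<^bsub>L\<^esub> b ! l) j"
 have "tr b' x = (\<Sum>i<?n'. \<Sum>j<?n. \<Sum>l<?n. ?M j l * (?Q l i * ?P i j))"
  unfolding tr_def by (simp add: crd_conjugate[OF b b' x] sum_distrib_left ac_simps)
 also have "\<dots> = (\<Sum>j<?n. \<Sum>i<?n'. \<Sum>l<?n. ?M j l * (?Q l i * ?P i j))" by (rule sum.swap)
 also have "\<dots> = (\<Sum>j<?n. \<Sum>l<?n. \<Sum>i<?n'. ?M j l * (?Q l i * ?P i j))"
  by (intro sum.cong refl sum.swap)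
 also have "\<dots> = (\<Sum>j<?n. \<Sum>l<?n. ?M j l * (if l = j then 1 else 0))"
  using change_inverse[OF b' b] by (simp add: sum_distrib_left[symmetric])
 also have "\<dots> = (\<Sum>j<?n. \<Sum>l<?n. if j = l then ?M j l else 0)"
  by (intro sum.cong) auto
 also have "\<dots> = (\<Sum>j<?n. ?M j j)" by simp
 finally show ?thesis by (simp add: tr_def)
qed

lemma nm_unique:
 assumes b: "alg_basis F L b" and b': "alg_basis F L b'" and x: "x \<in> carrier L"
 shows "nm b' x = nm b x"
proof -
 define n where "n = length b"
 have n: "length b = n" "length b' = n" using basis_length_unique[OF b b'] by (simp_all add: n_def)
 define P where "P = mat n n (\<lambda>(i, j). crd b' (b ! j) i)"
 define Q where "Q = mat n n (\<lambda>(l, k). crd b (b' ! k) l)"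
 define M where "M = mat n n (\<lambda>(j, l). crd b (x \<otimes>\<^bsub>L\<^esub> b ! l) j)"
 define M' where "M' = mat n n (\<lambda>(j, l). crd b' (x \<otimes>\<^bsub>L\<^esub> b' ! l) j)"
 have car: "P \<in> carrier_mat n n" "Q \<in> carrier_mat n n" "M \<in> carrier_mat n n" by (simp_all add: P_def Q_def M_def)
 have "M' = P * (M * Q)"
  by (rule eq_matI) (auto simp: M'_def P_def M_def Q_def scalar_prod_def n lessThan_atLeast0
    crd_conjugate[OF b b' x, unfolded n] intro!: sum.cong)
 then have "det M' = det P * (det M * det Q)" using car by (simp add: det_mult[of _ n])
 moreover have "P * Q = 1\<^sub>m n"
  using change_inverse[OF b b'] n
  by (intro eq_matI) (auto simp: P_def Q_def scalar_prod_def lessThan_atLeast0)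
 then have "det P * det Q = 1" using det_mult[OF car(1,2)] by simp
 ultimately have "det M' = det M" by (simp add: mult.left_commute)
 then show ?thesis by (simp add: nm_def M_def M'_def n)
qed

lemma mult_matrix_h:
 assumes "alg_basis F L b" "x \<in> carrier L" "i < length b" "j < length b"
 shows "mult_matrix F L x i j = h (crd (some_basis F L) (x \<otimes>\<^bsub>L\<^esub> some_basis F L ! j) i)"
 using some_basis[OF assms(1)] basis_length_unique[OF assms(1) some_basis[OF assms(1)]] assms
 by (simp add: mult_matrix_def coords_crd basis_nth)

lemma alg_trace_eq:
 assumes b: "alg_basis F L b" and x: "x \<in> carrier L"
 shows "alg_trace F L x = h (tr b x)"
proof -
 have len: "length (some_basis F L) = length b" using basis_length_unique[OF b some_basis[OF b]] by simp
 have "alg_trace F L x = (\<Oplus>\<^bsub>F\<^esub>i\<in>{..<length b}. h (crd (some_basis F L) (x \<otimes>\<^bsub>L\<^esub> some_basis F L ! i) i))"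
  unfolding alg_trace_def degree_over_eq[OF b]
  by (rule F.finsum_cong') (auto simp: mult_matrix_h[OF b x])
 also have "\<dots> = h (tr (some_basis F L) x)" by (simp add: tr_def len h_sum)
 finally show ?thesis using tr_unique[OF b some_basis[OF b] x] by simp
qed

lemma alg_norm_eq:
 assumes b: "alg_basis F L b" and x: "x \<in> carrier L"
 shows "alg_norm F L x = h (nm b x)"
proof -
 have len: "length (some_basis F L) = length b" using basis_length_unique[OF b some_basis[OF b]] by simp
 have "alg_norm F L x = h (nm (some_basis F L) x)"
  unfolding alg_norm_def degree_over_eq[OF b] nm_def len
  by (rule ring_det_h) (rule mult_matrix_h[OF b x])
 then show ?thesis using nm_unique[OF b some_basis[OF b] x] by simp
qed

lemma tr_finsum:
 assumes b: "alg_basis F L b" and J: "finite J" "\<And>j. j \<in> J ==> y j \<in> carrier L"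
 shows "tr b (\<Oplus>\<^bsub>L\<^esub>j\<in>J. h (s j) \<odot>\<^bsub>L\<^esub> y j) = (\<Sum>j\<in>J. s j * tr b (y j))"
proof -
 have "crd b ((\<Oplus>\<^bsub>L\<^esub>j\<in>J. h (s j) \<odot>\<^bsub>L\<^esub> y j) \<otimes>\<^bsub>L\<^esub> b ! i) i = (\<Sum>j\<in>J. s j * crd b (y j \<otimes>\<^bsub>L\<^esub> b ! i) i)"
  if i: "i < length b" for i
 proof -
  have "(\<Oplus>\<^bsub>L\<^esub>j\<in>J. h (s j) \<odot>\<^bsub>L\<^esub> y j) \<otimes>\<^bsub>L\<^esub> b ! i = (\<Oplus>\<^bsub>L\<^esub>j\<in>J. h (s j) \<odot>\<^bsub>L\<^esub> (y j \<otimes>\<^bsub>L\<^esub> b ! i))"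
   using J basis_nth[OF b i]
   by (subst L.finsum_ldistr) (auto simp: A.smult_assoc2 intro!: L.finsum_cong')
  also have "crd b \<dots> i = (\<Sum>j\<in>J. s j * crd b (y j \<otimes>\<^bsub>L\<^esub> b ! i) i)"
   using J basis_nth[OF b i] by (intro crd_finsum[OF b i]) auto
  finally show ?thesis .
 qed
 then show ?thesis unfolding tr_def by (simp add: sum_distrib_left) (rule sum.swap)
qed

text \<open>If \<open>C\<close> holds the coordinates of the tuple and \<open>T\<close> the trace
  form in the basis, the trace matrix of the tuple is \<open>C * T\<close> times the transpose of
  \<open>C\<close>, whence the square of \<open>det C\<close>.\<close>

lemma gram_det:
 assumes b: "alg_basis F L b" and w: "\<And>i. i < length b ==> w i \<in> carrier L"
 shows "ring_det F (length b) (\<lambda>i j. alg_trace F L (w i \<otimes>\<^bsub>L\<^esub> w j)) =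
  h ((det (mat (length b) (length b) (\<lambda>(i, k). crd b (w i) k)))\<^sup>2 *
    det (mat (length b) (length b) (\<lambda>(i, j). tr b (b ! i \<otimes>\<^bsub>L\<^esub> b ! j))))"
proof -
 define n where "n = length b"
 define C where "C = mat n n (\<lambda>(i, k). crd b (w i) k)"
 define T where "T = mat n n (\<lambda>(i, j). tr b (b ! i \<otimes>\<^bsub>L\<^esub> b ! j))"
 define W where "W = mat n n (\<lambda>(i, j). tr b (w i \<otimes>\<^bsub>L\<^esub> w j))"
 have car: "C \<in> carrier_mat n n" "T \<in> carrier_mat n n" "C\<^sup>T \<in> carrier_mat n n" by (simp_all add: C_def T_def)
 have tr2: "tr b (x \<otimes>\<^bsub>L\<^esub> y) = (\<Sum>k<n. crd b x k * tr b (b ! k \<otimes>\<^bsub>L\<^esub> y))"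
  if x: "x \<in> carrier L" and y: "y \<in> carrier L" for x y
 proof -
  have "x \<otimes>\<^bsub>L\<^esub> y = lc b (crd b x) \<otimes>\<^bsub>L\<^esub> y" using lc_crd[OF b x] by simp
  also have "\<dots> = (\<Oplus>\<^bsub>L\<^esub>k\<in>{..<n}. h (crd b x k) \<odot>\<^bsub>L\<^esub> (b ! k \<otimes>\<^bsub>L\<^esub> y))"
   unfolding lc_def n_def using y basis_nth[OF b]
   by (subst L.finsum_ldistr) (auto simp: A.smult_assoc2 intro!: L.finsum_cong')
  also have "tr b \<dots> = (\<Sum>k<n. crd b x k * tr b (b ! k \<otimes>\<^bsub>L\<^esub> y))"
   using y basis_nth[OF b] by (intro tr_finsum[OF b]) (auto simp: n_def)
  finally show ?thesis .
 qed
 have "W = C * (T * C\<^sup>T)"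
 proof (rule eq_matI)
  fix i j assume "i < dim_row (C * (T * C\<^sup>T))" "j < dim_col (C * (T * C\<^sup>T))"
  then have ij: "i < n" "j < n" by (simp_all add: C_def)
  have wi: "w i \<in> carrier L" "w j \<in> carrier L" using w ij by (simp_all add: n_def)
  have "W $$ (i, j) = (\<Sum>k<n. crd b (w i) k * tr b (w j \<otimes>\<^bsub>L\<^esub> b ! k))"
   using ij wi tr2[OF wi] basis_nth[OF b] by (simp add: W_def n_def L.m_comm)
  also have "\<dots> = (\<Sum>k<n. crd b (w i) k * (\<Sum>l<n. crd b (w j) l * tr b (b ! l \<otimes>\<^bsub>L\<^esub> b ! k)))"
   using wi basis_nth[OF b] by (intro sum.cong refl) (simp add: tr2 n_def)
  also have "\<dots> = (\<Sum>k<n. crd b (w i) k * (\<Sum>l<n. tr b (b ! k \<otimes>\<^bsub>L\<^esub> b ! l) * crd b (w j) l))"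
  proof -
   have "tr b (b ! l \<otimes>\<^bsub>L\<^esub> b ! k) = tr b (b ! k \<otimes>\<^bsub>L\<^esub> b ! l)" if "k < n" "l < n" for k l
    using that basis_nth[OF b] by (simp add: n_def L.m_comm[of "b ! l" "b ! k"])
   then show ?thesis by (auto intro!: sum.cong simp: mult.commute[of "crd b (w j) _"])
  qed
  also have "\<dots> = (C * (T * C\<^sup>T)) $$ (i, j)"
   using ij by (simp add: C_def T_def scalar_prod_def lessThan_atLeast0)
  finally show "W $$ (i, j) = (C * (T * C\<^sup>T)) $$ (i, j)" .
 qed (simp_all add: W_def C_def T_def)
 then have "det W = (det C)\<^sup>2 * det T"
  using car det_mult[of C n "T * C\<^sup>T"] det_mult[of T n "C\<^sup>T"] det_transpose[OF car(1)]
  by (simp add: power2_eq_square ac_simps)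
 moreover have "ring_det F n (\<lambda>i j. alg_trace F L (w i \<otimes>\<^bsub>L\<^esub> w j)) = h (det W)"
  unfolding W_def using w by (intro ring_det_h) (simp add: alg_trace_eq[OF b] n_def)
 ultimately show ?thesis by (simp add: C_def T_def n_def)
qed

end

section \<open>Discrete valuation rings given by a valuation\<close>

text \<open>Evaluates the abstract notions of maximal ideal, uniformizer and valuation of a ring
  \<open>B\<close> once some valuation with that ring is at hand. It serves both for
  \<open>F\<close> and for its quadratic extensions.\<close>

locale valued_field = K: field K for K :: "('b, 'm) ring_scheme" (structure) +
 fixes val :: "'b => int" and B :: "'b set"
 assumes val_mult: "\<lbrakk>x \<in> carrier K; y \<in> carrier K; x \<noteq> \<zero>; y \<noteq> \<zero>\<rbrakk> \<Longrightarrow> val (x \<otimes> y) = val x + val y"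
  and val_one_ex: "\<exists>p\<in>carrier K. p \<noteq> \<zero> \<and> val p = 1"
  and B_eq: "B = {x \<in> carrier K. x = \<zero> \<or> 0 \<le> val x}"
begin

lemma val_one: "val \<one> = 0"
 using val_mult[of \<one> \<one>] by simp

lemma inv_nz: "x \<in> carrier K ==> x \<noteq> \<zero> ==> inv x \<in> carrier K \<and> inv x \<noteq> \<zero> \<and> x \<otimes> inv x = \<one> \<and> inv x \<otimes> x = \<one>"
proof -
 assume x: "x \<in> carrier K" "x \<noteq> \<zero>"
 then have "x \<in> Units K" using K.field_Units by simp
 then have i: "inv x \<in> carrier K" "x \<otimes> inv x = \<one>" "inv x \<otimes> x = \<one>" by simp_all
 moreover have "inv x \<noteq> \<zero>" using i x by auto
 ultimately show ?thesis by blast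
qed

lemma val_inv: "x \<in> carrier K ==> x \<noteq> \<zero> ==> val (inv x) = - val x"
 using val_mult[of x "inv x"] inv_nz[of x] val_one by simp

lemma mult_nz: "x \<in> carrier K ==> y \<in> carrier K ==> x \<noteq> \<zero> ==> y \<noteq> \<zero> ==> x \<otimes> y \<noteq> \<zero>"
 using K.integral by blast

lemma val_nat_pow: "x \<in> carrier K ==> x \<noteq> \<zero> ==> x [^] (n::nat) \<noteq> \<zero> \<and> val (x [^] n) = int n * val x"
 by (induction n) (auto simp: val_one val_mult algebra_simps dest: K.integral)

lemma val_int_pow:
 "x \<in> carrier K ==> x \<noteq> \<zero> ==> x [^] (n::int) \<in> carrier K \<and> x [^] n \<noteq> \<zero> \<and> val (x [^] n) = n * val x"
proof -
 assume x: "x \<in> carrier K" "x \<noteq> \<zero>"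
 show ?thesis
 proof (cases "n < 0")
  case True
  define m where "m = nat (- n)"
  have m: "n = - int m" "m > 0" using True by (simp_all add: m_def)
  define y where "y = x [^] m"
  have y: "y \<in> carrier K" "y \<noteq> \<zero>" "val y = - n * val x"
   using val_nat_pow[OF x, of m] x by (simp_all add: y_def m)
  have "x [^] n = inv y" unfolding m(1) using m(2) by (subst int_pow_def2) (simp add: y_def)
  then show ?thesis using inv_nz[OF y(1,2)] val_inv[OF y(1,2)] y(3) by simp
 next
  case False
  define m where "m = nat n"
  have m: "n = int m" using False by (simp add: m_def)
  have "x [^] n = x [^] m" unfolding m by (subst int_pow_def2) simp
  then show ?thesis using val_nat_pow[OF x, of m] x m by simp
 qed
qed

lemma Units_B: "Units (K\<lparr>carrier := B\<rparr>) = {x \<in> carrier K. x \<noteq> \<zero> \<and> val x = 0}"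
proof (intro equalityI subsetI)
 fix x assume "x \<in> Units (K\<lparr>carrier := B\<rparr>)"
 then obtain y where xy: "x \<in> B" "y \<in> B" "x \<otimes> y = \<one>" by (auto simp: Units_def)
 then have nz: "x \<noteq> \<zero>" "y \<noteq> \<zero>" "x \<in> carrier K" "y \<in> carrier K" by (auto simp: B_eq)
 then have "val x + val y = 0" using val_mult[of x y] xy(3) val_one by simp
 then show "x \<in> {x \<in> carrier K. x \<noteq> \<zero> \<and> val x = 0}" using nz xy by (auto simp: B_eq)
next
 fix x assume "x \<in> {x \<in> carrier K. x \<noteq> \<zero> \<and> val x = 0}"
 then have x: "x \<in> carrier K" "x \<noteq> \<zero>" "val x = 0" by auto
 have "inv x \<in> B" "x \<in> B" using x inv_nz val_inv by (auto simp: B_eq)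
 then show "x \<in> Units (K\<lparr>carrier := B\<rparr>)" using inv_nz[OF x(1,2)] by (auto simp: Units_def)
qed

lemma max_ideal_eq: "max_ideal K B = {x \<in> carrier K. x = \<zero> \<or> 1 \<le> val x}"
 unfolding max_ideal_def Units_B by (auto simp: B_eq)

lemma uniformizer_iff: "uniformizer K B p \<longleftrightarrow> p \<in> carrier K \<and> p \<noteq> \<zero> \<and> val p = 1"
proof -
 have pidl: "PIdl\<^bsub>K\<lparr>carrier := B\<rparr>\<^esub> p = {x \<otimes> p | x. x \<in> B}" for p
  by (auto simp: cgenideal_def)
 show ?thesis
 proof
  assume u: "uniformizer K B p"
  then have p: "p \<in> carrier K" and eq: "{x \<otimes> p | x. x \<in> B} = {x \<in> carrier K. x = \<zero> \<or> 1 \<le> val x}"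
   unfolding uniformizer_def pidl max_ideal_eq by (auto simp: B_eq)
  obtain t where t: "t \<in> carrier K" "t \<noteq> \<zero>" "val t = 1" using val_one_ex by blast
  then have "t \<in> {x \<otimes> p | x. x \<in> B}" unfolding eq by simp
  then obtain x where x: "x \<in> B" "t = x \<otimes> p" by blast
  have nz: "p \<noteq> \<zero>" "x \<noteq> \<zero>" "x \<in> carrier K" using x t p by (auto simp: B_eq)
  then have "1 = val x + val p" using val_mult[OF nz(3) p nz(2,1)] x t by simp
  then have "val p \<le> 1" using x nz by (auto simp: B_eq)
  moreover have "\<one> \<otimes> p \<in> {x \<otimes> p | x. x \<in> B}" using val_one by (auto simp: B_eq)
  then have "1 \<le> val p" unfolding eq using nz p by simp
  ultimately show "p \<in> carrier K \<and> p \<noteq> \<zero> \<and> val p = 1" using p nz by simp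
 next
  assume p: "p \<in> carrier K \<and> p \<noteq> \<zero> \<and> val p = 1"
  have "{x \<otimes> p | x. x \<in> B} = {x \<in> carrier K. x = \<zero> \<or> 1 \<le> val x}"
  proof (intro equalityI subsetI)
   fix y assume "y \<in> {x \<otimes> p | x. x \<in> B}"
   then obtain x where "x \<in> B" "y = x \<otimes> p" by blast
   then show "y \<in> {x \<in> carrier K. x = \<zero> \<or> 1 \<le> val x}"
    using p val_mult[of x p] by (cases "x = \<zero>") (auto simp: B_eq)
  next
   fix y assume "y \<in> {x \<in> carrier K. x = \<zero> \<or> 1 \<le> val x}"
   then have y: "y \<in> carrier K" "y = \<zero> \<or> 1 \<le> val y" by auto
   have ip: "inv p \<in> carrier K" "inv p \<otimes> p = \<one>" "inv p \<noteq> \<zero>" "val (inv p) = - 1"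
    using p inv_nz val_inv by auto
   have "y \<otimes> inv p \<in> B" using y ip val_mult[of y "inv p"] by (cases "y = \<zero>") (auto simp: B_eq)
   moreover have "y = (y \<otimes> inv p) \<otimes> p" using y ip p by (simp add: K.m_assoc)
   ultimately show "y \<in> {x \<otimes> p | x. x \<in> B}" by blast
  qed
  then show "uniformizer K B p" using p unfolding uniformizer_def pidl max_ideal_eq by (auto simp: B_eq)
 qed
qed

lemma dvr_val_eq:
 assumes x: "x \<in> carrier K" "x \<noteq> \<zero>"
 shows "dvr_val K B x = val x"
 unfolding dvr_val_def uniformizer_iff Units_B
proof (rule the_equality)
 obtain p where p: "p \<in> carrier K" "p \<noteq> \<zero>" "val p = 1" using val_one_ex by blast
 let ?y = "p [^] (val x)"
 have y: "?y \<in> carrier K" "?y \<noteq> \<zero>" "val ?y = val x" using val_int_pow[OF p(1,2), of "val x"] p by auto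
 have i: "inv ?y \<in> carrier K" "inv ?y \<noteq> \<zero>" "?y \<otimes> inv ?y = \<one>" "val (inv ?y) = - val x"
  using inv_nz val_inv y by auto
 have "x = ?y \<otimes> (inv ?y \<otimes> x)" using i x y by (simp add: K.m_assoc[symmetric])
 moreover have "inv ?y \<otimes> x \<noteq> \<zero>" "val (inv ?y \<otimes> x) = 0" using mult_nz val_mult i x by auto
 ultimately show "\<exists>\<pi> u. (\<pi> \<in> carrier K \<and> \<pi> \<noteq> \<zero> \<and> val \<pi> = 1) \<and>
   u \<in> {x \<in> carrier K. x \<noteq> \<zero> \<and> val x = 0} \<and> x = \<pi> [^] val x \<otimes> u"
  using p i x by (intro exI[of _ p] exI[of _ "inv ?y \<otimes> x"]) auto
next
 fix n :: int
 assume "\<exists>\<pi> u. (\<pi> \<in> carrier K \<and> \<pi> \<noteq> \<zero> \<and> val \<pi> = 1) \<and>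
   u \<in> {x \<in> carrier K. x \<noteq> \<zero> \<and> val x = 0} \<and> x = \<pi> [^] n \<otimes> u"
 then obtain p u where pu: "p \<in> carrier K" "p \<noteq> \<zero>" "val p = 1" "u \<in> carrier K" "u \<noteq> \<zero>" "val u = 0" "x = p [^] n \<otimes> u"
  by blast
 then show "n = val x" using val_int_pow[of p n] val_mult[of "p [^] n" u] by simp
qed

end

section \<open>Homomorphisms and products of algebras\<close>

lemma alg_isoD:
 assumes "f \<in> alg_iso F L M"
 shows "f \<in> ring_iso L M" "f \<in> Ring.ring_hom L M" "bij_betw f (carrier L) (carrier M)"
  "\<And>a x. a \<in> carrier F ==> x \<in> carrier L ==> f (a \<odot>\<^bsub>L\<^esub> x) = a \<odot>\<^bsub>M\<^esub> f x"
 using assms by (auto simp: alg_iso_def ring_iso_def)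

lemma alg_isoI:
 assumes "f \<in> Ring.ring_hom L M" "bij_betw f (carrier L) (carrier M)"
  "\<And>a x. a \<in> carrier F ==> x \<in> carrier L ==> f (a \<odot>\<^bsub>L\<^esub> x) = a \<odot>\<^bsub>M\<^esub> f x"
 shows "f \<in> alg_iso F L M"
 using assms by (auto simp: alg_iso_def ring_iso_def)

lemma alg_iso_inv:
 assumes L: "algebra F L" and f: "f \<in> alg_iso F L M"
 shows "inv_into (carrier L) f \<in> alg_iso F M L"
proof -
 interpret L: cring L by (rule algebra.M_cring[OF L])
 interpret A: algebra F L by (rule L)
 note fD = alg_isoD[OF f]
 have "inv_into (carrier L) f \<in> ring_iso M L" by (rule ring_iso_set_sym[OF L.ring_axioms fD(1)])
 moreover have "inv_into (carrier L) f (a \<odot>\<^bsub>M\<^esub> y) = a \<odot>\<^bsub>L\<^esub> inv_into (carrier L) f y"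
  if a: "a \<in> carrier F" and y: "y \<in> carrier M" for a y
 proof -
  have img: "f ` carrier L = carrier M" and inj: "inj_on f (carrier L)"
   using fD(3) by (auto simp: bij_betw_def)
  obtain x where x: "x \<in> carrier L" "y = f x" using y img by blast
  have "a \<odot>\<^bsub>M\<^esub> y = f (a \<odot>\<^bsub>L\<^esub> x)" using fD(4)[OF a x(1)] x by simp
  then show ?thesis using inj x a by simp
 qed
 ultimately show ?thesis by (simp add: alg_iso_def)
qed

lemma alg_iso_comp: "f \<in> alg_iso F L M ==> g \<in> alg_iso F M N ==> g \<circ> f \<in> alg_iso F L N"
proof -
 assume f: "f \<in> alg_iso F L M" and g: "g \<in> alg_iso F M N"
 have "g \<circ> f \<in> ring_iso L N" by (rule ring_iso_set_trans[OF alg_isoD(1)[OF f] alg_isoD(1)[OF g]])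
 moreover have "(g \<circ> f) (a \<odot>\<^bsub>L\<^esub> x) = a \<odot>\<^bsub>N\<^esub> (g \<circ> f) x" if "a \<in> carrier F" "x \<in> carrier L" for a x
  using that alg_isoD(4)[OF f] alg_isoD(4)[OF g] ring_hom_closed[OF alg_isoD(2)[OF f]] by simp
 ultimately show ?thesis by (simp add: alg_iso_def)
qed

lemma alg_isomorphic_sym: "algebra F L ==> alg_isomorphic F L M ==> alg_isomorphic F M L"
 using alg_iso_inv by (fastforce simp: alg_isomorphic_def)

lemma alg_isomorphic_trans: "alg_isomorphic F L M ==> alg_isomorphic F M N ==> alg_isomorphic F L N"
 using alg_iso_comp by (fastforce simp: alg_isomorphic_def)

lemma integral_over_hom:
 assumes L: "algebra F L" and M: "algebra F M" and f: "f \<in> Ring.ring_hom L M"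
  and sm: "\<And>a x. a \<in> carrier F ==> x \<in> carrier L ==> f (a \<odot>\<^bsub>L\<^esub> x) = a \<odot>\<^bsub>M\<^esub> f x"
  and A: "A \<subseteq> carrier F" and x: "x \<in> carrier L" and int: "integral_over A L x"
 shows "integral_over A M (f x)"
proof -
 interpret L: cring L by (rule algebra.M_cring[OF L])
 interpret A: algebra F L by (rule L)
 interpret M: cring M by (rule algebra.M_cring[OF M])
 interpret B: algebra F M by (rule M)
 interpret H: ring_hom_cring L M f by unfold_locales (rule f)
 obtain n :: nat and c where c: "c \<in> {..<n} \<rightarrow> A"
  "x [^]\<^bsub>L\<^esub> n \<oplus>\<^bsub>L\<^esub> (\<Oplus>\<^bsub>L\<^esub>i\<in>{..<n}. c i \<odot>\<^bsub>L\<^esub> (x [^]\<^bsub>L\<^esub> i)) = \<zero>\<^bsub>L\<^esub>"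
  using int by (auto simp: integral_over_def)
 have cF: "c i \<in> carrier F" if "i < n" for i using c(1) A that by auto
 have pow: "f (x [^]\<^bsub>L\<^esub> i) = f x [^]\<^bsub>M\<^esub> i" for i :: nat
  by (induction i) (use x in auto)
 have cl: "(\<lambda>i. c i \<odot>\<^bsub>L\<^esub> (x [^]\<^bsub>L\<^esub> i)) \<in> {..<n} \<rightarrow> carrier L" using cF x by auto
 have "f (\<Oplus>\<^bsub>L\<^esub>i\<in>{..<n}. c i \<odot>\<^bsub>L\<^esub> (x [^]\<^bsub>L\<^esub> i)) = (\<Oplus>\<^bsub>M\<^esub>i\<in>{..<n}. c i \<odot>\<^bsub>M\<^esub> (f x [^]\<^bsub>M\<^esub> i))"
  unfolding H.hom_finsum[OF cl] using cF x by (intro M.finsum_cong') (auto simp: sm pow)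
 then have "f x [^]\<^bsub>M\<^esub> n \<oplus>\<^bsub>M\<^esub> (\<Oplus>\<^bsub>M\<^esub>i\<in>{..<n}. c i \<odot>\<^bsub>M\<^esub> (f x [^]\<^bsub>M\<^esub> i)) = f \<zero>\<^bsub>L\<^esub>"
  unfolding c(2)[symmetric] using x L.finsum_closed[OF cl] by (simp add: pow del: H.hom_finsum)
 then show ?thesis using c(1) unfolding integral_over_def by auto
qed

lemma integral_closure_iso:
 assumes L: "algebra F L" and M: "algebra F M" and f: "f \<in> alg_iso F L M" and A: "A \<subseteq> carrier F"
 shows "integral_closure A M = f ` integral_closure A L"
proof (intro equalityI subsetI)
 note fD = alg_isoD[OF f]
 note gD = alg_isoD[OF alg_iso_inv[OF L f]]
 fix y assume "y \<in> integral_closure A M"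
 then have y: "y \<in> carrier M" "integral_over A M y" by (auto simp: integral_closure_def)
 let ?x = "inv_into (carrier L) f y"
 have "integral_over A L ?x" by (rule integral_over_hom[OF M L gD(2,4) A y]) auto
 moreover have "?x \<in> carrier L" "f ?x = y"
  using y(1) fD(3) by (auto simp: bij_betw_def intro: inv_into_into f_inv_into_f)
 ultimately show "y \<in> f ` integral_closure A L" by (force simp: integral_closure_def)
next
 note fD = alg_isoD[OF f]
 fix y assume "y \<in> f ` integral_closure A L"
 then obtain x where x: "x \<in> carrier L" "integral_over A L x" "y = f x" by (auto simp: integral_closure_def)
 then show "y \<in> integral_closure A M"
  using integral_over_hom[OF L M fD(2,4) A x(1,2)] ring_hom_closed[OF fD(2) x(1)] by (auto simp: integral_closure_def)
qed

lemma Units_iso_sub: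
 assumes "algebra F L" "algebra F M" "f \<in> alg_iso F L M"
 shows "f ` Units L \<subseteq> Units M"
proof
 interpret L: cring L by (rule algebra.M_cring[OF assms(1)])
 interpret M: cring M by (rule algebra.M_cring[OF assms(2)])
 interpret H: ring_hom_cring L M f by unfold_locales (rule alg_isoD(2)[OF assms(3)])
 fix y assume "y \<in> f ` Units L"
 then obtain x z where xz: "x \<in> carrier L" "z \<in> carrier L" "z \<otimes>\<^bsub>L\<^esub> x = \<one>\<^bsub>L\<^esub>" "x \<otimes>\<^bsub>L\<^esub> z = \<one>\<^bsub>L\<^esub>" "y = f x"
  by (auto simp: Units_def)
 then have "f z \<otimes>\<^bsub>M\<^esub> f x = \<one>\<^bsub>M\<^esub>" "f x \<otimes>\<^bsub>M\<^esub> f z = \<one>\<^bsub>M\<^esub>"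
  using H.hom_mult[of z x] H.hom_mult[of x z] H.hom_one by auto
 then show "y \<in> Units M" using xz by (auto simp: Units_def)
qed

lemma Units_iso:
 assumes L: "algebra F L" and M: "algebra F M" and f: "f \<in> alg_iso F L M"
 shows "Units M = f ` Units L"
proof -
 have "Units M \<subseteq> f ` Units L"
 proof
  fix y assume y: "y \<in> Units M"
  then have "inv_into (carrier L) f y \<in> Units L" using Units_iso_sub[OF M L alg_iso_inv[OF L f]] by blast
  moreover have "f (inv_into (carrier L) f y) = y"
   using y alg_isoD(3)[OF f] by (intro f_inv_into_f) (auto simp: Units_def bij_betw_def)
  ultimately show "y \<in> f ` Units L" by (metis imageI)
 qed
 with Units_iso_sub[OF L M f] show ?thesis by blast
qed

context typed_algebra
begin

lemma lc_Nil [simp]: "lc [] c = \<zero>\<^bsub>L\<^esub>"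
 by (simp add: lc_def)

lemma lc_Cons:
 assumes "set (p # b) \<subseteq> carrier L"
 shows "lc (p # b) c = h (c 0) \<odot>\<^bsub>L\<^esub> p \<oplus>\<^bsub>L\<^esub> lc b (\<lambda>i. c (Suc i))"
proof -
 have p: "p \<in> carrier L" and b: "\<And>i. i < length b ==> b ! i \<in> carrier L" using assms by (auto simp: subset_iff)
 let ?g = "\<lambda>i. h (c i) \<odot>\<^bsub>L\<^esub> (p # b) ! i"
 have g: "?g \<in> {..<Suc (length b)} \<rightarrow> carrier L" using p b by (auto simp: nth_Cons split: nat.splits)
 have eq: "{..<Suc (length b)} = insert 0 (Suc ` {..<length b})" by (rule lessThan_Suc_eq_insert_0)
 have "lc (p # b) c = (\<Oplus>\<^bsub>L\<^esub>i\<in>insert 0 (Suc ` {..<length b}). ?g i)"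
  unfolding lc_def length_Cons eq ..
 also have "\<dots> = ?g 0 \<oplus>\<^bsub>L\<^esub> (\<Oplus>\<^bsub>L\<^esub>i\<in>Suc ` {..<length b}. ?g i)"
  using g unfolding eq by (intro L.finsum_insert) auto
 also have "(\<Oplus>\<^bsub>L\<^esub>i\<in>Suc ` {..<length b}. ?g i) = (\<Oplus>\<^bsub>L\<^esub>i\<in>{..<length b}. ?g (Suc i))"
  using g unfolding eq by (intro L.finsum_reindex) auto
 finally show ?thesis by (simp add: lc_def)
qed

lemma lc_append:
 "set (b @ b') \<subseteq> carrier L ==> lc (b @ b') c = lc b c \<oplus>\<^bsub>L\<^esub> lc b' (\<lambda>i. c (i + length b))"
proof (induction b arbitrary: c)
 case Nil
 then show ?case using lc_closed[of b'] by simp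
next
 case (Cons p b)
 have cl: "p \<in> carrier L" "set b \<subseteq> carrier L" "set b' \<subseteq> carrier L" using Cons.prems by auto
 have "lc ((p # b) @ b') c = h (c 0) \<odot>\<^bsub>L\<^esub> p \<oplus>\<^bsub>L\<^esub> (lc b (\<lambda>i. c (Suc i)) \<oplus>\<^bsub>L\<^esub> lc b' (\<lambda>i. c (Suc (i + length b))))"
  using Cons.prems Cons.IH[of "\<lambda>i. c (Suc i)"] by (simp add: lc_Cons)
 also have "\<dots> = lc (p # b) c \<oplus>\<^bsub>L\<^esub> lc b' (\<lambda>i. c (i + length (p # b)))"
  using cl by (simp add: lc_Cons L.a_assoc lc_closed)
 finally show ?case .
qed

end

locale typed_hom = L: typed_algebra F h L + M: typed_algebra F h M
 for F :: "('a, 'm) ring_scheme" and h :: "'k::field_char_0 => 'a"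
  and L :: "('a, 'b, 'n) module_scheme" and M :: "('a, 'c, 'l) module_scheme" +
 fixes f :: "'b => 'c"
 assumes f_hom: "f \<in> Ring.ring_hom L M"
  and f_smult: "a \<in> carrier F ==> x \<in> carrier L ==> f (a \<odot>\<^bsub>L\<^esub> x) = a \<odot>\<^bsub>M\<^esub> f x"
begin

lemma f_closed: "x \<in> carrier L ==> f x \<in> carrier M"
 using ring_hom_closed[OF f_hom] by blast

lemma f_lc: "set b \<subseteq> carrier L ==> f (L.lc b c) = M.lc (map f b) c"
proof (induction b arbitrary: c)
 case Nil
 then show ?case using ring_hom_zero[OF f_hom L.L.ring_axioms M.L.ring_axioms] by simp
next
 case (Cons p b)
 then have "set (map f (p # b)) \<subseteq> carrier M" using f_closed by auto
 with Cons show ?case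
  by (simp add: L.lc_Cons M.lc_Cons ring_hom_add[OF f_hom] L.lc_closed f_smult)
qed

end

locale typed_iso = typed_hom F h L M f
 for F :: "('a, 'm) ring_scheme" and h :: "'k::field_char_0 => 'a"
  and L :: "('a, 'b, 'n) module_scheme" and M :: "('a, 'c, 'l) module_scheme" and f +
 assumes f_bij: "bij_betw f (carrier L) (carrier M)"
begin

lemma basis_map:
 assumes b: "alg_basis F L b"
 shows "alg_basis F M (map f b)"
proof -
 have cl: "set b \<subseteq> carrier L" by (rule L.basis_closed[OF b])
 have "\<exists>c. y = M.lc (map f b) c" if y: "y \<in> carrier M" for y
 proof -
  obtain x where "x \<in> carrier L" "y = f x" using y f_bij unfolding bij_betw_def by blast
  then show ?thesis using f_lc[OF cl] L.lc_crd[OF b] by metis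
 qed
 moreover have "c i = d i" if "M.lc (map f b) c = M.lc (map f b) d" "i < length b" for c d i
 proof -
  have "f (L.lc b c) = f (L.lc b d)" using that(1) f_lc[OF cl] by simp
  then have "L.lc b c = L.lc b d"
   using f_bij L.lc_closed[OF cl] by (auto simp: bij_betw_def dest: inj_onD)
  then show ?thesis using L.lc_inj[OF b] that(2) by blast
 qed
 ultimately show ?thesis unfolding M.alg_basis_iff using cl f_closed by auto
qed

lemma crd_map:
 assumes b: "alg_basis F L b" and "x \<in> carrier L" "i < length b"
 shows "M.crd (map f b) (f x) i = L.crd b x i"
 using f_lc[OF L.basis_closed[OF b], of "L.crd b x"] L.lc_crd[OF b] assms
 by (intro M.crd_eqI[OF basis_map[OF b]]) simp_all

lemma crd_mult_map:
 assumes b: "alg_basis F L b" and x: "x \<in> carrier L" and ij: "i < length b" "j < length b"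
 shows "M.crd (map f b) (f x \<otimes>\<^bsub>M\<^esub> map f b ! j) i = L.crd b (x \<otimes>\<^bsub>L\<^esub> b ! j) i"
 using crd_map[OF b, of "x \<otimes>\<^bsub>L\<^esub> b ! j" i] ring_hom_mult[OF f_hom, of x "b ! j"] L.basis_nth[OF b] x ij
 by simp

lemma degree_iso: "alg_basis F L b ==> degree_over F M = degree_over F L"
 using L.degree_over_eq M.degree_over_eq[OF basis_map] by simp

lemma norm_iso:
 assumes b: "alg_basis F L b" and x: "x \<in> carrier L"
 shows "alg_norm F M (f x) = alg_norm F L x"
proof -
 have "mat (length b) (length b) (\<lambda>(i, j). M.crd (map f b) (f x \<otimes>\<^bsub>M\<^esub> map f b ! j) i) =
  mat (length b) (length b) (\<lambda>(i, j). L.crd b (x \<otimes>\<^bsub>L\<^esub> b ! j) i)"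
  using crd_mult_map[OF b x] by (intro eq_matI) simp_all
 then show ?thesis
  using L.alg_norm_eq[OF b x] M.alg_norm_eq[OF basis_map[OF b] f_closed[OF x]] by (simp add: L.nm_def M.nm_def)
qed

end

lemma typed_algebraI:
 assumes "typed_field F h" "algebra F L"
 shows "typed_algebra F h L"
proof -
 interpret typed_field F h by fact
 interpret L: cring L by (rule algebra.M_cring) fact
 interpret A: algebra F L by fact
 show ?thesis by unfold_locales
qed

lemma typed_isoI:
 assumes "typed_field F h" "algebra F L" "algebra F M" "f \<in> alg_iso F L M"
 shows "typed_iso F h L M f"
proof -
 interpret L: typed_algebra F h L by (rule typed_algebraI) fact+
 interpret M: typed_algebra F h M by (rule typed_algebraI) fact+
 show ?thesis by unfold_locales (use alg_isoD[OF assms(4)] in auto)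
qed

lemma alg_prod_simps [simp]:
 "carrier (alg_prod L M) = carrier L \<times> carrier M"
 "x \<otimes>\<^bsub>alg_prod L M\<^esub> y = (fst x \<otimes>\<^bsub>L\<^esub> fst y, snd x \<otimes>\<^bsub>M\<^esub> snd y)"
 "x \<oplus>\<^bsub>alg_prod L M\<^esub> y = (fst x \<oplus>\<^bsub>L\<^esub> fst y, snd x \<oplus>\<^bsub>M\<^esub> snd y)"
 "\<one>\<^bsub>alg_prod L M\<^esub> = (\<one>\<^bsub>L\<^esub>, \<one>\<^bsub>M\<^esub>)"
 "\<zero>\<^bsub>alg_prod L M\<^esub> = (\<zero>\<^bsub>L\<^esub>, \<zero>\<^bsub>M\<^esub>)"
 "a \<odot>\<^bsub>alg_prod L M\<^esub> x = (a \<odot>\<^bsub>L\<^esub> fst x, a \<odot>\<^bsub>M\<^esub> snd x)"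
 by (cases x; cases y; simp add: alg_prod_def RDirProd_def DirProd_def ring.defs monoid.defs module.defs split: prod.splits)+

lemma algebra_alg_prod:
 assumes L: "algebra F L" and M: "algebra F M"
 shows "algebra F (alg_prod L M)"
proof -
 interpret L: cring L by (rule algebra.M_cring) fact
 interpret A: algebra F L by fact
 interpret M: cring M by (rule algebra.M_cring) fact
 interpret B: algebra F M by fact
 have cr: "cring (alg_prod L M)"
 proof (rule cringI)
  show "abelian_group (alg_prod L M)"
  proof (rule abelian_groupI)
   fix x assume "x \<in> carrier (alg_prod L M)"
   then show "\<exists>y\<in>carrier (alg_prod L M). y \<oplus>\<^bsub>alg_prod L M\<^esub> x = \<zero>\<^bsub>alg_prod L M\<^esub>"
    by (intro bexI[of _ "(\<ominus>\<^bsub>L\<^esub> fst x, \<ominus>\<^bsub>M\<^esub> snd x)"]) (auto simp: L.l_neg M.l_neg)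
  qed (auto simp: L.a_ac M.a_ac)
  show "comm_monoid (alg_prod L M)"
   by (rule comm_monoidI) (auto simp: L.m_ac M.m_ac)
 qed (auto simp: L.l_distr M.l_distr)
 show ?thesis
  by (rule algebraI[OF A.R_cring cr])
   (auto simp: A.smult_l_distr A.smult_r_distr A.smult_assoc1 A.smult_assoc2
    B.smult_l_distr B.smult_r_distr B.smult_assoc1 B.smult_assoc2)
qed

locale typed_prod = L: typed_algebra F h L + M: typed_algebra F h M
 for F :: "('a, 'm) ring_scheme" and h :: "'k::field_char_0 => 'a"
  and L :: "('a, 'b, 'n) module_scheme" and M :: "('a, 'c, 'l) module_scheme"
begin

sublocale P: typed_algebra F h "alg_prod L M"
 by (rule typed_algebraI[OF L.typed_field_axioms algebra_alg_prod[OF L.A.algebra_axioms M.A.algebra_axioms]])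

definition join :: "'b list => 'c list => ('b \<times> 'c) list" where
 "join b b' = map (\<lambda>x. (x, \<zero>\<^bsub>M\<^esub>)) b @ map (\<lambda>y. (\<zero>\<^bsub>L\<^esub>, y)) b'"

lemma join_closed: "set b \<subseteq> carrier L ==> set b' \<subseteq> carrier M ==> set (join b b') \<subseteq> carrier (alg_prod L M)"
 by (auto simp: join_def)

lemma length_join [simp]: "length (join b b') = length b + length b'"
 by (simp add: join_def)

lemma join_nth: "i < length b + length b' ==>
  join b b' ! i = (if i < length b then (b ! i, \<zero>\<^bsub>M\<^esub>) else (\<zero>\<^bsub>L\<^esub>, b' ! (i - length b)))"
 by (simp add: join_def nth_append)

lemma lc_left: "set b \<subseteq> carrier L ==> P.lc (map (\<lambda>x. (x, \<zero>\<^bsub>M\<^esub>)) b) c = (L.lc b c, \<zero>\<^bsub>M\<^esub>)"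
proof (induction b arbitrary: c)
 case (Cons p b)
 then have "set (map (\<lambda>x. (x, \<zero>\<^bsub>M\<^esub>)) (p # b)) \<subseteq> carrier (alg_prod L M)" by auto
 with Cons show ?case by (simp add: L.lc_Cons P.lc_Cons)
qed simp

lemma lc_right: "set b \<subseteq> carrier M ==> P.lc (map (\<lambda>y. (\<zero>\<^bsub>L\<^esub>, y)) b) c = (\<zero>\<^bsub>L\<^esub>, M.lc b c)"
proof (induction b arbitrary: c)
 case (Cons p b)
 then have "set (map (\<lambda>y. (\<zero>\<^bsub>L\<^esub>, y)) (p # b)) \<subseteq> carrier (alg_prod L M)" by auto
 with Cons show ?case by (simp add: M.lc_Cons P.lc_Cons)
qed simp

lemma lc_join:
 assumes "set b \<subseteq> carrier L" "set b' \<subseteq> carrier M"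
 shows "P.lc (join b b') c = (L.lc b c, M.lc b' (\<lambda>i. c (i + length b)))"
 using P.lc_append[OF join_closed[OF assms, unfolded join_def], of c] assms
 by (simp add: join_def lc_left lc_right L.lc_closed M.lc_closed)

lemma basis_join:
 assumes b: "alg_basis F L b" and b': "alg_basis F M b'"
 shows "alg_basis F (alg_prod L M) (join b b')"
proof -
 note cl = L.basis_closed[OF b] M.basis_closed[OF b']
 have "\<exists>c. z = P.lc (join b b') c" if "z \<in> carrier (alg_prod L M)" for z
 proof -
  have z: "fst z \<in> carrier L" "snd z \<in> carrier M" using that by auto
  define c where "c i = (if i < length b then L.crd b (fst z) i else M.crd b' (snd z) (i - length b))" for i
  have "L.lc b c = fst z"
   using L.lc_cong[of b c "L.crd b (fst z)"] L.lc_crd[OF b z(1)] cl by (simp add: c_def)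
  moreover have "M.lc b' (\<lambda>i. c (i + length b)) = snd z"
   using M.lc_crd[OF b' z(2)] by (simp add: c_def)
  ultimately show ?thesis using lc_join[OF cl, of c] by (intro exI[of _ c]) simp
 qed
 moreover have "c i = d i" if eq: "P.lc (join b b') c = P.lc (join b b') d" and i: "i < length b + length b'" for c d i
 proof (cases "i < length b")
  case True
  then show ?thesis using eq L.lc_inj[OF b, of c d i] by (simp add: lc_join[OF cl])
 next
  case False
  then show ?thesis
   using eq M.lc_inj[OF b', of "\<lambda>i. c (i + length b)" "\<lambda>i. d (i + length b)" "i - length b"] i
   by (simp add: lc_join[OF cl])
 qed
 ultimately show ?thesis unfolding P.alg_basis_iff using join_closed[OF cl] by simp
qed

lemma crd_join:
 assumes b: "alg_basis F L b" and b': "alg_basis F M b'" and xy: "x \<in> carrier L" "y \<in> carrier M"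
  and i: "i < length b + length b'"
 shows "P.crd (join b b') (x, y) i = (if i < length b then L.crd b x i else M.crd b' y (i - length b))"
proof (rule P.crd_eqI[OF basis_join[OF b b']])
 note cl = L.basis_closed[OF b] M.basis_closed[OF b']
 let ?c = "\<lambda>i. if i < length b then L.crd b x i else M.crd b' y (i - length b)"
 have "L.lc b ?c = x" using L.lc_cong[of b ?c "L.crd b x"] L.lc_crd[OF b xy(1)] cl by simp
 moreover have "M.lc b' (\<lambda>i. ?c (i + length b)) = y" using M.lc_crd[OF b' xy(2)] by simp
 ultimately show "(x, y) = P.lc (join b b') ?c" by (simp add: lc_join[OF cl])
qed (use i in simp)

lemma tr_join:
 assumes b: "alg_basis F L b" and b': "alg_basis F M b'" and xy: "x \<in> carrier L" "y \<in> carrier M"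
 shows "P.tr (join b b') (x, y) = L.tr b x + M.tr b' y"
proof -
 let ?g = "\<lambda>i. P.crd (join b b') ((x, y) \<otimes>\<^bsub>alg_prod L M\<^esub> join b b' ! i) i"
 have 1: "?g i = L.crd b (x \<otimes>\<^bsub>L\<^esub> b ! i) i" if "i < length b" for i
  using that xy L.basis_nth[OF b] by (simp add: join_nth crd_join[OF b b'])
 have 2: "?g (length b + i) = M.crd b' (y \<otimes>\<^bsub>M\<^esub> b' ! i) i" if "i < length b'" for i
  using that xy M.basis_nth[OF b'] by (simp add: join_nth crd_join[OF b b'])
 have split: "(\<Sum>i<n + m. g i) = (\<Sum>i<n. g i) + (\<Sum>i<m. g (n + i))" for n m and g :: "nat => 'k"
  by (induction m) (simp_all add: add.assoc)
 have "P.tr (join b b') (x, y) = (\<Sum>i<length b. ?g i) + (\<Sum>i<length b'. ?g (length b + i))"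
  unfolding P.tr_def length_join by (rule split)
 then show ?thesis using 1 2 by (simp add: L.tr_def M.tr_def)
qed

lemma det_block_diag:
 fixes A B :: "nat => nat => 'k"
 shows "det (mat (n + m) (n + m) (\<lambda>(i, j). if i < n \<and> j < n then A i j
   else if \<not> i < n \<and> \<not> j < n then B (i - n) (j - n) else 0)) =
  det (mat n n (\<lambda>(i, j). A i j)) * det (mat m m (\<lambda>(i, j). B i j))" (is "det ?X = _")
proof -
 have "?X = four_block_mat (mat n n (\<lambda>(i, j). A i j)) (0\<^sub>m n m) (0\<^sub>m m n) (mat m m (\<lambda>(i, j). B i j))"
  by (rule eq_matI) auto
 then show ?thesis
  using det_four_block_mat_upper_right_zero[of "mat n n (\<lambda>(i, j). A i j)" n "0\<^sub>m n m" m "0\<^sub>m m n" "mat m m (\<lambda>(i, j). B i j)"]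
  by simp
qed

lemma nm_join:
 assumes b: "alg_basis F L b" and b': "alg_basis F M b'" and xy: "x \<in> carrier L" "y \<in> carrier M"
 shows "P.nm (join b b') (x, y) = L.nm b x * M.nm b' y"
proof -
 have "mat (length (join b b')) (length (join b b')) (\<lambda>(i, j). P.crd (join b b') ((x, y) \<otimes>\<^bsub>alg_prod L M\<^esub> join b b' ! j) i) =
  mat (length b + length b') (length b + length b') (\<lambda>(i, j). if i < length b \<and> j < length b then L.crd b (x \<otimes>\<^bsub>L\<^esub> b ! j) i
   else if \<not> i < length b \<and> \<not> j < length b then M.crd b' (y \<otimes>\<^bsub>M\<^esub> b' ! (j - length b)) (i - length b) else 0)"
  using xy L.basis_nth[OF b] M.basis_nth[OF b']
  by (intro eq_matI)
   (auto simp: join_nth crd_join[OF b b'] L.crd_zero[OF b] M.crd_zero[OF b'])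
 then show ?thesis unfolding P.nm_def L.nm_def M.nm_def
  by (simp only: det_block_diag[of "length b" "length b'" "\<lambda>i j. L.crd b (x \<otimes>\<^bsub>L\<^esub> b ! j) i"
     "\<lambda>i j. M.crd b' (y \<otimes>\<^bsub>M\<^esub> b' ! j) i"])
qed

lemma gram_join:
 assumes b: "alg_basis F L b" and b': "alg_basis F M b'"
 shows "det (mat (length (join b b')) (length (join b b'))
   (\<lambda>(i, j). P.tr (join b b') (join b b' ! i \<otimes>\<^bsub>alg_prod L M\<^esub> join b b' ! j))) =
  det (mat (length b) (length b) (\<lambda>(i, j). L.tr b (b ! i \<otimes>\<^bsub>L\<^esub> b ! j))) *
  det (mat (length b') (length b') (\<lambda>(i, j). M.tr b' (b' ! i \<otimes>\<^bsub>M\<^esub> b' ! j)))"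
proof -
 have z: "L.tr b \<zero>\<^bsub>L\<^esub> = 0" "M.tr b' \<zero>\<^bsub>M\<^esub> = 0"
  using L.basis_nth[OF b] M.basis_nth[OF b'] L.crd_zero[OF b] M.crd_zero[OF b'] by (simp_all add: L.tr_def M.tr_def)
 have "mat (length (join b b')) (length (join b b'))
   (\<lambda>(i, j). P.tr (join b b') (join b b' ! i \<otimes>\<^bsub>alg_prod L M\<^esub> join b b' ! j)) =
  mat (length b + length b') (length b + length b') (\<lambda>(i, j). if i < length b \<and> j < length b then L.tr b (b ! i \<otimes>\<^bsub>L\<^esub> b ! j)
   else if \<not> i < length b \<and> \<not> j < length b then M.tr b' (b' ! (i - length b) \<otimes>\<^bsub>M\<^esub> b' ! (j - length b)) else 0)"
  using L.basis_nth[OF b] M.basis_nth[OF b']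
  by (intro eq_matI) (auto simp: join_nth tr_join[OF b b'] z)
 then show ?thesis
  by (simp only: det_block_diag[of "length b" "length b'" "\<lambda>i j. L.tr b (b ! i \<otimes>\<^bsub>L\<^esub> b ! j)"
     "\<lambda>i j. M.tr b' (b' ! i \<otimes>\<^bsub>M\<^esub> b' ! j)"])
qed

end

lemma det_2:
 fixes M :: "nat => nat => 'k::comm_ring_1"
 shows "det (mat 2 2 (\<lambda>(i, j). M i j)) = M 0 0 * M 1 1 - M 0 1 * M 1 0"
proof -
 let ?A = "mat 2 2 (\<lambda>(i, j). M i j)"
 have "det ?A = (\<Sum>i<2. ?A $$ (i, 0) * cofactor ?A i 0)"
  by (rule laplace_expansion_column) simp_all
 also have "\<dots> = M 0 0 * cofactor ?A 0 0 + M 1 0 * cofactor ?A 1 0"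
  by (simp add: numeral_2_eq_2)
 also have "cofactor ?A 0 0 = M 1 1"
  unfolding cofactor_def by (subst det_single) (simp_all add: mat_delete_def)
 also have "cofactor ?A 1 0 = - M 0 1"
  unfolding cofactor_def by (subst det_single) (simp_all add: mat_delete_def)
 finally show ?thesis by (simp add: mult.commute)
qed

section \<open>Quadratic algebras over a 2-adic field\<close>

locale local_field = typed_field F h + dyadic Ob \<pi> e R
 for F :: "(q2, 'a) module" and h :: "'k::field_char_0 => 'a"
  and Ob :: "'k set" and \<pi> e R +
 assumes O_F_eq: "O_F F = h ` Ob"
begin

definition hi :: "'a => 'k" where "hi = inv_into UNIV h"

lemma hi_h [simp]: "hi (h x) = x"
 unfolding hi_def by (rule inv_into_f_f) (auto simp: inj_on_def)

lemma h_hi [simp]: "a \<in> carrier F ==> h (hi a) = a"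
 using h_surj by force

lemma hi_mult: "a \<in> carrier F ==> b \<in> carrier F ==> hi (a \<otimes>\<^bsub>F\<^esub> b) = hi a * hi b"
 using h_surj[of a] h_surj[of b] by (auto simp flip: h_mult)

lemma hi_add: "a \<in> carrier F ==> b \<in> carrier F ==> hi (a \<oplus>\<^bsub>F\<^esub> b) = hi a + hi b"
 using h_surj[of a] h_surj[of b] by (auto simp flip: h_add)

lemma hi_one [simp]: "hi \<one>\<^bsub>F\<^esub> = 1"
 by (simp flip: h_one)

lemma h_eq_zero [simp]: "h x = \<zero>\<^bsub>F\<^esub> \<longleftrightarrow> x = 0"
 by (simp flip: h_zero)

lemma field_F: "field F"
proof (rule F.cring_fieldI)
 show "Units F = carrier F - {\<zero>\<^bsub>F\<^esub>}"
 proof (intro equalityI subsetI)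
  fix a assume a: "a \<in> Units F"
  have "\<one>\<^bsub>F\<^esub> \<noteq> \<zero>\<^bsub>F\<^esub>" by (simp flip: h_one)
  then show "a \<in> carrier F - {\<zero>\<^bsub>F\<^esub>}" using a by (auto simp: Units_def)
 next
  fix a assume a: "a \<in> carrier F - {\<zero>\<^bsub>F\<^esub>}"
  then obtain x where x: "a = h x" "x \<noteq> 0" using h_surj[of a] h_zero by auto
  have "h (1 / x) \<otimes>\<^bsub>F\<^esub> h x = \<one>\<^bsub>F\<^esub>" "h x \<otimes>\<^bsub>F\<^esub> h (1 / x) = \<one>\<^bsub>F\<^esub>"
   using x by (simp_all flip: h_mult h_one)
  then show "a \<in> Units F" using x by (auto simp: Units_def)
 qed
qed

lemma valued_F: "valued_field F (\<lambda>a. v (hi a)) (O_F F)"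
proof -
 interpret field F by (rule field_F)
 show ?thesis
 proof
  fix x y assume xy: "x \<in> carrier F" "y \<in> carrier F" "x \<noteq> \<zero>\<^bsub>F\<^esub>" "y \<noteq> \<zero>\<^bsub>F\<^esub>"
  then have "hi x \<noteq> 0" "hi y \<noteq> 0" using h_hi h_zero by metis+
  with xy show "v (hi (x \<otimes>\<^bsub>F\<^esub> y)) = v (hi x) + v (hi y)" by (simp add: hi_mult v_mult)
 next
  show "\<exists>p\<in>carrier F. p \<noteq> \<zero>\<^bsub>F\<^esub> \<and> v (hi p) = 1"
   using pi_nonzero by (intro bexI[of _ "h \<pi>"]) auto
  have "(x \<in> h ` Ob) = (x \<in> carrier F \<and> (x = \<zero>\<^bsub>F\<^esub> \<or> 0 \<le> v (hi x)))" for x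
  proof (cases "x \<in> carrier F")
   case True
   then obtain y where "x = h y" using h_surj by blast
   then show ?thesis by (auto simp: in_O_iff image_iff)
  qed auto
  then show "O_F F = {x \<in> carrier F. x = \<zero>\<^bsub>F\<^esub> \<or> 0 \<le> v (hi x)}" unfolding O_F_eq by blast
 qed
qed

lemma v_F_h: "x \<noteq> 0 ==> v_F F (h x) = v x"
 unfolding v_F_def by (subst valued_field.dvr_val_eq[OF valued_F]) auto

lemma abs_ram_index_eq: "abs_ram_index F = e"
proof -
 have "\<one>\<^bsub>F\<^esub> \<oplus>\<^bsub>F\<^esub> \<one>\<^bsub>F\<^esub> = h 2" using h_add[of 1 1] by (simp add: h_one)
 then show ?thesis unfolding abs_ram_index_def by (simp add: v_F_h v_two)
qed

lemma h_P: "h ` P n = {x \<in> carrier F. x = \<zero>\<^bsub>F\<^esub> \<or> n \<le> v (hi x)}"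
proof -
 have "(x \<in> h ` P n) = (x \<in> carrier F \<and> (x = \<zero>\<^bsub>F\<^esub> \<or> n \<le> v (hi x)))" for x
 proof (cases "x \<in> carrier F")
  case True
  then obtain y where "x = h y" using h_surj by blast
  then show ?thesis by (auto simp: P_def image_iff)
 qed auto
 then show ?thesis by blast
qed

lemma max_ideal_F: "max_ideal F (O_F F) = h ` P 1"
 unfolding h_P by (rule valued_field.max_ideal_eq[OF valued_F])

lemma card_quotient: "card (carrier (F\<lparr>carrier := O_F F\<rparr> Quot (h ` P (int n)))) = card R ^ n"
proof -
 define C where "C x = h ` {z. z - x \<in> P (int n)}" for x
 have coset: "h ` P (int n) +>\<^bsub>F\<lparr>carrier := h ` Ob\<rparr>\<^esub> h x = C x" for x
 proof -
  have "{z. z - x \<in> P (int n)} = (\<lambda>p. p + x) ` P (int n)"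
   by (auto simp: image_iff) (metis diff_add_cancel)
  then show ?thesis by (auto simp: C_def a_r_coset_def' h_add image_iff)
 qed
 obtain S where S0: "finite S \<and> card S = card R ^ n \<and> S \<subseteq> Ob \<and> (\<forall>x\<in>Ob. \<exists>!s. s \<in> S \<and> x - s \<in> P (int n))"
  using transversal[of n] by (rule exE)
 then have S: "finite S" "card S = card R ^ n" "S \<subseteq> Ob" by simp_all
 have S4: "\<exists>!s. s \<in> S \<and> x - s \<in> P (int n)" if "x \<in> Ob" for x using S0 that by simp
 have C_eq: "C x = C y" if "x - y \<in> P (int n)" for x y
 proof -
  have "z - x \<in> P (int n) \<longleftrightarrow> z - y \<in> P (int n)" for z
   using P_add[OF _ that, of "z - x"] P_diff[OF _ that, of "z - y"] by auto
  then show ?thesis by (simp add: C_def)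
 qed
 have "carrier (F\<lparr>carrier := O_F F\<rparr> Quot (h ` P (int n))) = C ` Ob"
  unfolding O_F_eq by (auto simp: FactRing_def A_RCOSETS_def' coset)
 also have "\<dots> = C ` S"
 proof
  show "C ` Ob \<subseteq> C ` S"
  proof
   fix D assume "D \<in> C ` Ob"
   then obtain x where x: "x \<in> Ob" "D = C x" by blast
   obtain s where "s \<in> S" "x - s \<in> P (int n)" using ex1_implies_ex[OF S4[OF x(1)]] by blast
   then show "D \<in> C ` S" using C_eq x by blast
  qed
 qed (use S in blast)
 finally have car: "carrier (F\<lparr>carrier := O_F F\<rparr> Quot (h ` P (int n))) = C ` S" .
 have "inj_on C S"
 proof (rule inj_onI)
  fix x y assume st: "x \<in> S" "y \<in> S" "C x = C y"
  have "h x \<in> C y" unfolding st(3)[symmetric] by (auto simp: C_def)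
  then have "x - y \<in> P (int n)" by (auto simp: C_def)
  moreover have "x - x \<in> P (int n)" "x \<in> Ob" using st S by auto
  ultimately show "x = y" using ex1E[OF S4[of x]] st by metis
 qed
 then show ?thesis unfolding car by (simp add: card_image S(2))
qed

lemma card_residue_field: "card (carrier (residue_field F)) = card R"
 using card_quotient[of 1] by (simp add: residue_field_def max_ideal_F)

lemma ideal_norm_P: "ideal_norm F (h ` P (int n)) = card R ^ n"
 unfolding ideal_norm_def by (rule card_quotient)

lemma ideal_val_P: "ideal_val F (h ` P n) = n"
proof -
 have "v_F F ` (h ` P n - {\<zero>\<^bsub>F\<^esub>}) = {n..}"
 proof (intro equalityI subsetI)
  fix m assume "m \<in> v_F F ` (h ` P n - {\<zero>\<^bsub>F\<^esub>})"
  then show "m \<in> {n..}" by (auto simp: v_F_h P_def)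
 next
  fix m assume "m \<in> {n..}"
  then have "\<pi> powi m \<in> P n" "v_F F (h (\<pi> powi m)) = m" "h (\<pi> powi m) \<noteq> \<zero>\<^bsub>F\<^esub>"
   using pi_nonzero by (simp_all add: P_def v_F_h)
  then show "m \<in> v_F F ` (h ` P n - {\<zero>\<^bsub>F\<^esub>})"
   by (intro image_eqI[of _ _ "h (\<pi> powi m)"] DiffI imageI) simp_all
 qed
 then show ?thesis unfolding ideal_val_def by (simp add: cInf_atLeast)
qed

text \<open>A concrete model of the extension by a square root of \<open>a\<close>, with that root
  as \<open>(0, 1)\<close>; it is an algebra for every \<open>a\<close>, and a field when
  \<open>a\<close> is no square.\<close>

definition Qalg :: "'k => ('a, 'k \<times> 'k) module" where
 "Qalg a = \<lparr>carrier = UNIV, monoid.mult = qmul a, one = (1, 0), ring.zero = 0, ring.add = (+),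
  module.smult = (\<lambda>c z. (hi c * fst z, hi c * snd z))\<rparr>"

lemma Qalg_simps [simp]:
 "carrier (Qalg a) = UNIV" "z \<otimes>\<^bsub>Qalg a\<^esub> w = qmul a z w" "\<one>\<^bsub>Qalg a\<^esub> = (1, 0)"
 "\<zero>\<^bsub>Qalg a\<^esub> = 0" "z \<oplus>\<^bsub>Qalg a\<^esub> w = z + w" "c \<odot>\<^bsub>Qalg a\<^esub> z = (hi c * fst z, hi c * snd z)"
 by (simp_all add: Qalg_def)

lemma qmul_assoc: "qmul a (qmul a z w) u = qmul a z (qmul a w u)"
 by (simp add: qmul_def algebra_simps)

lemma qmul_comm: "qmul a z w = qmul a w z"
 by (simp add: qmul_def algebra_simps)

lemma qmul_one [simp]: "qmul a (1, 0) z = z" "qmul a z (1, 0) = z"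
 by (simp_all add: qmul_def)

lemma qmul_distrib: "qmul a (z + w) u = qmul a z u + qmul a w u" "qmul a u (z + w) = qmul a u z + qmul a u w"
 by (simp_all add: qmul_def plus_prod_def algebra_simps)

lemma algebra_Qalg: "algebra F (Qalg a)"
proof -
 have cr: "cring (Qalg a)"
 proof (rule cringI)
  show "abelian_group (Qalg a)"
  proof (rule abelian_groupI)
   fix x assume "x \<in> carrier (Qalg a)"
   show "\<exists>y\<in>carrier (Qalg a). y \<oplus>\<^bsub>Qalg a\<^esub> x = \<zero>\<^bsub>Qalg a\<^esub>"
    by (intro bexI[of _ "- x"]) auto
  qed (auto simp: ac_simps)
  show "comm_monoid (Qalg a)"
   by (rule comm_monoidI) (auto simp: qmul_assoc intro: qmul_comm)
 qed (auto simp: qmul_distrib)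
 show ?thesis
  by (rule algebraI[OF F.is_cring cr])
   (auto simp: hi_add hi_mult plus_prod_def qmul_def algebra_simps)
qed

lemma typed_Qalg: "typed_algebra F h (Qalg a)"
 by (rule typed_algebraI[OF typed_field_axioms algebra_Qalg])

interpretation Q: typed_algebra F h "Qalg a" for a
 by (rule typed_Qalg)

lemma lc_Qalg: "Q.lc a [z, w] c = (c 0 * fst z + c 1 * fst w, c 0 * snd z + c 1 * snd w)"
 by (simp add: Q.lc_Cons plus_prod_def)

lemma basis_Qalg:
 assumes k: "k \<noteq> 0"
 shows "alg_basis F (Qalg a) [(1, 0), (g, k)]"
 unfolding Q.alg_basis_iff
proof (intro conjI ballI allI impI)
 fix z :: "'k \<times> 'k"
 show "\<exists>c. z = Q.lc a [(1, 0), (g, k)] c"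
  by (rule exI[of _ "\<lambda>i. if i = 0 then fst z - snd z / k * g else snd z / k"]) (use k in \<open>simp add: lc_Qalg\<close>)
next
 fix c d i
 assume eq: "Q.lc a [(1, 0), (g, k)] c = Q.lc a [(1, 0), (g, k)] d" and i: "i < length [(1::'k, 0::'k), (g, k)]"
 have "c 1 = d 1" using eq k by (simp add: lc_Qalg)
 moreover have "c 0 = d 0" using eq calculation by (simp add: lc_Qalg)
 ultimately show "c i = d i" using i by (cases i) (auto simp: less_Suc_eq)
qed simp

lemma crd_Qalg:
 assumes k: "k \<noteq> 0"
 shows "Q.crd a [(1, 0), (g, k)] z 0 = fst z - snd z / k * g" "Q.crd a [(1, 0), (g, k)] z (Suc 0) = snd z / k"
proof -
 let ?c = "\<lambda>i::nat. if i = 0 then fst z - snd z / k * g else snd z / k"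
 have z: "z = Q.lc a [(1, 0), (g, k)] ?c" using k by (simp add: lc_Qalg)
 show "Q.crd a [(1, 0), (g, k)] z 0 = fst z - snd z / k * g"
  using Q.crd_eqI[OF basis_Qalg[OF k] z, of 0] by simp
 show "Q.crd a [(1, 0), (g, k)] z (Suc 0) = snd z / k"
  using Q.crd_eqI[OF basis_Qalg[OF k] z, of 1] by simp
qed

lemma tr_Qalg:
 assumes k: "k \<noteq> 0"
 shows "Q.tr a [(1, 0), (g, k)] z = 2 * fst z"
 using k by (simp add: Q.tr_def numeral_2_eq_2 crd_Qalg) (simp add: qmul_def field_simps)

lemma nm_Qalg: "Q.nm a [(1, 0), (0, 1)] z = qnorm a z"
proof -
 have "Q.nm a [(1, 0), (0, 1)] z = det (mat 2 2 (\<lambda>(i, j). Q.crd a [(1, 0), (0, 1)] (qmul a z ([(1, 0), (0, 1)] ! j)) i))"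
  by (simp add: Q.nm_def numeral_2_eq_2)
 also have "\<dots> = qnorm a z"
  by (subst det_2) (simp add: crd_Qalg qmul_def qnorm_def power2_eq_square algebra_simps)
 finally show ?thesis .
qed

lemma norm_Qalg: "alg_norm F (Qalg a) z = h (qnorm a z)"
 using Q.alg_norm_eq[OF basis_Qalg[of 1 a 0]] nm_Qalg by simp

lemma degree_Qalg: "degree_over F (Qalg a) = 2"
 using Q.degree_over_eq[OF basis_Qalg[of 1 a 0]] by simp

lemma gram_Qalg:
 fixes g :: 'k
 assumes k: "k \<noteq> 0"
 defines "b \<equiv> [(1, 0), (g, k)]"
 shows "det (mat (length b) (length b) (\<lambda>(i, j). Q.tr a b (b ! i \<otimes>\<^bsub>Qalg a\<^esub> b ! j))) = 4 * a * k\<^sup>2"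
proof -
 have len: "length b = 2" by (simp add: b_def)
 show ?thesis unfolding len
  by (subst det_2) (simp add: b_def tr_Qalg[OF k] qmul_def power2_eq_square algebra_simps)
qed

lemma finsum_Qalg: "(\<Oplus>\<^bsub>Qalg a\<^esub>i\<in>{..<Suc n}. f i) = f n + (\<Oplus>\<^bsub>Qalg a\<^esub>i\<in>{..<n}. f i)"
 by (simp add: lessThan_Suc)

lemma pow_Qalg_Suc: "z [^]\<^bsub>Qalg a\<^esub> Suc n = qmul a (z [^]\<^bsub>Qalg a\<^esub> n) z"
 by (simp add: Q.L.nat_pow_Suc)

text \<open>An element is a root of its characteristic polynomial, whose coefficients are the norm
  and, up to sign, the trace.\<close>

lemma QO_integral:
 assumes b: "int_basis a g k" and z: "z \<in> QO a"
 shows "integral_over (O_F F) (Qalg a) z"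
proof -
 define c where "c i = (if i = 0 then h (qnorm a z) else h (- (2 * fst z)))" for i :: nat
 have "qnorm a z \<in> Ob" "- (2 * fst z) \<in> Ob" using z QO_trace[OF b z] by (simp_all add: QO_def uminus_O)
 then have c: "c \<in> {..<2} \<rightarrow> O_F F" by (auto simp: c_def O_F_eq)
 have "z [^]\<^bsub>Qalg a\<^esub> (2::nat) \<oplus>\<^bsub>Qalg a\<^esub> (\<Oplus>\<^bsub>Qalg a\<^esub>i\<in>{..<2}. c i \<odot>\<^bsub>Qalg a\<^esub> (z [^]\<^bsub>Qalg a\<^esub> i)) = \<zero>\<^bsub>Qalg a\<^esub>"
  by (cases z) (simp add: numeral_2_eq_2 finsum_Qalg pow_Qalg_Suc c_def qmul_def qnorm_def
    plus_prod_def zero_prod_def algebra_simps)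
 with c show ?thesis unfolding integral_over_def by blast
qed

lemma qnorm_one [simp]: "qnorm a (1, 0) = 1"
 by (simp add: qnorm_def)

text \<open>If \<open>z\<close> is not in \<open>QO a\<close> then its inverse \<open>w\<close> has norm in the maximal ideal, and an integral
 equation for \<open>z\<close> would make 1 a multiple of \<open>w\<close>.\<close>

lemma integral_imp_QO:
 assumes b: "int_basis a g k" and int: "integral_over (O_F F) (Qalg a) z"
 shows "z \<in> QO a"
proof (rule ccontr)
 assume z: "z \<notin> QO a"
 then have nz: "qnorm a z \<noteq> 0" and vn: "v (qnorm a z) < 0" by (auto simp: QO_def in_O_iff zero_O)
 define w where "w = (fst z / qnorm a z, - snd z / qnorm a z)"
 have zw: "qmul a z w = (1, 0)"
  using nz by (simp add: w_def qmul_def field_simps) (simp add: qnorm_def power2_eq_square algebra_simps)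
 then have qw: "qnorm a w = 1 / qnorm a z" using qnorm_qmul[of a z w] nz by (simp add: field_simps)
 have wP: "qnorm a w \<in> P 1" unfolding qw using nz vn by (simp add: P_def v_divide)
 then have w: "w \<in> QO a" unfolding QO_def by (simp add: P_sub_O)
 have one: "(1, 0) \<in> QO a" by (simp add: QO_def one_O)
 \<comment> \<open>The ideal generated by \<open>w\<close>. Multiplying the integral equation by the
   \<open>n\<close>-th power of \<open>w\<close> turns the leading term into 1 and every lower term
   into an element of \<open>I\<close>.\<close>
 define I where "I = qmul a w ` QO a"
 have I_add: "x + y \<in> I" if "x \<in> I" "y \<in> I" for x y
  using that QO_add[OF b] unfolding I_def by (auto simp: image_iff qmul_distrib(2)[symmetric])
 have I_zero: "0 \<in> I" unfolding I_def
  by (rule image_eqI[of _ _ "0"]) (simp_all add: QO_def qnorm_def zero_O qmul_def zero_prod_def)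
 obtain n :: nat and c where c: "c \<in> {..<n} \<rightarrow> O_F F"
  "z [^]\<^bsub>Qalg a\<^esub> n + (\<Oplus>\<^bsub>Qalg a\<^esub>i\<in>{..<n}. c i \<odot>\<^bsub>Qalg a\<^esub> (z [^]\<^bsub>Qalg a\<^esub> i)) = 0"
  using int by (auto simp: integral_over_def)
 define W where "W j = w [^]\<^bsub>Qalg a\<^esub> j" for j :: nat
 have W_Suc: "W (Suc j) = qmul a w (W j)" for j by (simp add: W_def pow_Qalg_Suc qmul_comm)
 have W0: "W 0 = (1, 0)" by (simp add: W_def)
 have WQ: "W j \<in> QO a" for j by (induction j) (auto simp: W0 W_Suc one intro: QO_qmul w)
 have zW: "qmul a (z [^]\<^bsub>Qalg a\<^esub> i) (W (i + j)) = W j" for i j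
 proof (induction i)
  case (Suc i)
  have "qmul a (z [^]\<^bsub>Qalg a\<^esub> Suc i) (W (Suc i + j)) = qmul a (z [^]\<^bsub>Qalg a\<^esub> i) (qmul a (qmul a z w) (W (i + j)))"
   by (simp add: pow_Qalg_Suc W_Suc qmul_assoc)
  then show ?case using Suc by (simp add: zw)
 qed simp
 have trm: "qmul a (c i \<odot>\<^bsub>Qalg a\<^esub> (z [^]\<^bsub>Qalg a\<^esub> i)) (W n) \<in> I" if i: "i < n" for i
 proof -
  obtain x where x: "x \<in> Ob" "c i = h x" using c(1) i by (auto simp: O_F_eq Pi_iff)
  have "qmul a (z [^]\<^bsub>Qalg a\<^esub> i) (W n) = W (n - i)" using zW[of i "n - i"] i by simp
  also have "\<dots> = W (Suc (n - i - 1))" using i by (simp add: Suc_diff_Suc)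
  also have "\<dots> = qmul a w (W (n - i - 1))" by (rule W_Suc)
  finally have eq: "qmul a (z [^]\<^bsub>Qalg a\<^esub> i) (W n) = qmul a w (W (n - i - 1))" .
  have sc1: "qmul a (c i \<odot>\<^bsub>Qalg a\<^esub> u) u' = (x * fst (qmul a u u'), x * snd (qmul a u u'))" for u u'
   by (simp add: x(2) qmul_def algebra_simps)
  have sc2: "(x * fst (qmul a u u'), x * snd (qmul a u u')) = qmul a u (x * fst u', x * snd u')" for u u'
   by (simp add: qmul_def algebra_simps)
  have "qmul a (c i \<odot>\<^bsub>Qalg a\<^esub> (z [^]\<^bsub>Qalg a\<^esub> i)) (W n) =
    qmul a w (x * fst (W (n - i - 1)), x * snd (W (n - i - 1)))"
   unfolding sc1 eq sc2 ..
  then show ?thesis unfolding I_def using QO_scale[OF x(1) WQ] by blast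
 qed
 have "qmul a (\<Oplus>\<^bsub>Qalg a\<^esub>i\<in>{..<m}. c i \<odot>\<^bsub>Qalg a\<^esub> (z [^]\<^bsub>Qalg a\<^esub> i)) (W n) \<in> I" if "m \<le> n" for m
  using that
 proof (induction m)
  case 0
  then show ?case using I_zero by (simp add: qmul_def zero_prod_def)
 next
  case (Suc m)
  then show ?case using I_add[OF trm[of m]] by (simp add: finsum_Qalg qmul_distrib(1) del: Qalg_simps(6))
 qed
 then have "qmul a (\<Oplus>\<^bsub>Qalg a\<^esub>i\<in>{..<n}. c i \<odot>\<^bsub>Qalg a\<^esub> (z [^]\<^bsub>Qalg a\<^esub> i)) (W n) \<in> I" by simp
 then obtain u where u: "u \<in> QO a" "qmul a (\<Oplus>\<^bsub>Qalg a\<^esub>i\<in>{..<n}. c i \<odot>\<^bsub>Qalg a\<^esub> (z [^]\<^bsub>Qalg a\<^esub> i)) (W n) = qmul a w u"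
  unfolding I_def by blast
 have "qmul a (z [^]\<^bsub>Qalg a\<^esub> n + (\<Oplus>\<^bsub>Qalg a\<^esub>i\<in>{..<n}. c i \<odot>\<^bsub>Qalg a\<^esub> (z [^]\<^bsub>Qalg a\<^esub> i))) (W n) = (1, 0) + qmul a w u"
  unfolding qmul_distrib(1) u(2) using zW[of n 0] W0 by simp
 then have "(1, 0) + qmul a w u = 0" unfolding c(2) by (simp add: qmul_def zero_prod_def)
 then have "qmul a w u = (- 1, 0)" by (cases "qmul a w u") (simp add: zero_prod_def add_eq_0_iff)
 then have "qnorm a w * qnorm a u = 1" unfolding qnorm_qmul[symmetric] by (simp add: qnorm_def)
 moreover have "qnorm a w * qnorm a u \<in> P 1" using u(1) by (intro P_mult_O wP) (simp add: QO_def)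
 ultimately show False by (simp add: P_def)
qed

lemma O_L_Qalg: "int_basis a g k ==> O_L F (Qalg a) = QO a"
 using QO_integral integral_imp_QO by (auto simp: O_L_def integral_closure_def)

lemma O_F_sub: "O_F F \<subseteq> carrier F"
 by (auto simp: O_F_eq)

lemma field_Qalg:
 assumes a: "\<not> is_square a"
 shows "field (Qalg a)"
proof (rule Q.L.cring_fieldI)
 show "Units (Qalg a) = carrier (Qalg a) - {\<zero>\<^bsub>Qalg a\<^esub>}"
 proof (intro equalityI subsetI)
  fix z assume "z \<in> Units (Qalg a)"
  then show "z \<in> carrier (Qalg a) - {\<zero>\<^bsub>Qalg a\<^esub>}"
   by (auto simp: Units_def qmul_def)
 next
  fix z assume "z \<in> carrier (Qalg a) - {\<zero>\<^bsub>Qalg a\<^esub>}"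
  then have nz: "qnorm a z \<noteq> 0" using qnorm_eq_0[OF a] by simp
  define w where "w = (fst z / qnorm a z, - snd z / qnorm a z)"
  have zw: "qmul a z w = (1, 0)"
   using nz by (simp add: w_def qmul_def field_simps) (simp add: qnorm_def power2_eq_square algebra_simps)
  then show "z \<in> Units (Qalg a)" using qmul_comm[of a z w]
   unfolding Units_def mem_Collect_eq by (intro conjI bexI[of _ w]) simp_all
 qed
qed

lemma norm_group_Qalg:
 assumes a: "\<not> is_square a"
 shows "norm_group F (Qalg a) = h ` N a"
proof -
 interpret field "Qalg a" by (rule field_Qalg[OF a])
 have U: "Units (Qalg a) = - {0}" using field_Units by auto
 have "qnorm a ` (- {0}) = N a"
 proof (intro equalityI subsetI)
  fix x assume "x \<in> qnorm a ` (- {0})"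
  then show "x \<in> N a" using qnorm_eq_0[OF a] by (auto simp: N_def qnorm_def)
 next
  fix x assume "x \<in> N a"
  then obtain y z where "x \<noteq> 0" "x = y\<^sup>2 - a * z\<^sup>2" by (auto simp: N_def)
  then have "x = qnorm a (y, z)" "(y, z) \<noteq> 0" by (auto simp: qnorm_def zero_prod_def)
  then show "x \<in> qnorm a ` (- {0})" by blast
 qed
 then show ?thesis unfolding norm_group_def U norm_Qalg by (metis (no_types, lifting) image_cong image_image)
qed

end

section \<open>Discriminant ideals from integral bases\<close>

locale local_algebra = local_field F h Ob \<pi> e R + typed_algebra F h L
 for F :: "(q2, 'a) module" and h :: "'k::field_char_0 => 'a" and Ob :: "'k set" and \<pi> e R
  and L :: "('a, 'b) module"
begin

text \<open>By \<open>gram_det\<close> a tuple of integral elements has as discriminant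
  \<open>D\<close> times the square of an integral determinant, and the basis itself attains
  \<open>D\<close>; so the ideal is generated by \<open>D\<close>.\<close>

lemma disc_ideal_eq:
 assumes b: "alg_basis F L b"
  and OL: "O_L F L = {x \<in> carrier L. \<forall>i<length b. crd b x i \<in> Ob}"
  and D: "D = det (mat (length b) (length b) (\<lambda>(i, j). tr b (b ! i \<otimes>\<^bsub>L\<^esub> b ! j)))" "D \<noteq> 0" "0 \<le> v D"
 shows "disc_ideal F L = h ` P (v D)"
proof -
 let ?RO = "F\<lparr>carrier := h ` Ob\<rparr>"
 let ?n = "length b"
 have DO: "D \<in> Ob" using D by (simp add: in_O_iff)
 have cr: "cring ?RO"
 proof (rule cringI)
  show "abelian_group ?RO"
  proof (rule abelian_groupI)
   fix x assume "x \<in> carrier ?RO"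
   then obtain y where y: "x = h y" "y \<in> Ob" by auto
   show "\<exists>z\<in>carrier ?RO. z \<oplus>\<^bsub>?RO\<^esub> x = \<zero>\<^bsub>?RO\<^esub>"
    by (rule bexI[of _ "h (- y)"]) (use y in \<open>auto simp: uminus_O simp flip: h_add h_zero\<close>)
  qed (auto simp: add_O zero_O F.a_ac simp flip: h_add h_zero intro!: imageI)
  show "comm_monoid ?RO"
   by (rule comm_monoidI) (auto simp: mult_O one_O F.m_ac simp flip: h_mult h_one intro!: imageI)
 qed (auto simp: F.l_distr)
 interpret RO: cring ?RO by (rule cr)
 have pidl: "PIdl\<^bsub>?RO\<^esub> (h D) = h ` P (v D)"
 proof -
  have "PIdl\<^bsub>?RO\<^esub> (h D) = h ` ((\<lambda>x. x * D) ` Ob)"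
   by (auto simp: cgenideal_def image_iff h_mult)
  also have "(\<lambda>x. x * D) ` Ob = P (v D)"
  proof (intro equalityI subsetI)
   fix x assume "x \<in> P (v D)"
   then have "x / D \<in> Ob" using D(2) by (cases "x = 0") (auto simp: P_def in_O_iff v_divide)
   then show "x \<in> (\<lambda>x. x * D) ` Ob" using D(2) by (intro image_eqI[of _ _ "x / D"]) auto
  next
   fix x assume "x \<in> (\<lambda>x. x * D) ` Ob"
   then obtain y where "y \<in> Ob" "x = y * D" by blast
   then show "x \<in> P (v D)" using P_mult_O[of D "v D" y] by (simp add: P_def mult.commute)
  qed
  finally show ?thesis .
 qed
 define S where "S = {ring_det F ?n (\<lambda>i j. alg_trace F L (w i \<otimes>\<^bsub>L\<^esub> w j)) | w. w \<in> {..<?n} \<rightarrow> O_L F L}"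
 have disc: "disc_ideal F L = Idl\<^bsub>?RO\<^esub> S"
  unfolding disc_ideal_def S_def degree_over_eq[OF b] O_F_eq ..
 have S_sub: "S \<subseteq> h ` P (v D)"
 proof
  fix y assume "y \<in> S"
  then obtain w where w: "w \<in> {..<?n} \<rightarrow> O_L F L" "y = ring_det F ?n (\<lambda>i j. alg_trace F L (w i \<otimes>\<^bsub>L\<^esub> w j))"
   unfolding S_def by blast
  have wL: "w i \<in> carrier L" "\<And>k. k < ?n ==> crd b (w i) k \<in> Ob" if "i < ?n" for i
   using w(1) that OL by (auto simp: Pi_iff)
  define C where "C = mat ?n ?n (\<lambda>(i, k). crd b (w i) k)"
  have "det C = (\<Sum>p | p permutes {0..<?n}. signof p * (\<Prod>i = 0..<?n. C $$ (i, p i)))"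
   by (rule det_def') (simp add: C_def)
  also have "\<dots> \<in> Ob"
  proof (intro sum_O mult_O prod_O)
   fix p i assume p: "p \<in> {p. p permutes {0..<?n}}" and i: "i \<in> {0..<?n}"
   then have "p i < ?n" using permutes_in_image[of p "{0..<?n}" i] by simp
   then show "C $$ (i, p i) \<in> Ob" using i wL by (simp add: C_def)
  next
   fix p :: "nat => nat" show "(signof p :: 'k) \<in> Ob" by (auto simp: sign_def one_O uminus_O)
  qed
  finally have "(det C)\<^sup>2 \<in> Ob" by (rule power_O)
  then have "D * (det C)\<^sup>2 \<in> P (v D)" by (intro P_mult_O) (simp add: P_def)
  moreover have "y = h ((det C)\<^sup>2 * D)" unfolding w(2) C_def D(1) by (rule gram_det[OF b wL(1)])
  ultimately show "y \<in> h ` P (v D)" by (simp add: mult.commute)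
 qed
 have D_S: "h D \<in> S"
 proof -
  have bO: "(\<lambda>i. b ! i) \<in> {..<?n} \<rightarrow> O_L F L"
   using basis_nth[OF b] by (auto simp: OL crd_nth[OF b] zero_O one_O)
  have "mat ?n ?n (\<lambda>(i, k). crd b (b ! i) k) = 1\<^sub>m ?n"
   by (rule eq_matI) (auto simp: crd_nth[OF b])
  then have "ring_det F ?n (\<lambda>i j. alg_trace F L (b ! i \<otimes>\<^bsub>L\<^esub> b ! j)) = h D"
   using gram_det[OF b, of "\<lambda>i. b ! i"] basis_nth[OF b] by (simp add: D(1))
  then show ?thesis unfolding S_def using bO by (intro CollectI exI[of _ "\<lambda>i. b ! i"]) simp
 qed
 have PO: "h ` P (v D) \<subseteq> carrier ?RO" using P_sub_O D(3) by auto
 have id: "ideal (h ` P (v D)) ?RO" using RO.cgenideal_ideal[of "h D"] DO pidl by simp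
 have "Idl\<^bsub>?RO\<^esub> S \<subseteq> h ` P (v D)" by (rule RO.genideal_minimal[OF id S_sub])
 moreover have "h ` P (v D) \<subseteq> Idl\<^bsub>?RO\<^esub> S"
  unfolding pidl[symmetric]
  by (rule RO.cgenideal_minimal[OF RO.genideal_ideal]) (use S_sub PO D_S RO.genideal_self[of S] in blast)+
 ultimately show ?thesis unfolding disc by blast
qed

end

context typed_iso
begin

lemma f_iso: "f \<in> alg_iso F L M"
 using f_hom f_bij f_smult by (rule alg_isoI)

lemma tr_map: "alg_basis F L b ==> x \<in> carrier L ==> M.tr (map f b) (f x) = L.tr b x"
 by (simp add: M.tr_def L.tr_def crd_mult_map del: nth_map)

lemma gram_map:
 assumes b: "alg_basis F L b"
 shows "mat (length (map f b)) (length (map f b)) (\<lambda>(i, j). M.tr (map f b) (map f b ! i \<otimes>\<^bsub>M\<^esub> map f b ! j)) =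
  mat (length b) (length b) (\<lambda>(i, j). L.tr b (b ! i \<otimes>\<^bsub>L\<^esub> b ! j))"
proof (rule eq_matI)
 fix i j
 assume "i < dim_row (mat (length b) (length b) (\<lambda>(i, j). L.tr b (b ! i \<otimes>\<^bsub>L\<^esub> b ! j)))"
  "j < dim_col (mat (length b) (length b) (\<lambda>(i, j). L.tr b (b ! i \<otimes>\<^bsub>L\<^esub> b ! j)))"
 then have ij: "i < length b" "j < length b" by simp_all
 then have "f (b ! i \<otimes>\<^bsub>L\<^esub> b ! j) = map f b ! i \<otimes>\<^bsub>M\<^esub> map f b ! j"
  using ring_hom_mult[OF f_hom] L.basis_nth[OF b] by simp
 then show "mat (length (map f b)) (length (map f b)) (\<lambda>(i, j). M.tr (map f b) (map f b ! i \<otimes>\<^bsub>M\<^esub> map f b ! j)) $$ (i, j) =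
   mat (length b) (length b) (\<lambda>(i, j). L.tr b (b ! i \<otimes>\<^bsub>L\<^esub> b ! j)) $$ (i, j)"
  using ij tr_map[OF b, of "b ! i \<otimes>\<^bsub>L\<^esub> b ! j"] L.basis_nth[OF b] by (simp del: nth_map)
qed simp_all

end

locale local_iso = local_field F h Ob \<pi> e R + typed_iso F h L M f
 for F :: "(q2, 'a) module" and h :: "'k::field_char_0 => 'a" and Ob :: "'k set" and \<pi> e R
  and L :: "('a, 'b) module" and M :: "('a, 'c) module" and f
begin

lemma disc_ideal_eq_iso:
 assumes b: "alg_basis F L b"
  and OL: "O_L F L = {x \<in> carrier L. \<forall>i<length b. L.crd b x i \<in> Ob}"
  and D: "D = det (mat (length b) (length b) (\<lambda>(i, j). L.tr b (b ! i \<otimes>\<^bsub>L\<^esub> b ! j)))" "D \<noteq> 0" "0 \<le> v D"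
 shows "disc_ideal F M = h ` P (v D)"
proof -
 interpret A: local_algebra F h Ob \<pi> e R M
  by (rule local_algebra.intro[OF local_field_axioms M.typed_algebra_axioms])
 have "O_L F M = f ` O_L F L"
  unfolding O_L_def by (rule integral_closure_iso[OF L.A.algebra_axioms M.A.algebra_axioms f_iso O_F_sub])
 also have "\<dots> = {y \<in> carrier M. \<forall>i<length (map f b). M.crd (map f b) y i \<in> Ob}"
 proof (intro equalityI subsetI)
  fix y assume "y \<in> f ` O_L F L"
  then obtain x where "y = f x" "x \<in> carrier L" "\<forall>i<length b. L.crd b x i \<in> Ob" by (auto simp: OL)
  then show "y \<in> {y \<in> carrier M. \<forall>i<length (map f b). M.crd (map f b) y i \<in> Ob}"
   by (simp add: crd_map[OF b] f_closed)
 next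
  fix y assume y: "y \<in> {y \<in> carrier M. \<forall>i<length (map f b). M.crd (map f b) y i \<in> Ob}"
  then obtain x where "y = f x" "x \<in> carrier L" using f_bij by (auto simp: bij_betw_def)
  with y show "y \<in> f ` O_L F L" by (simp add: OL crd_map[OF b])
 qed
 finally show ?thesis
  by (rule A.disc_ideal_eq[OF basis_map[OF b]]) (use D gram_map[OF b] in simp_all)
qed

end

section \<open>Ramification and presentation of quadratic extensions\<close>

context local_field
begin

interpretation Q: typed_algebra F h "Qalg a" for a
 by (rule typed_Qalg)

interpretation PR: typed_prod F h "Qalg a" "Qalg b" for a b
 by (rule typed_prod.intro[OF typed_Qalg typed_Qalg])

lemma O_L_crd_Qalg:
 assumes b: "int_basis a g k"
 shows "O_L F (Qalg a) = {x \<in> carrier (Qalg a). \<forall>i<length [(1, 0), (g, k)]. Q.crd a [(1, 0), (g, k)] x i \<in> Ob}"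
proof -
 have k: "k \<noteq> 0" using b by (simp add: int_basis_def)
 have "z \<in> QO a \<longleftrightarrow> (\<forall>i<2. Q.crd a [(1, 0), (g, k)] z i \<in> Ob)" for z
  using b by (cases z) (auto simp: int_basis_def crd_Qalg[OF k] less_2_cases_iff)
 then show ?thesis unfolding O_L_Qalg[OF b] by (auto simp: numeral_2_eq_2)
qed

lemma Qalg_scale:
 assumes s: "s \<noteq> 0"
 shows "(\<lambda>z. (fst z, s * snd z)) \<in> alg_iso F (Qalg (a * s\<^sup>2)) (Qalg a)"
proof (rule alg_isoI)
 show "bij_betw (\<lambda>z. (fst z, s * snd z)) (carrier (Qalg (a * s\<^sup>2))) (carrier (Qalg a))"
  by (rule bij_betw_byWitness[where f' = "\<lambda>z. (fst z, snd z / s)"]) (use s in auto)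
 show "(\<lambda>z. (fst z, s * snd z)) \<in> Ring.ring_hom (Qalg (a * s\<^sup>2)) (Qalg a)"
  by (rule ring_hom_memI) (auto simp: qmul_def plus_prod_def power2_eq_square algebra_simps)
qed simp

lemma O_L_iso:
 assumes L: "algebra F L" and f: "f \<in> alg_iso F (Qalg a) L" and b: "int_basis a g k"
 shows "O_L F L = f ` QO a"
 using integral_closure_iso[OF algebra_Qalg L f O_F_sub] O_L_Qalg[OF b] by (simp add: O_L_def)

lemma iso_zero:
 assumes "algebra F L" "algebra F M" "f \<in> alg_iso F L M"
 shows "f \<zero>\<^bsub>L\<^esub> = \<zero>\<^bsub>M\<^esub>"
proof -
 interpret L: cring L by (rule algebra.M_cring[OF assms(1)])
 interpret M: cring M by (rule algebra.M_cring[OF assms(2)])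
 show ?thesis by (rule ring_hom_zero[OF alg_isoD(2)[OF assms(3)] L.ring_axioms M.ring_axioms])
qed

lemma field_iso:
 assumes L: "algebra F L" and f: "f \<in> alg_iso F (Qalg a) L" and a: "\<not> is_square a"
 shows "field L"
proof -
 interpret L: cring L by (rule algebra.M_cring[OF L])
 interpret Qa: field "Qalg a" by (rule field_Qalg[OF a])
 have "Units L = f ` (carrier (Qalg a) - {\<zero>\<^bsub>Qalg a\<^esub>})"
  using Units_iso[OF algebra_Qalg L f] Qa.field_Units by simp
 also have "\<dots> = carrier L - {\<zero>\<^bsub>L\<^esub>}"
  using alg_isoD(3)[OF f] iso_zero[OF algebra_Qalg L f] unfolding bij_betw_def
  by (subst inj_on_image_set_diff[where C = UNIV]) auto
 finally show ?thesis by (rule L.cring_fieldI)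
qed

text \<open>\<open>w\<close> is a candidate for the normalized valuation on the model. Additivity,
  attaining 1, and having \<open>QO a\<close> as its ring of nonnegative elements pin it down as the
  valuation of \<open>L\<close>.\<close>

lemma dvr_val_iso:
 assumes L: "algebra F L" and f: "f \<in> alg_iso F (Qalg a) L" and a: "\<not> is_square a" and b: "int_basis a g k"
  and w_mult: "\<And>z u. z \<noteq> 0 ==> u \<noteq> 0 ==> w (qmul a z u) = w z + w u"
  and w_one: "p \<noteq> 0" "w p = 1"
  and w_QO: "\<And>z. z \<in> QO a \<longleftrightarrow> z = 0 \<or> 0 \<le> (w z :: int)"
  and z: "z \<noteq> 0"
 shows "dvr_val L (O_L F L) (f z) = w z"
proof -
 define f' where "f' = inv_into UNIV f"
 have bij: "bij_betw f UNIV (carrier L)" using alg_isoD(3)[OF f] by simp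
 have f'f: "f' (f z) = z" for z using bij unfolding f'_def bij_betw_def by simp
 have f0: "f 0 = \<zero>\<^bsub>L\<^esub>" using iso_zero[OF algebra_Qalg L f] by simp
 have surj: "\<exists>z. y = f z" if "y \<in> carrier L" for y using that bij unfolding bij_betw_def by blast
 have fz: "f z \<in> carrier L" for z using bij unfolding bij_betw_def by blast
 have inj: "f z = f u \<longleftrightarrow> z = u" for z u using f'f by metis
 have fmult: "f z \<otimes>\<^bsub>L\<^esub> f u = f (qmul a z u)" for z u
  using ring_hom_mult[OF alg_isoD(2)[OF f], of z u] by simp
 interpret L: field L by (rule field_iso[OF L f a])
 have "valued_field L (\<lambda>y. w (f' y)) (O_L F L)"
 proof
  fix x y assume xy: "x \<in> carrier L" "y \<in> carrier L" "x \<noteq> \<zero>\<^bsub>L\<^esub>" "y \<noteq> \<zero>\<^bsub>L\<^esub>"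
  obtain z u where zu: "x = f z" "y = f u" using surj xy by blast
  then have "z \<noteq> 0" "u \<noteq> 0" using xy f0 by auto
  then show "w (f' (x \<otimes>\<^bsub>L\<^esub> y)) = w (f' x) + w (f' y)" by (simp add: zu fmult f'f w_mult)
 next
  show "\<exists>p\<in>carrier L. p \<noteq> \<zero>\<^bsub>L\<^esub> \<and> w (f' p) = 1"
   using w_one by (intro bexI[of _ "f p"]) (simp_all add: f'f fz inj flip: f0)
  have "y \<in> f ` QO a \<longleftrightarrow> y \<in> carrier L \<and> (y = \<zero>\<^bsub>L\<^esub> \<or> 0 \<le> w (f' y))" for y
  proof (cases "y \<in> carrier L")
   case True
   then obtain z where "y = f z" using surj by blast
   then show ?thesis using w_QO[of z] fz[of z] by (auto simp: f'f inj image_iff simp flip: f0)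
  qed (use fz in auto)
  then show "O_L F L = {x \<in> carrier L. x = \<zero>\<^bsub>L\<^esub> \<or> 0 \<le> w (f' x)}"
   unfolding O_L_iso[OF L f b] by blast
 qed
 then have "dvr_val L (O_L F L) (f z) = w (f' (f z))"
  by (rule valued_field.dvr_val_eq) (use fz z inj f0 in metis)+
 then show ?thesis by (simp add: f'f)
qed

lemma some_uniformizer: "\<exists>x. x \<noteq> 0 \<and> v x = 1 \<and> (SOME p. uniformizer F (O_F F) p) = h x"
proof -
 have "uniformizer F (O_F F) (h \<pi>)"
  unfolding valued_field.uniformizer_iff[OF valued_F] using pi_nonzero by simp
 then have u: "uniformizer F (O_F F) (SOME p. uniformizer F (O_F F) p)"
  by (rule someI[where P = "uniformizer F (O_F F)"])
 define p where "p = (SOME p. uniformizer F (O_F F) p)"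
 have p: "p \<in> carrier F" "p \<noteq> \<zero>\<^bsub>F\<^esub>" "v (hi p) = 1"
  using u[folded p_def] unfolding valued_field.uniformizer_iff[OF valued_F] by auto
 moreover have "hi p \<noteq> 0"
 proof
  assume "hi p = 0"
  then have "h (hi p) = \<zero>\<^bsub>F\<^esub>" by (simp only: h_zero)
  then show False using h_hi[OF p(1)] p(2) by simp
 qed
 ultimately show ?thesis unfolding p_def[symmetric] by (intro exI[of _ "hi p"]) simp
qed

text \<open>The index is defined through an arbitrarily chosen uniformizer of \<open>F\<close>;
  hence \<open>w_base\<close> speaks of all elements of valuation 1.\<close>

lemma ram_index_iso:
 assumes L: "algebra F L" and f: "f \<in> alg_iso F (Qalg a) L" and a: "\<not> is_square a" and b: "int_basis a g k"
  and w_mult: "\<And>z u. z \<noteq> 0 ==> u \<noteq> 0 ==> w (qmul a z u) = w z + w u"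
  and w_one: "p \<noteq> 0" "w p = 1"
  and w_QO: "\<And>z. z \<in> QO a \<longleftrightarrow> z = 0 \<or> 0 \<le> (w z :: int)"
  and w_base: "\<And>x. x \<noteq> 0 ==> v x = 1 ==> w (x, 0) = n"
 shows "ram_index F L = n"
proof -
 obtain x where x: "x \<noteq> 0" "v x = 1" "(SOME p. uniformizer F (O_F F) p) = h x"
  using some_uniformizer by blast
 have "h x \<odot>\<^bsub>L\<^esub> \<one>\<^bsub>L\<^esub> = f (h x \<odot>\<^bsub>Qalg a\<^esub> \<one>\<^bsub>Qalg a\<^esub>)"
  using alg_isoD(4)[OF f, of "h x" "\<one>\<^bsub>Qalg a\<^esub>"] ring_hom_one[OF alg_isoD(2)[OF f]] by simp
 then have eq: "h x \<odot>\<^bsub>L\<^esub> \<one>\<^bsub>L\<^esub> = f (x, 0)" by simp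
 have nz: "(x, 0) \<noteq> (0 :: 'k \<times> 'k)" using x by (simp add: zero_prod_def)
 have "dvr_val L (O_L F L) (f (x, 0)) = w (x, 0)"
  by (rule dvr_val_iso[where w = w, OF L f a b _ w_one _ nz]) (fact w_mult w_QO)+
 then show ?thesis unfolding ram_index_def x(3) eq using w_base[OF x(1,2)] by simp
qed

text \<open>Here \<open>v\<close> of the norm attains 1, so it is the normalized valuation of the
  extension; on elements of \<open>F\<close> it is twice the old one.\<close>

lemma ram_index_ramified:
 assumes L: "algebra F L" and f: "f \<in> alg_iso F (Qalg a) L" and a: "ram_gen a r"
 shows "ram_index F L = 2"
proof -
 note ns = ram_gen_not_square[OF a]
 obtain g k where b: "int_basis a g k" using ram_gen_int_basis[OF a] by blast
 obtain p where p: "p \<noteq> 0" "v (qnorm a p) = 1" using ram_gen_norm_one[OF a] by blast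
 show ?thesis
 proof (rule ram_index_iso[where w = "\<lambda>z. v (qnorm a z)", OF L f ns b _ p])
  fix z u :: "'k \<times> 'k" assume "z \<noteq> 0" "u \<noteq> 0"
  then show "v (qnorm a (qmul a z u)) = v (qnorm a z) + v (qnorm a u)"
   using qnorm_eq_0[OF ns] by (simp add: qnorm_qmul v_mult)
 next
  fix z show "z \<in> QO a \<longleftrightarrow> z = 0 \<or> 0 \<le> v (qnorm a z)"
   using qnorm_eq_0[OF ns, of z] by (auto simp: QO_def in_O_iff)
 next
  fix x :: 'k assume "x \<noteq> 0" "v x = 1"
  then show "v (qnorm a (x, 0)) = 2" by (simp add: qnorm_def v_power)
 qed
qed

text \<open>All norms have even valuation, so the normalized valuation is half the valuation of the
  norm and extends that of \<open>F\<close>.\<close>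

lemma ram_index_unramified:
 assumes L: "algebra F L" and f: "f \<in> alg_iso F (Qalg (1 + 4 * c)) L" and c: "c \<in> Ob" "\<not> AS c"
 shows "ram_index F L = 1"
proof -
 define a where "a = 1 + 4 * c"
 have ns: "\<not> is_square a" unfolding a_def by (rule not_AS_not_square[OF c])
 have b: "int_basis a (1 / 2) (1 / 2)" unfolding a_def by (rule int_basis_unramified[OF c])
 have ev: "even (v (qnorm a z))" if "z \<noteq> 0" for z
  unfolding a_def by (rule unramified_qnorm_even[OF c that])
 have p: "(\<pi>, 0) \<noteq> (0 :: 'k \<times> 'k)" "v (qnorm a (\<pi>, 0)) div 2 = 1"
  using pi_nonzero by (simp_all add: zero_prod_def qnorm_def v_power)
 show ?thesis
 proof (rule ram_index_iso[where w = "\<lambda>z. v (qnorm a z) div 2", OF L f[folded a_def] ns b _ p])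
  fix z u :: "'k \<times> 'k" assume "z \<noteq> 0" "u \<noteq> 0"
  then show "v (qnorm a (qmul a z u)) div 2 = v (qnorm a z) div 2 + v (qnorm a u) div 2"
   using qnorm_eq_0[OF ns] ev by (auto simp: qnorm_qmul v_mult elim!: evenE)
 next
  fix z show "z \<in> QO a \<longleftrightarrow> z = 0 \<or> 0 \<le> v (qnorm a z) div 2"
   using qnorm_eq_0[OF ns, of z] by (auto simp: QO_def in_O_iff)
 next
  fix x :: 'k assume "x \<noteq> 0" "v x = 1"
  then show "v (qnorm a (x, 0)) div 2 = 1" by (simp add: qnorm_def v_power)
 qed
qed

lemma iso_basis: "algebra F L ==> f \<in> alg_iso F (Qalg a) L ==> k \<noteq> 0 ==> alg_basis F L (map f [(1, 0), (g, k)])"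
 using typed_iso.basis_map[OF typed_isoI[OF typed_field_axioms algebra_Qalg] basis_Qalg] by blast

lemma tot_ramI:
 assumes L: "algebra F L" and f: "f \<in> alg_iso F (Qalg a) L" and a: "ram_gen a r"
 shows "tot_ram_quadratic F L"
proof -
 have "degree_over F L = 2"
  using typed_iso.degree_iso[OF typed_isoI[OF typed_field_axioms algebra_Qalg L f] basis_Qalg[of 1]] degree_Qalg by simp
 moreover have "finite_field_ext F L"
  unfolding finite_field_ext_def using field_iso[OF L f ram_gen_not_square[OF a]] L iso_basis[OF L f, of 1 0] by auto
 ultimately show ?thesis using ram_index_ramified[OF L f a] by (simp add: tot_ram_quadratic_def)
qed

lemma norm_group_iso:
 assumes L: "algebra F L" and M: "algebra F M" and f: "f \<in> alg_iso F L M" and b: "alg_basis F L b"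
 shows "norm_group F M = norm_group F L"
proof -
 have "alg_norm F M (f x) = alg_norm F L x" if "x \<in> Units L" for x
  using typed_iso.norm_iso[OF typed_isoI[OF typed_field_axioms L M f] b] that by (auto simp: Units_def)
 then show ?thesis unfolding norm_group_def Units_iso[OF L M f] image_image by auto
qed

text \<open>Completing the square in a quadratic extension.\<close>

lemma quadratic_presentation:
 assumes L: "algebra F L" "field L" and b0: "alg_basis F L b0" "length b0 = 2"
 shows "\<exists>a f. \<not> is_square a \<and> f \<in> alg_iso F (Qalg a) L"
proof -
 interpret L: typed_algebra F h L by (rule typed_algebraI[OF typed_field_axioms L(1)])
 interpret LF: field L by (rule L(2))
 define E where "E x = h x \<odot>\<^bsub>L\<^esub> \<one>\<^bsub>L\<^esub>" for x
 have E_cl [simp]: "E x \<in> carrier L" for x by (simp add: E_def)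
 have E_sm: "h x \<odot>\<^bsub>L\<^esub> y = E x \<otimes>\<^bsub>L\<^esub> y" if "y \<in> carrier L" for x y
  using that by (simp add: E_def L.A.smult_assoc2)
 have E_add: "E (x + y) = E x \<oplus>\<^bsub>L\<^esub> E y" for x y by (simp add: E_def h_add L.A.smult_l_distr)
 have E_mult: "E (x * y) = E x \<otimes>\<^bsub>L\<^esub> E y" for x y
  by (simp add: E_def h_mult L.A.smult_assoc1 L.A.smult_assoc2)
 have E_one: "E 1 = \<one>\<^bsub>L\<^esub>" by (simp add: E_def h_one)
 have E_zero: "E 0 = \<zero>\<^bsub>L\<^esub>" by (simp add: E_def h_zero)
 have E_uminus: "E (- x) = \<ominus>\<^bsub>L\<^esub> E x" for x
 proof -
  have "E (- x) \<oplus>\<^bsub>L\<^esub> E x = \<zero>\<^bsub>L\<^esub>" by (simp flip: E_add add: E_zero)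
  then show ?thesis by (simp add: L.L.minus_equality)
 qed
 \<comment> \<open>Were all elements scalar, both vectors of the basis would be multiples of 1,
   against independence.\<close>
 have not_scalar: "\<exists>\<theta>\<in>carrier L. \<forall>x. \<theta> \<noteq> E x"
 proof (rule ccontr)
  assume "\<not> ?thesis"
  then have all: "\<exists>x. \<theta> = E x" if "\<theta> \<in> carrier L" for \<theta> using that by blast
  have bn: "b0 ! 0 \<in> carrier L" "b0 ! 1 \<in> carrier L" using L.basis_nth[OF b0(1)] b0(2) by auto
  obtain x y where xy: "b0 ! 0 = E x" "b0 ! 1 = E y" using all bn by metis
  have one: "L.crd b0 (E z) i = z * L.crd b0 \<one>\<^bsub>L\<^esub> i" if "i < 2" for z i
   unfolding E_def by (rule L.crd_smult[OF b0(1)]) (use that b0(2) in auto)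
  have "L.crd b0 (b0 ! 0) 0 = 1" "L.crd b0 (b0 ! 0) 1 = 0" "L.crd b0 (b0 ! 1) 0 = 0" "L.crd b0 (b0 ! 1) 1 = 1"
   using b0(2) by (simp_all add: L.crd_nth[OF b0(1)])
  then show False using one[of 0 x] one[of 1 x] one[of 0 y] one[of 1 y] unfolding xy by auto
 qed
 then obtain \<theta> where \<theta>: "\<theta> \<in> carrier L" "\<And>x. \<theta> \<noteq> E x" by blast
 have indep: "x = 0 \<and> y = 0" if eq: "E x \<oplus>\<^bsub>L\<^esub> E y \<otimes>\<^bsub>L\<^esub> \<theta> = \<zero>\<^bsub>L\<^esub>" for x y
 proof -
  have "y = 0"
  proof (rule ccontr)
   assume y: "y \<noteq> 0"
   have "E (1 / y) \<otimes>\<^bsub>L\<^esub> (E x \<oplus>\<^bsub>L\<^esub> E y \<otimes>\<^bsub>L\<^esub> \<theta>) =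
     E (1 / y) \<otimes>\<^bsub>L\<^esub> E x \<oplus>\<^bsub>L\<^esub> (E (1 / y) \<otimes>\<^bsub>L\<^esub> E y) \<otimes>\<^bsub>L\<^esub> \<theta>"
    using \<theta>(1) by (simp add: L.L.r_distr L.L.m_assoc)
   also have "\<dots> = E (x / y) \<oplus>\<^bsub>L\<^esub> E (1 / y * y) \<otimes>\<^bsub>L\<^esub> \<theta>"
    unfolding E_mult[symmetric] by simp
   finally have "E (x / y) \<oplus>\<^bsub>L\<^esub> \<theta> = \<zero>\<^bsub>L\<^esub>" using eq y \<theta>(1) by (simp add: E_one)
   then have "\<theta> = \<ominus>\<^bsub>L\<^esub> E (x / y)" using \<theta>(1) by (metis E_cl L.L.minus_equality L.L.minus_minus L.L.a_comm)
   then have "\<theta> = E (- (x / y))" by (simp add: E_uminus)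
   with \<theta>(2) show False by blast
  qed
  moreover from this have "E x = E 0" using eq \<theta>(1) by (simp add: E_zero)
  then have "x = 0"
  proof -
   have i: "L.crd b0 (E z) i = z * L.crd b0 \<one>\<^bsub>L\<^esub> i" if "i < 2" for z i
    unfolding E_def by (rule L.crd_smult[OF b0(1)]) (use that b0(2) in auto)
   have nz: "L.crd b0 \<one>\<^bsub>L\<^esub> 0 \<noteq> 0 \<or> L.crd b0 \<one>\<^bsub>L\<^esub> 1 \<noteq> 0"
   proof (rule ccontr)
    assume "\<not> ?thesis"
    then have "L.lc b0 (L.crd b0 \<one>\<^bsub>L\<^esub>) = L.lc b0 (\<lambda>_. 0)"
     using b0(2) L.basis_closed[OF b0(1)] by (intro L.lc_cong) (auto simp: less_2_cases_iff)
    then show False using L.lc_crd[OF b0(1), of "\<one>\<^bsub>L\<^esub>"] L.lc_zero[OF L.basis_closed[OF b0(1)]] LF.one_not_zero by simp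
   qed
   show ?thesis using i[of 0 x] i[of 1 x] i[of 0 0] i[of 1 0] nz \<open>E x = E 0\<close> by auto
  qed
  ultimately show ?thesis by simp
 qed
 have b1: "alg_basis F L [\<one>\<^bsub>L\<^esub>, \<theta>]"
 proof -
  let ?b = "[\<one>\<^bsub>L\<^esub>, \<theta>]"
  have lc: "L.lc ?b c = E (c 0) \<oplus>\<^bsub>L\<^esub> E (c 1) \<otimes>\<^bsub>L\<^esub> \<theta>" for c
   using \<theta>(1) by (simp add: L.lc_Cons E_sm)
  let ?p = "\<lambda>i. L.crd b0 \<one>\<^bsub>L\<^esub> i" and ?t = "\<lambda>i. L.crd b0 \<theta> i"
  have crd: "L.crd b0 (E x \<oplus>\<^bsub>L\<^esub> E y \<otimes>\<^bsub>L\<^esub> \<theta>) i = x * ?p i + y * ?t i" if "i < 2" for x y i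
   unfolding E_sm[OF \<theta>(1), symmetric] unfolding E_def using that b0(2) \<theta>(1)
   by (simp add: L.crd_add[OF b0(1)] L.crd_smult[OF b0(1)])
  have zero_iff: "z = \<zero>\<^bsub>L\<^esub>" if "z \<in> carrier L" "L.crd b0 z 0 = 0" "L.crd b0 z 1 = 0" for z
  proof -
   have "L.lc b0 (L.crd b0 z) = L.lc b0 (\<lambda>_. 0)"
    using b0(2) L.basis_closed[OF b0(1)] that by (intro L.lc_cong) (auto simp: less_2_cases_iff)
   then show ?thesis using L.lc_crd[OF b0(1) that(1)] L.lc_zero[OF L.basis_closed[OF b0(1)]] by simp
  qed
  \<comment> \<open>A vanishing determinant would produce a linear relation between 1 and
    \<open>\<theta>\<close>. Once it is nonzero, coordinates with respect to 1 and
    \<open>\<theta>\<close> come from Cramer's rule.\<close>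
  have det: "?p 0 * ?t 1 - ?p 1 * ?t 0 \<noteq> 0"
  proof
   assume d: "?p 0 * ?t 1 - ?p 1 * ?t 0 = 0"
   have "E (?t 0) \<oplus>\<^bsub>L\<^esub> E (- ?p 0) \<otimes>\<^bsub>L\<^esub> \<theta> = \<zero>\<^bsub>L\<^esub>"
    by (rule zero_iff) (use d \<theta>(1) in \<open>simp_all add: crd algebra_simps\<close>)
   then have p0: "?p 0 = 0" "?t 0 = 0" using indep by fastforce+
   have "E (?t 1) \<oplus>\<^bsub>L\<^esub> E (- ?p 1) \<otimes>\<^bsub>L\<^esub> \<theta> = \<zero>\<^bsub>L\<^esub>"
    by (rule zero_iff) (use p0 \<theta>(1) in \<open>simp_all add: crd algebra_simps\<close>)
   then have "?p 1 = 0" using indep by fastforce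
   then have "\<one>\<^bsub>L\<^esub> = \<zero>\<^bsub>L\<^esub>" using p0 by (intro zero_iff) simp_all
   then show False using LF.one_not_zero by simp
  qed
  have "\<exists>c. z = L.lc ?b c" if z: "z \<in> carrier L" for z
  proof -
   define d where "d = ?p 0 * ?t 1 - ?p 1 * ?t 0"
   define x where "x = (L.crd b0 z 0 * ?t 1 - L.crd b0 z 1 * ?t 0) / d"
   define y where "y = (?p 0 * L.crd b0 z 1 - ?p 1 * L.crd b0 z 0) / d"
   have d0: "d \<noteq> 0" using det by (simp add: d_def)
   have "x * ?p 0 + y * ?t 0 = L.crd b0 z 0 * d / d"
    unfolding x_def y_def by (simp add: d_def algebra_simps flip: add_divide_distrib)
   moreover have "x * ?p 1 + y * ?t 1 = L.crd b0 z 1 * d / d"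
    unfolding x_def y_def by (simp add: d_def algebra_simps flip: add_divide_distrib)
   ultimately have "L.crd b0 (E x \<oplus>\<^bsub>L\<^esub> E y \<otimes>\<^bsub>L\<^esub> \<theta>) i = L.crd b0 z i" if "i < length b0" for i
    using that b0(2) d0 by (auto simp: crd less_2_cases_iff)
   then have "L.lc b0 (L.crd b0 (E x \<oplus>\<^bsub>L\<^esub> E y \<otimes>\<^bsub>L\<^esub> \<theta>)) = L.lc b0 (L.crd b0 z)"
    by (rule L.lc_cong[OF _ L.basis_closed[OF b0(1)]])
   then have "z = E x \<oplus>\<^bsub>L\<^esub> E y \<otimes>\<^bsub>L\<^esub> \<theta>" using L.lc_crd[OF b0(1)] z \<theta>(1) by simp
   then show ?thesis by (intro exI[of _ "\<lambda>i. if i = 0 then x else y"]) (simp add: lc)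
  qed
  moreover have "c i = d i" if eq: "L.lc ?b c = L.lc ?b d" and i: "i < 2" for c d i
  proof -
   have "(c 0 - d 0) * ?p j + (c 1 - d 1) * ?t j = 0" if "j < 2" for j
    using arg_cong[OF eq, of "\<lambda>z. L.crd b0 z j"] that by (simp add: lc crd algebra_simps)
   then have "E (c 0 - d 0) \<oplus>\<^bsub>L\<^esub> E (c 1 - d 1) \<otimes>\<^bsub>L\<^esub> \<theta> = \<zero>\<^bsub>L\<^esub>"
    by (intro zero_iff) (use \<theta>(1) in \<open>simp_all add: crd\<close>)
   then have "c 0 - d 0 = 0 \<and> c 1 - d 1 = 0" by (rule indep)
   then show ?thesis using i by (auto simp: less_2_cases_iff)
  qed
  ultimately show ?thesis unfolding L.alg_basis_iff using \<theta>(1) by simp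
 qed
 have lc1: "L.lc [\<one>\<^bsub>L\<^esub>, \<theta>] c = E (c 0) \<oplus>\<^bsub>L\<^esub> E (c 1) \<otimes>\<^bsub>L\<^esub> \<theta>" for c
  using \<theta>(1) by (simp add: L.lc_Cons E_sm)
 define s where "s = L.crd [\<one>\<^bsub>L\<^esub>, \<theta>] (\<theta> \<otimes>\<^bsub>L\<^esub> \<theta>)"
 have sq: "\<theta> \<otimes>\<^bsub>L\<^esub> \<theta> = E (s 0) \<oplus>\<^bsub>L\<^esub> E (s 1) \<otimes>\<^bsub>L\<^esub> \<theta>"
  using L.lc_crd[OF b1, of "\<theta> \<otimes>\<^bsub>L\<^esub> \<theta>"] \<theta>(1) by (simp add: lc1 s_def)
 \<comment> \<open>From \<open>\<theta> ^ 2 = s 0 + s 1 * \<theta>\<close> the shifted element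
   \<open>\<theta> - m\<close> has the scalar square \<open>a\<close>; \<open>f\<close> sends the
   root \<open>(0, 1)\<close> of the model to it.\<close>
 define m where "m = s 1 / 2"
 define a where "a = s 0 + m\<^sup>2"
 define f where "f z = E (fst z - snd z * m) \<oplus>\<^bsub>L\<^esub> E (snd z) \<otimes>\<^bsub>L\<^esub> \<theta>" for z
 have f_cl: "f z \<in> carrier L" for z using \<theta>(1) by (simp add: f_def)
 have gen_mult: "(E x \<oplus>\<^bsub>L\<^esub> E y \<otimes>\<^bsub>L\<^esub> \<theta>) \<otimes>\<^bsub>L\<^esub> (E x' \<oplus>\<^bsub>L\<^esub> E y' \<otimes>\<^bsub>L\<^esub> \<theta>) =
   E (x * x' + y * y' * s 0) \<oplus>\<^bsub>L\<^esub> E (x * y' + y * x' + y * y' * s 1) \<otimes>\<^bsub>L\<^esub> \<theta>" for x y x' y'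
 proof -
  have "(E x \<oplus>\<^bsub>L\<^esub> E y \<otimes>\<^bsub>L\<^esub> \<theta>) \<otimes>\<^bsub>L\<^esub> (E x' \<oplus>\<^bsub>L\<^esub> E y' \<otimes>\<^bsub>L\<^esub> \<theta>) =
   E x \<otimes>\<^bsub>L\<^esub> E x' \<oplus>\<^bsub>L\<^esub> (E x \<otimes>\<^bsub>L\<^esub> E y' \<oplus>\<^bsub>L\<^esub> E y \<otimes>\<^bsub>L\<^esub> E x') \<otimes>\<^bsub>L\<^esub> \<theta> \<oplus>\<^bsub>L\<^esub> (E y \<otimes>\<^bsub>L\<^esub> E y') \<otimes>\<^bsub>L\<^esub> (\<theta> \<otimes>\<^bsub>L\<^esub> \<theta>)"
   using \<theta>(1) by (simp add: L.L.l_distr L.L.r_distr L.L.m_ac L.L.a_ac)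
  also have "\<dots> = E (x * x') \<oplus>\<^bsub>L\<^esub> E (x * y' + y * x') \<otimes>\<^bsub>L\<^esub> \<theta> \<oplus>\<^bsub>L\<^esub> E (y * y') \<otimes>\<^bsub>L\<^esub> (E (s 0) \<oplus>\<^bsub>L\<^esub> E (s 1) \<otimes>\<^bsub>L\<^esub> \<theta>)"
   by (simp add: sq E_mult E_add)
  also have "\<dots> = (E (x * x') \<oplus>\<^bsub>L\<^esub> E (y * y') \<otimes>\<^bsub>L\<^esub> E (s 0)) \<oplus>\<^bsub>L\<^esub> (E (x * y' + y * x') \<oplus>\<^bsub>L\<^esub> E (y * y') \<otimes>\<^bsub>L\<^esub> E (s 1)) \<otimes>\<^bsub>L\<^esub> \<theta>"
   using \<theta>(1) by (simp add: L.L.l_distr L.L.r_distr L.L.m_ac L.L.a_ac)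
  also have "\<dots> = E (x * x' + y * y' * s 0) \<oplus>\<^bsub>L\<^esub> E (x * y' + y * x' + y * y' * s 1) \<otimes>\<^bsub>L\<^esub> \<theta>"
   by (simp add: E_mult E_add)
  finally show ?thesis .
 qed
 have f_mult: "f (qmul a z u) = f z \<otimes>\<^bsub>L\<^esub> f u" for z u
 proof -
  have m2: "s 1 = 2 * m" by (simp add: m_def)
  have "fst (qmul a z u) - snd (qmul a z u) * m =
   (fst z - snd z * m) * (fst u - snd u * m) + snd z * snd u * s 0"
   by (simp add: qmul_def a_def power2_eq_square algebra_simps)
  moreover have "snd (qmul a z u) = (fst z - snd z * m) * snd u + snd z * (fst u - snd u * m) + snd z * snd u * s 1"
   by (simp add: qmul_def m2[unfolded One_nat_def] algebra_simps)
  ultimately show ?thesis unfolding f_def gen_mult by (simp only:)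
 qed
 have f_add: "f (z + u) = f z \<oplus>\<^bsub>L\<^esub> f u" for z u
 proof -
  have eq: "fst (z + u) - snd (z + u) * m = (fst z - snd z * m) + (fst u - snd u * m)" "snd (z + u) = snd z + snd u"
   by (simp_all add: algebra_simps)
  show ?thesis unfolding f_def unfolding eq(1) unfolding eq(2) E_add using \<theta>(1) by (simp add: L.L.l_distr L.L.a_ac)
 qed
 have f_sm: "f (c \<odot>\<^bsub>Qalg a\<^esub> z) = c \<odot>\<^bsub>L\<^esub> f z" if c: "c \<in> carrier F" for c z
 proof -
  obtain x where x: "c = h x" using h_surj[OF c] by blast
  have eq: "c \<odot>\<^bsub>Qalg a\<^esub> z = (x * fst z, x * snd z)" by (simp add: x)
  have eq': "fst (x * fst z, x * snd z) - snd (x * fst z, x * snd z) * m = x * (fst z - snd z * m)"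
   "snd (x * fst z, x * snd z) = x * snd z" by (simp_all add: algebra_simps)
  have "f (c \<odot>\<^bsub>Qalg a\<^esub> z) = E x \<otimes>\<^bsub>L\<^esub> f z"
   unfolding eq f_def unfolding eq'(1) unfolding eq'(2) E_mult using \<theta>(1) by (simp add: L.L.r_distr L.L.m_assoc)
  then show ?thesis using E_sm[OF f_cl] x by simp
 qed
 have bij: "bij_betw f UNIV (carrier L)"
 proof (rule bij_betw_byWitness[where f' = "\<lambda>z. (L.crd [\<one>\<^bsub>L\<^esub>, \<theta>] z 0 + L.crd [\<one>\<^bsub>L\<^esub>, \<theta>] z 1 * m, L.crd [\<one>\<^bsub>L\<^esub>, \<theta>] z 1)"])
  have fz: "f z = L.lc [\<one>\<^bsub>L\<^esub>, \<theta>] (\<lambda>i. if i = 0 then fst z - snd z * m else snd z)" for z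
   by (simp add: f_def lc1)
  show "\<forall>z\<in>UNIV. (L.crd [\<one>\<^bsub>L\<^esub>, \<theta>] (f z) 0 + L.crd [\<one>\<^bsub>L\<^esub>, \<theta>] (f z) 1 * m, L.crd [\<one>\<^bsub>L\<^esub>, \<theta>] (f z) 1) = z"
   using L.crd_eqI[OF b1 fz, of 0] L.crd_eqI[OF b1 fz, of 1] by simp
  show "\<forall>z\<in>carrier L. f (L.crd [\<one>\<^bsub>L\<^esub>, \<theta>] z 0 + L.crd [\<one>\<^bsub>L\<^esub>, \<theta>] z 1 * m, L.crd [\<one>\<^bsub>L\<^esub>, \<theta>] z 1) = z"
  proof
   fix z assume "z \<in> carrier L"
   from L.lc_crd[OF b1 this] show "f (L.crd [\<one>\<^bsub>L\<^esub>, \<theta>] z 0 + L.crd [\<one>\<^bsub>L\<^esub>, \<theta>] z 1 * m, L.crd [\<one>\<^bsub>L\<^esub>, \<theta>] z 1) = z"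
    by (simp add: f_def lc1)
  qed
 qed (use f_cl in auto)
 have iso: "f \<in> alg_iso F (Qalg a) L"
 proof (rule alg_isoI)
  have "f (1, 0) = \<one>\<^bsub>L\<^esub>" using \<theta>(1) by (simp add: f_def E_one E_zero)
  then show "f \<in> Ring.ring_hom (Qalg a) L" by (intro ring_hom_memI) (auto simp: f_cl f_mult f_add)
 qed (use bij f_sm in auto)
 have "\<not> is_square a"
 proof
  assume "is_square a"
  then obtain t where t: "a = t\<^sup>2" by (auto simp: is_square_def)
  \<comment> \<open>A square \<open>a\<close> would give the model zero divisors
    \<open>t + sqrt a\<close> and \<open>- t + sqrt a\<close>, which the field \<open>L\<close>
    cannot have.\<close>
  have "qmul a (t, 1) (- t, 1) = 0" by (simp add: qmul_def t power2_eq_square zero_prod_def)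
  then have "f (t, 1) \<otimes>\<^bsub>L\<^esub> f (- t, 1) = f 0" by (simp flip: f_mult)
  also have "\<dots> = \<zero>\<^bsub>L\<^esub>" using \<theta>(1) by (simp add: f_def E_zero)
  finally have "f (t, 1) = f 0 \<or> f (- t, 1) = f 0"
   using LF.integral[of "f (t, 1)" "f (- t, 1)"] f_cl \<theta>(1) by (simp add: f_def[of 0] E_zero)
  then have "(t, 1) = (0 :: 'k \<times> 'k) \<or> (- t, 1) = (0 :: 'k \<times> 'k)"
   using inj_onD[OF bij_betw_imp_inj_on[OF bij]] by blast
  then show False by (simp add: zero_prod_def)
 qed
 with iso show ?thesis by blast
qed

text \<open>By \<open>quadratic_presentation\<close> and \<open>normal_form\<close> the generator
  may be taken ramified or unramified; ramification index 2 rules out the latter.\<close>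

lemma tot_ramD:
 assumes "tot_ram_quadratic F L"
 shows "\<exists>a r. ram_gen a r \<and> alg_isomorphic F (Qalg a) L"
proof -
 have L: "algebra F L" "field L" and ram: "ram_index F L = 2" and deg: "degree_over F L = 2"
  using assms by (auto simp: tot_ram_quadratic_def finite_field_ext_def)
 obtain b where b: "alg_basis F L b" using assms by (auto simp: tot_ram_quadratic_def finite_field_ext_def)
 interpret L: typed_algebra F h L by (rule typed_algebraI[OF typed_field_axioms L(1)])
 have "length b = 2" using L.degree_over_eq[OF b] deg by simp
 then obtain a f where af: "\<not> is_square a" "f \<in> alg_iso F (Qalg a) L"
  using quadratic_presentation[OF L b] by blast
 have a0: "a \<noteq> 0" using af(1) by (auto simp: is_square_def)
 obtain s where s: "s \<noteq> 0" "normal (a * s\<^sup>2)" using normal_form[OF a0] by blast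
 have iso: "f \<circ> (\<lambda>z. (fst z, s * snd z)) \<in> alg_iso F (Qalg (a * s\<^sup>2)) L"
  by (rule alg_iso_comp[OF Qalg_scale[OF s(1)] af(2)])
 have ns: "\<not> is_square (a * s\<^sup>2)"
 proof
  assume "is_square (a * s\<^sup>2)"
  then obtain t where "a * s\<^sup>2 = t\<^sup>2" by (auto simp: is_square_def)
  then have "a = (t / s)\<^sup>2" using s(1) by (simp add: power_divide field_simps)
  with af(1) show False by (auto simp: is_square_def)
 qed
 show ?thesis using s(2) ns
 proof (cases rule: normal_cases)
  case (1 r)
  then show ?thesis using iso by (auto simp: alg_isomorphic_def)
 next
  case (2 c)
  have "ram_index F L = 1" by (rule ram_index_unramified[OF L(1) iso[unfolded 2(3)] 2(1,2)])
  with ram show ?thesis by simp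
 qed
qed

lemma disc_ideal_iso:
 assumes L: "algebra F L" and f: "f \<in> alg_iso F (Qalg a) L" and a: "ram_gen a r"
 shows "disc_ideal F L = h ` P r"
proof -
 obtain g k where b: "int_basis a g k" "v (4 * a * k\<^sup>2) = r" using ram_gen_int_basis[OF a] by blast
 have k: "k \<noteq> 0" using b by (simp add: int_basis_def)
 interpret I: local_iso F h Ob \<pi> e R "Qalg a" L f
  by (rule local_iso.intro[OF local_field_axioms typed_isoI[OF typed_field_axioms algebra_Qalg L f]])
 have r: "0 \<le> r" using ram_gen_values[OF a] by auto
 have "a \<noteq> 0" using a by (simp add: ram_gen_def)
 then show ?thesis
  using I.disc_ideal_eq_iso[OF basis_Qalg[OF k] O_L_crd_Qalg[OF b(1)] gram_Qalg[OF k, symmetric]] b(2) r k by simp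
qed

lemma disc_val_iso:
 assumes "algebra F L" "f \<in> alg_iso F (Qalg a) L" "ram_gen a r"
 shows "disc_val F L = r"
 using disc_ideal_iso[OF assms] ideal_val_P by (simp add: disc_val_def)

end

section \<open>Automorphisms\<close>

lemma alg_iso_restrict:
 assumes L: "algebra F L" and f: "f \<in> alg_iso F L M" and eq: "\<And>x. x \<in> carrier L ==> f x = g x"
 shows "g \<in> alg_iso F L M"
proof -
 interpret L: cring L by (rule algebra.M_cring[OF L])
 interpret A: algebra F L by (rule L)
 have "g \<in> ring_iso L M" by (rule L.ring_iso_restrict[OF alg_isoD(1)[OF f] eq])
 then show ?thesis using alg_isoD(4)[OF f] by (simp add: alg_iso_def eq[symmetric])
qed

lemma alg_aut_conj:
 assumes M: "algebra F M" and f: "f \<in> alg_iso F L M" "f' \<in> alg_iso F M L" and g: "g \<in> alg_aut F L"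
 shows "restrict (f \<circ> g \<circ> f') (carrier M) \<in> alg_aut F M"
proof -
 have "g \<in> alg_iso F L L" using g by (simp add: alg_aut_def)
 then have "f \<circ> g \<circ> f' \<in> alg_iso F M M" by (intro alg_iso_comp[OF f(2)] alg_iso_comp[OF _ f(1)])
 then have "restrict (f \<circ> g \<circ> f') (carrier M) \<in> alg_iso F M M"
  by (rule alg_iso_restrict[OF M]) simp
 then show ?thesis by (simp add: alg_aut_def)
qed

lemma alg_aut_conj_inv:
 assumes f: "f \<in> alg_iso F L M" and f': "\<And>x. x \<in> carrier L ==> f' (f x) = x" and g: "g \<in> alg_aut F L"
 shows "restrict (f' \<circ> restrict (f \<circ> g \<circ> f') (carrier M) \<circ> f) (carrier L) = g"
proof
 fix x
 have g': "g \<in> alg_iso F L L" "g \<in> extensional (carrier L)" using g by (simp_all add: alg_aut_def)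
 show "restrict (f' \<circ> restrict (f \<circ> g \<circ> f') (carrier M) \<circ> f) (carrier L) x = g x"
 proof (cases "x \<in> carrier L")
  case True
  then have "f x \<in> carrier M" "g x \<in> carrier L"
   using ring_hom_closed[OF alg_isoD(2)[OF f]] ring_hom_closed[OF alg_isoD(2)[OF g'(1)]] by blast+
  then show ?thesis using True f' by simp
 qed (use g'(2) in \<open>simp add: extensional_def\<close>)
qed

lemma card_alg_aut_iso:
 assumes L: "algebra F L" and M: "algebra F M" and f: "f \<in> alg_iso F L M"
 shows "card (alg_aut F M) = card (alg_aut F L)"
proof -
 define f' where "f' = inv_into (carrier L) f"
 have f': "f' \<in> alg_iso F M L" unfolding f'_def by (rule alg_iso_inv[OF L f])
 have bij: "bij_betw f (carrier L) (carrier M)" by (rule alg_isoD(3)[OF f])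
 have f'f: "f' (f x) = x" if "x \<in> carrier L" for x
  using bij that unfolding f'_def bij_betw_def by simp
 have ff': "f (f' y) = y" if "y \<in> carrier M" for y
  using bij that unfolding f'_def by (simp add: bij_betw_inv_into_right)
 have "bij_betw (\<lambda>g. restrict (f \<circ> g \<circ> f') (carrier M)) (alg_aut F L) (alg_aut F M)"
 proof (rule bij_betw_byWitness[where f' = "\<lambda>g. restrict (f' \<circ> g \<circ> f) (carrier L)"])
  show "\<forall>g\<in>alg_aut F L. restrict (f' \<circ> restrict (f \<circ> g \<circ> f') (carrier M) \<circ> f) (carrier L) = g"
   by (intro ballI alg_aut_conj_inv[OF f f'f])
  show "\<forall>g\<in>alg_aut F M. restrict (f \<circ> restrict (f' \<circ> g \<circ> f) (carrier L) \<circ> f') (carrier M) = g"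
   by (intro ballI alg_aut_conj_inv[OF f' ff'])
 qed (use alg_aut_conj[OF M f f'] alg_aut_conj[OF L f' f] in \<open>blast+\<close>)
 then show ?thesis by (rule bij_betw_same_card[symmetric])
qed

section \<open>Products of two quadratic extensions\<close>

context local_field
begin

interpretation Q: typed_algebra F h "Qalg a" for a
 by (rule typed_Qalg)

interpretation PR: typed_prod F h "Qalg a" "Qalg b" for a b
 by (rule typed_prod.intro[OF typed_Qalg typed_Qalg])

abbreviation Pr :: "'k => 'k => ('a, ('k \<times> 'k) \<times> ('k \<times> 'k)) module" where
 "Pr a b \<equiv> alg_prod (Qalg a) (Qalg b)"

lemma algebra_Pr: "algebra F (Pr a b)"
 by (rule algebra_alg_prod[OF algebra_Qalg algebra_Qalg])

lemma basis_Pr: "k \<noteq> 0 ==> k' \<noteq> 0 ==> alg_basis F (Pr a b) (PR.join a b [(1, 0), (g, k)] [(1, 0), (g', k')])"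
 by (intro PR.basis_join basis_Qalg)

lemma pow_Pr_Suc: "p [^]\<^bsub>Pr a b\<^esub> Suc n = p [^]\<^bsub>Pr a b\<^esub> n \<otimes>\<^bsub>Pr a b\<^esub> p"
 by (simp add: PR.P.L.nat_pow_Suc del: alg_prod_simps)

lemma finsum_Pr: "(\<Oplus>\<^bsub>Pr a b\<^esub>i\<in>{..<Suc n}. f i) = f n \<oplus>\<^bsub>Pr a b\<^esub> (\<Oplus>\<^bsub>Pr a b\<^esub>i\<in>{..<n}. f i)"
 using PR.P.L.finsum_insert[of "{..<n}" n f a b] by (simp add: lessThan_Suc del: alg_prod_simps(2-))

text \<open>Both components are roots of the product of the two characteristic polynomials.\<close>

lemma O_L_Pr:
 assumes b: "int_basis a g k" "int_basis b g' k'"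
 shows "O_L F (Pr a b) = QO a \<times> QO b"
proof (intro equalityI subsetI)
 fix p assume "p \<in> O_L F (Pr a b)"
 then have int: "integral_over (O_F F) (Pr a b) p" by (simp add: O_L_def integral_closure_def)
 have "integral_over (O_F F) (Qalg a) (fst p)"
  by (rule integral_over_hom[OF algebra_Pr algebra_Qalg _ _ O_F_sub _ int]) (auto intro!: ring_hom_memI)
 moreover have "integral_over (O_F F) (Qalg b) (snd p)"
  by (rule integral_over_hom[OF algebra_Pr algebra_Qalg _ _ O_F_sub _ int]) (auto intro!: ring_hom_memI)
 ultimately show "p \<in> QO a \<times> QO b" using integral_imp_QO b by (simp add: mem_Times_iff)
next
 fix p assume "p \<in> QO a \<times> QO b"
 then obtain x y u w where p: "p = ((x, y), (u, w))" and QO: "(x, y) \<in> QO a" "(u, w) \<in> QO b"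
  by (cases p) auto
 define t t' n n' where defs: "t = 2 * x" "t' = 2 * u" "n = x\<^sup>2 - a * y\<^sup>2" "n' = u\<^sup>2 - b * w\<^sup>2"
 have O: "t \<in> Ob" "t' \<in> Ob" "n \<in> Ob" "n' \<in> Ob"
  using QO QO_trace[OF b(1) QO(1)] QO_trace[OF b(2) QO(2)] by (simp_all add: defs QO_def qnorm_def)
 \<comment> \<open>The coefficients below the leading one of the product of
   \<open>X ^ 2 - t * X + n\<close> and \<open>X ^ 2 - t' * X + n'\<close>.\<close>
 define d where "d i = (if i = 0 then n * n' else if i = 1 then - (t * n' + t' * n)
   else if i = 2 then n + n' + t * t' else - (t + t'))" for i :: nat
 have "(\<lambda>i. h (d i)) \<in> {..<4} \<rightarrow> O_F F"
 proof -
  have "- (t * n' + t' * n) \<in> Ob" "- (t + t') \<in> Ob" by (intro uminus_O add_O mult_O O)+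
  then show ?thesis by (auto simp: d_def O_F_eq intro!: imageI mult_O add_O O)
 qed
 moreover have "p [^]\<^bsub>Pr a b\<^esub> (4::nat) \<oplus>\<^bsub>Pr a b\<^esub> (\<Oplus>\<^bsub>Pr a b\<^esub>i\<in>{..<4}. h (d i) \<odot>\<^bsub>Pr a b\<^esub> (p [^]\<^bsub>Pr a b\<^esub> i)) = \<zero>\<^bsub>Pr a b\<^esub>"
 proof -
  have four: "(4::nat) = Suc (Suc (Suc (Suc 0)))" by simp
  have pw0: "p [^]\<^bsub>Pr a b\<^esub> (0::nat) = ((1, 0), (1, 0))" by simp
  define X2 Y2 U2 W2 where d2: "X2 = x * x + a * y * y" "Y2 = x * y + y * x" "U2 = u * u + b * w * w" "W2 = u * w + w * u"
  define X3 Y3 U3 W3 where d3: "X3 = X2 * x + a * Y2 * y" "Y3 = X2 * y + Y2 * x" "U3 = U2 * u + b * W2 * w" "W3 = U2 * w + W2 * u"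
  define X4 Y4 U4 W4 where d4: "X4 = X3 * x + a * Y3 * y" "Y4 = X3 * y + Y3 * x" "U4 = U3 * u + b * W3 * w" "W4 = U3 * w + W3 * u"
  have pw1: "p [^]\<^bsub>Pr a b\<^esub> Suc 0 = ((x, y), (u, w))" unfolding pow_Pr_Suc pw0 by (simp add: p)
  have pw2: "p [^]\<^bsub>Pr a b\<^esub> Suc (Suc 0) = ((X2, Y2), (U2, W2))" unfolding pow_Pr_Suc[of _ _ _ "Suc 0"] pw1 by (simp add: p qmul_def d2)
  have pw3: "p [^]\<^bsub>Pr a b\<^esub> Suc (Suc (Suc 0)) = ((X3, Y3), (U3, W3))" unfolding pow_Pr_Suc[of _ _ _ "Suc (Suc 0)"] pw2 by (simp add: p qmul_def d3)
  have pw4: "p [^]\<^bsub>Pr a b\<^esub> Suc (Suc (Suc (Suc 0))) = ((X4, Y4), (U4, W4))" unfolding pow_Pr_Suc[of _ _ _ "Suc (Suc (Suc 0))"] pw3 by (simp add: p qmul_def d4)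
  have d: "d 0 = n * n'" "d (Suc 0) = - (t * n' + t' * n)" "d (Suc (Suc 0)) = n + n' + t * t'" "d (Suc (Suc (Suc 0))) = - (t + t')"
   by (simp_all add: d_def)
  \<comment> \<open>Each quadratic polynomial gives a recurrence for the coordinates of the powers;
    these recurrences reduce the relation of degree 4 to identities in each coordinate.\<close>
  have r: "X2 = t * x - n" "Y2 = t * y" "U2 = t' * u - n'" "W2 = t' * w"
   by (simp_all add: d2 defs power2_eq_square algebra_simps)
  have r3: "X3 = t * X2 - n * x" "Y3 = t * Y2 - n * y" "U3 = t' * U2 - n' * u" "W3 = t' * W2 - n' * w"
   by (simp_all add: d3 d2 defs power2_eq_square algebra_simps)
  have r4: "X4 = t * X3 - n * X2" "Y4 = t * Y3 - n * Y2" "U4 = t' * U3 - n' * U2" "W4 = t' * W3 - n' * W2"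
   by (simp_all add: d4 d3 d2 defs power2_eq_square algebra_simps)
  have "X4 + (- (t + t') * X3 + ((n + n' + t * t') * X2 + (- (t * n' + t' * n) * x + n * n'))) = 0"
   "Y4 + (- (t + t') * Y3 + ((n + n' + t * t') * Y2 + - (t * n' + t' * n) * y)) = 0"
   "U4 + (- (t + t') * U3 + ((n + n' + t * t') * U2 + (- (t * n' + t' * n) * u + n * n'))) = 0"
   "W4 + (- (t + t') * W3 + ((n + n' + t * t') * W2 + - (t * n' + t' * n) * w)) = 0"
   unfolding r4 r3 r by (simp_all add: algebra_simps)
  then show ?thesis
   unfolding four pw4 unfolding finsum_Pr pw0 pw1 pw2 pw3 d by (simp add: plus_prod_def zero_prod_def)
 qed
 ultimately show "p \<in> O_L F (Pr a b)"
  unfolding O_L_def integral_closure_def integral_over_def by (intro CollectI conjI exI bexI) auto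
qed

lemma O_L_crd_Pr:
 assumes b: "int_basis a g k" "int_basis b g' k'"
 shows "O_L F (Pr a b) = {x \<in> carrier (Pr a b). \<forall>i<length (PR.join a b [(1, 0), (g, k)] [(1, 0), (g', k')]).
   PR.P.crd a b (PR.join a b [(1, 0), (g, k)] [(1, 0), (g', k')]) x i \<in> Ob}"
proof -
 have k: "k \<noteq> 0" "k' \<noteq> 0" using b by (simp_all add: int_basis_def)
 have four: "(\<forall>i<4. P i) \<longleftrightarrow> P 0 \<and> P 1 \<and> P 2 \<and> P (3::nat)" for P
  by (auto simp: numeral_eq_Suc less_Suc_eq)
 have "(z, u) \<in> QO a \<times> QO b \<longleftrightarrow> (\<forall>i<4. PR.P.crd a b (PR.join a b [(1, 0), (g, k)] [(1, 0), (g', k')]) (z, u) i \<in> Ob)" for z u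
  using b unfolding four
  by (cases z; cases u) (auto simp: PR.crd_join[OF basis_Qalg[OF k(1)] basis_Qalg[OF k(2)]] int_basis_def crd_Qalg[OF k(1)] crd_Qalg[OF k(2)])
 note * = this
 show ?thesis unfolding O_L_Pr[OF b]
 proof (rule Set.set_eqI)
  fix p
  show "p \<in> QO a \<times> QO b \<longleftrightarrow> p \<in> {x \<in> carrier (Pr a b). \<forall>i<length (PR.join a b [(1, 0), (g, k)] [(1, 0), (g', k')]).
    PR.P.crd a b (PR.join a b [(1, 0), (g, k)] [(1, 0), (g', k')]) x i \<in> Ob}"
   using *[of "fst p" "snd p"] by (simp del: mem_Sigma_iff add: numeral_eq_Suc)
 qed
qed

lemma disc_ideal_Pr:
 assumes M: "algebra F M" and f: "f \<in> alg_iso F (Pr a b) M" and r: "ram_gen a r" "ram_gen b r'"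
 shows "disc_ideal F M = h ` P (r + r')"
proof -
 obtain g k where b: "int_basis a g k" "v (4 * a * k\<^sup>2) = r" using ram_gen_int_basis[OF r(1)] by blast
 obtain g' k' where b': "int_basis b g' k'" "v (4 * b * k'\<^sup>2) = r'" using ram_gen_int_basis[OF r(2)] by blast
 have k: "k \<noteq> 0" "k' \<noteq> 0" using b b' by (simp_all add: int_basis_def)
 interpret I: local_iso F h Ob \<pi> e R "Pr a b" M f
  by (rule local_iso.intro[OF local_field_axioms typed_isoI[OF typed_field_axioms algebra_Pr M f]])
 have "0 \<le> r + r'" using ram_gen_values[OF r(1)] ram_gen_values[OF r(2)] by auto
 moreover have ab: "a \<noteq> 0" "b \<noteq> 0" using r by (simp_all add: ram_gen_def)
 have v: "v ((4 * a * k\<^sup>2) * (4 * b * k'\<^sup>2)) = r + r'"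
  unfolding b(2)[symmetric] b'(2)[symmetric] by (rule v_mult) (use k ab in auto)
 have D: "(4 * a * k\<^sup>2) * (4 * b * k'\<^sup>2) = det (mat (length (PR.join a b [(1, 0), (g, k)] [(1, 0), (g', k')])) (length (PR.join a b [(1, 0), (g, k)] [(1, 0), (g', k')]))
   (\<lambda>(i, j). PR.P.tr a b (PR.join a b [(1, 0), (g, k)] [(1, 0), (g', k')])
    (PR.join a b [(1, 0), (g, k)] [(1, 0), (g', k')] ! i \<otimes>\<^bsub>Pr a b\<^esub> PR.join a b [(1, 0), (g, k)] [(1, 0), (g', k')] ! j)))"
  unfolding PR.gram_join[OF basis_Qalg[OF k(1)] basis_Qalg[OF k(2)]] gram_Qalg[OF k(1)] gram_Qalg[OF k(2)] ..
 have nz: "(4 * a * k\<^sup>2) * (4 * b * k'\<^sup>2) \<noteq> 0" using k ab by simp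
 ultimately have "0 \<le> v ((4 * a * k\<^sup>2) * (4 * b * k'\<^sup>2))" using v by simp
 from I.disc_ideal_eq_iso[OF basis_Pr[OF k] O_L_crd_Pr[OF b(1) b'(1)] D nz this]
 show ?thesis unfolding v .
qed

lemma norm_Pr: "alg_norm F (Pr a b) p = h (qnorm a (fst p) * qnorm b (snd p))"
proof -
 have "alg_norm F (Pr a b) p = h (PR.P.nm a b (PR.join a b [(1, 0), (0, 1)] [(1, 0), (0, 1)]) p)"
  by (rule PR.P.alg_norm_eq[OF basis_Pr[OF one_neq_zero one_neq_zero]]) simp
 moreover have "PR.P.nm a b (PR.join a b [(1, 0), (0, 1)] [(1, 0), (0, 1)]) (fst p, snd p) =
   Q.nm a [(1, 0), (0, 1)] (fst p) * Q.nm b [(1, 0), (0, 1)] (snd p)"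
  by (rule PR.nm_join[OF basis_Qalg[OF one_neq_zero] basis_Qalg[OF one_neq_zero]]) (simp_all only: Qalg_simps UNIV_I)
 ultimately show ?thesis unfolding nm_Qalg prod.collapse by (simp only:)
qed

lemma Units_Pr:
 assumes a: "\<not> is_square a" "\<not> is_square b"
 shows "Units (Pr a b) = {p. fst p \<noteq> 0 \<and> snd p \<noteq> 0}"
proof -
 interpret A: field "Qalg a" by (rule field_Qalg[OF a(1)])
 interpret B: field "Qalg b" by (rule field_Qalg[OF a(2)])
 have inv: "z \<noteq> 0 ==> \<exists>w. qmul a z w = (1, 0) \<and> qmul a w z = (1, 0)" "z \<noteq> 0 ==> \<exists>w. qmul b z w = (1, 0) \<and> qmul b w z = (1, 0)" for z
 proof -
  have "z \<in> Units (Qalg a)" "z \<in> Units (Qalg b)" if "z \<noteq> 0" for z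
   using that unfolding A.field_Units B.field_Units by simp_all
  then show "z \<noteq> 0 ==> \<exists>w. qmul a z w = (1, 0) \<and> qmul a w z = (1, 0)" "z \<noteq> 0 ==> \<exists>w. qmul b z w = (1, 0) \<and> qmul b w z = (1, 0)"
   by (simp_all add: Units_def conj_commute)
 qed
 have q0: "qmul c w 0 = 0" for c w by (simp add: qmul_def zero_prod_def)
 show ?thesis
 proof (intro equalityI subsetI)
  fix p assume "p \<in> Units (Pr a b)"
  then obtain q where q: "qmul a (fst q) (fst p) = (1, 0)" "qmul b (snd q) (snd p) = (1, 0)" by (auto simp: Units_def)
  have nz: "(0 :: 'k \<times> 'k) \<noteq> (1, 0)" by (simp add: zero_prod_def)
  have "fst p \<noteq> 0 \<and> snd p \<noteq> 0"
  proof (intro conjI notI)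
   assume "fst p = 0"
   with q(1) show False using nz by (simp only: q0)
  next
   assume "snd p = 0"
   with q(2) show False using nz by (simp only: q0)
  qed
  then show "p \<in> {p. fst p \<noteq> 0 \<and> snd p \<noteq> 0}" by simp
 next
  fix p :: "('k \<times> 'k) \<times> ('k \<times> 'k)" assume "p \<in> {p. fst p \<noteq> 0 \<and> snd p \<noteq> 0}"
  then obtain z w where "qmul a (fst p) z = (1, 0)" "qmul a z (fst p) = (1, 0)" "qmul b (snd p) w = (1, 0)" "qmul b w (snd p) = (1, 0)"
   using inv(1)[of "fst p"] inv(2)[of "snd p"] by blast
  then show "p \<in> Units (Pr a b)"
   unfolding Units_def by (intro CollectI conjI bexI[of _ "(z, w)"]) simp_all
 qed
qed

lemma norm_group_Pr:
 assumes M: "algebra F M" and f: "f \<in> alg_iso F (Pr a b) M" and a: "\<not> is_square a" "\<not> is_square b"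
 shows "norm_group F M = h ` {n * m | n m. n \<in> N a \<and> m \<in> N b}"
proof -
 have "norm_group F M = norm_group F (Pr a b)"
  by (rule norm_group_iso[OF algebra_Pr M f basis_Pr[of 1 1 _ _ 0 0]]) simp_all
 also have "\<dots> = h ` (\<lambda>p. qnorm a (fst p) * qnorm b (snd p)) ` {p. fst p \<noteq> 0 \<and> snd p \<noteq> 0}"
  unfolding norm_group_def Units_Pr[OF a] norm_Pr image_image ..
 also have "(\<lambda>p. qnorm a (fst p) * qnorm b (snd p)) ` {p. fst p \<noteq> 0 \<and> snd p \<noteq> 0} = {n * m | n m. n \<in> N a \<and> m \<in> N b}"
 proof -
  have N: "n \<in> N c \<longleftrightarrow> (\<exists>z. z \<noteq> 0 \<and> n = qnorm c z)" if "\<not> is_square c" for c n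
  proof
   assume "n \<in> N c"
   then obtain x y where "n \<noteq> 0" "n = x\<^sup>2 - c * y\<^sup>2" by (auto simp: N_def)
   then show "\<exists>z. z \<noteq> 0 \<and> n = qnorm c z" by (intro exI[of _ "(x, y)"]) (auto simp: qnorm_def zero_prod_def)
  next
   assume "\<exists>z. z \<noteq> 0 \<and> n = qnorm c z"
   then show "n \<in> N c" using qnorm_eq_0[OF that] by (auto simp: N_def qnorm_def)
  qed
  show ?thesis
  proof (intro equalityI subsetI)
   fix y assume "y \<in> {n * m | n m. n \<in> N a \<and> m \<in> N b}"
   then obtain n m where y: "y = n * m" "n \<in> N a" "m \<in> N b" by blast
   from iffD1[OF N[OF a(1)] y(2)] obtain z where "z \<noteq> 0" "n = qnorm a z" by (elim exE conjE)
   moreover from iffD1[OF N[OF a(2)] y(3)] obtain w where "w \<noteq> 0" "m = qnorm b w" by (elim exE conjE)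
   ultimately show "y \<in> (\<lambda>p. qnorm a (fst p) * qnorm b (snd p)) ` {p. fst p \<noteq> 0 \<and> snd p \<noteq> 0}"
    by (intro image_eqI[of _ _ "(z, w)"]) (simp_all add: y(1))
  next
   fix y assume "y \<in> (\<lambda>p. qnorm a (fst p) * qnorm b (snd p)) ` {p. fst p \<noteq> 0 \<and> snd p \<noteq> 0}"
   then obtain p where p: "fst p \<noteq> 0" "snd p \<noteq> 0" "y = qnorm a (fst p) * qnorm b (snd p)" by blast
   have "qnorm a (fst p) \<in> N a" by (rule iffD2[OF N[OF a(1)]]) (intro exI[of _ "fst p"] conjI refl p)
   moreover have "qnorm b (snd p) \<in> N b" by (rule iffD2[OF N[OF a(2)]]) (intro exI[of _ "snd p"] conjI refl p)
   ultimately show "y \<in> {n * m | n m. n \<in> N a \<and> m \<in> N b}" unfolding p(3) by blast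
  qed
 qed
 finally show ?thesis .
qed

text \<open>In the square of \<open>w\<close> the mixed coordinate must vanish; a scalar
  \<open>w\<close> would make \<open>a\<close> a square, so \<open>w\<close> is a pure multiple of
  the square root of \<open>b\<close>.\<close>

lemma qmul_root:
 assumes "qmul b w w = (a, 0)" "\<not> is_square a"
 shows "fst w = 0 \<and> snd w \<noteq> 0 \<and> a = b * (snd w)\<^sup>2"
proof -
 have eq: "(fst w)\<^sup>2 + b * (snd w)\<^sup>2 = a" "fst w = 0 \<or> snd w = 0"
  using assms(1) by (auto simp: qmul_def power2_eq_square mult.assoc)
 have "snd w \<noteq> 0"
 proof
  assume "snd w = 0"
  then have "a = (fst w)\<^sup>2" using eq(1) by simp
  with assms(2) show False by (auto simp: is_square_def)
 qed
 then show ?thesis using eq by auto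
qed

lemma iso_Qalg_iff:
 assumes "\<not> is_square a"
 shows "alg_isomorphic F (Qalg a) (Qalg b) \<longleftrightarrow> cls a = cls b"
proof
 assume "alg_isomorphic F (Qalg a) (Qalg b)"
 then obtain f where f: "f \<in> alg_iso F (Qalg a) (Qalg b)" by (auto simp: alg_isomorphic_def)
 have "qmul b (f (0, 1)) (f (0, 1)) = f (a, 0)"
  using ring_hom_mult[OF alg_isoD(2)[OF f], of "(0, 1)" "(0, 1)"] by (simp add: qmul_def)
 also have "f (a, 0) = (a, 0)"
  using alg_isoD(4)[OF f, of "h a" "(1, 0)"] ring_hom_one[OF alg_isoD(2)[OF f]] by simp
 finally have "snd (f (0, 1)) \<noteq> 0 \<and> a = b * (snd (f (0, 1)))\<^sup>2" using qmul_root[OF _ assms] by blast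
 then show "cls a = cls b" unfolding cls_eq_iff by blast
next
 assume "cls a = cls b"
 then obtain s where "s \<noteq> 0" "a = b * s\<^sup>2" by (auto simp: cls_eq_iff)
 then show "alg_isomorphic F (Qalg a) (Qalg b)" using Qalg_scale by (auto simp: alg_isomorphic_def)
qed

text \<open>Rescales the two square roots independently. It serves as isomorphism between products
  with equivalent generators and, for signs, as conjugation on the factors.\<close>

definition st :: "'k => 'k => ('k \<times> 'k) \<times> ('k \<times> 'k) => ('k \<times> 'k) \<times> ('k \<times> 'k)" where
 "st s t p = ((fst (fst p), s * snd (fst p)), (fst (snd p), t * snd (snd p)))"

lemma st_iso:
 assumes "s \<noteq> 0" "t \<noteq> 0"
 shows "st s t \<in> alg_iso F (Pr (a * s\<^sup>2) (b * t\<^sup>2)) (Pr a b)"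
proof (rule alg_isoI)
 show "bij_betw (st s t) (carrier (Pr (a * s\<^sup>2) (b * t\<^sup>2))) (carrier (Pr a b))"
  by (rule bij_betw_byWitness[where f' = "st (1 / s) (1 / t)"]) (use assms in \<open>auto simp: st_def\<close>)
 show "st s t \<in> Ring.ring_hom (Pr (a * s\<^sup>2) (b * t\<^sup>2)) (Pr a b)"
  by (rule ring_hom_memI) (auto simp: st_def qmul_def plus_prod_def power2_eq_square algebra_simps)
qed (simp add: st_def)

lemma swap_iso: "prod.swap \<in> alg_iso F (Pr a b) (Pr b a)"
proof (rule alg_isoI)
 show "bij_betw prod.swap (carrier (Pr a b)) (carrier (Pr b a))"
  by (rule bij_betw_byWitness[where f' = prod.swap]) auto
 show "prod.swap \<in> Ring.ring_hom (Pr a b) (Pr b a)"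
  by (rule ring_hom_memI) auto
qed simp

text \<open>Fixing the idempotent of the first factor makes the isomorphism respect both factors,
  and on each the image of a square root is determined up to a scalar by
  \<open>qmul_root\<close>.\<close>

lemma straight_iso:
 assumes f: "f \<in> alg_iso F (Pr a b) (Pr a' b')" and ns: "\<not> is_square a" "\<not> is_square b"
  and E1: "f ((1, 0), 0) = ((1, 0), 0)"
 shows "\<exists>s t. s \<noteq> 0 \<and> t \<noteq> 0 \<and> a = a' * s\<^sup>2 \<and> b = b' * t\<^sup>2 \<and> f = st s t"
proof -
 have fm: "f (qmul a (fst p) (fst q), qmul b (snd p) (snd q)) =
   (qmul a' (fst (f p)) (fst (f q)), qmul b' (snd (f p)) (snd (f q)))" for p q
  using ring_hom_mult[OF alg_isoD(2)[OF f], of p q] by simp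
 have fa: "f (p + q) = f p + f q" for p q
  using ring_hom_add[OF alg_isoD(2)[OF f], of p q] by (simp add: plus_prod_def)
 have fs: "f ((c * fst (fst p), c * snd (fst p)), (c * fst (snd p), c * snd (snd p))) =
   ((c * fst (fst (f p)), c * snd (fst (f p))), (c * fst (snd (f p)), c * snd (snd (f p))))" for c p
  using alg_isoD(4)[OF f, of "h c" p] by simp
 have q0: "qmul c w 0 = 0" for c w by (simp add: qmul_def zero_prod_def)
 have "f ((1, 0), 0) + f (0, (1, 0)) = ((1, 0), (1, 0))"
  using fa[of "((1, 0), 0)" "(0, (1, 0))"] ring_hom_one[OF alg_isoD(2)[OF f]] by simp
 then have E2: "f (0, (1, 0)) = (0, (1, 0))" unfolding E1
  by (cases "f (0, (1, 0))") (auto simp: plus_prod_def zero_prod_def)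
 define p where "p = f ((0, 1), 0)"
 define q where "q = f (0, (0, 1))"
 have sp: "snd p = 0" using fm[of "((0, 1), 0)" "((1, 0), 0)"] unfolding E1 p_def[symmetric] by (simp add: q0 p_def[symmetric]) (metis snd_conv p_def)
 have sq: "fst q = 0" using fm[of "(0, (0, 1))" "(0, (1, 0))"] unfolding E2 q_def[symmetric] by (simp add: q0 q_def[symmetric]) (metis fst_conv q_def)
 have "f ((a, 0), 0) = ((a, 0), 0)" using fs[of a "((1, 0), 0)"] unfolding E1 by (simp add: zero_prod_def)
 then have "qmul a' (fst p) (fst p) = (a, 0)"
  using fm[of "((0, 1), 0)" "((0, 1), 0)"] unfolding p_def[symmetric] by (simp add: qmul_def zero_prod_def)
 from qmul_root[OF this ns(1)] have p: "fst (fst p) = 0" "snd (fst p) \<noteq> 0" "a = a' * (snd (fst p))\<^sup>2" by blast+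
 have "f (0, (b, 0)) = (0, (b, 0))" using fs[of b "(0, (1, 0))"] unfolding E2 by (simp add: zero_prod_def)
 then have "qmul b' (snd q) (snd q) = (b, 0)"
  using fm[of "(0, (0, 1))" "(0, (0, 1))"] unfolding q_def[symmetric] by (simp add: qmul_def zero_prod_def)
 from qmul_root[OF this ns(2)] have q: "fst (snd q) = 0" "snd (snd q) \<noteq> 0" "b = b' * (snd (snd q))\<^sup>2" by blast+
 have "f z = st (snd (fst p)) (snd (snd q)) z" for z
 proof -
  obtain x y u w where z: "z = ((x, y), (u, w))" by (metis prod.exhaust)
  have "z = (((x, 0), (0, 0)) + ((0, y), (0, 0))) + (((0, 0), (u, 0)) + ((0, 0), (0, w)))" by (simp add: z)
  then have "f z = (f ((x, 0), (0, 0)) + f ((0, y), (0, 0))) + (f ((0, 0), (u, 0)) + f ((0, 0), (0, w)))"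
   by (simp only: fa)
  moreover have "f ((x, 0), (0, 0)) = ((x, 0), (0, 0))" using fs[of x "((1, 0), 0)"] unfolding E1 by (simp add: zero_prod_def)
  moreover have "f ((0, 0), (u, 0)) = ((0, 0), (u, 0))" using fs[of u "(0, (1, 0))"] unfolding E2 by (simp add: zero_prod_def)
  moreover have "f ((0, y), (0, 0)) = ((0, y * snd (fst p)), (0, 0))"
   using fs[of y "((0, 1), 0)"] unfolding p_def[symmetric] by (simp add: zero_prod_def p(1) sp)
  moreover have "f ((0, 0), (0, w)) = ((0, 0), (0, w * snd (snd q)))"
   using fs[of w "(0, (0, 1))"] unfolding q_def[symmetric] by (simp add: zero_prod_def q(1) sq)
  ultimately show ?thesis by (simp add: st_def z mult.commute)
 qed
 then show ?thesis using p q by blast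
qed

lemma qmul_idem:
 assumes "qmul a z z = z" "\<not> is_square a"
 shows "z = 0 \<or> z = (1, 0)"
proof -
 obtain x y where z: "z = (x, y)" by fastforce
 have eq: "x * x + a * y * y = x" "2 * x * y = y" using assms(1) by (simp_all add: z qmul_def)
 show ?thesis
 proof (cases "y = 0")
  case True
  then have "x * (x - 1) = 0" using eq(1) by (simp add: algebra_simps)
  then show ?thesis using True z by (auto simp: zero_prod_def)
 next
  case False
  then have "2 * x = 1" using eq(2) by simp
  then have x: "x = 1 / 2" by (simp add: field_simps)
  have "a * y * y = x - x * x" using eq(1) by (simp add: eq_diff_eq add.commute)
  also have "\<dots> = 1 / 4" by (simp add: x)
  finally have "a * (2 * y)\<^sup>2 = 1" by (simp add: power2_eq_square mult_ac)
  then have "a = (1 / (2 * y))\<^sup>2" using False by (simp add: power2_eq_square field_simps)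
  then show ?thesis using assms(2) by (auto simp: is_square_def)
 qed
qed

text \<open>The image of the first idempotent is again an idempotent, different from 0 and 1, so it
  is one of the two factor idempotents; in the second case composing with the swap leads back to
  \<open>straight_iso\<close>.\<close>

lemma prod_iso_cases:
 assumes f: "f \<in> alg_iso F (Pr a b) (Pr a' b')"
  and ns: "\<not> is_square a" "\<not> is_square b" "\<not> is_square a'" "\<not> is_square b'"
 shows "(\<exists>s t. s \<noteq> 0 \<and> t \<noteq> 0 \<and> a = a' * s\<^sup>2 \<and> b = b' * t\<^sup>2 \<and> f = st s t) \<or>
  (\<exists>s t. s \<noteq> 0 \<and> t \<noteq> 0 \<and> a = b' * s\<^sup>2 \<and> b = a' * t\<^sup>2 \<and> f = prod.swap \<circ> st s t)"
proof -
 define w where "w = f ((1, 0), 0)"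
 have inj: "f x = f y ==> x = y" for x y using inj_onD[OF bij_betw_imp_inj_on[OF alg_isoD(3)[OF f]], of x y] by simp
 have "((1, 0), 0) \<otimes>\<^bsub>Pr a b\<^esub> ((1, 0), 0) = ((1, 0), 0)" by (simp add: qmul_def zero_prod_def)
 then have "w \<otimes>\<^bsub>Pr a' b'\<^esub> w = w" unfolding w_def using ring_hom_mult[OF alg_isoD(2)[OF f], of "((1, 0), 0)" "((1, 0), 0)"] by simp
 then have "qmul a' (fst w) (fst w) = fst w" "qmul b' (snd w) (snd w) = snd w" by (simp_all add: prod_eq_iff)
 then have cases: "fst w = 0 \<or> fst w = (1, 0)" "snd w = 0 \<or> snd w = (1, 0)" using qmul_idem ns by blast+
 have "w \<noteq> (0, 0)"
 proof
  assume "w = (0, 0)"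
  then have "f ((1, 0), 0) = f (0, 0)" using iso_zero[OF algebra_Pr algebra_Pr f] by (simp add: w_def)
  then show False using inj by (fastforce simp: zero_prod_def)
 qed
 moreover have "w \<noteq> ((1, 0), (1, 0))"
 proof
  assume "w = ((1, 0), (1, 0))"
  then have "f ((1, 0), 0) = f ((1, 0), (1, 0))" using ring_hom_one[OF alg_isoD(2)[OF f]] by (simp add: w_def)
  then show False using inj by (fastforce simp: zero_prod_def)
 qed
 ultimately consider "w = ((1, 0), 0)" | "w = (0, (1, 0))" using cases by (cases w) auto
 then show ?thesis
 proof cases
  case 1
  then show ?thesis using straight_iso[OF f ns(1,2)] by (simp add: w_def)
 next
  case 2
  have "prod.swap \<circ> f \<in> alg_iso F (Pr a b) (Pr b' a')" by (rule alg_iso_comp[OF f swap_iso])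
  moreover have "(prod.swap \<circ> f) ((1, 0), 0) = ((1, 0), 0)" using 2 by (simp add: w_def)
  ultimately obtain s t where st: "s \<noteq> 0" "t \<noteq> 0" "a = b' * s\<^sup>2" "b = a' * t\<^sup>2" "prod.swap \<circ> f = st s t"
   using straight_iso[OF _ ns(1,2)] by blast
  have "f = prod.swap \<circ> (prod.swap \<circ> f)" by (simp add: fun_eq_iff)
  then have "f = prod.swap \<circ> st s t" unfolding st(5) .
  then show ?thesis using st(1-4) by (intro disjI2 exI[of _ s] exI[of _ t]) simp
 qed
qed

lemma alg_isomorphic_Pr_iff:
 assumes ns: "\<not> is_square a" "\<not> is_square b" "\<not> is_square a'" "\<not> is_square b'"
 shows "alg_isomorphic F (Pr a b) (Pr a' b') \<longleftrightarrow> {cls a, cls b} = {cls a', cls b'}"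
proof
 assume "alg_isomorphic F (Pr a b) (Pr a' b')"
 then obtain f where "f \<in> alg_iso F (Pr a b) (Pr a' b')" by (auto simp: alg_isomorphic_def)
 from prod_iso_cases[OF this ns] show "{cls a, cls b} = {cls a', cls b'}"
 proof (elim disjE exE conjE)
  fix s t assume "s \<noteq> 0" "t \<noteq> 0" "a = a' * s\<^sup>2" "b = b' * t\<^sup>2"
  then have "cls a = cls a'" "cls b = cls b'" unfolding cls_eq_iff by blast+
  then show ?thesis by simp
 next
  fix s t assume "s \<noteq> 0" "t \<noteq> 0" "a = b' * s\<^sup>2" "b = a' * t\<^sup>2"
  then have "cls a = cls b'" "cls b = cls a'" unfolding cls_eq_iff by blast+
  then show ?thesis by (simp add: insert_commute)
 qed
next
 assume "{cls a, cls b} = {cls a', cls b'}"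
 then consider "cls a = cls a'" "cls b = cls b'" | "cls a = cls b'" "cls b = cls a'" by (auto simp: doubleton_eq_iff)
 then show "alg_isomorphic F (Pr a b) (Pr a' b')"
 proof cases
  case 1
  then obtain s t where st: "s \<noteq> 0" "t \<noteq> 0" "a = a' * s\<^sup>2" "b = b' * t\<^sup>2" by (auto simp: cls_eq_iff)
  then show ?thesis using st_iso[OF st(1,2)] by (auto simp: alg_isomorphic_def)
 next
  case 2
  then obtain s t where st: "s \<noteq> 0" "t \<noteq> 0" "a = b' * s\<^sup>2" "b = a' * t\<^sup>2" by (auto simp: cls_eq_iff)
  then show ?thesis using alg_iso_comp[OF st_iso[OF st(1,2)] swap_iso] by (auto simp: alg_isomorphic_def)
 qed
qed

text \<open>There are two signs on each factor, and the exchange of the factors exists only when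
  they are isomorphic.\<close>

lemma card_alg_aut_Pr:
 assumes ns: "\<not> is_square a" "\<not> is_square b"
 shows "card (alg_aut F (Pr a b)) = (if cls a = cls b then 8 else 4)"
proof -
 have a0: "a \<noteq> 0" "b \<noteq> 0" using ns by (auto simp: is_square_def)
 define W where "W c s t = (if c then st s t else prod.swap \<circ> st s t)" for c s t
 have W_inj: "inj (\<lambda>(c, s, t). W c s t)"
 proof (rule injI)
  fix p p' assume "(\<lambda>(c, s, t). W c s t) p = (\<lambda>(c, s, t). W c s t) p'"
  moreover obtain c s t c' s' t' where p: "p = (c, s, t)" "p' = (c', s', t')" by (metis prod.exhaust)
  ultimately have eq: "W c s t = W c' s' t'" by simp
  have "c = c'" using fun_cong[OF eq, of "((1, 0), 0)"] by (auto simp: W_def st_def split: if_splits)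
  then show "p = p'" using fun_cong[OF eq, of "((0, 1), (0, 1))"] by (auto simp: p W_def st_def split: if_splits)
 qed
 have sq1: "s = 1 \<or> s = - 1" if "c = c * s\<^sup>2" "c \<noteq> 0" for c s :: 'k
  using that by (auto simp: power2_eq_1_iff)
 have aut: "alg_aut F (Pr c d) = alg_iso F (Pr c d) (Pr c d)" for c d by (auto simp: alg_aut_def)
 show ?thesis
 proof (cases "cls a = cls b")
  case True
  then obtain u where u: "u \<noteq> 0" "a = b * u\<^sup>2" by (auto simp: cls_eq_iff)
  \<comment> \<open>With equal generators the swap is a map of the product to itself, so the
    automorphisms can be listed.\<close>
  have "st u 1 \<in> alg_iso F (Pr a b) (Pr b b)" using st_iso[OF u(1), of 1 b b] u(2) by simp
  then have "card (alg_aut F (Pr a b)) = card (alg_aut F (Pr b b))"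
   by (rule card_alg_aut_iso[OF algebra_Pr algebra_Pr, symmetric])
  also have "alg_aut F (Pr b b) = (\<lambda>(c, s, t). W c s t) ` (UNIV \<times> {1, - 1} \<times> {1, - 1})"
  proof (intro equalityI subsetI)
   fix f assume "f \<in> alg_aut F (Pr b b)"
   then have "f \<in> alg_iso F (Pr b b) (Pr b b)" by (simp add: aut)
   from prod_iso_cases[OF this ns(2) ns(2) ns(2) ns(2)]
   have "\<exists>c s t. b = b * s\<^sup>2 \<and> b = b * t\<^sup>2 \<and> f = W c s t"
   proof (elim disjE exE conjE)
    fix s t assume "b = b * s\<^sup>2" "b = b * t\<^sup>2" "f = st s t"
    then show ?thesis by (intro exI[of _ True] exI[of _ s] exI[of _ t]) (simp add: W_def)
   next
    fix s t assume "b = b * s\<^sup>2" "b = b * t\<^sup>2" "f = prod.swap \<circ> st s t"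
    then show ?thesis by (intro exI[of _ False] exI[of _ s] exI[of _ t]) (simp add: W_def)
   qed
   then obtain c s t where "b = b * s\<^sup>2" "b = b * t\<^sup>2" "f = W c s t" by blast
   moreover from this have "s = 1 \<or> s = - 1" "t = 1 \<or> t = - 1" using sq1 a0 by blast+
   ultimately show "f \<in> (\<lambda>(c, s, t). W c s t) ` (UNIV \<times> {1, - 1} \<times> {1, - 1})"
    by (intro image_eqI[of _ _ "(c, s, t)"]) auto
  next
   fix f assume "f \<in> (\<lambda>(c, s, t). W c s t) ` (UNIV \<times> {1, - 1} \<times> {1, - 1})"
   then obtain c s t where st: "f = W c s t" "s \<in> {1, - 1}" "t \<in> {1, - 1}" by auto
   then have *: "b * s\<^sup>2 = b" "b * t\<^sup>2 = b" "s \<noteq> 0" "t \<noteq> 0" by auto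
   have "st s t \<in> alg_iso F (Pr b b) (Pr b b)" using st_iso[OF *(3,4), of b b] unfolding *(1,2) .
   then show "f \<in> alg_aut F (Pr b b)" unfolding aut st(1) W_def using alg_iso_comp[OF _ swap_iso] by auto
  qed
  also have "card \<dots> = card ((UNIV :: bool set) \<times> {1, - 1 :: 'k} \<times> {1, - 1 :: 'k})"
   by (rule card_image[OF inj_on_subset[OF W_inj]]) simp
  finally show ?thesis using True by (simp add: card_cartesian_product)
 next
  case False
  have "alg_aut F (Pr a b) = (\<lambda>(c, s, t). W c s t) ` ({True} \<times> {1, - 1} \<times> {1, - 1})"
  proof (intro equalityI subsetI)
   fix f assume "f \<in> alg_aut F (Pr a b)"
   then have "f \<in> alg_iso F (Pr a b) (Pr a b)" by (simp add: aut)
   from prod_iso_cases[OF this ns ns]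
   have "\<exists>s t. a = a * s\<^sup>2 \<and> b = b * t\<^sup>2 \<and> f = W True s t"
   proof (elim disjE exE conjE)
    fix s t assume "a = a * s\<^sup>2" "b = b * t\<^sup>2" "f = st s t"
    then show ?thesis by (intro exI[of _ s] exI[of _ t]) (simp add: W_def)
   next
    fix s t assume "s \<noteq> 0" "a = b * s\<^sup>2"
    then have "cls a = cls b" unfolding cls_eq_iff by blast
    with False show ?thesis by blast
   qed
   then obtain s t where "a = a * s\<^sup>2" "b = b * t\<^sup>2" "f = W True s t" by blast
   moreover from this have "s = 1 \<or> s = - 1" "t = 1 \<or> t = - 1" using sq1 a0 by blast+
   ultimately show "f \<in> (\<lambda>(c, s, t). W c s t) ` ({True} \<times> {1, - 1} \<times> {1, - 1})"
    by (intro image_eqI[of _ _ "(True, s, t)"]) auto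
  next
   fix f assume "f \<in> (\<lambda>(c, s, t). W c s t) ` ({True} \<times> {1, - 1} \<times> {1, - 1})"
   then obtain s t where st: "f = W True s t" "s \<in> {1, - 1}" "t \<in> {1, - 1}" by auto
   then have *: "a * s\<^sup>2 = a" "b * t\<^sup>2 = b" "s \<noteq> 0" "t \<noteq> 0" by auto
   have "st s t \<in> alg_iso F (Pr a b) (Pr a b)" using st_iso[OF *(3,4), of a b] unfolding *(1,2) .
   then show "f \<in> alg_aut F (Pr a b)" unfolding aut st(1) W_def by simp
  qed
  then have "card (alg_aut F (Pr a b)) = card ({True} \<times> {1, - 1 :: 'k} \<times> {1, - 1 :: 'k})"
   using card_image[OF inj_on_subset[OF W_inj], of "{True} \<times> {1, - 1} \<times> {1, - 1}"] by simp
  then show ?thesis using False by (simp add: card_cartesian_product)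
 qed
qed

end

section \<open>The 2-adic absolute value\<close>

lemma rat_fraction: "\<exists>a b. b \<noteq> 0 \<and> x = rat_of_int a / rat_of_int b"
proof -
 obtain a b where ab: "quotient_of x = (a, b)" by fastforce
 show ?thesis using quotient_of_denom_pos[OF ab] quotient_of_div[OF ab] by (intro exI[of _ a] exI[of _ b]) simp
qed

lemma val2_fraction:
 assumes "a \<noteq> 0" "b \<noteq> 0"
 shows "val2 (rat_of_int a / rat_of_int b) = int (multiplicity 2 a) - int (multiplicity 2 b)"
proof -
 obtain n d where nd: "quotient_of (rat_of_int a / rat_of_int b) = (n, d)" by fastforce
 have d: "d > 0" using quotient_of_denom_pos[OF nd] .
 have "rat_of_int a / rat_of_int b = rat_of_int n / rat_of_int d" using quotient_of_div[OF nd] .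
 then have "rat_of_int (a * d) = rat_of_int (n * b)" using assms d by (simp add: field_simps)
 then have eq: "a * d = n * b" by (simp only: of_int_eq_iff)
 then have n: "n \<noteq> 0" using assms d by auto
 have "multiplicity 2 (a * d) = multiplicity 2 (n * b)" using eq by simp
 then have "multiplicity 2 a + multiplicity 2 d = multiplicity 2 n + multiplicity 2 b"
  using assms n d by (simp add: prime_elem_multiplicity_mult_distrib)
 then show ?thesis by (simp add: val2_def nd)
qed

lemma abs2_fraction:
 assumes "a \<noteq> 0" "b \<noteq> 0"
 shows "abs2 (rat_of_int a / rat_of_int b) = 2 powi (int (multiplicity 2 b) - int (multiplicity 2 a))"
 using assms by (simp add: abs2_def val2_fraction)

lemma abs2_0 [simp]: "abs2 0 = 0" by (simp add: abs2_def)

lemma abs2_nonneg [simp]: "0 \<le> abs2 x" by (simp add: abs2_def)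

lemma abs2_pos: "x \<noteq> 0 ==> 0 < abs2 x" by (simp add: abs2_def)

lemma abs2_mult: "abs2 (x * y) = abs2 x * abs2 y"
proof (cases "x = 0 \<or> y = 0")
 case False
 obtain a b c d where f: "b \<noteq> 0" "x = rat_of_int a / rat_of_int b" "d \<noteq> 0" "y = rat_of_int c / rat_of_int d"
  using rat_fraction by metis
 have ac: "a \<noteq> 0" "c \<noteq> 0" using False f by auto
 have xy: "x * y = rat_of_int (a * c) / rat_of_int (b * d)" by (simp add: f)
 have m: "multiplicity 2 (a * c) = multiplicity 2 a + multiplicity 2 c" "multiplicity 2 (b * d) = multiplicity 2 b + multiplicity 2 d"
  using ac f by (simp_all add: prime_elem_multiplicity_mult_distrib)
 have "abs2 (x * y) = 2 powi (int (multiplicity 2 b + multiplicity 2 d) - int (multiplicity 2 a + multiplicity 2 c))"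
  unfolding xy m[symmetric] by (rule abs2_fraction) (use ac f in auto)
 also have "\<dots> = 2 powi (int (multiplicity 2 b) - int (multiplicity 2 a)) * 2 powi (int (multiplicity 2 d) - int (multiplicity 2 c))"
  by (subst power_int_add[symmetric]) (auto simp: algebra_simps)
 also have "\<dots> = abs2 x * abs2 y" unfolding f(2,4) using ac f by (simp add: abs2_fraction)
 finally show ?thesis .
qed auto

lemma abs2_1 [simp]: "abs2 1 = 1"
 using abs2_fraction[of 1 1] by simp

lemma abs2_minus [simp]: "abs2 (- x) = abs2 x"
proof -
 have "(abs2 (- 1))\<^sup>2 = 1\<^sup>2" using abs2_mult[of "- 1" "- 1"] by (simp add: power2_eq_square)
 then have "abs2 (- 1) = 1" by (rule power2_eq_imp_eq) simp_all
 then show ?thesis using abs2_mult[of "- 1" x] by simp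
qed

lemma abs2_two_power: "abs2 (2 ^ k) = 1 / 2 ^ k"
proof (induction k)
 case (Suc k)
 have two: "abs2 2 = 1 / 2" using abs2_fraction[of 2 1] by (simp add: power_int_minus)
 show ?case unfolding power_Suc abs2_mult Suc two by simp
qed simp

lemma abs2_divide_two_power: "abs2 (x / 2 ^ k) = 2 ^ k * abs2 x"
proof -
 have "abs2 (x / 2 ^ k * 2 ^ k) = abs2 (x / 2 ^ k) * (1 / 2 ^ k)" unfolding abs2_mult abs2_two_power ..
 then show ?thesis by (simp add: field_simps)
qed

lemma abs2_add: "abs2 (x + y) \<le> max (abs2 x) (abs2 y)"
proof (cases "x = 0 \<or> y = 0 \<or> x + y = 0")
 case True
 then show ?thesis by (auto simp: le_max_iff_disj)
next
 case False
 obtain a b c d where f: "b \<noteq> 0" "x = rat_of_int a / rat_of_int b" "d \<noteq> 0" "y = rat_of_int c / rat_of_int d"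
  using rat_fraction by metis
 have bd: "b * d \<noteq> 0" using f by simp
 have x: "x = rat_of_int (a * d) / rat_of_int (b * d)" and y: "y = rat_of_int (c * b) / rat_of_int (b * d)"
  using f by (simp_all add: mult.commute)
 have xy: "x + y = rat_of_int (a * d + c * b) / rat_of_int (b * d)" unfolding x y by (simp add: add_divide_distrib)
 have nz: "a * d \<noteq> 0" "c * b \<noteq> 0" "a * d + c * b \<noteq> 0" using False x y xy by (metis div_0 of_int_0)+
 define k where "k = min (multiplicity 2 (a * d)) (multiplicity 2 (c * b))"
 have "2 ^ k dvd a * d + c * b" by (rule dvd_add) (auto simp: k_def intro: multiplicity_dvd')
 then have k: "k \<le> multiplicity 2 (a * d + c * b)" using nz by (intro multiplicity_geI) auto
 have "(2::real) powi (int (multiplicity 2 (b * d)) - int (multiplicity 2 (a * d + c * b))) \<le> 2 powi (int (multiplicity 2 (b * d)) - int k)"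
  using k by (intro power_int_increasing) auto
 also have "\<dots> \<le> max (abs2 x) (abs2 y)"
  unfolding x y abs2_fraction[OF nz(1) bd] abs2_fraction[OF nz(2) bd] by (auto simp: k_def min_def)
 finally show ?thesis unfolding xy abs2_fraction[OF nz(3) bd] .
qed

lemma abs2_diff: "abs2 (x - y) \<le> max (abs2 x) (abs2 y)"
 using abs2_add[of x "- y"] by simp

lemma abs2_add_le: "abs2 x \<le> c ==> abs2 y \<le> c ==> abs2 (x + y) \<le> c"
 using abs2_add[of x y] by simp

lemma abs2_add_less: "abs2 x < c ==> abs2 y < c ==> abs2 (x + y) < c"
 using abs2_add[of x y] by simp

lemma abs2_diff_le: "abs2 x \<le> c ==> abs2 y \<le> c ==> abs2 (x - y) \<le> c"
 using abs2_diff[of x y] by simp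

lemma abs2_of_int_le: "abs2 (rat_of_int a) \<le> 1"
proof (cases "a = 0")
 case False
 then have "abs2 (rat_of_int a) = 2 powi (- int (multiplicity 2 a))" using abs2_fraction[of a 1] by simp
 also have "\<dots> \<le> 2 powi 0" by (rule power_int_increasing) auto
 finally show ?thesis by simp
qed simp

text \<open>In lowest terms the denominator of \<open>q\<close> is odd, so the parity of the
  numerator is the last binary digit of \<open>q\<close>.\<close>

lemma abs2_half:
 assumes q: "abs2 q \<le> 1"
 shows "\<exists>\<epsilon>\<in>{0, 1}. abs2 ((q - \<epsilon>) / 2) \<le> 1"
proof (cases "q = 0")
 case False
 obtain a b where ab: "quotient_of q = (a, b)" by fastforce
 have b: "b > 0" "coprime a b" and q_eq: "q = rat_of_int a / rat_of_int b"
  using quotient_of_denom_pos[OF ab] quotient_of_coprime[OF ab] quotient_of_div[OF ab] by auto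
 have a: "a \<noteq> 0" using False q_eq by auto
 have odd: "odd b"
 proof
  assume ev: "even b"
  then have "odd a" using b(2) by (metis coprime_common_divisor odd_one)
  then have "multiplicity 2 a = 0" by (rule not_dvd_imp_multiplicity_0)
  moreover have "1 \<le> multiplicity 2 b" using ev b by (intro multiplicity_geI) auto
  then have "(2::real) ^ 1 \<le> 2 ^ multiplicity 2 b" by (rule power_increasing) simp
  ultimately have "2 \<le> abs2 q" unfolding q_eq using a b by (subst abs2_fraction) auto
  with q show False by simp
 qed
 then have "multiplicity 2 b = 0" by (rule not_dvd_imp_multiplicity_0)
 then have "abs2 (1 / rat_of_int b) = 1" using abs2_fraction[of 1 b] b by simp
 then have le: "abs2 (rat_of_int c / rat_of_int b) \<le> 1" for c
  using abs2_mult[of "rat_of_int c" "1 / rat_of_int b"] abs2_of_int_le[of c] by simp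
 show ?thesis
 proof (cases "even a")
  case True
  then obtain c where "a = 2 * c" by blast
  then have "(q - 0) / 2 = rat_of_int c / rat_of_int b" by (simp add: q_eq)
  then show ?thesis using le by (intro bexI[of _ 0]) simp_all
 next
  case False
  then have "even (a - b)" using odd by simp
  then obtain c where c: "a - b = 2 * c" by blast
  have "(q - 1) / 2 = rat_of_int (a - b) / (2 * rat_of_int b)" using b by (simp add: q_eq field_simps)
  then have "(q - 1) / 2 = rat_of_int c / rat_of_int b" by (simp add: c)
  then show ?thesis using le by (intro bexI[of _ 1]) simp_all
 qed
qed simp

section \<open>Cauchy sequences and null sequences\<close>

lemma cauchy2D: "s \<in> cauchy2 ==> 0 < \<epsilon> ==> \<exists>N. \<forall>m\<ge>N. \<forall>n\<ge>N. abs2 (s m - s n) < \<epsilon>"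
 by (simp add: cauchy2_def)

lemma null2D: "s \<in> null2 ==> 0 < \<epsilon> ==> \<exists>N. \<forall>n\<ge>N. abs2 (s n) < \<epsilon>"
 by (simp add: null2_def)

lemma const_cauchy2: "(\<lambda>_. c) \<in> cauchy2"
 by (simp add: cauchy2_def)

lemma null2_cauchy2: "s \<in> null2 ==> s \<in> cauchy2"
 unfolding cauchy2_def
proof (intro CollectI allI impI)
 fix \<epsilon> :: real assume s: "s \<in> null2" and "0 < \<epsilon>"
 then obtain N where "\<forall>n\<ge>N. abs2 (s n) < \<epsilon>" using null2D by blast
 then have "\<forall>m\<ge>N. \<forall>n\<ge>N. abs2 (s m - s n) < \<epsilon>" using abs2_diff by (meson max_less_iff_conj le_less_trans)
 then show "\<exists>N. \<forall>m\<ge>N. \<forall>n\<ge>N. abs2 (s m - s n) < \<epsilon>" by blast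
qed

lemma cauchy2_bounded:
 assumes s: "s \<in> cauchy2"
 shows "\<exists>k::nat. \<forall>n. abs2 (s n) \<le> 2 ^ k"
proof -
 obtain N where N: "\<forall>m\<ge>N. \<forall>n\<ge>N. abs2 (s m - s n) < 1" using cauchy2D[OF s, of 1] by auto
 define M where "M = 1 + (\<Sum>n\<le>N. abs2 (s n))"
 have le: "abs2 (s n) \<le> M" for n
 proof (cases "n \<le> N")
  case True
  then have "abs2 (s n) \<le> (\<Sum>n\<le>N. abs2 (s n))" by (intro member_le_sum) auto
  then show ?thesis by (simp add: M_def)
 next
  case False
  have "abs2 (s N) \<le> (\<Sum>n\<le>N. abs2 (s n))" by (intro member_le_sum) auto
  moreover have "abs2 (s n - s N) < 1" using N False by simp
  moreover have "0 \<le> (\<Sum>n\<le>N. abs2 (s n))" by (intro sum_nonneg) auto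
  ultimately show ?thesis using abs2_add[of "s n - s N" "s N"] by (simp add: M_def)
 qed
 obtain k where "M < 2 ^ k" using real_arch_pow[of 2 M] by auto
 then show ?thesis using le by (intro exI[of _ k] allI) (meson less_imp_le order_trans)
qed

lemma add_cauchy2:
 assumes "s \<in> cauchy2" "t \<in> cauchy2"
 shows "(\<lambda>n. s n + t n) \<in> cauchy2"
 unfolding cauchy2_def
proof (intro CollectI allI impI)
 fix \<epsilon> :: real assume "0 < \<epsilon>"
 then obtain N N' where N: "\<forall>m\<ge>N. \<forall>n\<ge>N. abs2 (s m - s n) < \<epsilon>" "\<forall>m\<ge>N'. \<forall>n\<ge>N'. abs2 (t m - t n) < \<epsilon>"
  using cauchy2D assms by metis
 have "abs2 (s m + t m - (s n + t n)) < \<epsilon>" if "max N N' \<le> m" "max N N' \<le> n" for m n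
  using abs2_add_less[of "s m - s n" \<epsilon> "t m - t n"] N that by (simp add: algebra_simps)
 then show "\<exists>N. \<forall>m\<ge>N. \<forall>n\<ge>N. abs2 (s m + t m - (s n + t n)) < \<epsilon>" by blast
qed

lemma mult_cauchy2:
 assumes s: "s \<in> cauchy2" and t: "t \<in> cauchy2"
 shows "(\<lambda>n. s n * t n) \<in> cauchy2"
 unfolding cauchy2_def
proof (intro CollectI allI impI)
 fix \<epsilon> :: real assume e: "0 < \<epsilon>"
 obtain j k where jk: "\<And>n. abs2 (s n) \<le> 2 ^ j" "\<And>n. abs2 (t n) \<le> 2 ^ k" using cauchy2_bounded assms by metis
 have "0 < \<epsilon> / 2 ^ j" "0 < \<epsilon> / 2 ^ k" using e by simp_all
 then obtain N N' where N: "\<forall>m\<ge>N. \<forall>n\<ge>N. abs2 (s m - s n) < \<epsilon> / 2 ^ k" "\<forall>m\<ge>N'. \<forall>n\<ge>N'. abs2 (t m - t n) < \<epsilon> / 2 ^ j"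
  using cauchy2D assms by metis
 have "abs2 (s m * t m - s n * t n) < \<epsilon>" if mn: "max N N' \<le> m" "max N N' \<le> n" for m n
 proof -
  have lt: "abs2 (t m - t n) < \<epsilon> / 2 ^ j" "abs2 (s m - s n) < \<epsilon> / 2 ^ k" using N mn by simp_all
  have "abs2 (s m) * abs2 (t m - t n) \<le> 2 ^ j * abs2 (t m - t n)" by (rule mult_right_mono[OF jk(1)]) simp
  also have "\<dots> < \<epsilon>" using lt(1) by (simp add: field_simps)
  finally have 1: "abs2 (s m * (t m - t n)) < \<epsilon>" by (simp add: abs2_mult)
  have "abs2 (t n) * abs2 (s m - s n) \<le> 2 ^ k * abs2 (s m - s n)" by (rule mult_right_mono[OF jk(2)]) simp
  also have "\<dots> < \<epsilon>" using lt(2) by (simp add: field_simps)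
  finally have 2: "abs2 (t n * (s m - s n)) < \<epsilon>" by (simp add: abs2_mult)
  show ?thesis using abs2_add_less[OF 1 2] by (simp add: algebra_simps)
 qed
 then show "\<exists>N. \<forall>m\<ge>N. \<forall>n\<ge>N. abs2 (s m * t m - s n * t n) < \<epsilon>" by blast
qed

lemma scale_cauchy2: "s \<in> cauchy2 ==> (\<lambda>n. c * s n) \<in> cauchy2"
 by (rule mult_cauchy2[OF const_cauchy2])

lemma uminus_cauchy2: "s \<in> cauchy2 ==> (\<lambda>n. - s n) \<in> cauchy2"
 using scale_cauchy2[of s "- 1"] by simp

lemma diff_cauchy2: "s \<in> cauchy2 ==> t \<in> cauchy2 ==> (\<lambda>n. s n - t n) \<in> cauchy2"
 using add_cauchy2[OF _ uminus_cauchy2, of s t] by simp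

lemma eventually_eq_null2: "(\<And>n. N \<le> n ==> s n = 0) ==> s \<in> null2"
 unfolding null2_def by (auto intro!: exI[of _ N])

lemma add_null2:
 assumes "s \<in> null2" "t \<in> null2"
 shows "(\<lambda>n. s n + t n) \<in> null2"
 unfolding null2_def
proof (intro CollectI allI impI)
 fix \<epsilon> :: real assume "0 < \<epsilon>"
 then obtain N N' where N: "\<forall>n\<ge>N. abs2 (s n) < \<epsilon>" "\<forall>n\<ge>N'. abs2 (t n) < \<epsilon>" using null2D assms by metis
 then have "\<forall>n\<ge>max N N'. abs2 (s n + t n) < \<epsilon>" by (simp add: abs2_add_less)
 then show "\<exists>N. \<forall>n\<ge>N. abs2 (s n + t n) < \<epsilon>" by blast
qed

lemma mult_null2:
 assumes s: "s \<in> cauchy2" and t: "t \<in> null2"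
 shows "(\<lambda>n. s n * t n) \<in> null2"
 unfolding null2_def
proof (intro CollectI allI impI)
 fix \<epsilon> :: real assume e: "0 < \<epsilon>"
 obtain j where j: "\<And>n. abs2 (s n) \<le> 2 ^ j" using cauchy2_bounded s by metis
 have "0 < \<epsilon> / 2 ^ j" using e by simp
 then obtain N where N: "\<forall>n\<ge>N. abs2 (t n) < \<epsilon> / 2 ^ j" using null2D t by blast
 have "abs2 (s n * t n) < \<epsilon>" if "N \<le> n" for n
 proof -
  have "abs2 (s n) * abs2 (t n) \<le> 2 ^ j * abs2 (t n)" by (rule mult_right_mono[OF j]) simp
  also have "\<dots> < \<epsilon>" using N that by (simp add: field_simps)
  finally show ?thesis by (simp add: abs2_mult)
 qed
 then show "\<exists>N. \<forall>n\<ge>N. abs2 (s n * t n) < \<epsilon>" by blast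
qed

lemma uminus_null2: "s \<in> null2 ==> (\<lambda>n. - s n) \<in> null2"
 by (simp add: null2_def)

section \<open>Fields over the 2-adic numbers\<close>

text \<open>An embedding of the 2-adic numbers into the field type, expressed on Cauchy sequences
  with the null sequences as kernel; this keeps cosets out of the analysis.\<close>

locale two_adic_embedding =
 fixes \<psi> :: "(nat => rat) => 'k::field_char_0"
 assumes psi_add: "s \<in> cauchy2 ==> t \<in> cauchy2 ==> \<psi> (\<lambda>n. s n + t n) = \<psi> s + \<psi> t"
  and psi_mult: "s \<in> cauchy2 ==> t \<in> cauchy2 ==> \<psi> (\<lambda>n. s n * t n) = \<psi> s * \<psi> t"
  and psi_one: "\<psi> (\<lambda>_. 1) = 1"
  and psi_zero_iff: "s \<in> cauchy2 ==> \<psi> s = 0 \<longleftrightarrow> s \<in> null2"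
begin

definition Q :: "'k set" where "Q = \<psi> ` cauchy2"

definition Z :: "'k set" where "Z = \<psi> ` {s \<in> cauchy2. \<forall>n. abs2 (s n) \<le> 1}"

lemma psi_minus: "s \<in> cauchy2 ==> \<psi> (\<lambda>n. - s n) = - \<psi> s"
proof -
 assume s: "s \<in> cauchy2"
 have "\<psi> (\<lambda>n. - s n + s n) = 0"
  by (subst psi_zero_iff) (auto simp: const_cauchy2 intro: eventually_eq_null2)
 then show ?thesis using psi_add[OF uminus_cauchy2[OF s] s] by (simp add: add_eq_0_iff)
qed

lemma psi_diff: "s \<in> cauchy2 ==> t \<in> cauchy2 ==> \<psi> (\<lambda>n. s n - t n) = \<psi> s - \<psi> t"
 using psi_add[OF _ uminus_cauchy2, of s t] psi_minus[of t] by simp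

lemma psi_eq_iff: "s \<in> cauchy2 ==> t \<in> cauchy2 ==> \<psi> s = \<psi> t \<longleftrightarrow> (\<lambda>n. s n - t n) \<in> null2"
 using psi_zero_iff[OF diff_cauchy2, of s t] by (simp add: psi_diff)

lemma psi_eq: "s \<in> cauchy2 ==> t \<in> cauchy2 ==> (\<And>n. N \<le> n ==> s n = t n) ==> \<psi> s = \<psi> t"
 by (subst psi_eq_iff) (auto intro: eventually_eq_null2[of N])

lemma psi_zero: "\<psi> (\<lambda>_. 0) = 0"
 by (subst psi_zero_iff) (auto simp: const_cauchy2 intro: eventually_eq_null2)

lemma psi_of_nat: "\<psi> (\<lambda>_. of_nat n) = of_nat n"
proof (induction n)
 case (Suc n)
 then show ?case using psi_add[OF const_cauchy2[of 1] const_cauchy2[of "of_nat n"]] by (simp add: psi_one)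
qed (simp add: psi_zero)

lemma psi_of_int: "\<psi> (\<lambda>_. of_int a) = of_int a"
 using psi_of_nat psi_minus[OF const_cauchy2] by (cases a rule: int_cases2) simp_all

lemma psi_const: "\<psi> (\<lambda>_. q) = of_rat q"
proof -
 obtain a b where ab: "b \<noteq> 0" "q = rat_of_int a / rat_of_int b" using rat_fraction by blast
 have "\<psi> (\<lambda>_. q) * \<psi> (\<lambda>_. of_int b) = \<psi> (\<lambda>_. of_int a)"
  using psi_mult[OF const_cauchy2[of q] const_cauchy2[of "of_int b"]] ab by simp
 then have "\<psi> (\<lambda>_. q) = of_int a / of_int b" using ab(1) unfolding psi_of_int by (simp add: field_simps)
 then show ?thesis by (simp add: ab(2) of_rat_divide)
qed

text \<open>Only the tail matters: replacing the first \<open>N\<close> terms by 0 alters the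
  sequence by a null sequence.\<close>

lemma in_Z:
 assumes s: "s \<in> cauchy2" and le: "\<And>n. N \<le> n ==> abs2 (s n) \<le> 1"
 shows "\<psi> s \<in> Z"
proof -
 define t where "t n = (if N \<le> n then s n else 0)" for n
 have "(\<lambda>n. t n - s n) \<in> null2" by (rule eventually_eq_null2[of N]) (simp add: t_def)
 then have t: "(\<lambda>n. s n + (t n - s n)) \<in> cauchy2" by (intro add_cauchy2[OF s] null2_cauchy2)
 then have t: "t \<in> cauchy2" by simp
 have "\<psi> s = \<psi> t" by (rule psi_eq[OF s t, of N]) (simp add: t_def)
 moreover have "\<forall>n. abs2 (t n) \<le> 1" using le by (simp add: t_def)
 ultimately show ?thesis using t by (simp add: Z_def)
qed

lemma Z_sub_Q: "Z \<subseteq> Q" by (auto simp: Z_def Q_def)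

lemma ZD: "x \<in> Z ==> \<exists>s. s \<in> cauchy2 \<and> (\<forall>n. abs2 (s n) \<le> 1) \<and> x = \<psi> s"
 by (auto simp: Z_def)

lemma one_in_Z: "1 \<in> Z"
 using in_Z[OF const_cauchy2[of 1], of 0] by (simp add: psi_one)

lemma zero_in_Z: "0 \<in> Z"
 using in_Z[OF const_cauchy2[of 0], of 0] by (simp add: psi_zero)

lemma add_in_Z: "x \<in> Z ==> y \<in> Z ==> x + y \<in> Z"
proof -
 assume "x \<in> Z" "y \<in> Z"
 then obtain s t where st: "s \<in> cauchy2" "\<forall>n. abs2 (s n) \<le> 1" "x = \<psi> s" "t \<in> cauchy2" "\<forall>n. abs2 (t n) \<le> 1" "y = \<psi> t"
  using ZD by metis
 have "\<psi> (\<lambda>n. s n + t n) \<in> Z" by (rule in_Z[of _ 0]) (use st in \<open>auto intro: add_cauchy2 abs2_add_le\<close>)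
 then show ?thesis using st by (simp add: psi_add)
qed

lemma mult_in_Z: "x \<in> Z ==> y \<in> Z ==> x * y \<in> Z"
proof -
 assume "x \<in> Z" "y \<in> Z"
 then obtain s t where st: "s \<in> cauchy2" "\<forall>n. abs2 (s n) \<le> 1" "x = \<psi> s" "t \<in> cauchy2" "\<forall>n. abs2 (t n) \<le> 1" "y = \<psi> t"
  using ZD by metis
 have "\<psi> (\<lambda>n. s n * t n) \<in> Z"
  by (rule in_Z[of _ 0]) (use st in \<open>auto intro: mult_cauchy2 mult_le_one simp: abs2_mult\<close>)
 then show ?thesis using st by (simp add: psi_mult)
qed

lemma uminus_in_Z: "x \<in> Z ==> - x \<in> Z"
proof -
 assume "x \<in> Z"
 then obtain s where s: "s \<in> cauchy2" "\<forall>n. abs2 (s n) \<le> 1" "x = \<psi> s" using ZD by metis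
 have "\<psi> (\<lambda>n. - s n) \<in> Z" by (rule in_Z[of _ 0]) (use s in \<open>auto intro: uminus_cauchy2\<close>)
 then show ?thesis using s by (simp add: psi_minus)
qed

lemma Q_add: "x \<in> Q ==> y \<in> Q ==> x + y \<in> Q"
 unfolding Q_def by (auto simp flip: psi_add intro: imageI add_cauchy2)

lemma Q_mult: "x \<in> Q ==> y \<in> Q ==> x * y \<in> Q"
 unfolding Q_def by (auto simp flip: psi_mult intro: imageI mult_cauchy2)

lemma Q_uminus: "x \<in> Q ==> - x \<in> Q"
 unfolding Q_def by (auto simp flip: psi_minus intro: imageI uminus_cauchy2)

lemma Q_of_rat: "of_rat q \<in> Q"
 unfolding Q_def psi_const[symmetric] by (rule imageI[OF const_cauchy2])

lemma psi_divide: "s \<in> cauchy2 ==> \<psi> s / 2 ^ k = \<psi> (\<lambda>n. s n / 2 ^ k) \<and> (\<lambda>n. s n / 2 ^ k) \<in> cauchy2"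
proof -
 assume s: "s \<in> cauchy2"
 have "\<psi> (\<lambda>n. (1 / 2 ^ k) * s n) = of_rat (1 / 2 ^ k) * \<psi> s"
  using psi_mult[OF const_cauchy2[of "1 / 2 ^ k"] s] by (simp add: psi_const)
 then show ?thesis using scale_cauchy2[OF s, of "1 / 2 ^ k"] by (simp add: of_rat_divide of_rat_power)
qed

lemma Q_divide: "x \<in> Q ==> x / 2 ^ k \<in> Q"
 using psi_divide unfolding Q_def by auto

lemma Q_absorbing: "x \<in> Q ==> \<exists>k::nat. 2 ^ k * x \<in> Z"
proof -
 assume "x \<in> Q"
 then obtain s where s: "s \<in> cauchy2" "x = \<psi> s" by (auto simp: Q_def)
 obtain k where k: "\<forall>n. abs2 (s n) \<le> 2 ^ k" using cauchy2_bounded[OF s(1)] by blast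
 have "\<psi> (\<lambda>n. 2 ^ k * s n) \<in> Z"
  by (rule in_Z[of _ 0]) (use k in \<open>auto intro!: scale_cauchy2 s simp: abs2_mult abs2_two_power\<close>)
 moreover have "\<psi> (\<lambda>n. 2 ^ k * s n) = 2 ^ k * x"
  using psi_mult[OF const_cauchy2[of "2 ^ k"] s(1)] s(2) by (simp add: psi_const of_rat_power)
 ultimately show ?thesis by auto
qed

lemma in_Z_imp_abs2:
 assumes s: "s \<in> cauchy2" and Z: "\<psi> s / 2 ^ k \<in> Z"
 shows "\<exists>N. \<forall>n\<ge>N. abs2 (s n) \<le> 1 / 2 ^ k"
proof -
 obtain t where t: "t \<in> cauchy2" "\<forall>n. abs2 (t n) \<le> 1" "\<psi> s / 2 ^ k = \<psi> t" using ZD[OF Z] by blast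
 have "(\<lambda>n. s n / 2 ^ k - t n) \<in> null2" using psi_eq_iff[of "\<lambda>n. s n / 2 ^ k" t] psi_divide[OF s, of k] t by simp
 then obtain N where N: "\<forall>n\<ge>N. abs2 (s n / 2 ^ k - t n) < 1" using null2D[of _ 1] by auto
 have "abs2 (s n) \<le> 1 / 2 ^ k" if "N \<le> n" for n
 proof -
  have "abs2 ((s n / 2 ^ k - t n) + t n) \<le> 1" using N t(2) that by (intro abs2_add_le) (auto intro: less_imp_le)
  then show ?thesis by (simp add: abs2_divide_two_power field_simps)
 qed
 then show ?thesis by blast
qed

lemma Q_separated:
 assumes x: "x \<in> Q" and Z: "\<And>k::nat. x / 2 ^ k \<in> Z"
 shows "x = 0"
proof -
 obtain s where s: "s \<in> cauchy2" "x = \<psi> s" using x by (auto simp: Q_def)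
 have "s \<in> null2"
  unfolding null2_def
 proof (intro CollectI allI impI)
  fix \<epsilon> :: real assume "0 < \<epsilon>"
  then obtain k where k: "(1 / 2) ^ k < \<epsilon>" using real_arch_pow_inv[of \<epsilon> "1 / 2"] by auto
  obtain N where "\<forall>n\<ge>N. abs2 (s n) \<le> 1 / 2 ^ k" using in_Z_imp_abs2[OF s(1)] Z s(2) by blast
  then have "\<forall>n\<ge>N. abs2 (s n) < \<epsilon>" using k by (force simp: power_divide)
  then show "\<exists>N. \<forall>n\<ge>N. abs2 (s n) < \<epsilon>" by blast
 qed
 then show ?thesis using psi_zero_iff[OF s(1)] s(2) by simp
qed

lemma Z_mod_2: "x \<in> Z ==> \<exists>\<epsilon>\<in>{0, 1}. (x - \<epsilon>) / 2 \<in> Z"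
proof -
 assume "x \<in> Z"
 then obtain s where s: "s \<in> cauchy2" "\<forall>n. abs2 (s n) \<le> 1" "x = \<psi> s" using ZD by metis
 obtain N where N: "\<forall>m\<ge>N. \<forall>n\<ge>N. abs2 (s m - s n) < 1 / 2" using cauchy2D[OF s(1), of "1 / 2"] by auto
 obtain \<epsilon> where \<epsilon>: "\<epsilon> \<in> {0, 1}" "abs2 ((s N - \<epsilon>) / 2) \<le> 1" using abs2_half s(2) by blast
 have c: "(\<lambda>n. s n - \<epsilon>) \<in> cauchy2" by (rule diff_cauchy2[OF s(1) const_cauchy2])
 have "\<psi> (\<lambda>n. (s n - \<epsilon>) / 2 ^ 1) \<in> Z"
 proof (rule in_Z)
  show "(\<lambda>n. (s n - \<epsilon>) / 2 ^ 1) \<in> cauchy2" using psi_divide[OF c] by blast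
  fix n assume "N \<le> n"
  then have "abs2 (s n - s N) < 1 / 2" using N by blast
  then have "abs2 ((s n - s N) / 2 ^ 1) \<le> 1" unfolding abs2_divide_two_power by simp
  from abs2_add_le[OF this \<epsilon>(2)] show "abs2 ((s n - \<epsilon>) / 2 ^ 1) \<le> 1" by (simp flip: add_divide_distrib)
 qed
 also have "\<psi> (\<lambda>n. (s n - \<epsilon>) / 2 ^ 1) = (x - of_rat \<epsilon>) / 2"
  using psi_divide[OF c, of 1] psi_diff[OF s(1) const_cauchy2[of \<epsilon>]] s(3) by (simp add: psi_const)
 finally show ?thesis using \<epsilon>(1) by (intro bexI[of _ "of_rat \<epsilon>"]) auto
qed

lemma two_power_in_Z: "x \<in> Z ==> 2 ^ k * x \<in> Z"
proof (induction k)
 case (Suc k)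
 then show ?case using add_in_Z[of "2 ^ k * x" "2 ^ k * x"] by (simp add: mult_2[symmetric] mult.assoc)
qed simp

lemma rational_approximation:
 assumes "x \<in> Q"
 shows "\<exists>r. (x - of_rat r) / 2 ^ k \<in> Z"
proof -
 obtain s where s: "s \<in> cauchy2" "x = \<psi> s" using assms by (auto simp: Q_def)
 have "0 < (1::real) / 2 ^ k" by simp
 then obtain N where N: "\<forall>m\<ge>N. \<forall>n\<ge>N. abs2 (s m - s n) < 1 / 2 ^ k" using cauchy2D[OF s(1)] by blast
 have c: "(\<lambda>n. s n - s N) \<in> cauchy2" by (rule diff_cauchy2[OF s(1) const_cauchy2])
 have "\<psi> (\<lambda>n. (s n - s N) / 2 ^ k) \<in> Z"
 proof (rule in_Z)
  show "(\<lambda>n. (s n - s N) / 2 ^ k) \<in> cauchy2" using psi_divide[OF c] by blast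
  fix n assume "N \<le> n"
  then have "abs2 (s n - s N) \<le> 1 / 2 ^ k" using N by (simp add: less_imp_le)
  then show "abs2 ((s n - s N) / 2 ^ k) \<le> 1" unfolding abs2_divide_two_power by (simp add: field_simps)
 qed
 also have "\<psi> (\<lambda>n. (s n - s N) / 2 ^ k) = (x - of_rat (s N)) / 2 ^ k"
  using psi_divide[OF c, of k] psi_diff[OF s(1) const_cauchy2[of "s N"]] s(2) by (simp add: psi_const)
 finally show ?thesis by blast
qed

text \<open>Replace each \<open>f k\<close> by a rational that agrees with it to precision
  \<open>2 ^ k\<close>. These rationals form a Cauchy sequence, and its image is the limit.\<close>

lemma Q_complete:
 assumes Q: "\<And>k. f k \<in> Q" and step: "\<And>k::nat. (f (Suc k) - f k) / 2 ^ k \<in> Z"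
 shows "\<exists>x\<in>Q. \<forall>k. (x - f k) / 2 ^ k \<in> Z"
proof -
 have "\<forall>k. \<exists>r. (f k - of_rat r) / 2 ^ k \<in> Z" using rational_approximation[OF Q] by blast
 then obtain r where r: "\<And>k. (f k - of_rat (r k)) / 2 ^ k \<in> Z" by metis
 have r_step: "abs2 (r (Suc k) - r k) \<le> 1 / 2 ^ k" for k
 proof -
  have "2 ^ 1 * (z / 2 ^ Suc k) = z / 2 ^ k" for z :: 'k by simp
  then have "(f (Suc k) - of_rat (r (Suc k))) / 2 ^ k \<in> Z" using two_power_in_Z[OF r[of "Suc k"], of 1] by (simp only:)
  then have "- ((f (Suc k) - of_rat (r (Suc k))) / 2 ^ k) + (f (Suc k) - f k) / 2 ^ k + (f k - of_rat (r k)) / 2 ^ k \<in> Z"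
   by (intro add_in_Z uminus_in_Z step r)
  then have "\<psi> (\<lambda>_. r (Suc k) - r k) / 2 ^ k \<in> Z"
   by (simp add: psi_const of_rat_diff diff_divide_distrib)
  from in_Z_imp_abs2[OF const_cauchy2 this] show ?thesis by blast
 qed
 have r_le: "abs2 (r (k + j) - r k) \<le> 1 / 2 ^ k" for k j
 proof (induction j)
  case (Suc j)
  have "abs2 (r (Suc (k + j)) - r (k + j)) \<le> 1 / 2 ^ (k + j)" by (rule r_step)
  also have "\<dots> \<le> 1 / 2 ^ k" by (simp add: power_add field_simps)
  finally have "abs2 (r (Suc (k + j)) - r (k + j)) \<le> 1 / 2 ^ k" .
  from abs2_add_le[OF this Suc] show ?case by (simp add: algebra_simps)
 qed simp
 have r_le': "abs2 (r n - r k) \<le> 1 / 2 ^ k" if "k \<le> n" for n k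
  using r_le[of k "n - k"] that by simp
 have c: "r \<in> cauchy2"
  unfolding cauchy2_def
 proof (intro CollectI allI impI)
  fix \<epsilon> :: real assume "0 < \<epsilon>"
  then obtain k where k: "(1 / 2) ^ k < \<epsilon>" using real_arch_pow_inv[of \<epsilon> "1 / 2"] by auto
  have "abs2 (r m - r n) < \<epsilon>" if "k \<le> m" "k \<le> n" for m n
   using abs2_diff_le[OF r_le'[OF that(1)] r_le'[OF that(2)]] k by (simp add: power_divide)
  then show "\<exists>N. \<forall>m\<ge>N. \<forall>n\<ge>N. abs2 (r m - r n) < \<epsilon>" by blast
 qed
 have "(\<psi> r - f k) / 2 ^ k \<in> Z" for k
 proof -
  have d: "(\<lambda>n. r n - r k) \<in> cauchy2" by (rule diff_cauchy2[OF c const_cauchy2])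
  have "\<psi> (\<lambda>n. (r n - r k) / 2 ^ k) \<in> Z"
  proof (rule in_Z)
   show "(\<lambda>n. (r n - r k) / 2 ^ k) \<in> cauchy2" using psi_divide[OF d] by blast
   fix n assume "k \<le> n"
   then show "abs2 ((r n - r k) / 2 ^ k) \<le> 1" unfolding abs2_divide_two_power using r_le' by (simp add: field_simps)
  qed
  also have "\<psi> (\<lambda>n. (r n - r k) / 2 ^ k) = (\<psi> r - of_rat (r k)) / 2 ^ k"
   using psi_divide[OF d, of k] psi_diff[OF c const_cauchy2[of "r k"]] by (simp add: psi_const)
  finally have "(\<psi> r - of_rat (r k)) / 2 ^ k + - ((f k - of_rat (r k)) / 2 ^ k) \<in> Z"
   by (intro add_in_Z uminus_in_Z r)
  then show ?thesis by (simp add: diff_divide_distrib)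
 qed
 then show ?thesis using c by (auto simp: Q_def)
qed

lemma partial_sums:
 assumes "\<And>k::nat. (s (Suc k) - s k) / 2 ^ k \<in> Z"
 shows "s k - s 0 \<in> Z"
proof (induction k)
 case (Suc k)
 have "(s k - s 0) + 2 ^ k * ((s (Suc k) - s k) / 2 ^ k) \<in> Z" by (intro add_in_Z Suc two_power_in_Z assms)
 then show ?case by simp
qed (simp add: zero_in_Z)

lemma Z_complete:
 assumes step: "\<And>k::nat. (s (Suc k) - s k) / 2 ^ k \<in> Z"
 shows "\<exists>x. \<forall>k. (x - s k) / 2 ^ k \<in> Z"
proof -
 have "(s (Suc k) - s 0 - (s k - s 0)) / 2 ^ k \<in> Z" for k using step by simp
 then obtain y where "\<forall>k. (y - (s k - s 0)) / 2 ^ k \<in> Z"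
  using Q_complete[of "\<lambda>k. s k - s 0"] partial_sums[of s, OF step] Z_sub_Q by blast
 then show ?thesis by (intro exI[of _ "y + s 0"]) (simp add: algebra_simps)
qed

lemma sum_in_Z: "(\<And>i. i \<in> I ==> f i \<in> Z) ==> sum f I \<in> Z"
 by (induction I rule: infinite_finite_induct) (auto simp: zero_in_Z add_in_Z)

lemma common_denominator:
 assumes "finite I" "\<And>i. i \<in> I ==> x i \<in> Q"
 shows "\<exists>k::nat. \<forall>i\<in>I. 2 ^ k * x i \<in> Z"
 using assms
proof (induction I rule: finite_induct)
 case (insert i I)
 then obtain k where k: "\<forall>i\<in>I. 2 ^ k * x i \<in> Z" by blast
 obtain j where j: "2 ^ j * x i \<in> Z" using Q_absorbing insert by blast
 have "2 ^ (k + j) * x l \<in> Z" if "l \<in> insert i I" for l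
  using two_power_in_Z[of "2 ^ k * x l" j] two_power_in_Z[OF j, of k] k that by (auto simp: power_add mult_ac)
 then show ?case by blast
qed simp

text \<open>The lattice is spanned by a multiple of the basis that absorbs the structure constants.\<close>

theorem exists_lattice:
 fixes b :: "nat => 'k" and n :: nat
 assumes span: "\<And>x. \<exists>c. (\<forall>i<n. c i \<in> Q) \<and> x = (\<Sum>i<n. c i * b i)"
  and indep: "\<And>c. (\<forall>i<n. c i \<in> Q) ==> (\<Sum>i<n. c i * b i) = 0 ==> \<forall>i<n. c i = 0"
 shows "\<exists>\<Lambda>. two_adic_lattice_over \<Lambda> Z"
proof -
 obtain a where a: "\<And>x. \<forall>i<n. a x i \<in> Q" "\<And>x. x = (\<Sum>i<n. a x i * b i)" using span by metis
 have uniq: "a x i = c i" if "\<forall>i<n. c i \<in> Q" "x = (\<Sum>i<n. c i * b i)" "i < n" for x c i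
 proof -
  have "(\<Sum>i<n. (a x i + - c i) * b i) = (\<Sum>i<n. a x i * b i) - (\<Sum>i<n. c i * b i)"
   by (simp add: left_diff_distrib sum_subtractf)
  also have "\<dots> = 0" unfolding a(2)[of x, symmetric] that(2)[symmetric] by simp
  finally have "(\<Sum>i<n. (a x i + - c i) * b i) = 0" .
  from indep[OF _ this] have "a x i + - c i = 0" using a(1) that by (blast intro: Q_add Q_uminus)
  then show ?thesis by simp
 qed
 have "finite ({..<n} \<times> {..<n} \<times> {..<n})" by simp
 moreover have "(\<lambda>(i, j, l). a (b i * b j) l) p \<in> Q" if "p \<in> {..<n} \<times> {..<n} \<times> {..<n}" for p
  using that a(1) by auto
 ultimately obtain m where "\<forall>p\<in>{..<n} \<times> {..<n} \<times> {..<n}. 2 ^ m * (\<lambda>(i, j, l). a (b i * b j) l) p \<in> Z"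
  using common_denominator by metis
 then have m: "2 ^ m * a (b i * b j) l \<in> Z" if "i < n" "j < n" "l < n" for i j l using that by auto
 \<comment> \<open>For \<open>2 ^ m * b\<close> in place of \<open>b\<close> the structure constants
   get multiplied by \<open>2 ^ m\<close> and become integral; so the span of the
   \<open>\<beta>\<close> is closed under multiplication.\<close>
 define \<beta> where "\<beta> i = 2 ^ m * b i" for i
 define d where "d x i = a x i / 2 ^ m" for x i
 have d_Q: "\<forall>i<n. d x i \<in> Q" for x using a(1) Q_divide by (simp add: d_def)
 have d_eq: "x = (\<Sum>i<n. d x i * \<beta> i)" for x
 proof -
  have "(\<Sum>i<n. d x i * \<beta> i) = (\<Sum>i<n. a x i * b i)" by (simp add: d_def \<beta>_def)
  then show ?thesis unfolding a(2)[of x, symmetric] by (rule sym)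
 qed
 have d_uniq: "d x i = c i" if c: "\<forall>i<n. c i \<in> Q" "x = (\<Sum>i<n. c i * \<beta> i)" "i < n" for x c i
 proof -
  have "2 ^ m * c i \<in> Q" if "i < n" for i using Q_mult[OF Q_of_rat[of "2 ^ m"]] c(1) that by (simp add: of_rat_power)
  then have "a x i = 2 ^ m * c i" using c by (intro uniq) (auto simp: \<beta>_def mult_ac)
  then show ?thesis by (simp add: d_def)
 qed
 have d_add: "d (x + y) i = d x i + d y i" if "i < n" for x y i
 proof (rule d_uniq[OF _ _ that])
  show "\<forall>i<n. d x i + d y i \<in> Q" using d_Q Q_add by blast
  show "x + y = (\<Sum>i<n. (d x i + d y i) * \<beta> i)"
   by (simp add: distrib_right sum.distrib flip: d_eq)
 qed
 have d_scale: "d (q * x) i = q * d x i" if "i < n" "q \<in> Q" for x q i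
 proof (rule d_uniq[OF _ _ that(1)])
  show "\<forall>i<n. q * d x i \<in> Q" using d_Q Q_mult that(2) by blast
  show "q * x = (\<Sum>i<n. q * d x i * \<beta> i)" by (simp add: mult.assoc flip: sum_distrib_left d_eq)
 qed
 have d_sum: "d (sum f I) i = (\<Sum>j\<in>I. d (f j) i)" if "i < n" "finite I" for f i and I :: "nat set"
  using that(2)
 proof (induction I rule: finite_induct)
  case empty
  show ?case using d_scale[OF that(1), of 0 0] Z_sub_Q zero_in_Z by auto
 qed (simp add: d_add that(1))
 define \<Lambda> where "\<Lambda> = {x. \<forall>i<n. d x i \<in> Z}"
 have d_rat: "d (of_rat q * x) i = of_rat q * d x i" if "i < n" for q x i by (rule d_scale[OF that Q_of_rat])
 have d_div: "d (x / 2 ^ k) i = d x i / 2 ^ k" if "i < n" for x k i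
  using d_rat[OF that, of "1 / 2 ^ k" x] by (simp add: of_rat_divide of_rat_power)
 have d_pow: "d (2 ^ k * x) i = 2 ^ k * d x i" if "i < n" for x k i
  using d_rat[OF that, of "2 ^ k" x] by (simp add: of_rat_power)
 have d_minus: "d (- x) i = - d x i" if "i < n" for x i
  using d_rat[OF that, of "- 1" x] by (simp add: of_rat_minus)
 have d_diff: "d (x - y) i = d x i - d y i" if "i < n" for x y i
  using d_add[OF that, of x "- y"] d_minus[OF that] by simp
 have d_lc: "d (\<Sum>i<n. c i * \<beta> i) i = c i" if "i < n" "\<forall>i<n. c i \<in> Q" for c i
  by (rule d_uniq[OF that(2) refl that(1)])
 have lc_in: "(\<Sum>i<n. c i * \<beta> i) \<in> \<Lambda>" if "\<And>i. i < n ==> c i \<in> Z" for c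
  unfolding \<Lambda>_def using d_lc[of _ c] that Z_sub_Q by (simp add: subset_iff)
 have add: "x + y \<in> \<Lambda>" if "x \<in> \<Lambda>" "y \<in> \<Lambda>" for x y using that by (simp add: \<Lambda>_def d_add add_in_Z)
 have scale: "z * x \<in> \<Lambda>" if "z \<in> Z" "x \<in> \<Lambda>" for z x
  using that Z_sub_Q by (simp add: \<Lambda>_def d_scale subset_iff mult_in_Z)
 have sum: "sum f I \<in> \<Lambda>" if "\<And>i. i \<in> I ==> f i \<in> \<Lambda>" "finite I" for f and I :: "nat set"
  using that by (simp add: \<Lambda>_def d_sum sum_in_Z)
 have \<beta>\<beta>: "\<beta> i * \<beta> j \<in> \<Lambda>" if ij: "i < n" "j < n" for i j
 proof -
  have "\<beta> i * \<beta> j = 2 ^ m * 2 ^ m * (\<Sum>l<n. a (b i * b j) l * b l)"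
   unfolding a(2)[of "b i * b j", symmetric] by (simp add: \<beta>_def)
  also have "\<dots> = (\<Sum>l<n. (2 ^ m * a (b i * b j) l) * \<beta> l)"
   by (simp add: sum_distrib_left \<beta>_def mult_ac)
  also have "\<dots> \<in> \<Lambda>" using m[OF ij] by (rule lc_in)
  finally show ?thesis .
 qed
 have "two_adic_lattice \<Lambda>"
 proof
  show "0 \<in> \<Lambda>" using lc_in[of "\<lambda>_. 0"] zero_in_Z by simp
  show "- x \<in> \<Lambda>" if "x \<in> \<Lambda>" for x using that by (simp add: \<Lambda>_def d_minus uminus_in_Z)
  show "x * y \<in> \<Lambda>" if "x \<in> \<Lambda>" "y \<in> \<Lambda>" for x y
  proof -
   have "x * y = (\<Sum>i<n. \<Sum>j<n. (d x i * d y j) * (\<beta> i * \<beta> j))"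
   proof -
    have "x * y = (\<Sum>i<n. d x i * \<beta> i) * (\<Sum>j<n. d y j * \<beta> j)" by (simp flip: d_eq)
    then show ?thesis unfolding sum_product by (simp add: mult_ac)
   qed
   also have "\<dots> \<in> \<Lambda>" using that by (intro sum scale mult_in_Z \<beta>\<beta>) (auto simp: \<Lambda>_def)
   finally show ?thesis .
  qed
  show "\<exists>k::nat. 2 ^ k * x \<in> \<Lambda>" for x
  proof -
   have "finite {..<n}" by simp
   then obtain k where "\<forall>i\<in>{..<n}. 2 ^ k * d x i \<in> Z" using common_denominator[of "{..<n}" "d x"] d_Q by blast
   then show ?thesis by (intro exI[of _ k]) (simp add: \<Lambda>_def d_pow)
  qed
  show "x = 0" if sep: "\<And>k::nat. x / 2 ^ k \<in> \<Lambda>" for x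
  proof -
   have "d x i = 0" if i: "i < n" for i
   proof (rule Q_separated)
    show "d x i \<in> Q" using d_Q i by blast
    show "d x i / 2 ^ k \<in> Z" for k using sep[of k] i by (simp add: \<Lambda>_def d_div)
   qed
   then have "(\<Sum>i<n. d x i * \<beta> i) = 0" by simp
   then show ?thesis unfolding d_eq[of x, symmetric] .
  qed
  show "\<exists>S. finite S \<and> (\<forall>x\<in>\<Lambda>. \<exists>s\<in>S. (x - s) / 2 \<in> \<Lambda>)"
  proof (intro exI conjI ballI)
   show "finite ((\<lambda>c. \<Sum>i<n. c i * \<beta> i) ` ({..<n} \<rightarrow>\<^sub>E {0, 1}))" by (intro finite_imageI finite_PiE) auto
   fix x assume x: "x \<in> \<Lambda>"
   have "\<forall>i. \<exists>\<epsilon>\<in>{0, 1}. i < n --> (d x i - \<epsilon>) / 2 \<in> Z" using Z_mod_2 x by (fastforce simp: \<Lambda>_def)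
   then obtain c where c: "\<And>i. c i \<in> {0, 1}" "\<And>i. i < n ==> (d x i - c i) / 2 \<in> Z" by metis
   define y where "y = (\<Sum>i<n. restrict c {..<n} i * \<beta> i)"
   have y: "y = (\<Sum>i<n. c i * \<beta> i)" by (simp add: y_def)
   have "\<forall>i<n. c i \<in> Q" using c(1) zero_in_Z one_in_Z Z_sub_Q by (metis insertE singletonD subsetD)
   then have dy: "d y i = c i" if "i < n" for i unfolding y using that by (intro d_lc)
   have "(x - y) / 2 \<in> \<Lambda>"
    unfolding \<Lambda>_def mem_Collect_eq
   proof (intro allI impI)
    fix i assume i: "i < n"
    have "d ((x - y) / 2 ^ 1) i = (d x i - c i) / 2 ^ 1" unfolding d_div[OF i] d_diff[OF i] dy[OF i] ..
    then show "d ((x - y) / 2) i \<in> Z" using c(2)[OF i] by (simp only: power_one_right)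
   qed
   moreover have "y \<in> (\<lambda>c. \<Sum>i<n. c i * \<beta> i) ` ({..<n} \<rightarrow>\<^sub>E {0, 1})"
    unfolding y_def
   proof (intro imageI PiE_I)
    fix i assume "i \<in> {..<n}"
    then show "restrict c {..<n} i \<in> {0, 1}" using c(1)[of i] by simp
   qed simp
   ultimately show "\<exists>s\<in>(\<lambda>c. \<Sum>i<n. c i * \<beta> i) ` ({..<n} \<rightarrow>\<^sub>E {0, 1}). (x - s) / 2 \<in> \<Lambda>" by blast
  qed
  show "\<exists>x. \<forall>k. (x - s k) / 2 ^ k \<in> \<Lambda>" if step: "\<And>k::nat. (s (Suc k) - s k) / 2 ^ k \<in> \<Lambda>" for s
  proof -
   have "\<exists>y. i < n --> (\<forall>k. (y - d (s k) i) / 2 ^ k \<in> Z \<and> y - d (s 0) i \<in> Q)" for i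
   proof (cases "i < n")
    case True
    have st: "(d (s (Suc k)) i - d (s k) i) / 2 ^ k \<in> Z" for k
     using step[of k] True by (simp add: \<Lambda>_def d_div d_diff)
    obtain y where y: "\<forall>k. (y - d (s k) i) / 2 ^ k \<in> Z" using Z_complete[of "\<lambda>k. d (s k) i", OF st] by blast
    then have "y - d (s 0) i \<in> Z" using spec[OF y, of 0] by simp
    with y show ?thesis using Z_sub_Q by blast
   qed simp
   then obtain y where y: "\<And>i k. i < n ==> (y i - d (s k) i) / 2 ^ k \<in> Z" "\<And>i. i < n ==> y i - d (s 0) i \<in> Q" by metis
   have yQ: "y i \<in> Q" if "i < n" for i using Q_add[OF y(2)[OF that], of "d (s 0) i"] d_Q that by simp
   have "((\<Sum>i<n. y i * \<beta> i) - s k) / 2 ^ k \<in> \<Lambda>" for k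
    unfolding \<Lambda>_def using y(1) d_lc[of _ y] yQ by (simp add: d_div d_diff)
   then show ?thesis by blast
  qed
 qed (fact add)
 then interpret two_adic_lattice \<Lambda> .
 have "two_adic_lattice_over \<Lambda> Z"
  by unfold_locales (fact zero_in_Z one_in_Z add_in_Z uminus_in_Z mult_in_Z scale Z_complete)+
 then show ?thesis by blast
qed

end

section \<open>The field \<open>Q2\<close> of cosets inside a 2-adic field\<close>

lemma cauchy2_ring_simps [simp]:
 "carrier cauchy2_ring = cauchy2" "s \<otimes>\<^bsub>cauchy2_ring\<^esub> t = (\<lambda>n. s n * t n)" "\<one>\<^bsub>cauchy2_ring\<^esub> = (\<lambda>n. 1)"
 "\<zero>\<^bsub>cauchy2_ring\<^esub> = (\<lambda>n. 0)" "s \<oplus>\<^bsub>cauchy2_ring\<^esub> t = (\<lambda>n. s n + t n)"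
 by (simp_all add: cauchy2_ring_def)

lemma cring_cauchy2_ring: "cring cauchy2_ring"
proof (rule cringI)
 show "abelian_group cauchy2_ring"
 proof (rule abelian_groupI)
  fix s assume "s \<in> carrier cauchy2_ring"
  then show "\<exists>t\<in>carrier cauchy2_ring. t \<oplus>\<^bsub>cauchy2_ring\<^esub> s = \<zero>\<^bsub>cauchy2_ring\<^esub>"
   by (intro bexI[of _ "\<lambda>n. - s n"]) (auto simp: uminus_cauchy2)
 qed (auto simp: add_cauchy2 const_cauchy2 add_ac)
 show "Group.comm_monoid cauchy2_ring"
  by (rule comm_monoidI) (auto simp: mult_cauchy2 const_cauchy2 mult_ac)
qed (auto simp: distrib_right)

lemma uminus_cauchy2_ring: "s \<in> cauchy2 ==> \<ominus>\<^bsub>cauchy2_ring\<^esub> s = (\<lambda>n. - s n)"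
proof -
 interpret cring cauchy2_ring by (rule cring_cauchy2_ring)
 assume "s \<in> cauchy2"
 then show ?thesis by (intro minus_equality) (auto simp: uminus_cauchy2)
qed

lemma ideal_null2: "ideal null2 cauchy2_ring"
proof (rule idealI)
 interpret cring cauchy2_ring by (rule cring_cauchy2_ring)
 show "ring cauchy2_ring" by (rule ring_axioms)
 show "subgroup null2 (add_monoid cauchy2_ring)"
 proof
  fix s assume "s \<in> null2"
  then show "inv\<^bsub>add_monoid cauchy2_ring\<^esub> s \<in> null2"
   using uminus_cauchy2_ring[OF null2_cauchy2] by (simp add: a_inv_def uminus_null2)
 qed (auto simp: null2_cauchy2 add_null2 intro: eventually_eq_null2)
next
 fix s t assume "s \<in> null2" "t \<in> carrier cauchy2_ring"
 then show "t \<otimes>\<^bsub>cauchy2_ring\<^esub> s \<in> null2" "s \<otimes>\<^bsub>cauchy2_ring\<^esub> t \<in> null2"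
  using mult_null2[of t s] by (simp_all add: mult.commute)
qed

abbreviation q2_of :: "(nat => rat) => q2" where
 "q2_of s \<equiv> null2 +>\<^bsub>cauchy2_ring\<^esub> s"

lemma q2_of_eq_iff:
 assumes "s \<in> cauchy2" "t \<in> cauchy2"
 shows "q2_of s = q2_of t \<longleftrightarrow> (\<lambda>n. s n - t n) \<in> null2"
proof -
 interpret ideal null2 cauchy2_ring by (rule ideal_null2)
 have "s \<ominus>\<^bsub>cauchy2_ring\<^esub> t = (\<lambda>n. s n - t n)" using assms by (simp add: a_minus_def uminus_cauchy2_ring)
 then show ?thesis using quotient_eq_iff_same_a_r_cos[OF ideal_null2, of s t] assms by simp
qed

lemma Q2_simps:
 "s \<in> cauchy2 ==> q2_of s \<in> carrier Q2"
 "s \<in> cauchy2 ==> t \<in> cauchy2 ==> q2_of s \<oplus>\<^bsub>Q2\<^esub> q2_of t = q2_of (\<lambda>n. s n + t n)"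
 "s \<in> cauchy2 ==> t \<in> cauchy2 ==> q2_of s \<otimes>\<^bsub>Q2\<^esub> q2_of t = q2_of (\<lambda>n. s n * t n)"
 "\<one>\<^bsub>Q2\<^esub> = q2_of (\<lambda>_. 1)" "\<zero>\<^bsub>Q2\<^esub> = q2_of (\<lambda>_. 0)"
proof -
 interpret ideal null2 cauchy2_ring by (rule ideal_null2)
 show "s \<in> cauchy2 ==> q2_of s \<in> carrier Q2"
  by (auto simp: Q2_def FactRing_def A_RCOSETS_def' )
 show "s \<in> cauchy2 ==> t \<in> cauchy2 ==> q2_of s \<oplus>\<^bsub>Q2\<^esub> q2_of t = q2_of (\<lambda>n. s n + t n)"
  using a_rcos_sum[of s t] by (simp add: Q2_def FactRing_def)
 show "s \<in> cauchy2 ==> t \<in> cauchy2 ==> q2_of s \<otimes>\<^bsub>Q2\<^esub> q2_of t = q2_of (\<lambda>n. s n * t n)"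
  using rcoset_mult_add[of s t] by (simp add: Q2_def FactRing_def)
 show "\<one>\<^bsub>Q2\<^esub> = q2_of (\<lambda>_. 1)" by (simp add: Q2_def FactRing_def)
 show "\<zero>\<^bsub>Q2\<^esub> = q2_of (\<lambda>_. 0)"
  using a_coset_add_zero[of null2] null2_cauchy2 by (simp add: Q2_def FactRing_def subset_iff)
qed

lemma Q2_cases: "c \<in> carrier Q2 ==> \<exists>s\<in>cauchy2. c = q2_of s"
 by (auto simp: Q2_def FactRing_def A_RCOSETS_def')

locale q2_field = Fd: field F + A: algebra Q2 F for F :: "(q2, 'a) module" +
 assumes exists_basis: "\<exists>b. alg_basis Q2 F b"
begin

definition em :: "(nat => rat) => 'a" where
 "em s = q2_of s \<odot>\<^bsub>F\<^esub> \<one>\<^bsub>F\<^esub>"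

lemma em_closed: "s \<in> cauchy2 ==> em s \<in> carrier F"
 by (simp add: em_def Q2_simps A.smult_closed)

lemma em_add: "s \<in> cauchy2 ==> t \<in> cauchy2 ==> em (\<lambda>n. s n + t n) = em s \<oplus>\<^bsub>F\<^esub> em t"
 by (simp add: em_def Q2_simps(1) A.smult_l_distr flip: Q2_simps(2))

lemma smult_em: "s \<in> cauchy2 ==> x \<in> carrier F ==> q2_of s \<odot>\<^bsub>F\<^esub> x = em s \<otimes>\<^bsub>F\<^esub> x"
 by (simp add: em_def A.smult_assoc2 Q2_simps(1))

lemma em_mult: "s \<in> cauchy2 ==> t \<in> cauchy2 ==> em (\<lambda>n. s n * t n) = em s \<otimes>\<^bsub>F\<^esub> em t"
 using smult_em[of s "em t"] by (simp add: em_closed) (simp add: em_def A.smult_assoc1 Q2_simps(1) flip: Q2_simps(3))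

lemma em_one: "em (\<lambda>_. 1) = \<one>\<^bsub>F\<^esub>"
 unfolding em_def Q2_simps(4)[symmetric] by (rule A.smult_one) simp

lemma em_zero: "em (\<lambda>_. 0) = \<zero>\<^bsub>F\<^esub>"
 unfolding em_def Q2_simps(5)[symmetric] by (rule A.smult_l_null) simp

lemma unique_coords:
 assumes b: "alg_basis Q2 F b" and c: "c \<in> {..<length b} \<rightarrow> carrier Q2" "d \<in> {..<length b} \<rightarrow> carrier Q2"
  and eq: "(\<Oplus>\<^bsub>F\<^esub>i\<in>{..<length b}. c i \<odot>\<^bsub>F\<^esub> b ! i) = (\<Oplus>\<^bsub>F\<^esub>i\<in>{..<length b}. d i \<odot>\<^bsub>F\<^esub> b ! i)" and i: "i < length b"
 shows "c i = d i"
proof -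
 have bc: "b ! i \<in> carrier F" if "i < length b" for i
  using b that by (auto simp: alg_basis_def)
 define P where "P x c \<longleftrightarrow> c \<in> {..<length b} \<rightarrow>\<^sub>E carrier Q2 \<and> x = (\<Oplus>\<^bsub>F\<^esub>i\<in>{..<length b}. c i \<odot>\<^bsub>F\<^esub> b ! i)" for x c
 have ex1: "\<exists>!c. P x c" if "x \<in> carrier F" for x
  unfolding P_def by (rule bspec[OF b[unfolded alg_basis_def, THEN conjunct2] that])
 have P: "P (\<Oplus>\<^bsub>F\<^esub>i\<in>{..<length b}. c i \<odot>\<^bsub>F\<^esub> b ! i) (restrict c {..<length b})" if "c \<in> {..<length b} \<rightarrow> carrier Q2" for c
  unfolding P_def
 proof
  show "restrict c {..<length b} \<in> {..<length b} \<rightarrow>\<^sub>E carrier Q2" using that by auto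
  show "(\<Oplus>\<^bsub>F\<^esub>i\<in>{..<length b}. c i \<odot>\<^bsub>F\<^esub> b ! i) = (\<Oplus>\<^bsub>F\<^esub>i\<in>{..<length b}. restrict c {..<length b} i \<odot>\<^bsub>F\<^esub> b ! i)"
   using that bc by (intro Fd.finsum_cong') (auto intro!: A.smult_closed)
 qed
 have x: "(\<Oplus>\<^bsub>F\<^esub>i\<in>{..<length b}. c i \<odot>\<^bsub>F\<^esub> b ! i) \<in> carrier F"
  using c(1) bc by (intro Fd.finsum_closed) (auto intro!: A.smult_closed)
 have "restrict c {..<length b} = restrict d {..<length b}"
  using ex1[OF x] P[OF c(1)] P[OF c(2)] unfolding eq by blast
 from fun_cong[OF this, of i] show ?thesis using i by simp
qed

lemma zero_lc: "alg_basis Q2 F b ==> (\<Oplus>\<^bsub>F\<^esub>i\<in>{..<length b}. \<zero>\<^bsub>Q2\<^esub> \<odot>\<^bsub>F\<^esub> b ! i) = \<zero>\<^bsub>F\<^esub>"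
proof -
 assume b: "alg_basis Q2 F b"
 have "b ! i \<in> carrier F" if "i < length b" for i using b that by (auto simp: alg_basis_def)
 then have "(\<Oplus>\<^bsub>F\<^esub>i\<in>{..<length b}. \<zero>\<^bsub>Q2\<^esub> \<odot>\<^bsub>F\<^esub> b ! i) = (\<Oplus>\<^bsub>F\<^esub>i\<in>{..<length b}. \<zero>\<^bsub>F\<^esub>)"
  by (intro Fd.finsum_cong') (auto simp: A.smult_l_null)
 then show ?thesis by simp
qed

text \<open>Injectivity is read off a basis: if \<open>em s\<close> vanishes, the coset of
  \<open>s\<close> as first coordinate gives a second expansion of 0, so uniqueness of coordinates
  makes it the zero coset.\<close>

lemma em_eq_zero_iff:
 assumes s: "s \<in> cauchy2"
 shows "em s = \<zero>\<^bsub>F\<^esub> \<longleftrightarrow> s \<in> null2"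
proof
 assume "s \<in> null2"
 then have "q2_of s = q2_of (\<lambda>_. 0)" using q2_of_eq_iff[OF s const_cauchy2[of 0]] by simp
 then have "em s = em (\<lambda>_. 0)" by (simp add: em_def)
 then show "em s = \<zero>\<^bsub>F\<^esub>" by (simp add: em_zero)
next
 assume z: "em s = \<zero>\<^bsub>F\<^esub>"
 obtain b where b: "alg_basis Q2 F b" using exists_basis by blast
 have bc: "b ! i \<in> carrier F" if "i < length b" for i using b that by (auto simp: alg_basis_def)
 have "b \<noteq> []"
 proof
  assume "b = []"
  then have "\<exists>c. \<one>\<^bsub>F\<^esub> = (\<Oplus>\<^bsub>F\<^esub>i\<in>{..<0::nat}. c i \<odot>\<^bsub>F\<^esub> b ! i)"
   using bspec[OF b[unfolded alg_basis_def, THEN conjunct2], of "\<one>\<^bsub>F\<^esub>"] by auto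
  then show False using Fd.one_not_zero by simp
 qed
 then have 0: "0 < length b" by simp
 have "(\<Oplus>\<^bsub>F\<^esub>i\<in>{..<length b}. (if i = 0 then q2_of s else \<zero>\<^bsub>Q2\<^esub>) \<odot>\<^bsub>F\<^esub> b ! i) = (\<Oplus>\<^bsub>F\<^esub>i\<in>{..<length b}. \<zero>\<^bsub>Q2\<^esub> \<odot>\<^bsub>F\<^esub> b ! i)"
  using bc s z by (intro Fd.finsum_cong') (auto simp: A.smult_l_null smult_em)
 from unique_coords[OF b _ _ this 0] have "q2_of s = \<zero>\<^bsub>Q2\<^esub>" using s by (auto simp: Q2_simps(1))
 then show "s \<in> null2" unfolding Q2_simps(5) using q2_of_eq_iff[OF s const_cauchy2[of 0]] by simp
qed

lemma em_of_nat: "em (\<lambda>_. of_nat n) = add_pow F n \<one>\<^bsub>F\<^esub>"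
proof (induction n)
 case 0
 then show ?case by (simp add: em_zero)
next
 case (Suc n)
 have "em (\<lambda>_. of_nat (Suc n)) = em (\<lambda>_. of_nat n + 1)" by (simp add: add.commute)
 also have "\<dots> = em (\<lambda>_. of_nat n) \<oplus>\<^bsub>F\<^esub> em (\<lambda>_. 1)" by (rule em_add[OF const_cauchy2 const_cauchy2])
 finally show ?case by (simp add: Suc em_one Fd.add.nat_pow_Suc)
qed

text \<open>The constant sequence \<open>n\<close> has constant positive absolute value, so it is
  not null and its image is not 0.\<close>

lemma char_zero: "(n::nat) \<noteq> 0 ==> add_pow F n \<one>\<^bsub>F\<^esub> \<noteq> \<zero>\<^bsub>F\<^esub>"
proof
 assume n: "n \<noteq> 0" and "add_pow F n \<one>\<^bsub>F\<^esub> = \<zero>\<^bsub>F\<^esub>"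
 then have "(\<lambda>_. of_nat n) \<in> null2" using em_eq_zero_iff[OF const_cauchy2] by (simp flip: em_of_nat)
 then obtain N :: nat where "\<forall>k\<ge>N. abs2 (of_nat n) < abs2 (of_nat n)"
  using null2D[of "\<lambda>_. of_nat n" "abs2 (of_nat n)"] abs2_pos[of "of_nat n"] n by auto
 then show False by blast
qed

end

lemma q2_fieldI: "two_adic_field F ==> q2_field F"
 unfolding two_adic_field_def finite_field_ext_def q2_field_def q2_field_axioms_def by blast

text \<open>A basis over \<open>Q2\<close> yields a lattice, its power-bounded elements form a
  dyadic ring, and \<open>power_bounded_iff_integral\<close> matches this ring with
  \<open>O_F\<close>.\<close>

theorem exists_local_field:
 fixes F :: "(q2, 'a) module" and h :: "'k::field_char_0 => 'a"
 assumes F: "two_adic_field F" and h: "typed_field F h"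
 shows "\<exists>Ob \<pi> e R. local_field F h Ob \<pi> e R"
proof -
 interpret T: typed_field F h by (rule h)
 interpret q: q2_field F by (rule q2_fieldI[OF F])
 define hi where "hi = inv_into UNIV h"
 have h_hi: "h (hi a) = a" if "a \<in> carrier F" for a
  using T.h_bij that unfolding hi_def by (simp add: bij_betw_def f_inv_into_f)
 define \<psi> where "\<psi> s = hi (q.em s)" for s
 have h\<psi>: "h (\<psi> s) = q.em s" if "s \<in> cauchy2" for s
  using that by (simp add: \<psi>_def h_hi q.em_closed)
 interpret E: two_adic_embedding \<psi>
 proof
  fix s t assume st: "s \<in> cauchy2" "t \<in> cauchy2"
  have "h (\<psi> (\<lambda>n. s n + t n)) = h (\<psi> s + \<psi> t)"
   using st by (simp add: T.h_add h\<psi> add_cauchy2 q.em_add)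
  then show "\<psi> (\<lambda>n. s n + t n) = \<psi> s + \<psi> t" by simp
  have "h (\<psi> (\<lambda>n. s n * t n)) = h (\<psi> s * \<psi> t)"
   using st by (simp add: T.h_mult h\<psi> mult_cauchy2 q.em_mult)
  then show "\<psi> (\<lambda>n. s n * t n) = \<psi> s * \<psi> t" by simp
 next
  have "h (\<psi> (\<lambda>_. 1)) = h 1" by (simp add: h\<psi> const_cauchy2 q.em_one T.h_one)
  then show "\<psi> (\<lambda>_. 1) = 1" by simp
 next
  fix s assume s: "s \<in> cauchy2"
  have "\<psi> s = 0 \<longleftrightarrow> h (\<psi> s) = h 0" by simp
  also have "\<dots> \<longleftrightarrow> s \<in> null2" unfolding h\<psi>[OF s] T.h_zero by (rule q.em_eq_zero_iff[OF s])
  finally show "\<psi> s = 0 \<longleftrightarrow> s \<in> null2" .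
 qed
 have smult: "q2_of s \<odot>\<^bsub>F\<^esub> h x = h (\<psi> s * x)" if "s \<in> cauchy2" for s x
  using that by (simp add: q.smult_em T.h_mult h\<psi>)
 obtain b where b: "alg_basis Q2 F b" using q.exists_basis by blast
 have bc: "b ! i \<in> carrier F" if "i < length b" for i using b that by (auto simp: alg_basis_def)
 have sums: "(\<Oplus>\<^bsub>F\<^esub>i\<in>{..<length b}. q2_of (s i) \<odot>\<^bsub>F\<^esub> b ! i) = h (\<Sum>i<length b. \<psi> (s i) * hi (b ! i))"
  if "\<And>i. i < length b ==> s i \<in> cauchy2" for s
  unfolding T.h_sum
 proof (rule T.F.finsum_cong')
  fix i assume "i \<in> {..<length b}"
  then show "q2_of (s i) \<odot>\<^bsub>F\<^esub> b ! i = h (\<psi> (s i) * hi (b ! i))"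
   using smult[of "s i" "hi (b ! i)"] that bc h_hi by simp
 qed auto
 obtain \<Lambda> where \<Lambda>: "two_adic_lattice_over \<Lambda> E.Z"
 proof (rule exE[OF E.exists_lattice])
  fix x
  have "\<exists>c. c \<in> {..<length b} \<rightarrow>\<^sub>E carrier Q2 \<and> h x = (\<Oplus>\<^bsub>F\<^esub>i\<in>{..<length b}. c i \<odot>\<^bsub>F\<^esub> b ! i)"
   using bspec[OF b[unfolded alg_basis_def, THEN conjunct2], of "h x"] by (auto elim: ex1E)
  then obtain c where c: "c \<in> {..<length b} \<rightarrow>\<^sub>E carrier Q2" "h x = (\<Oplus>\<^bsub>F\<^esub>i\<in>{..<length b}. c i \<odot>\<^bsub>F\<^esub> b ! i)" by blast
  have "\<forall>i. \<exists>s. i < length b --> s \<in> cauchy2 \<and> c i = q2_of s" using c(1) Q2_cases by (blast dest: PiE_mem)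
  then obtain s where s: "\<And>i. i < length b ==> s i \<in> cauchy2" "\<And>i. i < length b ==> c i = q2_of (s i)" by metis
  have "h x = (\<Oplus>\<^bsub>F\<^esub>i\<in>{..<length b}. q2_of (s i) \<odot>\<^bsub>F\<^esub> b ! i)"
   unfolding c(2) using s bc by (intro T.F.finsum_cong') (auto intro!: q.A.smult_closed Q2_simps(1))
  also have "\<dots> = h (\<Sum>i<length b. \<psi> (s i) * hi (b ! i))" by (rule sums) (rule s(1))
  finally have "x = (\<Sum>i<length b. \<psi> (s i) * hi (b ! i))" by (simp only: T.h_eq_iff)
  then show "\<exists>c. (\<forall>i<length b. c i \<in> E.Q) \<and> x = (\<Sum>i<length b. c i * hi (b ! i))"
   using s(1) by (intro exI[of _ "\<lambda>i. \<psi> (s i)"]) (auto simp: E.Q_def)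
 next
  fix c assume c: "\<forall>i<length b. c i \<in> E.Q" "(\<Sum>i<length b. c i * hi (b ! i)) = 0"
  have "\<forall>i. \<exists>s. i < length b --> s \<in> cauchy2 \<and> c i = \<psi> s" using c(1) by (auto simp: E.Q_def)
  then obtain s where s: "\<And>i. i < length b ==> s i \<in> cauchy2" "\<And>i. i < length b ==> c i = \<psi> (s i)" by metis
  have "(\<Sum>i<length b. \<psi> (s i) * hi (b ! i)) = 0" using c(2) s(2) by simp
  moreover have "(\<Oplus>\<^bsub>F\<^esub>i\<in>{..<length b}. q2_of (s i) \<odot>\<^bsub>F\<^esub> b ! i) = h (\<Sum>i<length b. \<psi> (s i) * hi (b ! i))"
   by (rule sums) (rule s(1))
  ultimately have "(\<Oplus>\<^bsub>F\<^esub>i\<in>{..<length b}. q2_of (s i) \<odot>\<^bsub>F\<^esub> b ! i) = (\<Oplus>\<^bsub>F\<^esub>i\<in>{..<length b}. \<zero>\<^bsub>Q2\<^esub> \<odot>\<^bsub>F\<^esub> b ! i)"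
   unfolding q.zero_lc[OF b] by (simp add: T.h_zero)
  then have eq: "q2_of (s i) = \<zero>\<^bsub>Q2\<^esub>" if "i < length b" for i
   using q.unique_coords[OF b _ _ _ that, of "\<lambda>i. q2_of (s i)" "\<lambda>_. \<zero>\<^bsub>Q2\<^esub>"] s(1) Q2_simps(1) by (auto simp: Pi_iff)
  show "\<forall>i<length b. c i = 0"
  proof (intro allI impI)
   fix i assume i: "i < length b"
   have "s i \<in> null2" using eq[OF i] q2_of_eq_iff[OF s(1)[OF i] const_cauchy2[of 0]] by (simp add: Q2_simps(5))
   then show "c i = 0" using E.psi_zero_iff[OF s(1)[OF i]] s(2)[OF i] by simp
  qed
 qed
 interpret \<Lambda>: two_adic_lattice_over \<Lambda> E.Z by (rule \<Lambda>)
 obtain \<pi> e R where dy: "dyadic \<Lambda>.power_bounded \<pi> e R" using \<Lambda>.exists_dyadic by blast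
 have h_pow: "h x [^]\<^bsub>F\<^esub> n = h (x ^ n)" for x and n :: nat
  by (induction n) (simp_all add: T.h_one T.h_mult mult.commute T.F.m_comm)
 \<comment> \<open>Translates an integral equation over \<open>Z2\<close> in \<open>F\<close> into
   one over \<open>E.Z\<close> in the field type, and back.\<close>
 have rel: "h y [^]\<^bsub>F\<^esub> n \<oplus>\<^bsub>F\<^esub> (\<Oplus>\<^bsub>F\<^esub>i\<in>{..<n}. c i \<odot>\<^bsub>F\<^esub> (h y [^]\<^bsub>F\<^esub> i)) = h (y ^ n + (\<Sum>i<n. \<psi> (s i) * y ^ i))"
  if "\<And>i. i < n ==> s i \<in> cauchy2 \<and> c i = q2_of (s i)" for y n c s
 proof -
  have "(\<Oplus>\<^bsub>F\<^esub>i\<in>{..<n}. c i \<odot>\<^bsub>F\<^esub> (h y [^]\<^bsub>F\<^esub> i)) = h (\<Sum>i<n. \<psi> (s i) * y ^ i)"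
   unfolding T.h_sum
  proof (rule T.F.finsum_cong')
   fix i assume "i \<in> {..<n}"
   then show "c i \<odot>\<^bsub>F\<^esub> (h y [^]\<^bsub>F\<^esub> i) = h (\<psi> (s i) * y ^ i)" using that[of i] smult by (simp add: h_pow)
  qed auto
  then show ?thesis by (simp add: h_pow T.h_add)
 qed
 have "O_F F = h ` \<Lambda>.power_bounded"
 proof (intro equalityI subsetI)
  fix x assume "x \<in> O_F F"
  then obtain n c where x: "x \<in> carrier F" and c: "c \<in> {..<n} \<rightarrow> Z2"
   "x [^]\<^bsub>F\<^esub> (n::nat) \<oplus>\<^bsub>F\<^esub> (\<Oplus>\<^bsub>F\<^esub>i\<in>{..<n}. c i \<odot>\<^bsub>F\<^esub> (x [^]\<^bsub>F\<^esub> i)) = \<zero>\<^bsub>F\<^esub>"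
   unfolding O_F_def integral_closure_def integral_over_def by blast
  obtain y where y: "x = h y" using T.h_surj[OF x] by blast
  have "\<forall>i. \<exists>s. i < n --> s \<in> cauchy2 \<and> (\<forall>k. abs2 (s k) \<le> 1) \<and> c i = q2_of s"
  proof
   fix i
   show "\<exists>s. i < n --> s \<in> cauchy2 \<and> (\<forall>k. abs2 (s k) \<le> 1) \<and> c i = q2_of s"
   proof (cases "i < n")
    case True
    then have "c i \<in> Z2" using c(1) by auto
    then show ?thesis unfolding Z2_def by blast
   qed blast
  qed
  then obtain s where s: "\<And>i. i < n ==> s i \<in> cauchy2 \<and> (\<forall>k. abs2 (s i k) \<le> 1) \<and> c i = q2_of (s i)" by metis
  have "h (y ^ n + (\<Sum>i<n. \<psi> (s i) * y ^ i)) = h 0"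
   using c(2) rel[of n s c y] s unfolding y T.h_zero by simp
  then have "y ^ n + (\<Sum>i<n. \<psi> (s i) * y ^ i) = 0" by (simp only: T.h_eq_iff)
  moreover have "\<forall>i<n. \<psi> (s i) \<in> E.Z" using s by (auto simp: E.Z_def)
  ultimately have "y \<in> \<Lambda>.power_bounded"
   unfolding \<Lambda>.power_bounded_iff_integral by (intro exI[of _ n] exI[of _ "\<lambda>i. \<psi> (s i)"]) simp
  then show "x \<in> h ` \<Lambda>.power_bounded" using y by blast
 next
  fix x assume "x \<in> h ` \<Lambda>.power_bounded"
  then obtain y where y: "x = h y" "y \<in> \<Lambda>.power_bounded" by blast
  obtain n c where c: "\<forall>i<n. c i \<in> E.Z" "y ^ n + (\<Sum>i<n. c i * y ^ i) = 0"
   using y(2) unfolding \<Lambda>.power_bounded_iff_integral by blast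
  have "\<forall>i. \<exists>s. i < n --> s \<in> cauchy2 \<and> (\<forall>k. abs2 (s k) \<le> 1) \<and> c i = \<psi> s" using c(1) E.ZD by blast
  then obtain s where s: "\<And>i. i < n ==> s i \<in> cauchy2 \<and> (\<forall>k. abs2 (s i k) \<le> 1) \<and> c i = \<psi> (s i)" by metis
  have "y ^ n + (\<Sum>i<n. \<psi> (s i) * y ^ i) = 0" using c(2) s by simp
  then have "x [^]\<^bsub>F\<^esub> n \<oplus>\<^bsub>F\<^esub> (\<Oplus>\<^bsub>F\<^esub>i\<in>{..<n}. q2_of (s i) \<odot>\<^bsub>F\<^esub> (x [^]\<^bsub>F\<^esub> i)) = \<zero>\<^bsub>F\<^esub>"
   using rel[of n s "\<lambda>i. q2_of (s i)" y] s unfolding y(1) T.h_zero[symmetric] by simp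
  moreover have "(\<lambda>i. q2_of (s i)) \<in> {..<n} \<rightarrow> Z2" using s by (auto simp: Z2_def)
  ultimately show "x \<in> O_F F"
   unfolding O_F_def integral_closure_def integral_over_def using y(1)
   by (intro CollectI conjI exI[of _ n] bexI[of _ "\<lambda>i. q2_of (s i)"]) simp_all
 qed
 then have "local_field F h \<Lambda>.power_bounded \<pi> e R"
  by (intro local_field.intro[OF h dy] local_field_axioms.intro)
 then show ?thesis by blast
qed

section \<open>Counting\<close>

text \<open>Maps with the same fibres have images in bijection. This is the passage from isomorphism
  classes of algebras to sets of square classes.\<close>

lemma sum_image_transfer:
 assumes eq: "\<And>x y. x \<in> S ==> y \<in> S ==> f x = f y \<longleftrightarrow> g x = g y"
  and u: "\<And>x. x \<in> S ==> u (f x) = w (g x)"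
 shows "sum u (f ` S) = sum w (g ` S)"
proof -
 define \<phi> where "\<phi> z = g (inv_into S f z)" for z
 have \<phi>: "\<phi> (f x) = g x" if "x \<in> S" for x
 proof -
  have "inv_into S f (f x) \<in> S" "f (inv_into S f (f x)) = f x"
   using that by (auto intro: inv_into_into f_inv_into_f)
  then show ?thesis unfolding \<phi>_def using eq that by blast
 qed
 have "inj_on \<phi> (f ` S)"
 proof (rule inj_onI)
  fix z z' assume "z \<in> f ` S" "z' \<in> f ` S" "\<phi> z = \<phi> z'"
  then show "z = z'" using \<phi> eq by force
 qed
 moreover have "\<phi> ` f ` S = g ` S" unfolding image_image by (rule image_cong[OF refl \<phi>])
 ultimately have "sum w (g ` S) = (\<Sum>z\<in>f ` S. w (\<phi> z))" using sum.reindex[of \<phi> "f ` S" w] by simp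
 also have "\<dots> = sum u (f ` S)"
 proof (rule sum.cong[OF refl])
  fix z assume "z \<in> f ` S"
  then obtain x where "x \<in> S" "z = f x" by blast
  then show "w (\<phi> z) = u z" using \<phi> u by simp
 qed
 finally show ?thesis by simp
qed

lemma card_image_transfer:
 "(\<And>x y. x \<in> S ==> y \<in> S ==> f x = f y \<longleftrightarrow> g x = g y) ==> card (f ` S) = card (g ` S)"
 using sum_image_transfer[of S f g "\<lambda>_. 1 :: nat" "\<lambda>_. 1"] by simp

text \<open>In the expanded square every unordered pair of different elements occurs twice, beside
  the diagonal.\<close>

lemma sum_unordered_pairs:
 fixes f :: "'b => real"
 assumes T: "finite T"
 shows "2 * (\<Sum>U\<in>(\<lambda>(c, d). {c, d}) ` {(c, d). c \<in> T \<and> d \<in> T \<and> c \<noteq> d}. prod f U) = (sum f T)\<^sup>2 - (\<Sum>c\<in>T. (f c)\<^sup>2)"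
proof -
 define S where "S = {(c, d). c \<in> T \<and> d \<in> T \<and> c \<noteq> d}"
 have fin: "finite S" by (rule finite_subset[of _ "T \<times> T"]) (auto simp: S_def T)
 have "(sum f T)\<^sup>2 = (\<Sum>p\<in>T \<times> T. f (fst p) * f (snd p))"
  by (simp add: power2_eq_square sum_product sum.cartesian_product split_beta)
 also have "T \<times> T = (\<lambda>c. (c, c)) ` T \<union> S" by (auto simp: S_def)
 also have "(\<Sum>p\<in>(\<lambda>c. (c, c)) ` T \<union> S. f (fst p) * f (snd p)) =
   (\<Sum>p\<in>(\<lambda>c. (c, c)) ` T. f (fst p) * f (snd p)) + (\<Sum>p\<in>S. f (fst p) * f (snd p))"
  by (rule sum.union_disjoint) (use fin T in \<open>auto simp: S_def\<close>)
 also have "(\<Sum>p\<in>(\<lambda>c. (c, c)) ` T. f (fst p) * f (snd p)) = (\<Sum>c\<in>T. (f c)\<^sup>2)"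
  by (subst sum.reindex) (auto simp: inj_on_def power2_eq_square)
 also have "(\<Sum>p\<in>S. f (fst p) * f (snd p)) = (\<Sum>U\<in>(\<lambda>(c, d). {c, d}) ` S. \<Sum>p | p \<in> S \<and> (\<lambda>(c, d). {c, d}) p = U. f (fst p) * f (snd p))"
  by (rule sum.image_gen[OF fin])
 also have "\<dots> = (\<Sum>U\<in>(\<lambda>(c, d). {c, d}) ` S. 2 * prod f U)"
 proof (rule sum.cong[OF refl])
  fix U assume "U \<in> (\<lambda>(c, d). {c, d}) ` S"
  then obtain c d where cd: "c \<in> T" "d \<in> T" "c \<noteq> d" "U = {c, d}" by (auto simp: S_def)
  have "{p. p \<in> S \<and> (\<lambda>(c, d). {c, d}) p = U} = {(c, d), (d, c)}"
   using cd by (auto simp: S_def doubleton_eq_iff)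
  then show "(\<Sum>p | p \<in> S \<and> (\<lambda>(c, d). {c, d}) p = U. f (fst p) * f (snd p)) = 2 * prod f U"
   using cd by (simp add: mult.commute)
 qed
 also have "\<dots> = 2 * (\<Sum>U\<in>(\<lambda>(c, d). {c, d}) ` S. prod f U)" by (simp add: sum_distrib_left)
 finally show ?thesis by (simp add: S_def)
qed

subsection \<open>The generating function of the numbers N_neq\<close>

lemma card_sum_pairs:
 assumes "2 \<le> m" "m \<le> 2 * e"
 shows "card {(i, j). i \<in> {1..e} \<and> j \<in> {1..e} \<and> i + j = m} = (if m \<le> e then m - 1 else 2 * e + 1 - m)"
proof -
 have "{(i, j). i \<in> {1..e} \<and> j \<in> {1..e} \<and> i + j = m} = (\<lambda>i. (i, m - i)) ` {max 1 (m - e)..min e (m - 1)}"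
  using assms by (auto simp: image_iff)
 moreover have "card ((\<lambda>i. (i, m - i)) ` {max 1 (m - e)..min e (m - 1)}) = card {max 1 (m - e)..min e (m - 1)}"
  by (rule card_image) (auto simp: inj_on_def)
 ultimately show ?thesis using assms by (auto simp: max_def min_def)
qed

text \<open>The number of square classes with discriminant exponent \<open>2 j\<close>, as in
  \<open>card_TR_wild\<close>.\<close>

definition disc_count :: "nat => nat => real" where
 "disc_count q j = 2 * (real q - 1) * real q ^ (j - 1)"

text \<open>Both even branches of \<open>N_neq\<close> count the pairs \<open>(i, j)\<close> between
  1 and \<open>e\<close> with sum \<open>m\<close>, as in \<open>card_sum_pairs\<close>; the
  correction for multiples of 4 removes the pairs of equal classes.\<close>

lemma N_neq_even:
 assumes "2 \<le> m" "m \<le> 2 * e"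
 shows "2 * N_neq q e (2 * m) = 4 * (real q - 1)\<^sup>2 * real q ^ (m - 2) * real (if m \<le> e then m - 1 else 2 * e + 1 - m) -
  (if even m then disc_count q (m div 2) else 0)"
proof -
 have d: "4 dvd 2 * m \<longleftrightarrow> even m" "2 * m div 4 = m div 2" by presburger+
 show ?thesis
 proof (cases "m \<le> e")
  case True
  have "N_neq q e (2 * m) = 2 * (real q - 1)\<^sup>2 * real q ^ (2 * m div 2 - 2) * (real (2 * m) / 2 - 1)
    - (if 4 dvd 2 * m then (real q - 1) * real q ^ (2 * m div 4 - 1) else 0)"
   unfolding N_neq_def by (rule if_P) (use assms True in auto)
  then show ?thesis unfolding d using assms True
   by (cases "even m") (simp_all add: disc_count_def of_nat_diff algebra_simps)
 next
  case False
  have "N_neq q e (2 * m) = 2 * (real q - 1)\<^sup>2 * real q ^ (2 * m div 2 - 2) * (2 * real e - real (2 * m) / 2 + 1)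
    - (if 4 dvd 2 * m then (real q - 1) * real q ^ (2 * m div 4 - 1) else 0)"
   unfolding N_neq_def by (rule trans[OF if_not_P if_P]) (use assms False in auto)
  moreover have "real (2 * e + 1 - m) = 2 * real e - real m + 1" using assms by (simp add: of_nat_diff)
  ultimately show ?thesis unfolding d using assms False
   by (cases "even m") (simp_all add: disc_count_def algebra_simps)
 qed
qed

lemma N_neq_odd:
 assumes "1 \<le> j" "j \<le> e"
 shows "N_neq q e (2 * j + (2 * e + 1)) = disc_count q j * (2 * real q ^ e)"
proof -
 have "(2 * j + (2 * e + 1) - 1) div 2 - 1 = (j - 1) + e" using assms by simp
 moreover have "N_neq q e (2 * j + (2 * e + 1)) = 4 * (real q - 1) * real q ^ ((2 * j + (2 * e + 1) - 1) div 2 - 1)"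
  unfolding N_neq_def by (rule trans[OF if_not_P trans[OF if_not_P if_P]]) (use assms in auto)
 ultimately show ?thesis by (simp add: disc_count_def power_add)
qed

lemma N_neq_zero:
 assumes "4 \<le> m" "m \<le> 4 * e + 1" "odd m" "m < 2 * e + 3"
 shows "N_neq q e m = 0"
 using assms by (auto simp: N_neq_def)

lemma N_neq_top: "1 \<le> e ==> 2 * N_neq q e (4 * e + 2) = (2 * real q ^ e)\<^sup>2 - 2 * real q ^ e"
 by (simp add: N_neq_def power2_eq_square algebra_simps)

lemma sum_N_neq:
 fixes x :: real
 assumes e: "1 \<le> e"
 shows "2 * (\<Sum>m = 4..4 * e + 2. x ^ m * N_neq q e m) =
  ((\<Sum>j = 1..e. disc_count q j * x ^ (2 * j)) + 2 * real q ^ e * x ^ (2 * e + 1))\<^sup>2 -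
  ((\<Sum>j = 1..e. disc_count q j * x ^ (4 * j)) + 2 * real q ^ e * x ^ (4 * e + 2))"
proof -
 define W where "W = (\<Sum>j = 1..e. disc_count q j * x ^ (2 * j))"
 define c where "c m = (if m \<le> e then m - 1 else 2 * e + 1 - m)" for m
 \<comment> \<open>Four groups: even indices up to \<open>4 e\<close>, odd ones from
   \<open>2 e + 3\<close> on, the top index, and the small odd indices, on which
   \<open>N_neq\<close> vanishes.\<close>
 have split: "{4..4 * e + 2} = (\<lambda>m. 2 * m) ` {2..2 * e} \<union> (\<lambda>j. 2 * j + (2 * e + 1)) ` {1..e} \<union> {4 * e + 2} \<union>
   {m \<in> {4..4 * e + 1}. odd m \<and> m < 2 * e + 3}" (is "_ = ?A \<union> ?B \<union> ?C \<union> ?D")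
 proof (intro equalityI subsetI)
  fix m assume m: "m \<in> {4..4 * e + 2}"
  show "m \<in> ?A \<union> ?B \<union> ?C \<union> ?D"
  proof (cases "even m")
   case True
   then obtain k where k: "m = 2 * k" by blast
   then have "k \<in> {2..2 * e} \<or> m = 4 * e + 2" using m by auto
   then show ?thesis using k by auto
  next
   case False
   show ?thesis
   proof (cases "m < 2 * e + 3")
    case True
    then show ?thesis using False m by auto
   next
    case big: False
    obtain k where k: "m = 2 * k + 1" using False by (elim oddE)
    then have "k - e \<in> {1..e}" "m = 2 * (k - e) + (2 * e + 1)" using m big by auto
    then show ?thesis by blast
   qed
  qed
 qed (use e in auto)
 have A: "even m \<and> m \<le> 4 * e" if "m \<in> ?A" for m using that by auto
 have B: "odd m \<and> 2 * e + 3 \<le> m" if "m \<in> ?B" for m using that by auto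
 have C: "even m \<and> m = 4 * e + 2" if "m \<in> ?C" for m using that by auto
 have D: "odd m \<and> m < 2 * e + 3" if "m \<in> ?D" for m using that by auto
 have dj: "?A \<inter> ?B = {}" "?A \<inter> ?D = {}" "?B \<inter> ?C = {}" "?C \<inter> ?D = {}" "?A \<inter> ?C = {}" "?B \<inter> ?D = {}"
  unfolding disjoint_iff by (intro allI impI notI; drule A B C D; drule A B C D; simp)+
 have dis: "?A \<inter> ?B = {}" "(?A \<union> ?B) \<inter> ?C = {}" "(?A \<union> ?B \<union> ?C) \<inter> ?D = {}"
  unfolding Int_Un_distrib2 dj by simp_all
 have fin: "finite ?A" "finite ?B" "finite ?C" "finite ?D" by auto
 have "(\<Sum>m = 4..4 * e + 2. x ^ m * N_neq q e m) =
  (\<Sum>m\<in>?A. x ^ m * N_neq q e m) + (\<Sum>m\<in>?B. x ^ m * N_neq q e m) + (\<Sum>m\<in>?C. x ^ m * N_neq q e m) + (\<Sum>m\<in>?D. x ^ m * N_neq q e m)"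
  unfolding split
  by (simp only: sum.union_disjoint[OF _ _ dis(3)] sum.union_disjoint[OF _ _ dis(2)] sum.union_disjoint[OF _ _ dis(1)]
    fin finite_Un simp_thms)
 also have "(\<Sum>m\<in>?D. x ^ m * N_neq q e m) = 0" by (rule sum.neutral) (simp add: N_neq_zero)
 also have "(\<Sum>m\<in>?A. x ^ m * N_neq q e m) = (\<Sum>m = 2..2 * e. x ^ (2 * m) * N_neq q e (2 * m))"
  by (subst sum.reindex) (auto simp: inj_on_def)
 also have "(\<Sum>m\<in>?B. x ^ m * N_neq q e m) = (\<Sum>j = 1..e. x ^ (2 * j + (2 * e + 1)) * N_neq q e (2 * j + (2 * e + 1)))"
  by (subst sum.reindex) (auto simp: inj_on_def)
 finally have total: "2 * (\<Sum>m = 4..4 * e + 2. x ^ m * N_neq q e m) =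
   (\<Sum>m = 2..2 * e. x ^ (2 * m) * (2 * N_neq q e (2 * m))) +
   2 * (\<Sum>j = 1..e. x ^ (2 * j + (2 * e + 1)) * N_neq q e (2 * j + (2 * e + 1))) +
   x ^ (4 * e + 2) * (2 * N_neq q e (4 * e + 2))"
  by (simp add: sum_distrib_left algebra_simps)
 have odd: "(\<Sum>j = 1..e. x ^ (2 * j + (2 * e + 1)) * N_neq q e (2 * j + (2 * e + 1))) = W * (2 * real q ^ e * x ^ (2 * e + 1))"
  unfolding W_def sum_distrib_right 
 proof (rule sum.cong[OF refl])
  fix j assume "j \<in> {1..e}"
  then have "N_neq q e (2 * j + (2 * e + 1)) = disc_count q j * (2 * real q ^ e)" by (simp only: N_neq_odd atLeastAtMost_iff)
  then show "x ^ (2 * j + (2 * e + 1)) * N_neq q e (2 * j + (2 * e + 1)) =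
    disc_count q j * x ^ (2 * j) * (2 * real q ^ e * x ^ (2 * e + 1))"
   by (simp only: power_add) (simp only: mult_ac)
 qed
 have even: "(\<Sum>m = 2..2 * e. x ^ (2 * m) * (if even m then disc_count q (m div 2) else 0)) = (\<Sum>j = 1..e. disc_count q j * x ^ (4 * j))"
 proof -
  have "(\<Sum>m = 2..2 * e. x ^ (2 * m) * (if even m then disc_count q (m div 2) else 0)) =
   (\<Sum>m\<in>(\<lambda>j. 2 * j) ` {1..e}. x ^ (2 * m) * (if even m then disc_count q (m div 2) else 0))"
  proof (rule sum.mono_neutral_right)
   show "\<forall>m\<in>{2..2 * e} - (\<lambda>j. 2 * j) ` {1..e}. x ^ (2 * m) * (if even m then disc_count q (m div 2) else 0) = 0"
   proof
    fix m assume m: "m \<in> {2..2 * e} - (\<lambda>j. 2 * j) ` {1..e}"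
    have "odd m"
    proof
     assume "even m"
     then obtain k where "m = 2 * k" by blast
     moreover from this have "k \<in> {1..e}" using m by auto
     ultimately show False using m by blast
    qed
    then show "x ^ (2 * m) * (if even m then disc_count q (m div 2) else 0) = 0" by simp
   qed
  qed auto
  also have "\<dots> = (\<Sum>j = 1..e. disc_count q j * x ^ (4 * j))"
   by (subst sum.reindex) (auto simp: inj_on_def mult.commute)
  finally show ?thesis .
 qed
 \<comment> \<open>The square is grouped by the sum \<open>i + j\<close> of exponents; the powers of
   \<open>q\<close> multiply to \<open>q ^ (m - 2)\<close>, which is the same for all pairs of one
   group.\<close>
 have W2: "W\<^sup>2 = (\<Sum>m = 2..2 * e. x ^ (2 * m) * (4 * (real q - 1)\<^sup>2 * real q ^ (m - 2) * real (c m)))"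
 proof -
  let ?f = "\<lambda>p. (disc_count q (fst p) * x ^ (2 * fst p)) * (disc_count q (snd p) * x ^ (2 * snd p))"
  have "W\<^sup>2 = (\<Sum>p\<in>{1..e} \<times> {1..e}. ?f p)"
   unfolding W_def power2_eq_square sum_product by (simp add: sum.cartesian_product split_beta)
  also have "\<dots> = (\<Sum>m = 2..2 * e. \<Sum>p\<in>{p \<in> {1..e} \<times> {1..e}. fst p + snd p = m}. ?f p)"
   by (rule sum.group[symmetric]) auto
  also have "\<dots> = (\<Sum>m = 2..2 * e. x ^ (2 * m) * (4 * (real q - 1)\<^sup>2 * real q ^ (m - 2) * real (c m)))"
  proof (rule sum.cong[OF refl])
   fix m assume m: "m \<in> {2..2 * e}"
   have "(\<Sum>p\<in>{p \<in> {1..e} \<times> {1..e}. fst p + snd p = m}. ?f p) =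
    (\<Sum>p\<in>{p \<in> {1..e} \<times> {1..e}. fst p + snd p = m}. x ^ (2 * m) * (4 * (real q - 1)\<^sup>2 * real q ^ (m - 2)))"
   proof (rule sum.cong[OF refl])
    fix p assume p: "p \<in> {p \<in> {1..e} \<times> {1..e}. fst p + snd p = m}"
    then have m: "m - 2 = (fst p - 1) + (snd p - 1)" "2 * m = 2 * fst p + 2 * snd p" by auto
    have four: "(4 :: real) = 2 * 2" by simp
    show "?f p = x ^ (2 * m) * (4 * (real q - 1)\<^sup>2 * real q ^ (m - 2))"
     unfolding disc_count_def m power_add power2_eq_square four by (simp only: mult_ac)
   qed
   also have "\<dots> = real (c m) * (x ^ (2 * m) * (4 * (real q - 1)\<^sup>2 * real q ^ (m - 2)))"
   proof -
    have "{p \<in> {1..e} \<times> {1..e}. fst p + snd p = m} = {(i, j). i \<in> {1..e} \<and> j \<in> {1..e} \<and> i + j = m}" by auto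
    then show ?thesis using card_sum_pairs[of m e] m by (simp add: c_def)
   qed
   finally show "(\<Sum>p\<in>{p \<in> {1..e} \<times> {1..e}. fst p + snd p = m}. ?f p) = x ^ (2 * m) * (4 * (real q - 1)\<^sup>2 * real q ^ (m - 2) * real (c m))"
    by (simp add: mult_ac)
  qed
  finally show ?thesis .
 qed
 have "(\<Sum>m = 2..2 * e. x ^ (2 * m) * (2 * N_neq q e (2 * m))) =
  (\<Sum>m = 2..2 * e. x ^ (2 * m) * (4 * (real q - 1)\<^sup>2 * real q ^ (m - 2) * real (c m)) -
   x ^ (2 * m) * (if even m then disc_count q (m div 2) else 0))"
  by (rule sum.cong[OF refl]) (simp only: N_neq_even atLeastAtMost_iff c_def right_diff_distrib)
 also have "\<dots> = W\<^sup>2 - (\<Sum>j = 1..e. disc_count q j * x ^ (4 * j))"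
  unfolding sum_subtractf W2 even ..
 finally have eq: "2 * (\<Sum>m = 4..4 * e + 2. x ^ m * N_neq q e m) = W\<^sup>2 - (\<Sum>j = 1..e. disc_count q j * x ^ (4 * j)) +
   2 * (W * (2 * real q ^ e * x ^ (2 * e + 1))) + x ^ (4 * e + 2) * ((2 * real q ^ e)\<^sup>2 - 2 * real q ^ e)"
  unfolding total odd N_neq_top[OF e] by simp
 have sq: "x ^ (4 * e + 2) = (x ^ (2 * e + 1))\<^sup>2"
 proof -
  have "4 * e + 2 = (2 * e + 1) * 2" by simp
  then show ?thesis by (simp only: power_mult)
 qed
 have alg: "W\<^sup>2 - D + 2 * (W * (y * Y)) + Y\<^sup>2 * (y\<^sup>2 - y) = (W + y * Y)\<^sup>2 - (D + y * Y\<^sup>2)" for W D y Y :: real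
  by (simp add: power2_eq_square algebra_simps)
 show ?thesis using eq unfolding W_def[symmetric] sq alg .
qed

text \<open>Like \<open>iso_class\<close>, but the representative may be carried by any type, so
  that the models on pairs can name the classes.\<close>

definition list_class :: "('a, 'm) ring_scheme => ('a, 'b, 'n) module_scheme => ('a, 'a list) module set" where
 "list_class F K = {M. algebra F M \<and> alg_isomorphic F K M}"

lemma list_class_cong:
 assumes K: "algebra F K" and iso: "alg_isomorphic F K K'"
 shows "list_class F K = list_class F K'"
 unfolding list_class_def using alg_isomorphic_trans[OF iso] alg_isomorphic_trans[OF alg_isomorphic_sym[OF K iso]] by blast

lemma iso_class_eq_list_class: "algebra F K ==> alg_isomorphic F K L ==> iso_class F L = list_class F K"
 using list_class_cong[of F K L] by (simp add: iso_class_def list_class_def)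

lemma list_class_eq_iff:
 fixes K :: "('a, 'b) module" and K' :: "('a, 'c) module"
 assumes K: "algebra F K" "alg_basis F K b" and K': "algebra F K'"
 shows "list_class F K = list_class F K' \<longleftrightarrow> alg_isomorphic F K K'"
proof
 assume eq: "list_class F K = list_class F K'"
 obtain M :: "('a, 'a list) module" where M: "algebra F M" "alg_isomorphic F K M"
  using algebra_copy_on_lists[OF K] by blast
 then have "M \<in> list_class F K'" using eq by (auto simp: list_class_def)
 then have "alg_isomorphic F K' M" by (simp add: list_class_def)
 then show "alg_isomorphic F K K'" by (rule alg_isomorphic_trans[OF M(2) alg_isomorphic_sym[OF K']])
qed (rule list_class_cong[OF K(1)])

lemma alg_prod_iso:
 assumes "f \<in> alg_iso F K L" "g \<in> alg_iso F K' L'"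
 shows "map_prod f g \<in> alg_iso F (alg_prod K K') (alg_prod L L')"
proof (rule alg_isoI)
 show "map_prod f g \<in> Ring.ring_hom (alg_prod K K') (alg_prod L L')"
  using alg_isoD(2)[OF assms(1)] alg_isoD(2)[OF assms(2)]
  by (intro ring_hom_memI) (auto simp: ring_hom_closed ring_hom_mult ring_hom_add ring_hom_one)
 show "bij_betw (map_prod f g) (carrier (alg_prod K K')) (carrier (alg_prod L L'))"
  using bij_betw_map_prod[OF alg_isoD(3)[OF assms(1)] alg_isoD(3)[OF assms(2)]] by simp
qed (use alg_isoD(4)[OF assms(1)] alg_isoD(4)[OF assms(2)] in auto)

lemma etale_algebra: "etale F L ==> algebra F L"
 by (erule etale.cases) (auto simp: finite_field_ext_def)

section \<open>The pre-mass as a sum over square classes\<close>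

context local_field
begin

abbreviation q :: nat where "q \<equiv> card R"

lemma q_ge_2: "2 \<le> q"
proof (rule ccontr)
 assume "\<not> 2 \<le> q"
 then have "card R = 1" using card_R_pos by linarith
 then obtain r where r: "R = {r}" by (auto simp: card_1_singleton_iff)
 have "(0 - r) / \<pi> \<in> Ob" "(1 - r) / \<pi> \<in> Ob"
  using R_transversal[OF zero_O] R_transversal[OF one_O] unfolding r by auto
 then have "(1 - r) / \<pi> - (0 - r) / \<pi> \<in> Ob" by (rule diff_O[rotated])
 moreover have "(1 - r) / \<pi> - (0 - r) / \<pi> = 1 / \<pi>" by (simp add: diff_divide_distrib)
 ultimately show False using pi_nonunit by (simp only:)
qed

definition gens :: "'k set" where "gens = {a. \<exists>r. ram_gen a r}"

definition T :: "'k set set" where "T = cls ` gens"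

lemma ram_gen_unique: "ram_gen a r ==> ram_gen b r' ==> cls a = cls b ==> r = r'"
 using TR_disjoint[of r r'] by (auto simp: TR_def)

text \<open>The discriminant exponent as a function of the square class; the choice is unambiguous
  on \<open>T\<close> because the sets \<open>TR r\<close> are disjoint.\<close>

definition dsc :: "'k set => nat" where
 "dsc c = nat (SOME r. \<exists>a. c = cls a \<and> ram_gen a r)"

lemma ram_gen_nonneg: "ram_gen a r ==> 2 \<le> r \<and> r \<le> 2 * int e + 1"
 using ram_gen_values[of a r] e_pos by auto

lemma dsc_cls: "ram_gen a r ==> int (dsc (cls a)) = r"
proof -
 assume a: "ram_gen a r"
 have "\<exists>b. cls a = cls b \<and> ram_gen b (SOME r. \<exists>b. cls a = cls b \<and> ram_gen b r)"
  by (rule someI[of "\<lambda>r. \<exists>b. cls a = cls b \<and> ram_gen b r" r]) (use a in blast)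
 then have "(SOME r. \<exists>b. cls a = cls b \<and> ram_gen b r) = r" using ram_gen_unique[OF a] by metis
 then show ?thesis using ram_gen_nonneg[OF a] by (simp add: dsc_def)
qed

lemma dsc_bounds: "c \<in> T ==> 2 \<le> dsc c \<and> dsc c \<le> 2 * e + 1"
 using dsc_cls ram_gen_nonneg by (force simp: T_def gens_def)

lemma T_dsc: "{c \<in> T. dsc c = n} = TR (int n)"
proof (intro equalityI subsetI)
 fix c assume "c \<in> {c \<in> T. dsc c = n}"
 then obtain a r where "c = cls a" "ram_gen a r" "dsc c = n" by (auto simp: T_def gens_def)
 then show "c \<in> TR (int n)" using dsc_cls[of a r] by (auto simp: TR_def)
next
 fix c assume "c \<in> TR (int n)"
 then obtain a where "c = cls a" "ram_gen a (int n)" by (auto simp: TR_def)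
 then show "c \<in> {c \<in> T. dsc c = n}" using dsc_cls[of a "int n"] by (auto simp: T_def gens_def)
qed

text \<open>Only the exponents \<open>2 j\<close> with \<open>1 \<le> j \<le> e\<close> and
  \<open>2 e + 1\<close> occur, so the classes are grouped by exponent and counted.\<close>

lemma sum_T:
 fixes f :: "nat => real"
 shows "finite T" and "(\<Sum>c\<in>T. f (dsc c)) = (\<Sum>j = 1..e. disc_count q j * f (2 * j)) + 2 * real q ^ e * f (2 * e + 1)"
proof -
 let ?D = "(\<lambda>j. 2 * j) ` {1..e} \<union> {2 * e + 1}"
 have D: "dsc ` T \<subseteq> ?D"
 proof
  fix n assume "n \<in> dsc ` T"
  then obtain a r where a: "ram_gen a r" "n = dsc (cls a)" by (auto simp: T_def gens_def)
  then have "int n = 2 * int e + 1 \<or> (\<exists>k. 1 \<le> k \<and> k \<le> e \<and> int n = 2 * int k)"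
   using dsc_cls[OF a(1)] ram_gen_values[OF a(1)] by simp
  then show "n \<in> ?D"
  proof (elim disjE exE conjE)
   assume "int n = 2 * int e + 1"
   then have "n = 2 * e + 1" by linarith
   then show ?thesis by simp
  next
   fix k assume "1 \<le> k" "k \<le> e" "int n = 2 * int k"
   then have "n = 2 * k" "k \<in> {1..e}" by auto
   then show ?thesis by blast
  qed
 qed
 have card: "real (card (TR (2 * int j))) = disc_count q j" if "j \<in> {1..e}" for j
  using card_TR_wild[of j] that q_ge_2 by (simp add: disc_count_def of_nat_diff)
 have fin: "finite (TR (int n))" if n: "n \<in> ?D" for n
 proof (rule card_ge_0_finite)
  consider j where "1 \<le> j" "j \<le> e" "n = 2 * j" | "n = 2 * e + 1" using n by auto
  then show "0 < card (TR (int n))"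
  proof cases
   case 1
   then have "int n = 2 * int j" by simp
   then show ?thesis using card_TR_wild[OF 1(1,2)] q_ge_2 by simp
  next
   case 2
   then have "int n = 2 * int e + 1" by simp
   then show ?thesis using card_TR_top q_ge_2 by (simp only:) simp
  qed
 qed
 have T: "T = (\<Union>n\<in>?D. TR (int n))"
 proof (intro equalityI subsetI)
  fix c assume c: "c \<in> T"
  then have "dsc c \<in> ?D" using D by auto
  moreover have "c \<in> TR (int (dsc c))" using c by (simp flip: T_dsc)
  ultimately show "c \<in> (\<Union>n\<in>?D. TR (int n))" by (rule UN_I)
 next
  fix c assume "c \<in> (\<Union>n\<in>?D. TR (int n))"
  then show "c \<in> T" by (auto simp flip: T_dsc)
 qed
 show finT: "finite T" unfolding T by (intro finite_UN_I fin) auto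
 have "(\<Sum>c\<in>T. f (dsc c)) = (\<Sum>n\<in>?D. \<Sum>c\<in>{c \<in> T. dsc c = n}. f (dsc c))"
  by (rule sum.group[OF finT _ D, symmetric]) simp
 also have "\<dots> = (\<Sum>n\<in>?D. real (card (TR (int n))) * f n)"
  by (rule sum.cong[OF refl]) (simp add: T_dsc[symmetric])
 also have "\<dots> = (\<Sum>n\<in>(\<lambda>j. 2 * j) ` {1..e}. real (card (TR (int n))) * f n) + real (card (TR (2 * int e + 1))) * f (2 * e + 1)"
 proof -
  have "2 * e + 1 \<notin> (\<lambda>j. 2 * j) ` {1..e}"
  proof
   assume "2 * e + 1 \<in> (\<lambda>j. 2 * j) ` {1..e}"
   then obtain j where "2 * e + 1 = 2 * j" by auto
   then show False by presburger
  qed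
  then show ?thesis by (simp add: add.commute)
 qed
 also have "(\<Sum>n\<in>(\<lambda>j. 2 * j) ` {1..e}. real (card (TR (int n))) * f n) = (\<Sum>j = 1..e. disc_count q j * f (2 * j))"
 proof -
  have "(\<Sum>n\<in>(\<lambda>j. 2 * j) ` {1..e}. real (card (TR (int n))) * f n) = (\<Sum>j = 1..e. real (card (TR (int (2 * j)))) * f (2 * j))"
   by (subst sum.reindex) (auto simp: inj_on_def)
  also have "\<dots> = (\<Sum>j = 1..e. disc_count q j * f (2 * j))"
   by (rule sum.cong[OF refl]) (simp add: card)
  finally show ?thesis .
 qed
 finally show "(\<Sum>c\<in>T. f (dsc c)) = (\<Sum>j = 1..e. disc_count q j * f (2 * j)) + 2 * real q ^ e * f (2 * e + 1)"
  unfolding card_TR_top by simp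
qed

lemma gens_not_square: "a \<in> gens ==> \<not> is_square a"
 using ram_gen_not_square by (auto simp: gens_def)

lemma N_cong_cls: "cls a = cls b ==> N a = N b"
 unfolding cls_eq_iff using N_cong_square by auto

lemma Et_ram2_eq:
 "Et_ram2 F A r = (\<lambda>a. list_class F (Qalg a)) ` {a \<in> gens. A \<subseteq> h ` N a \<and> of_nat (dsc (cls a)) = r}"
proof (intro equalityI subsetI)
 fix C assume "C \<in> Et_ram2 F A r"
 then obtain L :: "('a, 'a list) module" where L: "C = iso_class F L" "tot_ram_quadratic F L" "A \<subseteq> norm_group F L"
  "of_int (disc_val F L) = r" unfolding Et_ram2_def by blast
 obtain a s where a: "ram_gen a s" "alg_isomorphic F (Qalg a) L" using tot_ramD[OF L(2)] by blast
 then obtain f where f: "f \<in> alg_iso F (Qalg a) L" by (auto simp: alg_isomorphic_def)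
 have algL: "algebra F L" using L(2) by (simp add: tot_ram_quadratic_def finite_field_ext_def)
 have "A \<subseteq> h ` N a"
  using L(3) norm_group_iso[OF algebra_Qalg algL f basis_Qalg[OF one_neq_zero]] norm_group_Qalg[OF ram_gen_not_square[OF a(1)]] by simp
 moreover have "of_nat (dsc (cls a)) = r"
  using L(4) disc_val_iso[OF algL f a(1)] dsc_cls[OF a(1)] by (metis of_int_of_nat_eq)
 moreover have "a \<in> gens" using a(1) by (auto simp: gens_def)
 moreover have "C = list_class F (Qalg a)" unfolding L(1) by (rule iso_class_eq_list_class[OF algebra_Qalg a(2)])
 ultimately show "C \<in> (\<lambda>a. list_class F (Qalg a)) ` {a \<in> gens. A \<subseteq> h ` N a \<and> of_nat (dsc (cls a)) = r}" by blast
next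
 fix C assume "C \<in> (\<lambda>a. list_class F (Qalg a)) ` {a \<in> gens. A \<subseteq> h ` N a \<and> of_nat (dsc (cls a)) = r}"
 then obtain a s where a: "C = list_class F (Qalg a)" "ram_gen a s" "A \<subseteq> h ` N a" "of_nat (dsc (cls a)) = r"
  by (auto simp: gens_def)
 obtain L :: "('a, 'a list) module" where L: "algebra F L" "alg_isomorphic F (Qalg a) L"
  using algebra_copy_on_lists[OF algebra_Qalg basis_Qalg[OF one_neq_zero]] by blast
 then obtain f where f: "f \<in> alg_iso F (Qalg a) L" by (auto simp: alg_isomorphic_def)
 have "A \<subseteq> norm_group F L"
  using a(3) norm_group_iso[OF algebra_Qalg L(1) f basis_Qalg[OF one_neq_zero]] norm_group_Qalg[OF ram_gen_not_square[OF a(2)]] by simp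
 moreover have "of_int (disc_val F L) = r"
  using a(4) disc_val_iso[OF L(1) f a(2)] dsc_cls[OF a(2)] by (metis of_int_of_nat_eq)
 ultimately show "C \<in> Et_ram2 F A r"
  unfolding Et_ram2_def a(1) iso_class_eq_list_class[OF algebra_Qalg L(2), symmetric] using tot_ramI[OF L(1) f a(2)] by blast
qed

definition good :: "'a set => 'k set set" where
 "good A = cls ` {a \<in> gens. A \<subseteq> h ` N a}"

lemma card_Et_ram2: "card (Et_ram2 F A r) = card {c \<in> good A. of_nat (dsc c) = r}"
proof -
 have "card (Et_ram2 F A r) = card (cls ` {a \<in> gens. A \<subseteq> h ` N a \<and> of_nat (dsc (cls a)) = r})"
  unfolding Et_ram2_eq
  by (rule card_image_transfer)
   (use list_class_eq_iff[OF algebra_Qalg basis_Qalg[OF one_neq_zero] algebra_Qalg] iso_Qalg_iff gens_not_square in blast)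
 also have "cls ` {a \<in> gens. A \<subseteq> h ` N a \<and> of_nat (dsc (cls a)) = r} = {c \<in> good A. of_nat (dsc c) = r}"
  by (auto simp: good_def)
 finally show ?thesis .
qed

lemma Et_ram2_ram2_eq:
 "Et_ram2_ram2 F A = (\<lambda>(a, b). list_class F (Pr a b)) `
  {(a, b). a \<in> gens \<and> b \<in> gens \<and> A \<subseteq> h ` {n * m | n m. n \<in> N a \<and> m \<in> N b}}"
proof (intro equalityI subsetI)
 fix C assume "C \<in> Et_ram2_ram2 F A"
 then obtain L L1 L2 :: "('a, 'a list) module" where L: "C = iso_class F L" "etale F L" "A \<subseteq> norm_group F L"
  "tot_ram_quadratic F L1" "tot_ram_quadratic F L2" "alg_isomorphic F L (alg_prod L1 L2)"
  unfolding Et_ram2_ram2_def by blast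
 have algL: "algebra F L" by (rule etale_algebra[OF L(2)])
 obtain a r b s where ab: "ram_gen a r" "alg_isomorphic F (Qalg a) L1" "ram_gen b s" "alg_isomorphic F (Qalg b) L2"
  using tot_ramD[OF L(4)] tot_ramD[OF L(5)] by blast
 then have "alg_isomorphic F (Pr a b) (alg_prod L1 L2)" using alg_prod_iso unfolding alg_isomorphic_def by blast
 then have iso: "alg_isomorphic F (Pr a b) L" by (rule alg_isomorphic_trans[OF _ alg_isomorphic_sym[OF algL L(6)]])
 then obtain f where f: "f \<in> alg_iso F (Pr a b) L" by (auto simp: alg_isomorphic_def)
 have "A \<subseteq> h ` {n * m | n m. n \<in> N a \<and> m \<in> N b}"
  using L(3) unfolding norm_group_Pr[OF algL f ram_gen_not_square[OF ab(1)] ram_gen_not_square[OF ab(3)]] .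
 moreover have "a \<in> gens" "b \<in> gens" using ab by (auto simp: gens_def)
 moreover have "C = list_class F (Pr a b)" unfolding L(1) by (rule iso_class_eq_list_class[OF algebra_Pr iso])
 ultimately show "C \<in> (\<lambda>(a, b). list_class F (Pr a b)) `
   {(a, b). a \<in> gens \<and> b \<in> gens \<and> A \<subseteq> h ` {n * m | n m. n \<in> N a \<and> m \<in> N b}}"
  by (intro image_eqI[of _ _ "(a, b)"]) simp_all
next
 fix C assume "C \<in> (\<lambda>(a, b). list_class F (Pr a b)) `
   {(a, b). a \<in> gens \<and> b \<in> gens \<and> A \<subseteq> h ` {n * m | n m. n \<in> N a \<and> m \<in> N b}}"
 then obtain p where p: "C = (\<lambda>(a, b). list_class F (Pr a b)) p"
  "p \<in> {(a, b). a \<in> gens \<and> b \<in> gens \<and> A \<subseteq> h ` {n * m | n m. n \<in> N a \<and> m \<in> N b}}" by (rule imageE)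
 obtain a b where "p = (a, b)" by (cases p)
 then have C: "C = list_class F (Pr a b)" "a \<in> gens" "b \<in> gens" "A \<subseteq> h ` {n * m | n m. n \<in> N a \<and> m \<in> N b}"
  using p unfolding mem_Collect_eq by (simp_all only: split)
 obtain r s where rs: "ram_gen a r" "ram_gen b s" using C(2,3) by (auto simp: gens_def)
 obtain L1 :: "('a, 'a list) module" where L1: "algebra F L1" "alg_isomorphic F (Qalg a) L1"
  using algebra_copy_on_lists[OF algebra_Qalg basis_Qalg[OF one_neq_zero]] by blast
 obtain L2 :: "('a, 'a list) module" where L2: "algebra F L2" "alg_isomorphic F (Qalg b) L2"
  using algebra_copy_on_lists[OF algebra_Qalg basis_Qalg[OF one_neq_zero]] by blast
 obtain L :: "('a, 'a list) module" where L: "algebra F L" "alg_isomorphic F (Pr a b) L"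
  using algebra_copy_on_lists[OF algebra_Pr basis_Pr[OF one_neq_zero one_neq_zero]] by blast
 have "alg_isomorphic F (Pr a b) (alg_prod L1 L2)"
  using L1(2) L2(2) alg_prod_iso unfolding alg_isomorphic_def by blast
 then have iso: "alg_isomorphic F L (alg_prod L1 L2)" by (rule alg_isomorphic_trans[OF alg_isomorphic_sym[OF algebra_Pr L(2)]])
 obtain f1 f2 f where f: "f1 \<in> alg_iso F (Qalg a) L1" "f2 \<in> alg_iso F (Qalg b) L2" "f \<in> alg_iso F (Pr a b) L"
  using L1(2) L2(2) L(2) unfolding alg_isomorphic_def by blast
 have tr: "tot_ram_quadratic F L1" "tot_ram_quadratic F L2"
  using tot_ramI[OF L1(1) f(1) rs(1)] tot_ramI[OF L2(1) f(2) rs(2)] .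
 then have "etale F L1" "etale F L2" by (auto simp: tot_ram_quadratic_def intro: etale.ext)
 then have "etale F L" by (rule etale.prod[OF _ _ L(1) iso])
 moreover have "A \<subseteq> norm_group F L"
  using C(4) unfolding norm_group_Pr[OF L(1) f(3) ram_gen_not_square[OF rs(1)] ram_gen_not_square[OF rs(2)]] .
 ultimately show "C \<in> Et_ram2_ram2 F A"
  unfolding Et_ram2_ram2_def C(1) iso_class_eq_list_class[OF algebra_Pr L(2), symmetric] using tr iso by blast
qed

lemma norm_condition:
 assumes A: "A \<subseteq> Units F" and ab: "a \<in> gens" "b \<in> gens"
 shows "A \<subseteq> h ` {n * m | n m. n \<in> N a \<and> m \<in> N b} \<longleftrightarrow> (cls a = cls b --> A \<subseteq> h ` N a)"
proof (cases "cls a = cls b")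
 case True
 have "{n * m | n m. n \<in> N a \<and> m \<in> N b} = N a"
 proof (intro equalityI subsetI)
  fix x assume "x \<in> {n * m | n m. n \<in> N a \<and> m \<in> N b}"
  then show "x \<in> N a" using N_mult N_cong_cls[OF True] by auto
 next
  fix x assume "x \<in> N a"
  moreover have "1 \<in> N b" using N_square[of 1 b] by simp
  ultimately show "x \<in> {n * m | n m. n \<in> N a \<and> m \<in> N b}" by (intro CollectI exI[of _ x] exI[of _ 1]) simp
 qed
 then show ?thesis using True by simp
next
 case False
 have ab0: "a \<noteq> 0" "b \<noteq> 0" using ab by (auto simp: gens_def ram_gen_def)
 have ns: "\<not> is_square (a * b)"
 proof
  assume "is_square (a * b)"
  then obtain s where s: "a * b = s\<^sup>2" by (auto simp: is_square_def)
  then have "a = b * (s / b)\<^sup>2" using ab0 by (simp add: power2_eq_square field_simps)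
  moreover have "s / b \<noteq> 0" using s ab0 by auto
  ultimately show False using False unfolding cls_eq_iff by blast
 qed
 have "A \<subseteq> h ` {n * m | n m. n \<in> N a \<and> m \<in> N b}"
 proof
  fix x assume "x \<in> A"
  then have x: "x \<in> Units F" using A by blast
  interpret Fd: field F by (rule field_F)
  have "x \<in> carrier F" "x \<noteq> \<zero>\<^bsub>F\<^esub>" using x Fd.field_Units by auto
  then obtain c where c: "x = h c" "c \<noteq> 0" using h_surj by force
  then obtain n m where "n \<in> N a" "m \<in> N b" "c = n * m" using norm_groups_generate[OF ab0 ns c(2)] by blast
  then show "x \<in> h ` {n * m | n m. n \<in> N a \<and> m \<in> N b}" using c(1) by blast
 qed
 then show ?thesis using False by simp
qed

definition weight :: "'k set set => real" where
 "weight U = (\<Prod>c\<in>U. (1 / real q) ^ dsc c)"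

text \<open>Whatever representative is picked, it is isomorphic to \<open>Pr a b\<close>, and its
  discriminant ideal and number of automorphisms are computed on that model.\<close>

lemma premass_term:
 assumes a: "a \<in> gens" and b: "b \<in> gens"
 shows "(let L = (SOME L. L \<in> list_class F (Pr a b)) in
   inverse (real (ideal_norm F (disc_ideal F L))) / real (card (alg_aut F L))) =
   (if cls a = cls b then (weight {cls a})\<^sup>2 / 8 else weight {cls a, cls b} / 4)"
proof -
 obtain r s where rs: "ram_gen a r" "ram_gen b s" using a b by (auto simp: gens_def)
 obtain M :: "('a, 'a list) module" where M: "algebra F M" "alg_isomorphic F (Pr a b) M"
  using algebra_copy_on_lists[OF algebra_Pr basis_Pr[OF one_neq_zero one_neq_zero]] by blast
 define L where "L = (SOME L. L \<in> list_class F (Pr a b))"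
 have "L \<in> list_class F (Pr a b)" unfolding L_def
  by (rule someI[of "\<lambda>L. L \<in> list_class F (Pr a b)" M]) (use M in \<open>simp add: list_class_def\<close>)
 then obtain f where L: "algebra F L" "f \<in> alg_iso F (Pr a b) L" by (auto simp: list_class_def alg_isomorphic_def)
 have r_s: "r + s = int (dsc (cls a) + dsc (cls b))" using dsc_cls[OF rs(1)] dsc_cls[OF rs(2)] by simp
 have norm: "ideal_norm F (disc_ideal F L) = q ^ (dsc (cls a) + dsc (cls b))"
  unfolding disc_ideal_Pr[OF L rs] r_s by (rule ideal_norm_P)
 have aut: "card (alg_aut F L) = (if cls a = cls b then 8 else 4)"
  unfolding card_alg_aut_iso[OF algebra_Pr L] by (rule card_alg_aut_Pr[OF gens_not_square[OF a] gens_not_square[OF b]])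
 have inv: "inverse (real (q ^ n)) = (1 / real q) ^ n" for n
  by (simp add: power_one_over inverse_eq_divide)
 show ?thesis
  unfolding L_def[symmetric] Let_def norm aut inv
  by (cases "cls a = cls b") (simp_all add: weight_def power_add power2_eq_square)
qed

theorem premass_eq:
 assumes A: "A \<subseteq> Units F"
 shows "premass F (Et_ram2_ram2 F A) =
   1 / 8 * (\<Sum>m = 4..4 * e + 2. real q powi (- int m) * real (card (Et_ram2 F A (of_nat m / 2))))
  + 1 / 4 * (\<Sum>m = 4..4 * e + 2. real q powi (- int m) * N_neq q e m)"
proof -
 define x where "x = 1 / real q"
 have x: "real q powi (- int m) = x ^ m" for m
  by (simp add: x_def power_int_minus power_one_over inverse_eq_divide)
 define S where "S = {(a, b). a \<in> gens \<and> b \<in> gens \<and> (cls a = cls b --> A \<subseteq> h ` N a)}"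
 have Et: "Et_ram2_ram2 F A = (\<lambda>(a, b). list_class F (Pr a b)) ` S"
 proof -
  have "{(a, b). a \<in> gens \<and> b \<in> gens \<and> A \<subseteq> h ` {n * m | n m. n \<in> N a \<and> m \<in> N b}} = S"
   unfolding S_def
  proof (rule Set.set_eqI)
   fix p :: "'k \<times> 'k"
   obtain a b where p: "p = (a, b)" by (cases p)
   show "p \<in> {(a, b). a \<in> gens \<and> b \<in> gens \<and> A \<subseteq> h ` {n * m | n m. n \<in> N a \<and> m \<in> N b}} \<longleftrightarrow>
    p \<in> {(a, b). a \<in> gens \<and> b \<in> gens \<and> (cls a = cls b --> A \<subseteq> h ` N a)}"
    unfolding p mem_Collect_eq split using norm_condition[OF A, of a b] by (simp only: cong: conj_cong)
  qed
  then show ?thesis unfolding Et_ram2_ram2_eq by (simp only:)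
 qed
 \<comment> \<open>A singleton stands for two equal classes, a multiplicity that the set forgets:
   hence the square of its weight, and 8 in place of 4.\<close>
 define w where "w U = (if \<exists>c. U = {c} then (weight U)\<^sup>2 / 8 else weight U / 4)" for U
 have "premass F (Et_ram2_ram2 F A) = sum w ((\<lambda>(a, b). {cls a, cls b}) ` S)"
  unfolding premass_def Et
 proof (rule sum_image_transfer)
  fix p p' assume "p \<in> S" "p' \<in> S"
  then obtain a b a' b' where p: "p = (a, b)" "p' = (a', b')" "a \<in> gens" "b \<in> gens" "a' \<in> gens" "b' \<in> gens"
   by (auto simp: S_def)
  show "(\<lambda>(a, b). list_class F (Pr a b)) p = (\<lambda>(a, b). list_class F (Pr a b)) p' \<longleftrightarrow>
    (\<lambda>(a, b). {cls a, cls b}) p = (\<lambda>(a, b). {cls a, cls b}) p'"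
   unfolding p(1,2) split list_class_eq_iff[OF algebra_Pr basis_Pr[OF one_neq_zero one_neq_zero] algebra_Pr]
   by (rule alg_isomorphic_Pr_iff) (intro gens_not_square p)+
 next
  fix p assume "p \<in> S"
  then obtain a b where p: "p = (a, b)" "a \<in> gens" "b \<in> gens" by (auto simp: S_def)
  have "(\<exists>c. {cls a, cls b} = {c}) \<longleftrightarrow> cls a = cls b" by auto
  then show "(let L = (SOME L. L \<in> (\<lambda>(a, b). list_class F (Pr a b)) p) in
   inverse (real (ideal_norm F (disc_ideal F L))) / real (card (alg_aut F L))) = w ((\<lambda>(a, b). {cls a, cls b}) p)"
   unfolding p(1) split premass_term[OF p(2,3)] w_def by simp
 qed
 also have "(\<lambda>(a, b). {cls a, cls b}) ` S = (\<lambda>c. {c}) ` good A \<union> (\<lambda>(c, d). {c, d}) ` {(c, d). c \<in> T \<and> d \<in> T \<and> c \<noteq> d}"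
  (is "_ = ?U \<union> ?V")
 proof (intro equalityI subsetI)
  fix U assume "U \<in> (\<lambda>(a, b). {cls a, cls b}) ` S"
  then obtain a b where ab: "U = {cls a, cls b}" "a \<in> gens" "b \<in> gens" "cls a = cls b --> A \<subseteq> h ` N a"
   by (auto simp: S_def)
  show "U \<in> ?U \<union> ?V"
  proof (cases "cls a = cls b")
   case True
   then have "cls a \<in> good A" using ab by (auto simp: good_def)
   then show ?thesis using True ab(1) by auto
  next
   case False
   then have "(cls a, cls b) \<in> {(c, d). c \<in> T \<and> d \<in> T \<and> c \<noteq> d}" using ab by (auto simp: T_def)
   then have "(\<lambda>(c, d). {c, d}) (cls a, cls b) \<in> ?V" by (rule imageI)
   then show ?thesis using ab(1) by simp
  qed
 next
  fix U assume "U \<in> ?U \<union> ?V"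
  then show "U \<in> (\<lambda>(a, b). {cls a, cls b}) ` S"
  proof
   assume "U \<in> ?U"
   then obtain a where a: "U = {cls a, cls a}" "a \<in> gens" "A \<subseteq> h ` N a" by (auto simp: good_def)
   then show ?thesis by (intro image_eqI[of _ _ "(a, a)"]) (simp_all add: S_def)
  next
   assume "U \<in> ?V"
   then obtain a b where ab: "U = {cls a, cls b}" "a \<in> gens" "b \<in> gens" "cls a \<noteq> cls b" by (auto simp: T_def)
   then show ?thesis by (intro image_eqI[of _ _ "(a, b)"]) (simp_all add: S_def)
  qed
 qed
 also have "sum w (?U \<union> ?V) = sum w ?U + sum w ?V"
 proof (rule sum.union_disjoint)
  have "good A \<subseteq> T" by (auto simp: good_def T_def)
  then show "finite ?U" using sum_T(1) finite_subset by blast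
  have "{(c, d). c \<in> T \<and> d \<in> T \<and> c \<noteq> d} \<subseteq> T \<times> T" by auto
  then show "finite ?V" using sum_T(1) by (meson finite_SigmaI finite_imageI finite_subset)
 qed auto
 also have "sum w ?U = 1 / 8 * (\<Sum>c\<in>good A. x ^ (2 * dsc c))"
  by (subst sum.reindex) (auto simp: inj_on_def w_def weight_def x_def sum_distrib_left power_even_eq)
 also have "(\<Sum>c\<in>good A. x ^ (2 * dsc c)) = (\<Sum>m = 4..4 * e + 2. x ^ m * real (card (Et_ram2 F A (of_nat m / 2))))"
 proof -
  have gT: "good A \<subseteq> T" by (auto simp: good_def T_def)
  have fin: "finite (good A)" using gT sum_T(1) by (rule finite_subset)
  have "(\<lambda>c. 2 * dsc c) ` good A \<subseteq> {4..4 * e + 2}" using gT dsc_bounds by fastforce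
  then have "(\<Sum>c\<in>good A. x ^ (2 * dsc c)) = (\<Sum>m = 4..4 * e + 2. \<Sum>c\<in>{c \<in> good A. 2 * dsc c = m}. x ^ (2 * dsc c))"
   by (rule sum.group[OF fin finite_atLeastAtMost, symmetric])
  also have "\<dots> = (\<Sum>m = 4..4 * e + 2. x ^ m * real (card (Et_ram2 F A (of_nat m / 2))))"
  proof (rule sum.cong[OF refl])
   fix m
   \<comment> \<open>For odd \<open>m\<close> both sides are 0, as \<open>m / 2\<close> is then no
     exponent and the set of classes is empty.\<close>
   have "of_nat (dsc c) = (of_nat m / 2 :: rat) \<longleftrightarrow> 2 * dsc c = m" for c
   proof -
    have "of_nat (dsc c) = (of_nat m / 2 :: rat) \<longleftrightarrow> (of_nat (2 * dsc c) :: rat) = of_nat m" by (auto simp: field_simps)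
    then show ?thesis by (simp only: of_nat_eq_iff)
   qed
   then show "(\<Sum>c\<in>{c \<in> good A. 2 * dsc c = m}. x ^ (2 * dsc c)) = x ^ m * real (card (Et_ram2 F A (of_nat m / 2)))"
    unfolding card_Et_ram2 by simp
  qed
  finally show ?thesis .
 qed
 also have "sum w ?V = 1 / 4 * (\<Sum>m = 4..4 * e + 2. x ^ m * N_neq q e m)"
 proof -
  have "sum w ?V = (\<Sum>U\<in>?V. (1 / 4) * prod (\<lambda>c. x ^ dsc c) U)"
   by (rule sum.cong[OF refl]) (auto simp: w_def weight_def x_def)
  also have "\<dots> = 1 / 4 * (\<Sum>U\<in>?V. prod (\<lambda>c. x ^ dsc c) U)" by (simp add: sum_distrib_left)
  finally have V: "sum w ?V = 1 / 4 * (\<Sum>U\<in>?V. prod (\<lambda>c. x ^ dsc c) U)" .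
  have "2 * (\<Sum>U\<in>?V. prod (\<lambda>c. x ^ dsc c) U) = (\<Sum>c\<in>T. x ^ dsc c)\<^sup>2 - (\<Sum>c\<in>T. (x ^ dsc c)\<^sup>2)"
   by (rule sum_unordered_pairs[OF sum_T(1)])
  also have "(\<Sum>c\<in>T. (x ^ dsc c)\<^sup>2) = (\<Sum>c\<in>T. x ^ (2 * dsc c))" by (simp add: power_even_eq)
  also have "(\<Sum>c\<in>T. x ^ dsc c)\<^sup>2 - (\<Sum>c\<in>T. x ^ (2 * dsc c)) = 2 * (\<Sum>m = 4..4 * e + 2. x ^ m * N_neq q e m)"
  proof -
   have exps: "2 * (2 * j) = 4 * j" "2 * (2 * j + 1) = 4 * j + 2" for j :: nat by simp_all
   show ?thesis
    unfolding sum_T(2)[of "\<lambda>n. x ^ n"] sum_T(2)[of "\<lambda>n. x ^ (2 * n)"] exps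
    by (rule sum_N_neq[symmetric]) (use e_pos in simp)
  qed
  finally show ?thesis unfolding V by simp
 qed
 finally show ?thesis unfolding x .
qed

end

section \<open>The type of a hypothetical counterexample\<close>

text \<open>The group \<open>A\<close> is quantified away to leave a predicate of \<open>F\<close>
  alone, to which the choice behind \<open>test_field\<close> can refer.\<close>

definition counterexample :: "(q2, 'a) module => bool" where
 "counterexample F \<longleftrightarrow> two_adic_field F \<and> (\<exists>A. fg_subgroup A (units_of F) \<and>
   premass F (Et_ram2_ram2 F A) \<noteq>
   1 / 8 * (\<Sum>m = 4..4 * abs_ram_index F + 2.
    real (card (carrier (residue_field F))) powi (- int m) * real (card (Et_ram2 F A (of_nat m / 2))))
  + 1 / 4 * (\<Sum>m = 4..4 * abs_ram_index F + 2.
    real (card (carrier (residue_field F))) powi (- int m) * N_neq (card (carrier (residue_field F))) (abs_ram_index F) m))"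

lemma no_typed_counterexample:
 fixes F :: "(q2, 'a) module" and h :: "'k::field_char_0 => 'a"
 assumes h: "typed_field F h"
 shows "\<not> counterexample F"
proof
 assume F: "counterexample F"
 then obtain Ob \<pi> e R where "local_field F h Ob \<pi> e R"
  using exists_local_field[OF _ h] by (auto simp: counterexample_def)
 then interpret local_field F h Ob \<pi> e R .
 have "A \<subseteq> Units F" if "fg_subgroup A (units_of F)" for A
  using that subgroup.subset by (fastforce simp: fg_subgroup_def units_of_carrier)
 then show False using F premass_eq unfolding counterexample_def abs_ram_index_eq card_residue_field by blast
qed

lemma iso_add_pow:
 assumes R: "ring R" and S: "ring S" and f: "f \<in> ring_iso R S"
 shows "f (add_pow R n \<one>\<^bsub>R\<^esub>) = add_pow S (n::nat) \<one>\<^bsub>S\<^esub>"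
proof -
 interpret R: ring R by (rule R)
 interpret S: ring S by (rule S)
 have hom: "f \<in> Ring.ring_hom R S" using f by (simp add: ring_iso_def)
 show ?thesis
 proof (induction n)
  case 0
  show ?case using ring_hom_zero[OF hom R S] by simp
 next
  case (Suc n)
  then show ?case using ring_hom_add[OF hom] ring_hom_one[OF hom] by (simp add: R.add.nat_pow_Suc S.add.nat_pow_Suc)
 qed
qed

definition char0_field :: "('a, 'm) ring_scheme => bool" where
 "char0_field K \<longleftrightarrow> field K \<and> (\<forall>n::nat. n \<noteq> 0 --> add_pow K n \<one>\<^bsub>K\<^esub> \<noteq> \<zero>\<^bsub>K\<^esub>)"

lemma char0_field_image:
 assumes K: "char0_field K" and inj: "inj f"
 shows "char0_field (image_ring f K)"
proof -
 interpret K: field K using K by (simp add: char0_field_def)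
 have inj': "inj_on f (carrier K)" using inj by (rule inj_on_subset) simp
 interpret I: field "image_ring f K" by (rule K.inj_imp_image_ring_is_field[OF inj'])
 have f: "f \<in> ring_iso K (image_ring f K)" by (rule inj_imp_image_ring_iso[OF inj'])
 have hom: "f \<in> Ring.ring_hom K (image_ring f K)" using f by (simp add: ring_iso_def)
 have "add_pow (image_ring f K) n \<one>\<^bsub>image_ring f K\<^esub> \<noteq> \<zero>\<^bsub>image_ring f K\<^esub>" if "n \<noteq> 0" for n :: nat
 proof
  assume "add_pow (image_ring f K) n \<one>\<^bsub>image_ring f K\<^esub> = \<zero>\<^bsub>image_ring f K\<^esub>"
  then have "f (add_pow K n \<one>\<^bsub>K\<^esub>) = f \<zero>\<^bsub>K\<^esub>"
   using iso_add_pow[OF K.ring_axioms I.ring_axioms f, of n] ring_hom_zero[OF hom K.ring_axioms I.ring_axioms] by simp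
  then have "add_pow K n \<one>\<^bsub>K\<^esub> = \<zero>\<^bsub>K\<^esub>" by (rule injD[OF inj])
  with K that show False by (simp add: char0_field_def)
 qed
 then show ?thesis using I.field_axioms by (simp add: char0_field_def)
qed

definition rat_ring :: "rat ring" where
 "rat_ring = \<lparr>carrier = UNIV, monoid.mult = (*), one = 1, ring.zero = 0, ring.add = (+)\<rparr>"

lemma char0_field_rat_ring: "char0_field rat_ring"
proof -
 have "cring rat_ring"
 proof (rule cringI)
  show "abelian_group rat_ring"
  proof (rule abelian_groupI)
   fix x assume "x \<in> carrier rat_ring"
   show "\<exists>y\<in>carrier rat_ring. y \<oplus>\<^bsub>rat_ring\<^esub> x = \<zero>\<^bsub>rat_ring\<^esub>"
    by (rule bexI[of _ "- x"]) (simp_all add: rat_ring_def)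
  qed (simp_all add: rat_ring_def)
  show "Group.comm_monoid rat_ring" by (rule comm_monoidI) (simp_all add: rat_ring_def)
 qed (simp add: rat_ring_def distrib_right)
 then interpret cring rat_ring .
 have "field rat_ring"
 proof (rule cring_fieldI)
  show "Units rat_ring = carrier rat_ring - {\<zero>\<^bsub>rat_ring\<^esub>}"
  proof (intro equalityI subsetI)
   fix x assume "x \<in> carrier rat_ring - {\<zero>\<^bsub>rat_ring\<^esub>}"
   then show "x \<in> Units rat_ring"
    by (auto simp: Units_def rat_ring_def intro!: exI[of _ "1 / x"])
  qed (auto simp: Units_def rat_ring_def)
 qed
 moreover have "add_pow rat_ring n \<one>\<^bsub>rat_ring\<^esub> = of_nat n" for n :: nat
  by (induction n) (simp_all add: add.nat_pow_Suc, simp_all add: rat_ring_def)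
 ultimately show ?thesis by (simp add: char0_field_def) (simp add: rat_ring_def)
qed

text \<open>A field of characteristic 0 on a type built from \<open>'a\<close> that is isomorphic to a counterexample
 on \<open>'a\<close> if there is any. The rational numbers only ensure existence.\<close>

definition test_field :: "('a + rat) ring" where
 "test_field = (SOME K. char0_field K \<and>
   ((\<exists>F :: (q2, 'a) module. counterexample F) --> (\<exists>F :: (q2, 'a) module. counterexample F \<and> K = image_ring Inl F)))"

lemma test_field:
 "char0_field (test_field :: ('a + rat) ring)"
 "counterexample (F :: (q2, 'a) module) ==> \<exists>F :: (q2, 'a) module. counterexample F \<and> (test_field :: ('a + rat) ring) = image_ring Inl F"
proof -
 have "\<exists>K :: ('a + rat) ring. char0_field K \<and>
   ((\<exists>F :: (q2, 'a) module. counterexample F) --> (\<exists>F :: (q2, 'a) module. counterexample F \<and> K = image_ring Inl F))"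
 proof (cases "\<exists>F :: (q2, 'a) module. counterexample F")
  case True
  then obtain F :: "(q2, 'a) module" where F: "counterexample F" by blast
  then interpret q2_field F by (intro q2_fieldI) (simp add: counterexample_def)
  have "char0_field F" using Fd.field_axioms char_zero by (simp add: char0_field_def)
  then have "char0_field (image_ring Inl F :: ('a + rat) ring)" by (rule char0_field_image) simp
  with F show ?thesis by blast
 next
  case False
  have "char0_field (image_ring Inr rat_ring :: ('a + rat) ring)" by (rule char0_field_image[OF char0_field_rat_ring]) simp
  with False show ?thesis by blast
 qed
 from someI_ex[OF this, folded test_field_def]
 show "char0_field (test_field :: ('a + rat) ring)"
  "counterexample (F :: (q2, 'a) module) ==> \<exists>F :: (q2, 'a) module. counterexample F \<and> (test_field :: ('a + rat) ring) = image_ring Inl F"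
  by blast+
qed

lemma field_test_field: "field (test_field :: ('a + rat) ring)"
 using test_field(1)[where 'a = 'a] by (simp add: char0_field_def)

interpretation test: cring test_field
 by (intro domain.axioms(1) field.axioms(1) field_test_field)

lemma Units_test_field: "Units test_field = carrier test_field - {\<zero>\<^bsub>test_field\<^esub>}"
 by (rule field.field_Units[OF field_test_field])

lemma zero_neq_one_test_field: "\<zero>\<^bsub>test_field\<^esub> \<noteq> \<one>\<^bsub>test_field\<^esub>"
 by (rule not_sym[OF domain.one_not_zero[OF field.axioms(1)[OF field_test_field]]])

text \<open>A type definition has to stand without assumptions; this is why the hypothetical
  counterexample is packed into the closed term \<open>test_field\<close>.\<close>

typedef 'a test = "carrier (test_field :: ('a + rat) ring)"
 by (rule exI[of _ "\<zero>\<^bsub>test_field\<^esub>"]) simp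

setup_lifting type_definition_test

instantiation test :: (type) "{zero, one, plus, times, uminus, minus, inverse}"
begin

lift_definition zero_test :: "'a test" is "\<zero>\<^bsub>test_field\<^esub>" by simp
lift_definition one_test :: "'a test" is "\<one>\<^bsub>test_field\<^esub>" by simp
lift_definition plus_test :: "'a test => 'a test => 'a test" is "\<lambda>x y. x \<oplus>\<^bsub>test_field\<^esub> y" by simp
lift_definition times_test :: "'a test => 'a test => 'a test" is "\<lambda>x y. x \<otimes>\<^bsub>test_field\<^esub> y" by simp
lift_definition uminus_test :: "'a test => 'a test" is "\<lambda>x. \<ominus>\<^bsub>test_field\<^esub> x" by simp
lift_definition minus_test :: "'a test => 'a test => 'a test" is "\<lambda>x y. x \<oplus>\<^bsub>test_field\<^esub> (\<ominus>\<^bsub>test_field\<^esub> y)" by simp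
lift_definition inverse_test :: "'a test => 'a test" is
 "\<lambda>x. if x = \<zero>\<^bsub>test_field\<^esub> then \<zero>\<^bsub>test_field\<^esub> else inv\<^bsub>test_field\<^esub> x"
 by (auto simp: Units_test_field)

lift_definition divide_test :: "'a test => 'a test => 'a test" is
 "\<lambda>x y. x \<otimes>\<^bsub>test_field\<^esub> (if y = \<zero>\<^bsub>test_field\<^esub> then \<zero>\<^bsub>test_field\<^esub> else inv\<^bsub>test_field\<^esub> y)"
 by (auto simp: Units_test_field)

instance ..

end

instance test :: (type) Fields.field
proof
 fix x y z :: "'a test"
 show "x + y + z = x + (y + z)" by transfer (simp add: test.a_assoc)
 show "x + y = y + x" by transfer (simp add: test.a_comm)
 show "0 + x = x" by transfer simp
 show "- x + x = 0" by transfer (simp add: test.l_neg)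
 show "x - y = x + - y" by transfer simp
 show "x * y * z = x * (y * z)" by transfer (simp add: test.m_assoc)
 show "x * y = y * x" by transfer (simp add: test.m_comm)
 show "1 * x = x" by transfer simp
 show "(x + y) * z = x * z + y * z" by transfer (simp add: test.l_distr)
 show "(0 :: 'a test) \<noteq> 1" by transfer (rule zero_neq_one_test_field)
 show "x \<noteq> 0 ==> inverse x * x = 1" by transfer (simp add: Units_test_field)
 show "x / y = x * inverse y" by transfer simp
 show "inverse (0 :: 'a test) = 0" by transfer simp
qed

lemma Rep_test_of_nat: "Rep_test (of_nat n) = add_pow test_field n \<one>\<^bsub>test_field\<^esub>"
proof (induction n)
 case 0
 show ?case by (simp add: zero_test.rep_eq)
next
 case (Suc n)
 then show ?case by (simp add: plus_test.rep_eq one_test.rep_eq test.add.nat_pow_Suc test.a_comm)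
qed

instance test :: (type) field_char_0
proof
 show "inj (of_nat :: nat => 'a test)"
 proof (rule linorder_injI)
  fix m n :: nat assume "m < n"
  then have "add_pow (test_field :: ('a + rat) ring) (n - m) \<one>\<^bsub>test_field\<^esub> \<noteq> \<zero>\<^bsub>test_field\<^esub>"
   using test_field(1)[where 'a = 'a] by (simp add: char0_field_def)
  then have "of_nat (n - m) \<noteq> (0 :: 'a test)"
   by (simp add: Rep_test_of_nat zero_test.rep_eq flip: Rep_test_inject)
  then show "of_nat m \<noteq> (of_nat n :: 'a test)" using \<open>m < n\<close> by (simp add: of_nat_diff)
 qed
qed

text \<open>The counterexample behind \<open>test_field\<close> may differ from the given one, but a
  single one suffices: its carrier is identified with the type \<open>'a test\<close>, and
  \<open>no_typed_counterexample\<close> refutes it.\<close>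

lemma no_counterexample: "\<not> counterexample (F :: (q2, 'a) module)"
proof
 assume "counterexample F"
 then obtain F :: "(q2, 'a) module" where F: "counterexample F" "(test_field :: ('a + rat) ring) = image_ring Inl F"
  using test_field(2) by blast
 then interpret q2_field F by (intro q2_fieldI) (simp add: counterexample_def)
 have iso: "Inl \<in> ring_iso F (test_field :: ('a + rat) ring)" unfolding F(2) by (rule inj_imp_image_ring_iso) simp
 have hom: "Inl \<in> Ring.ring_hom F (test_field :: ('a + rat) ring)" using iso by (simp add: ring_iso_def)
 define h :: "'a test => 'a" where "h x = projl (Rep_test x)" for x
 have carr: "carrier (test_field :: ('a + rat) ring) = Inl ` carrier F"
  using iso by (simp add: ring_iso_def bij_betw_def)
 have h: "Inl (h x) = Rep_test x" "h x \<in> carrier F" for x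
  using Rep_test[of x] unfolding carr h_def by auto
 have "typed_field F h"
 proof (intro typed_field.intro typed_field_axioms.intro)
  show "cring F" by (rule Fd.cring_axioms)
  show "bij_betw h UNIV (carrier F)"
   unfolding bij_betw_def
  proof (intro conjI equalityI subsetI injI)
   fix x y assume "h x = h y"
   then have "Rep_test x = Rep_test y" by (simp flip: h(1))
   then show "x = y" by (simp add: Rep_test_inject)
  next
   fix a assume "a \<in> carrier F"
   then have "Inl a \<in> carrier (test_field :: ('a + rat) ring)" by (simp add: carr)
   then have "h (Abs_test (Inl a)) = a" by (simp add: h_def Abs_test_inverse)
   then show "a \<in> range h" by (metis rangeI)
  qed (use h(2) in auto)
  fix x y
  have "Inl (h (x + y)) = (Inl (h x \<oplus>\<^bsub>F\<^esub> h y) :: 'a + rat)"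
   by (simp add: h plus_test.rep_eq ring_hom_add[OF hom])
  then show "h (x + y) = h x \<oplus>\<^bsub>F\<^esub> h y" by simp
  have "Inl (h (x * y)) = (Inl (h x \<otimes>\<^bsub>F\<^esub> h y) :: 'a + rat)"
   by (simp add: h times_test.rep_eq ring_hom_mult[OF hom])
  then show "h (x * y) = h x \<otimes>\<^bsub>F\<^esub> h y" by simp
 next
  have "Inl (h 1) = (Inl \<one>\<^bsub>F\<^esub> :: 'a + rat)"
   by (simp add: h one_test.rep_eq ring_hom_one[OF hom])
  then show "h 1 = \<one>\<^bsub>F\<^esub>" by simp
 qed
 then show False using no_typed_counterexample F(1) by blast
qed

theorem theorem4p7:
 fixes F :: "(q2, 'a) module" and A :: "'a set" and q e :: nat
 assumes "two_adic_field F"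
  and "q = card (carrier (residue_field F))"
  and "e = abs_ram_index F"
  and "fg_subgroup A (units_of F)"
 shows "premass F (Et_ram2_ram2 F A) =
   1 / 8 * (\<Sum>m = 4..4 * e + 2.
    real q powi (- int m) * real (card (Et_ram2 F A (of_nat m / 2))))
  + 1 / 4 * (\<Sum>m = 4..4 * e + 2. real q powi (- int m) * N_neq q e m)"
 using no_counterexample[of F] assms(1,4) unfolding counterexample_def assms(2,3) by blast

end
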